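(* Let $X$ be an emm-space. The following are equivalent: \begin{itemize} \item $\mathcal L_1(X)$ is compact; \item $X\in\overline{\mathcal X}^{d_{\rm conc}}$, i.e. the emm-isomorphism class of $X$ belongs to the completion of $(\mathcal X,d_{\rm conc})$, where this completion is identified with $(\mathfrak X_{\rm conc},d_{\rm conc})$ by means of the embedding of $\mathcal X$ in $\mathfrak X_{\rm conc}$ sending each mm-isomorphism class to the associated emm-isomorphism class; \item the pyramid $\overline{\mathcal P_X}^{\square}$ is concentrated. \end{itemize}
   Context: An mm-space is a complete separable metric space $(X,d)$ with a Borel probability measure $m$. Two mm-spaces are mm-isomorphic if there is a measure-preserving map between them which is distance-preserving on the support of the measure of the domain. $\mathcal X$ is the set of mm-isomorphism classes of mm-spaces. An emm-space is a quadruple $(X,\tau,d,m)$ where $(X,\tau)$ is a Polish topological space; $d:X\times X\to[0,+\infty]$ is an extended distance (symmetric, triangle inequality, $d(x,y)=0$ iff $x=y$) that is complete and $\tau\times\tau$-lower semicontinuous; the topology $\tau_d$ induced by $d$ is finer than or equal to $\tau$; $m$ is a $\tau$-Borel probability measure. Mm-spaces are emm-spaces with the metric topology. Two emm-spaces $X,Y$ are emm-isomorphic if there are an $m_X$-measurable map $F:X\to Y$ with $F_\#m_X=m_Y$ and an $m_X$-measurable set $A\subset X$ with $m_X(A)=1$ such that $d_Y(F(x),F(y))=d_X(x,y)$ for all $x,y\in A$. For emm-spaces write $Y\prec X$ if there are a measurable map $\varphi:X\to Y$ with $\varphi_\#m_X=m_Y$ and a set $E\subset X$ with $m_X(E)=1$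 such that $d_Y(\varphi(x),\varphi(y))\le d_X(x,y)$ for all $x,y\in E$. Put $\mathcal P_X:=\{Y\in\mathcal X: Y\prec X\}$. $L^0(X)$ is the space of $m_X$-classes of real measurable functions with the Ky Fan distance $d_{L^0}(f,g)=\inf\{\varepsilon>0: m_X(|f-g|>\varepsilon)\le\varepsilon\}$; $\mathrm{Lip}_1(X,m_X)\subset L^0(X)$ is the set of classes of functions $f$ for which there is $E$ with $m_X(E)=1$ and $|f(x)-f(y)|\le d_X(x,y)$ on $E\times E$; $\mathcal L_1(X)=\mathrm{Lip}_1(X,m_X)/\mathbb R$ is its quotient by addition of constants, with the quotient distance inherited from $L^0(X)/\mathbb R$. $\mathfrak X_{\rm conc}$ is the set of emm-isomorphism classes of emm-spaces with compact $\mathcal L_1(X)$ (concentrated emm-spaces). A parameter of $X$ is a Borel map $\iota_X$ from the unit interval $I$ with Lebesgue measure to $(X,\tau)$ with $(\iota_X)_\#\mathrm{Leb}=m_X$. For concentrated emm-spaces (in particular mm-spaces), $d_{\rm conc}(X,Y)=\inf_{\iota_X,\iota_Y}d_H^{L^0}(\iota_X^*\mathrm{Lip}_1(X,m_X),\iota_Y^*\mathrm{Lip}_1(Y,m_Y))$, infimum over all parameters, with $\iota^*f=f\circ\iota$ and $d_H^{L^0}$ the Hausdorff distance in $(L^0(I,\mathrm{Leb}),d_{L^0})$. The space $(\mathfrak X_{\rm conc},d_{\rm conc})$ is a completion of $(\mathcal X,d_{\rm conc})$ via the stated embedding. Box distance: for mm-spaces, $\square(X,Y)$ is the infimum, over all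 parameters, of the infimum of those $\varepsilon\ge0$ for which there is a Borel set $I_0\subset I$ with $\mathrm{Leb}(I_0)\ge1-\varepsilon$ and $|d_X(\iota_X(s),\iota_X(t))-d_Y(\iota_Y(s),\iota_Y(t))|\le\varepsilon$ for all $s,t\in I_0$; $\overline{\,\cdot\,}^{\square}$ is closure in $(\mathcal X,\square)$. A pyramid is a nonempty $\square$-closed set $\mathcal P\subset\mathcal X$ such that (a) $X\in\mathcal P$, $Y\in\mathcal X$, $Y\prec X$ imply $Y\in\mathcal P$; (b) for all $X,Y\in\mathcal P$ there is $Z\in\mathcal P$ with $X,Y\prec Z$. For every emm-space, $\overline{\mathcal P_X}^\square$ is a pyramid. A pyramid $\mathcal P$ is concentrated if $\{\mathcal L_1(X):X\in\mathcal P\}$ is precompact in the Gromov–Hausdorff topology on isometry classes of compact metric spaces. *)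

theory Defs
  imports "HOL-Probability.Probability"
begin

section \<open>Auxiliary notions for topologies and metrics\<close>

definition borel_of :: "'a topology \<Rightarrow> 'a measure" where
  "borel_of T = sigma (topspace T) {U. openin T U}"

definition precompact_in :: "'a topology \<Rightarrow> 'a set \<Rightarrow> bool" where
  "precompact_in T S \<longleftrightarrow> S \<subseteq> topspace T \<and> compactin T (T closure_of S)"

text \<open>The type \<^typ>\<open>'a metric\<close> asks for nonnegativity and symmetry off the carrier as well;
  distances given by infima are therefore set to 0 there.\<close>

definition metric_on :: "'a set \<Rightarrow> ('a \<Rightarrow> 'a \<Rightarrow> real) \<Rightarrow> 'a metric" where
  "metric_on S d = metric (S, \<lambda>x y. if x \<in> S \<and> y \<in> S then d x y else 0)"

definition hausdorff_dist :: "('a \<Rightarrow> 'a \<Rightarrow> real) \<Rightarrow> 'a set \<Rightarrow> 'a set \<Rightarrow> real" where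
  "hausdorff_dist d A B =
     Inf {r. 0 \<le> r \<and> (\<forall>a\<in>A. \<exists>b\<in>B. d a b \<le> r) \<and> (\<forall>b\<in>B. \<exists>a\<in>A. d a b \<le> r)}"

text \<open>A representative of an equivalence class. Everything below that is evaluated at
  representatives is invariant under the equivalence in question.\<close>

definition rep :: "'a set \<Rightarrow> 'a" where
  "rep c = (SOME x. x \<in> c)"

definition cauchy_seqs :: "'a set \<Rightarrow> ('a \<Rightarrow> 'a \<Rightarrow> real) \<Rightarrow> (nat \<Rightarrow> 'a) set" where
  "cauchy_seqs S d =
     {s. range s \<subseteq> S \<and> (\<forall>\<epsilon>>0. \<exists>N. \<forall>m\<ge>N. \<forall>n\<ge>N. d (s m) (s n) < \<epsilon>)}"

definition cauchy_completion :: "'a set \<Rightarrow> ('a \<Rightarrow> 'a \<Rightarrow> real) \<Rightarrow> (nat \<Rightarrow> 'a) set set" where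
  "cauchy_completion S d =
     cauchy_seqs S d // {(s, t). s \<in> cauchy_seqs S d \<and> t \<in> cauchy_seqs S d \<and>
                                 (\<lambda>n. d (s n) (t n)) \<longlonglongrightarrow> 0}"


section \<open>The Gromov--Hausdorff space\<close>

definition isometric_embedding :: "'a metric \<Rightarrow> 'b metric \<Rightarrow> ('a \<Rightarrow> 'b) \<Rightarrow> bool" where
  "isometric_embedding M N f \<longleftrightarrow>
     f ` mspace M \<subseteq> mspace N \<and>
     (\<forall>x\<in>mspace M. \<forall>y\<in>mspace M. mdist N (f x) (f y) = mdist M x y)"

definition isometric :: "'a metric \<Rightarrow> 'b metric \<Rightarrow> bool" where
  "isometric M N \<longleftrightarrow> (\<exists>f. isometric_embedding M N f \<and> f ` mspace M = mspace N)"

text \<open>The ambient space may be taken on the sum type: only the union of the two images matters,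
  and it injects into the disjoint union of the two spaces.\<close>

definition GH_dist :: "'a metric \<Rightarrow> 'b metric \<Rightarrow> real" where
  "GH_dist M N =
     Inf {hausdorff_dist (mdist Z) (f ` mspace M) (g ` mspace N) | (Z :: ('a + 'b) metric) f g.
            isometric_embedding M Z f \<and> isometric_embedding N Z g}"

definition compact_metric :: "'a metric \<Rightarrow> bool" where
  "compact_metric M \<longleftrightarrow> mspace M \<noteq> {} \<and> compact_space (mtopology_of M)"

text \<open>Compact metric spaces and Polish spaces have at most the cardinality of the continuum, so
  every isomorphism class has a representative whose carrier is a set of reals (with a metric or
  topology unrelated to the usual one). Here and below, the set of all isomorphism classes is
  formed over this carrier type, and the class of a space over an arbitrary type consists of the
  isomorphic spaces over the reals.\<close>

definition isometry_class :: "'a metric \<Rightarrow> real metric set" where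
  "isometry_class M = {N. compact_metric N \<and> isometric M N}"

definition GH_space :: "real metric set set" where
  "GH_space = isometry_class ` {M :: real metric. compact_metric M}"

definition GH_topology :: "real metric set topology" where
  "GH_topology = mtopology_of (metric_on GH_space (\<lambda>c c'. GH_dist (rep c) (rep c')))"


section \<open>Mm-spaces and emm-spaces\<close>

record 'a mm_data =
  mm_metric :: "'a metric"
  mm_measure :: "'a measure"

record 'a emm_data =
  emm_top :: "'a topology"
  emm_dist :: "'a \<Rightarrow> 'a \<Rightarrow> ennreal"
  emm_measure :: "'a measure"

definition mm_space :: "'a mm_data \<Rightarrow> bool" where
  "mm_space X \<longleftrightarrow>
     mcomplete_of (mm_metric X) \<and>
     separable_space (mtopology_of (mm_metric X)) \<and>
     sets (mm_measure X) = sets (borel_of (mtopology_of (mm_metric X))) \<and>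
     prob_space (mm_measure X)"

definition ext_distance_on :: "'a set \<Rightarrow> ('a \<Rightarrow> 'a \<Rightarrow> ennreal) \<Rightarrow> bool" where
  "ext_distance_on S d \<longleftrightarrow>
     (\<forall>x\<in>S. \<forall>y\<in>S. d x y = d y x) \<and>
     (\<forall>x\<in>S. \<forall>y\<in>S. \<forall>z\<in>S. d x z \<le> d x y + d y z) \<and>
     (\<forall>x\<in>S. \<forall>y\<in>S. d x y = 0 \<longleftrightarrow> x = y)"

definition ext_complete_on :: "'a set \<Rightarrow> ('a \<Rightarrow> 'a \<Rightarrow> ennreal) \<Rightarrow> bool" where
  "ext_complete_on S d \<longleftrightarrow>
     (\<forall>s :: nat \<Rightarrow> 'a. range s \<subseteq> S \<longrightarrow>
        (\<forall>\<epsilon>>0. \<exists>N. \<forall>m\<ge>N. \<forall>n\<ge>N. d (s m) (s n) < \<epsilon>) \<longrightarrow>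
        (\<exists>x\<in>S. (\<lambda>n. d (s n) x) \<longlonglongrightarrow> 0))"

definition ext_open_on :: "'a set \<Rightarrow> ('a \<Rightarrow> 'a \<Rightarrow> ennreal) \<Rightarrow> 'a set \<Rightarrow> bool" where
  "ext_open_on S d U \<longleftrightarrow> U \<subseteq> S \<and> (\<forall>x\<in>U. \<exists>r>0. {y\<in>S. d x y < r} \<subseteq> U)"

definition emm_space :: "'a emm_data \<Rightarrow> bool" where
  "emm_space X \<longleftrightarrow>
     completely_metrizable_space (emm_top X) \<and> separable_space (emm_top X) \<and>
     ext_distance_on (topspace (emm_top X)) (emm_dist X) \<and>
     ext_complete_on (topspace (emm_top X)) (emm_dist X) \<and>
     \<comment> \<open>lower semicontinuity\<close>
     (\<forall>a. openin (prod_topology (emm_top X) (emm_top X))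
            {p \<in> topspace (emm_top X) \<times> topspace (emm_top X). a < emm_dist X (fst p) (snd p)}) \<and>
     (\<forall>U. openin (emm_top X) U \<longrightarrow> ext_open_on (topspace (emm_top X)) (emm_dist X) U) \<and>
     sets (emm_measure X) = sets (borel_of (emm_top X)) \<and>
     prob_space (emm_measure X)"

definition emm_of_mm :: "'a mm_data \<Rightarrow> 'a emm_data" where
  "emm_of_mm X =
     \<lparr>emm_top = mtopology_of (mm_metric X),
      emm_dist = (\<lambda>x y. ennreal (mdist (mm_metric X) x y)),
      emm_measure = mm_measure X\<rparr>"

definition mm_support :: "'a mm_data \<Rightarrow> 'a set" where
  "mm_support X = {x \<in> mspace (mm_metric X).
     \<forall>U. openin (mtopology_of (mm_metric X)) U \<and> x \<in> U \<longrightarrow> 0 < emeasure (mm_measure X) U}"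

definition mm_iso :: "'a mm_data \<Rightarrow> 'b mm_data \<Rightarrow> bool" where
  "mm_iso X Y \<longleftrightarrow>
     (\<exists>F \<in> mm_measure X \<rightarrow>\<^sub>M mm_measure Y.
        distr (mm_measure X) (mm_measure Y) F = mm_measure Y \<and>
        (\<forall>x\<in>mm_support X. \<forall>y\<in>mm_support X.
           mdist (mm_metric Y) (F x) (F y) = mdist (mm_metric X) x y))"

definition emm_iso :: "'a emm_data \<Rightarrow> 'b emm_data \<Rightarrow> bool" where
  "emm_iso X Y \<longleftrightarrow>
     (\<exists>F \<in> completion (emm_measure X) \<rightarrow>\<^sub>M emm_measure Y.
        distr (completion (emm_measure X)) (emm_measure Y) F = emm_measure Y \<and>
        (\<exists>A \<in> sets (completion (emm_measure X)).
           emeasure (completion (emm_measure X)) A = 1 \<and>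
           (\<forall>x\<in>A. \<forall>y\<in>A. emm_dist Y (F x) (F y) = emm_dist X x y)))"

definition emm_prec :: "'a emm_data \<Rightarrow> 'b emm_data \<Rightarrow> bool" (infix "\<prec>\<^sub>e" 50) where
  "Y \<prec>\<^sub>e X \<longleftrightarrow>
     (\<exists>\<phi> \<in> emm_measure X \<rightarrow>\<^sub>M emm_measure Y.
        distr (emm_measure X) (emm_measure Y) \<phi> = emm_measure Y \<and>
        (\<exists>E \<in> sets (emm_measure X).
           emeasure (emm_measure X) E = 1 \<and>
           (\<forall>x\<in>E. \<forall>y\<in>E. emm_dist Y (\<phi> x) (\<phi> y) \<le> emm_dist X x y)))"

definition mm_class :: "'a mm_data \<Rightarrow> real mm_data set" where
  "mm_class X = {Z. mm_space Z \<and> mm_iso X Z}"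

definition mm_classes :: "real mm_data set set" where
  "mm_classes = mm_class ` {X :: real mm_data. mm_space X}"

definition emm_class :: "'a emm_data \<Rightarrow> real emm_data set" where
  "emm_class X = {Z. emm_space Z \<and> emm_iso X Z}"

definition emm_of_mm_class :: "real mm_data set \<Rightarrow> real emm_data set" where
  "emm_of_mm_class c = emm_class (emm_of_mm (rep c))"


section \<open>Spaces of Lipschitz functions\<close>

definition ky_fan :: "'a measure \<Rightarrow> ('a \<Rightarrow> real) \<Rightarrow> ('a \<Rightarrow> real) \<Rightarrow> real" where
  "ky_fan m f g = Inf {\<epsilon>. 0 < \<epsilon> \<and> measure m {x \<in> space m. \<bar>f x - g x\<bar> > \<epsilon>} \<le> \<epsilon>}"

definition L0_class :: "'a measure \<Rightarrow> ('a \<Rightarrow> real) \<Rightarrow> ('a \<Rightarrow> real) set" where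
  "L0_class m f = {g \<in> borel_measurable m. AE x in m. f x = g x}"

definition L0 :: "'a measure \<Rightarrow> ('a \<Rightarrow> real) set set" where
  "L0 m = L0_class m ` borel_measurable m"

definition L0_dist :: "'a measure \<Rightarrow> ('a \<Rightarrow> real) set \<Rightarrow> ('a \<Rightarrow> real) set \<Rightarrow> real" where
  "L0_dist m F G = ky_fan m (rep F) (rep G)"

definition Lip1 :: "'a emm_data \<Rightarrow> ('a \<Rightarrow> real) set set" where
  "Lip1 X = {F \<in> L0 (emm_measure X).
     \<exists>f\<in>F. \<exists>E \<in> sets (emm_measure X). emeasure (emm_measure X) E = 1 \<and>
       (\<forall>x\<in>E. \<forall>y\<in>E. ennreal \<bar>f x - f y\<bar> \<le> emm_dist X x y)}"

definition translates :: "'a measure \<Rightarrow> ('a \<Rightarrow> real) set \<Rightarrow> ('a \<Rightarrow> real) set set" where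
  "translates m F = {L0_class m (\<lambda>x. f x + c) | f c. f \<in> F}"

definition L1_metric :: "'a emm_data \<Rightarrow> ('a \<Rightarrow> real) set set metric" where
  "L1_metric X =
     metric_on (translates (emm_measure X) ` Lip1 X)
       (\<lambda>U V. Inf {L0_dist (emm_measure X) F G | F G. F \<in> U \<and> G \<in> V})"

definition concentrated :: "'a emm_data \<Rightarrow> bool" where
  "concentrated X \<longleftrightarrow> compact_space (mtopology_of (L1_metric X))"

definition conc_classes :: "real emm_data set set" where
  "conc_classes = emm_class ` {X :: real emm_data. emm_space X \<and> concentrated X}"


section \<open>Observable distance and completion\<close>

definition Leb_I :: "real measure" where
  "Leb_I = restrict_space lborel {0..1}"

definition parameters :: "'a measure \<Rightarrow> (real \<Rightarrow> 'a) set" where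
  "parameters m = {\<iota> \<in> Leb_I \<rightarrow>\<^sub>M m. distr Leb_I m \<iota> = m}"

definition pullback_Lip1 :: "(real \<Rightarrow> 'a) \<Rightarrow> 'a emm_data \<Rightarrow> (real \<Rightarrow> real) set set" where
  "pullback_Lip1 \<iota> X = {L0_class Leb_I (f \<circ> \<iota>) | f F. F \<in> Lip1 X \<and> f \<in> F}"

definition d_conc :: "'a emm_data \<Rightarrow> 'b emm_data \<Rightarrow> real" where
  "d_conc X Y =
     Inf {hausdorff_dist (L0_dist Leb_I) (pullback_Lip1 \<iota> X) (pullback_Lip1 \<kappa> Y) | \<iota> \<kappa>.
            \<iota> \<in> parameters (emm_measure X) \<and> \<kappa> \<in> parameters (emm_measure Y)}"

definition mm_class_conc :: "real mm_data set \<Rightarrow> real mm_data set \<Rightarrow> real" where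
  "mm_class_conc c c' = d_conc (emm_of_mm (rep c)) (emm_of_mm (rep c'))"

definition emm_class_conc :: "real emm_data set \<Rightarrow> real emm_data set \<Rightarrow> real" where
  "emm_class_conc c c' = d_conc (rep c) (rep c')"

text \<open>Under the identification induced by the embedding \<^const>\<open>emm_of_mm_class\<close>, the point of the
  completion given by a Cauchy sequence of mm-isomorphism classes is the limit, in the space of
  concentrated emm-isomorphism classes, of the embedded sequence.\<close>

definition conc_identified :: "(nat \<Rightarrow> real mm_data set) set \<Rightarrow> real emm_data set \<Rightarrow> bool" where
  "conc_identified \<xi> c \<longleftrightarrow>
     c \<in> conc_classes \<and>
     (\<exists>s\<in>\<xi>. (\<lambda>n. emm_class_conc (emm_of_mm_class (s n)) c) \<longlonglongrightarrow> 0)"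

definition conc_completion :: "real emm_data set set" where
  "conc_completion =
     {c. \<exists>\<xi> \<in> cauchy_completion mm_classes mm_class_conc. conc_identified \<xi> c}"


section \<open>Box distance and pyramids\<close>

definition box_dist :: "'a mm_data \<Rightarrow> 'b mm_data \<Rightarrow> real" where
  "box_dist X Y =
     Inf {Inf {\<epsilon>. 0 \<le> \<epsilon> \<and> (\<exists>J \<in> sets Leb_I. measure Leb_I J \<ge> 1 - \<epsilon> \<and>
                 (\<forall>s\<in>J. \<forall>t\<in>J. \<bar>mdist (mm_metric X) (\<iota> s) (\<iota> t)
                               - mdist (mm_metric Y) (\<kappa> s) (\<kappa> t)\<bar> \<le> \<epsilon>))} | \<iota> \<kappa>.
            \<iota> \<in> parameters (mm_measure X) \<and> \<kappa> \<in> parameters (mm_measure Y)}"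

definition box_closure :: "real mm_data set set \<Rightarrow> real mm_data set set" where
  "box_closure P = {c \<in> mm_classes. \<forall>\<epsilon>>0. \<exists>c'\<in>P. box_dist (rep c) (rep c') < \<epsilon>}"

definition mm_class_prec :: "real mm_data set \<Rightarrow> real mm_data set \<Rightarrow> bool" where
  "mm_class_prec c c' \<longleftrightarrow> emm_of_mm (rep c) \<prec>\<^sub>e emm_of_mm (rep c')"

definition pyramid :: "real mm_data set set \<Rightarrow> bool" where
  "pyramid P \<longleftrightarrow>
     P \<noteq> {} \<and> P \<subseteq> mm_classes \<and> box_closure P = P \<and>
     (\<forall>c\<in>P. \<forall>c'\<in>mm_classes. mm_class_prec c' c \<longrightarrow> c' \<in> P) \<and>
     (\<forall>c\<in>P. \<forall>c'\<in>P. \<exists>z\<in>P. mm_class_prec c z \<and> mm_class_prec c' z)"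

definition concentrated_pyramid :: "real mm_data set set \<Rightarrow> bool" where
  "concentrated_pyramid P \<longleftrightarrow>
     pyramid P \<and>
     precompact_in GH_topology ((\<lambda>c. isometry_class (L1_metric (emm_of_mm (rep c)))) ` P)"

definition mm_below :: "'a emm_data \<Rightarrow> real mm_data set set" where
  "mm_below X = {c \<in> mm_classes. emm_of_mm (rep c) \<prec>\<^sub>e X}"

end

theory Submission
  imports Defs "HOL-Library.Diagonal_Subsequence"
begin

text \<open>The space \<open>L\<^sub>1(X)\<close> is always complete, so its compactness amounts to total boundedness
  of the 1-Lipschitz functions modulo constants.

  If it is compact, a finite net of 1-Lipschitz functions maps \<open>X\<close> to an mm-space in a
  finite-dimensional space with the maximum metric. The 1-Lipschitz functions of that mm-space,
  pulled back to \<open>X\<close>, lie between the net and all 1-Lipschitz functions of \<open>X\<close>; so these mm-spaces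
  converge to \<open>X\<close> for the observable distance.

  Moreover, the set of dominated mm-spaces is then already box-closed. If dominated spaces \<open>Y\<^sub>n\<close>
  converge to \<open>Y\<close>, the distance functions from a dense sequence of \<open>Y\<close> are transported to \<open>Y\<^sub>n\<close> by
  McShane extension and pulled back to \<open>X\<close>, where they converge almost everywhere along a subsequence.
  The joint law of the limits is that of the distance functions on \<open>Y\<close>, so they are the distance
  functions along a 1-Lipschitz map from \<open>X\<close> that pushes the measure of \<open>X\<close> to that of \<open>Y\<close>. Since
  \<open>L\<^sub>1(Y)\<close> embeds isometrically into \<open>L\<^sub>1(X)\<close> for dominated \<open>Y\<close>, Blaschke's selection theorem gives
  the precompactness.

  Conversely, if \<open>L\<^sub>1(X)\<close> is not totally bounded, finite separated families of 1-Lipschitz functions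
  factor through dominated mm-spaces and make separated sets of unbounded size in the spaces \<open>L\<^sub>1(Y)\<close>.\<close>

section \<open>Standard Borel measures\<close>

text \<open>The extended distance of an emm-space need be neither finite nor continuous for the
  topology, so the analysis sees \<open>X\<close> only through its a.e. 1-Lipschitz functions and
  its measure-preserving maps to mm-spaces. This is why measurable structure comes first: Polish
  spaces are coded as Borel retracts of the line, which supplies parameters, copies with a real
  carrier for the types of classes, and measurable a.e. inverses. The inverses make isomorphism
  symmetric, so whatever is evaluated at \<open>rep\<close> can be moved back to the given space.

  The second obstacle is the quotient by constants. Compactness of \<open>L1_metric X\<close> gives
  convergence only up to constants, and these are controlled in three ways: by a good choice for
  completeness, by tightness of laws for box limits, and by adding them to the approximating
  functions for the observable distance, where \<open>Lip1\<close> is not divided by constants.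

  Gromov-Hausdorff distances are handled through correspondences, which compose and invert more
  easily than embeddings into ambient spaces.\<close>

lemma space_borel_of [simp]: "space (borel_of T) = topspace T"
  by (simp add: borel_of_def space_measure_of_conv)

lemma sets_borel_of: "sets (borel_of T) = sigma_sets (topspace T) {U. openin T U}"
  unfolding borel_of_def by (rule sets_measure_of) (auto dest: openin_subset)

lemma openin_sets_borel_of: "openin T U \<Longrightarrow> U \<in> sets (borel_of T)"
  by (auto simp: sets_borel_of)

lemma (in Metric_space) separable_dense_sequence:
  assumes "separable_space mtopology" "M \<noteq> {}"
  obtains a :: "nat \<Rightarrow> 'a" where "range a \<subseteq> M" "\<And>x e. x \<in> M \<Longrightarrow> 0 < e \<Longrightarrow> \<exists>i. d (a i) x < e"
proof -
  obtain C where C: "countable C" "C \<subseteq> M" "mtopology closure_of C = M"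
    using assms(1) by (auto simp: separable_space_def)
  have "C \<noteq> {}" using C(3) assms(2) by auto
  then have r: "range (from_nat_into C) = C" using C(1) by (rule range_from_nat_into)
  show thesis
  proof (rule that[of "from_nat_into C"])
    show "range (from_nat_into C) \<subseteq> M" using r C by simp
    fix x and e :: real assume "x \<in> M" "0 < e"
    with C(3) obtain y where "y \<in> C" "d x y < e" by (force simp: metric_closure_of)
    with r show "\<exists>i. d (from_nat_into C i) x < e" by (metis commute imageE)
  qed
qed

text \<open>Every open set is a union of balls from the countable family with centres
  \<open>a i\<close> and dyadic radii, so the distances to a dense sequence detect all Borel sets.
  It serves for the decoder of a Polish space, for pairs of maps and for the inverse of the
  Kuratowski embedding.\<close>

lemma (in Metric_space) measurable_borel_of_mtopology:
  fixes a :: "nat \<Rightarrow> 'a"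
  assumes a: "range a \<subseteq> M" and dense: "\<And>x e. x \<in> M \<Longrightarrow> 0 < e \<Longrightarrow> \<exists>i. d (a i) x < e"
    and f: "f \<in> space N \<rightarrow> M" and m: "\<And>i. (\<lambda>x. d (a i) (f x)) \<in> borel_measurable N"
  shows "f \<in> N \<rightarrow>\<^sub>M borel_of mtopology"
  unfolding borel_of_def
proof (rule measurable_measure_of)
  show "{U. openin mtopology U} \<subseteq> Pow (topspace mtopology)" using openin_subset[of mtopology] by blast
  show "f \<in> space N \<rightarrow> topspace mtopology" using f by simp
  fix U assume "U \<in> {U. openin mtopology U}"
  then have U: "openin mtopology U" by simp
  let ?I = "{p :: nat \<times> nat. mball (a (fst p)) (1/2^snd p) \<subseteq> U}"
  have *: "\<exists>p\<in>?I. d (a (fst p)) x < 1/2^snd p" if "x \<in> U" for x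
  proof -
    obtain r where r: "r > 0" "mball x r \<subseteq> U" using U \<open>x \<in> U\<close> by (meson openin_mtopology)
    have xM: "x \<in> M" using U \<open>x \<in> U\<close> by (meson openin_mtopology subsetD)
    \<comment> \<open>Radius below \<open>r/2\<close>: a ball of this radius whose centre is that
      close to \<open>x\<close> stays inside \<open>mball x r\<close>.\<close>
    obtain j where j: "(1/2)^j < r/2" using r(1) by (meson half_gt_zero one_less_numeral_iff reals_power_lt_ex real_arch_pow_inv semiring_norm(76) divide_less_eq_1_pos zero_less_numeral)
    obtain i where i: "d (a i) x < (1/2)^j" using dense[OF xM, of "(1/2)^j"] by auto
    have ai: "a i \<in> M" using a by auto
    have "mball (a i) ((1/2)^j) \<subseteq> mball x r"
      by (rule mball_subset) (use i j xM ai commute[of "a i" x] in auto)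
    then show ?thesis using r i by (intro bexI[of _ "(i,j)"]) (auto simp: power_one_over)
  qed
  have **: "f x \<in> U" if "p \<in> ?I" "x \<in> space N" "d (a (fst p)) (f x) < 1/2^snd p" for p x
    using that a f by (auto simp: subset_iff Pi_iff)
  have "f -` U \<inter> space N = (\<Union>p\<in>?I. {x\<in>space N. d (a (fst p)) (f x) < 1/2^snd p})"
    using * ** by blast
  also have "\<dots> \<in> sets N"
    using m by (intro sets.countable_UN') auto
  finally show "f -` U \<inter> space N \<in> sets N" .
qed

lemma (in Metric_space) measurable_dist_borel_of:
  assumes "x \<in> M" shows "d x \<in> borel_measurable (borel_of mtopology)"
proof -
  have "{y \<in> space (borel_of mtopology). d x y < r} = mball x r" for r
    using assms by auto
  then show ?thesis unfolding borel_measurable_iff_less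
    by (metis openin_sets_borel_of openin_mball)
qed

text \<open>Digits 0 and 1 in base three: everything after the first digit contributes at most 1/6,
  so the threshold 1/3 reads off the digit without the double expansions of base two. The coding is
  therefore injective with a Borel decoder.\<close>

definition ternary :: "(nat \<Rightarrow> bool) \<Rightarrow> real" where
  "ternary b = (\<Sum>n. of_bool (b n) * (1/3)^Suc n)"

fun ternary_digit :: "nat \<Rightarrow> real \<Rightarrow> bool" where
  "ternary_digit 0 t = (1/3 \<le> t)"
| "ternary_digit (Suc n) t = ternary_digit n (3 * t - of_bool (1/3 \<le> t))"

lemma summable_ternary: "summable (\<lambda>n. of_bool (b n) * (1/3::real)^Suc n)"
proof (rule summable_comparison_test')
  show "summable (\<lambda>n. (1/3::real)^Suc n)" by (subst summable_Suc_iff) (simp add: summable_geometric)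
  show "norm (of_bool (b n) * (1/3::real)^Suc n) \<le> (1/3)^Suc n" for n by auto
qed

lemma ternary_bounds: "0 \<le> ternary b" "ternary b \<le> 1/2"
proof -
  show "0 \<le> ternary b" unfolding ternary_def by (intro suminf_nonneg summable_ternary) auto
  have s: "(\<lambda>n. (1/3::real)^Suc n) sums (1/2)"
    using geometric_sums[of "1/3::real"] by (subst sums_Suc_iff) simp
  have "ternary b \<le> (\<Sum>n. (1/3::real)^Suc n)"
    unfolding ternary_def by (intro suminf_le summable_ternary sums_summable[OF s]) auto
  then show "ternary b \<le> 1/2" using s by (simp add: sums_iff)
qed

lemma ternary_rec: "3 * ternary b = of_bool (b 0) + ternary (\<lambda>n. b (Suc n))"
proof -
  have "(\<Sum>n. of_bool (b (Suc n)) * (1/3::real)^Suc (Suc n)) = ternary b - of_bool (b 0) / 3"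
    unfolding ternary_def using suminf_split_head[OF summable_ternary[of b]] by simp
  moreover have "(\<Sum>n. of_bool (b (Suc n)) * (1/3::real)^Suc (Suc n)) = ternary (\<lambda>n. b (Suc n)) / 3"
    unfolding ternary_def using suminf_mult[OF summable_ternary[of "\<lambda>n. b (Suc n)"], of "1/3"]
    by (simp add: algebra_simps)
  ultimately show ?thesis by simp
qed

lemma ternary_digit_ternary: "ternary_digit n (ternary b) = b n"
proof (induction n arbitrary: b)
  case 0
  show ?case using ternary_rec[of b] ternary_bounds[of b] ternary_bounds[of "\<lambda>n. b (Suc n)"]
    by (cases "b 0") auto
next
  case (Suc n)
  have "1/3 \<le> ternary b \<longleftrightarrow> b 0" 
    using ternary_rec[of b] ternary_bounds[of b] ternary_bounds[of "\<lambda>n. b (Suc n)"]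
    by (cases "b 0") auto
  then have "3 * ternary b - of_bool (1/3 \<le> ternary b) = ternary (\<lambda>n. b (Suc n))"
    using ternary_rec[of b] by simp
  then show ?case using Suc by simp
qed

lemma measurable_ternary_digit [measurable]: "Measurable.pred borel (ternary_digit n)"
proof (induction n)
  case (Suc n)
  have "(\<lambda>t. 3 * t - of_bool (1/3 \<le> t)) \<in> borel_measurable (borel :: real measure)"
    by measurable
  from measurable_compose[OF this Suc] show ?case by (simp add: pred_def)
qed (simp add: pred_def)

text \<open>\<open>M\<close> is a Borel retract of the line. The left inverse \<open>r\<close> is
  part of the notion because facts about the line are transported to \<open>M\<close> by composing
  with \<open>e\<close> on one side and with \<open>r\<close> on the other.\<close>

definition standard :: "'a measure \<Rightarrow> bool" where
  "standard M \<longleftrightarrow> (\<exists>e \<in> borel_measurable M. \<exists>r \<in> (borel :: real measure) \<rightarrow>\<^sub>M M. \<forall>x\<in>space M. r (e x) = x)"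

lemma standardE:
  assumes "standard M"
  obtains e r where "e \<in> borel_measurable M" "r \<in> (borel :: real measure) \<rightarrow>\<^sub>M M" "\<forall>x\<in>space M. r (e x) = x"
  using assms by (auto simp: standard_def)

text \<open>The code of a point lists, for all \<open>i\<close> and \<open>j\<close>, whether
  \<open>a i\<close> lies within \<open>(1/2)^j\<close> of it. Decoding picks for each
  \<open>j\<close> the first centre that is listed and passes to the limit of these centres.\<close>

lemma (in Metric_space) standard_borel_of:
  assumes "mcomplete" "separable_space mtopology" "M \<noteq> {}"
    and N: "sets N = sets (borel_of mtopology)"
  shows "standard N"
proof -
  obtain a :: "nat \<Rightarrow> 'a" where a: "range a \<subseteq> M"
    and dense: "\<And>x e. x \<in> M \<Longrightarrow> 0 < e \<Longrightarrow> \<exists>i. d (a i) x < e"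
    using separable_dense_sequence[OF assms(2,3)] by metis
  have aM: "a i \<in> M" for i using a by auto
  have spN: "space N = M" using sets_eq_imp_space_eq[OF N] by simp
  have dm: "d (a i) \<in> borel_measurable N" for i
    using measurable_dist_borel_of[OF aM[of i]] measurable_cong_sets[OF N refl] by blast
  define e where "e x = ternary (\<lambda>n. d (a (fst (prod_decode n))) x < (1/2)^snd (prod_decode n))" for x
  have e: "e \<in> borel_measurable N"
    unfolding e_def ternary_def using dm by measurable
  define I where "I j t = (LEAST i. ternary_digit (prod_encode (i, j)) t)" for j t
  have I [measurable]: "I j \<in> borel \<rightarrow>\<^sub>M count_space UNIV" for j
    unfolding I_def by measurable
  define x where "x t j = a (I j t)" for t j
  \<comment> \<open>The Cauchy property with tolerances \<open>inverse (real (Suc n))\<close> has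
    only countable quantifiers, hence is a Borel condition on \<open>t\<close>. All other reals are
    sent to the default \<open>a 0\<close>.\<close>
  define Q where "Q t \<longleftrightarrow> (\<forall>n::nat. \<exists>N. \<forall>i\<ge>N. \<forall>j\<ge>N. d (x t i) (x t j) < inverse (real (Suc n)))" for t
  have dd: "(\<lambda>t. d (x t i) (x t j)) \<in> borel_measurable borel" for i j
    unfolding x_def by measurable
  have Q [measurable]: "Measurable.pred borel Q"
    unfolding Q_def using dd by measurable
  have xM: "x t j \<in> M" for t j unfolding x_def using aM by simp
  define r where "r t = (if Q t then SOME l. limitin mtopology (x t) l sequentially else a 0)" for t
  have MC: "MCauchy (x t)" if "Q t" for t
    unfolding MCauchy_def
  proof safe
    fix \<epsilon> :: real assume "\<epsilon> > 0"
    then obtain n where "inverse (real (Suc n)) < \<epsilon>" using reals_Archimedean by blast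
    with that show "\<exists>N. \<forall>n n'. N \<le> n \<longrightarrow> N \<le> n' \<longrightarrow> d (x t n) (x t n') < \<epsilon>"
      unfolding Q_def by (meson less_trans)
  qed (use xM in auto)
  have lim: "limitin mtopology (x t) (r t) sequentially" if "Q t" for t
  proof -
    have "\<exists>l. limitin mtopology (x t) l sequentially"
      using assms(1) MC[OF that] unfolding mcomplete_def by auto
    then show ?thesis using that unfolding r_def by (auto intro: someI_ex)
  qed
  have rM: "r t \<in> M" for t
    using lim[of t] aM by (cases "Q t") (auto simp: r_def limitin_mspace)
  have dconv: "(\<lambda>j. d y (x t j)) \<longlonglongrightarrow> d y (r t)" if "Q t" "y \<in> M" for t y
  proof -
    have "(\<lambda>j. d (x t j) (r t)) \<longlonglongrightarrow> 0" using lim[OF that(1)] limitin_metric_dist_null by auto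
    then have "(\<lambda>j. d y (x t j) - d y (r t)) \<longlonglongrightarrow> 0"
      by (rule Lim_null_comparison[rotated])
        (use mdist_reverse_triangle xM rM that commute in \<open>auto intro!: always_eventually simp: abs_minus_commute\<close>, metis mdist_reverse_triangle xM rM that(2) commute)
    then show ?thesis by (simp add: LIM_zero_iff)
  qed
  have rm: "r \<in> borel \<rightarrow>\<^sub>M borel_of mtopology"
  proof (rule measurable_borel_of_mtopology[OF a dense])
    show "r \<in> space borel \<rightarrow> M" using rM by auto
    fix k
    have dk: "(\<lambda>t. d (a k) (x t j)) \<in> borel_measurable borel" for j
      unfolding x_def by measurable
    \<comment> \<open>Composed with a distance, the limit that defines \<open>r\<close> becomes a
      limit of real functions, and \<open>lim\<close> preserves measurability of those.\<close>
    have "d (a k) (r t) = (if Q t then lim (\<lambda>j. d (a k) (x t j)) else d (a k) (a 0))" for t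
    proof (cases "Q t")
      case True
      then show ?thesis using limI[OF dconv[OF True aM[of k]]] by simp
    qed (simp add: r_def)
    moreover have "(\<lambda>t. if Q t then lim (\<lambda>j. d (a k) (x t j)) else d (a k) (a 0)) \<in> borel_measurable borel"
      using dk by measurable
    ultimately show "(\<lambda>t. d (a k) (r t)) \<in> borel_measurable borel" by presburger
  qed
  have "r (e y) = y" if y: "y \<in> M" for y
  proof -
    have less: "d (x (e y) j) y < (1/2)^j" for j
    proof -
      have *: "ternary_digit (prod_encode (i, j)) (e y) \<longleftrightarrow> d (a i) y < (1/2)^j" for i
        unfolding e_def ternary_digit_ternary by simp
      obtain i where "d (a i) y < (1/2)^j" using dense[OF y, of "(1/2)^j"] by auto
      then show ?thesis unfolding x_def I_def * by (rule LeastI)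
    qed
    have "(\<lambda>j. d (x (e y) j) y) \<longlonglongrightarrow> 0"
      by (rule tendsto_sandwich[of "\<lambda>_. 0" _ _ "\<lambda>j. (1/2::real)^j"])
        (use less in \<open>auto intro!: always_eventually less_imp_le LIMSEQ_realpow_zero\<close>)
    then have l: "limitin mtopology (x (e y)) y sequentially"
      using y xM by (auto simp: limitin_metric_dist_null)
    then have "MCauchy (x (e y))" using xM by (auto intro!: convergent_imp_MCauchy)
    then have "Q (e y)" unfolding MCauchy_def Q_def
      by (metis inverse_positive_iff_positive of_nat_0_less_iff zero_less_Suc)
    from lim[OF this] l show ?thesis by (rule limitin_metric_unique) simp
  qed
  then show ?thesis unfolding standard_def
    using e rm spN measurable_cong_sets[OF refl N] by blast
qed

lemma standard_polish:
  assumes "completely_metrizable_space T" "separable_space T" "sets N = sets (borel_of T)" "prob_space N"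
  shows "standard N"
proof -
  obtain M d where M: "Metric_space M d" "Metric_space.mcomplete M d" "T = Metric_space.mtopology M d"
    using assms(1) by (auto simp: completely_metrizable_space_def)
  interpret Metric_space M d by fact
  have "M \<noteq> {}"
    using prob_space.not_empty[OF assms(4)] sets_eq_imp_space_eq[OF assms(3)] M(3) by auto
  then show ?thesis using standard_borel_of M assms by auto
qed

section \<open>Parameters and almost-everywhere inverses\<close>

lemma prob_space_Leb_I: "prob_space Leb_I"
  unfolding Leb_I_def by (intro prob_spaceI) (simp add: emeasure_restrict_space space_restrict_space)

text \<open>Quantile transform: \<open>I\<close> is the generalized inverse of the distribution
  function and lives on the open unit interval. On the closed interval the extension by 0 concerns
  only the two endpoints, which are null.\<close>

lemma real_distribution_parameter:
  assumes "real_distribution \<nu>"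
  obtains q where "q \<in> borel_measurable Leb_I" "distr Leb_I borel q = \<nu>"
proof -
  interpret cdf_distribution \<nu> using assms by (simp add: cdf_distribution_def)
  define q where "q s = (if s \<in> {0<..<1} then I s else 0)" for s
  have J: "q \<in> borel_measurable borel"
    unfolding q_def using measurable_CI by (subst measurable_restrict_space_iff[symmetric]) auto
  have q: "q \<in> borel_measurable Leb_I"
    unfolding Leb_I_def by (rule measurable_restrict_space1) (use J in simp)
  have "distr Leb_I borel q = distr (restrict_space lborel {0<..<1::real}) borel I"
  proof (rule measure_eqI)
    fix A assume "A \<in> sets (distr Leb_I borel q)"
    then have A: "A \<in> sets borel" by simp
    have "emeasure (distr Leb_I borel q) A = emeasure lborel (q -` A \<inter> {0..1})"
      using A q by (simp add: emeasure_distr) (simp add: Leb_I_def emeasure_restrict_space space_restrict_space)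
    also have "\<dots> = emeasure lborel (I -` A \<inter> {0<..<1})"
    proof (rule emeasure_eq_AE)
      show "AE x in lborel. (x \<in> q -` A \<inter> {0..1}) = (x \<in> I -` A \<inter> {0<..<1})"
        using AE_lborel_singleton[of 0] AE_lborel_singleton[of 1]
        by eventually_elim (auto simp: q_def)
      show "q -` A \<inter> {0..1} \<in> sets lborel" using measurable_sets[OF J A] by simp
      show "I -` A \<inter> {0<..<1} \<in> sets lborel"
        using measurable_sets[OF measurable_CI A] by (simp add: sets_restrict_space space_restrict_space) auto
    qed
    also have "\<dots> = emeasure (distr (restrict_space lborel {0<..<1::real}) borel I) A"
      using A measurable_CI by (subst emeasure_distr)
        (auto simp: emeasure_restrict_space space_restrict_space intro: measurable_CI cong: measurable_cong_sets)
    finally show "emeasure (distr Leb_I borel q) A = emeasure (distr (restrict_space lborel {0<..<1::real}) borel I) A" .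
  qed simp
  then show thesis using that[OF q] distr_I_eq_M by simp
qed

text \<open>The quantile transform of the coded law, decoded by \<open>r\<close>, has law
  \<open>M\<close>, since \<open>r\<close> undoes \<open>e\<close> on the space of
  \<open>M\<close>.\<close>

lemma parameters_nonempty:
  assumes "standard M" "prob_space M"
  shows "parameters M \<noteq> {}"
proof -
  obtain e r where e: "e \<in> borel_measurable M" and r: "r \<in> (borel :: real measure) \<rightarrow>\<^sub>M M"
    and re: "\<And>x. x \<in> space M \<Longrightarrow> r (e x) = x" using assms(1) by (auto simp: standard_def)
  interpret prob_space M by fact
  have "real_distribution (distr M borel e)" using e by (rule real_distribution_distr)
  then obtain q where q: "q \<in> borel_measurable Leb_I" "distr Leb_I borel q = distr M borel e"
    using real_distribution_parameter by blast
  have "distr Leb_I M (r \<circ> q) = distr (distr Leb_I borel q) M r"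
    using q(1) r by (simp add: distr_distr)
  also have "\<dots> = distr M M (r \<circ> e)" using q e r by (simp add: distr_distr)
  also have "\<dots> = distr M M (\<lambda>x. x)" by (rule distr_cong) (use re in auto)
  also have "\<dots> = M" by simp
  finally have "r \<circ> q \<in> parameters M" using q r by (auto simp: parameters_def)
  then show ?thesis by blast
qed

text \<open>The graph of \<open>f\<close> over \<open>A\<close> is a Borel set in the plane; inner regularity exhausts it by
  compact sets, whose projections to the first axis carry a Borel inverse.\<close>

lemma real_ae_inverse:
  fixes f :: "real \<Rightarrow> real"
  assumes f [measurable]: "f \<in> borel_measurable borel" and \<nu>: "prob_space \<nu>" "sets \<nu> = sets borel"
    and A [measurable]: "A \<in> sets borel" and A1: "emeasure \<nu> A = 1" and inj: "inj_on f A"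
  obtains g B where "g \<in> borel_measurable borel" "B \<in> sets borel" "B \<subseteq> A" "emeasure \<nu> B = 1"
    "\<And>x. x \<in> B \<Longrightarrow> g (f x) = x"
proof -
  interpret prob_space \<nu> by fact
  have sp: "space \<nu> = UNIV" using sets_eq_imp_space_eq[OF \<nu>(2)] by simp
  define h where "h x = (f x, x)" for x
  have hm: "h \<in> borel \<rightarrow>\<^sub>M borel" unfolding h_def by (intro borel_measurable_Pair) auto
  then have h: "h \<in> \<nu> \<rightarrow>\<^sub>M borel" using measurable_cong_sets[OF \<nu>(2) refl] by blast
  define \<gamma> where "\<gamma> = distr \<nu> borel h"
  interpret \<gamma>: prob_space \<gamma> unfolding \<gamma>_def by (rule prob_space_distr[OF h])
  define G where "G = {p. snd p \<in> A \<and> fst p = f (snd p)}"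
  have [measurable]: "fst \<in> (borel :: (real \<times> real) measure) \<rightarrow>\<^sub>M borel" "snd \<in> (borel :: (real \<times> real) measure) \<rightarrow>\<^sub>M borel"
    by (auto intro!: borel_measurable_continuous_onI continuous_intros)
  have G: "G \<in> sets borel" unfolding G_def by measurable
  have em: "emeasure \<gamma> C = emeasure \<nu> {x. h x \<in> C}" if "C \<in> sets borel" for C
    unfolding \<gamma>_def using that h sp by (simp add: emeasure_distr vimage_def)
  have G1: "emeasure \<gamma> G = 1"
    unfolding em[OF G] using A1 by (simp add: G_def h_def)
  have "\<exists>K. compact K \<and> K \<subseteq> G \<and> emeasure \<gamma> K > ennreal (1 - 1 / Suc n)" for n
  proof -
    have "ennreal (1 - 1 / Suc n) < emeasure \<gamma> G"
      unfolding G1 ennreal_1[symmetric] by (rule ennreal_lessI) auto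
    also have "emeasure \<gamma> G = (SUP K \<in> {K. K \<subseteq> G \<and> compact K}. emeasure \<gamma> K)"
      by (rule inner_regular) (use G \<gamma>.emeasure_finite in \<open>auto simp: \<gamma>_def\<close>)
    finally show ?thesis unfolding less_SUP_iff by auto
  qed
  then obtain K where K: "\<And>n. compact (K n)" "\<And>n. K n \<subseteq> G" "\<And>n. emeasure \<gamma> (K n) > ennreal (1 - 1 / Suc n)"
    by metis
  define U where "U = (\<Union>n. K n)"
  have U: "U \<in> sets borel" unfolding U_def using K(1) by (auto intro!: borel_compact sets.countable_UN)
  have UG: "U \<subseteq> G" unfolding U_def using K by auto
  have U1: "emeasure \<gamma> U = 1"
  proof (rule antisym)
    show "emeasure \<gamma> U \<le> 1" by (rule \<gamma>.emeasure_le_1)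
    have "ennreal (1 - 1 / Suc n) \<le> emeasure \<gamma> U" for n
      using K(3)[of n] emeasure_mono[of "K n" U \<gamma>] U by (force simp: U_def \<gamma>_def)
    moreover have "(\<lambda>n. ennreal (1 - 1 / Suc n)) \<longlonglongrightarrow> ennreal (1 - 0)"
      by (intro tendsto_ennrealI tendsto_diff tendsto_const LIMSEQ_inverse_real_of_nat[unfolded inverse_eq_divide])
    ultimately show "1 \<le> emeasure \<gamma> U" by (intro LIMSEQ_le_const2) auto
  qed
  define g where "g y = (if \<exists>x. (y, x) \<in> U then THE x. (y, x) \<in> U else 0)" for y
  have uniq: "x = x'" if "(y, x) \<in> U" "(y, x') \<in> U" for x x' y
  proof -
    have "x \<in> A" "x' \<in> A" "f x = f x'" using that UG by (auto simp: G_def subset_iff)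
    then show ?thesis using inj by (auto dest: inj_onD)
  qed
  have gU: "g y = x" if "(y, x) \<in> U" for x y
    unfolding g_def using that uniq by auto
  have "g \<in> borel_measurable borel"
    unfolding borel_measurable_iff_le
  proof safe
    fix c
    \<comment> \<open>Over the projection of \<open>U\<close>, a sublevel set of \<open>g\<close> is
      the projection of the sets \<open>K n\<close> cut by a closed half plane, a countable union of
      compact sets. Elsewhere \<open>g\<close> is 0, which adds the complement of \<open>?D\<close>
      exactly when \<open>0 \<le> c\<close>.\<close>
    have cl: "fst ` (K n \<inter> S) \<in> sets borel" if "closed S" for n S
      using compact_Int_closed[OF K(1) that] by (intro borel_compact compact_continuous_image continuous_intros)
    let ?D = "\<Union>n. fst ` (K n \<inter> UNIV)"
    have D: "?D \<in> sets borel" by (intro sets.countable_UN) (use cl[of UNIV] in auto)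
    have "{w \<in> space borel. g w \<le> c} = (\<Union>n. fst ` (K n \<inter> {p. snd p \<le> c})) \<union> (if 0 \<le> c then - ?D else {})"
      (is "?L = ?R")
    proof (rule set_eqI)
      fix y show "y \<in> ?L \<longleftrightarrow> y \<in> ?R"
      proof (cases "\<exists>x. (y, x) \<in> U")
        case True
        then obtain x where x: "(y, x) \<in> U" by auto
        have "y \<in> ?D" using x by (force simp: U_def)
        moreover have "y \<in> (\<Union>n. fst ` (K n \<inter> {p. snd p \<le> c})) \<longleftrightarrow> x \<le> c"
        proof
          assume "y \<in> (\<Union>n. fst ` (K n \<inter> {p. snd p \<le> c}))"
          then obtain n x' where "(y, x') \<in> K n" "x' \<le> c" by auto
          then show "x \<le> c" using uniq[OF x, of x'] by (auto simp: U_def)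
        next
          assume "x \<le> c" then show "y \<in> (\<Union>n. fst ` (K n \<inter> {p. snd p \<le> c}))"
            using x by (force simp: U_def)
        qed
        ultimately show ?thesis using gU[OF x] by auto
      next
        case False
        then have "y \<notin> ?D" "y \<notin> (\<Union>n. fst ` (K n \<inter> {p. snd p \<le> c}))" by (auto simp: U_def)
        then show ?thesis using False by (auto simp: g_def)
      qed
    qed
    moreover have "closed {p :: real \<times> real. snd p \<le> c}"
      by (intro closed_Collect_le continuous_intros)
    ultimately show "{w \<in> space borel. g w \<le> c} \<in> sets borel"
      using D by (auto intro!: sets.Un sets.countable_UN cl sets.Diff simp: Compl_eq_Diff_UNIV)
  qed
  moreover have "{x. h x \<in> U} \<in> sets borel"
    using measurable_sets[OF hm U] by (simp add: vimage_def)
  moreover have "{x. h x \<in> U} \<subseteq> A" using UG by (auto simp: h_def G_def)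
  moreover have "emeasure \<nu> {x. h x \<in> U} = 1" using em[OF U] U1 by simp
  moreover have "g (f x) = x" if "x \<in> {x. h x \<in> U}" for x
    using that gU by (auto simp: h_def)
  ultimately show thesis using that by blast
qed

text \<open>Both spaces are replaced by their codes: the map becomes \<open>f\<close> on the line,
  injective on the codes of points of \<open>A\<close>, and the inverse found there is
  decoded.\<close>

lemma standard_ae_inverse:
  assumes M: "standard M" "prob_space M" and N: "standard N"
    and F: "F \<in> M \<rightarrow>\<^sub>M N" and A: "A \<in> sets M" "emeasure M A = 1" "inj_on F A"
  obtains G B where "G \<in> N \<rightarrow>\<^sub>M M" "B \<in> sets M" "B \<subseteq> A" "emeasure M B = 1"
    "\<And>x. x \<in> B \<Longrightarrow> G (F x) = x"
proof -
  obtain e r where e: "e \<in> borel_measurable M" and r: "r \<in> (borel :: real measure) \<rightarrow>\<^sub>M M"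
    and re: "\<And>x. x \<in> space M \<Longrightarrow> r (e x) = x" using M(1) by (auto simp: standard_def)
  obtain e' r' where e': "e' \<in> borel_measurable N" and r': "r' \<in> (borel :: real measure) \<rightarrow>\<^sub>M N"
    and re': "\<And>x. x \<in> space N \<Longrightarrow> r' (e' x) = x" using N by (auto simp: standard_def)
  interpret prob_space M by fact
  note [measurable] = e r e' r' F A(1)
  have AM: "x \<in> A \<Longrightarrow> x \<in> space M" for x using sets.sets_into_space[OF A(1)] by auto
  define f where "f t = e' (F (r t))" for t
  have f: "f \<in> borel_measurable borel" unfolding f_def by measurable
  \<comment> \<open>The condition \<open>e (r t) = t\<close> selects the genuine codes. On these
    \<open>r\<close> is injective, and so is \<open>f\<close>.\<close>
  define A' where "A' = {t. r t \<in> A \<and> e (r t) = t}"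
  have A': "A' \<in> sets borel" unfolding A'_def by measurable
  have "emeasure (distr M borel e) A' = emeasure M (e -` A' \<inter> space M)"
    by (rule emeasure_distr[OF e A'])
  also have "e -` A' \<inter> space M = A" using re AM by (auto simp: A'_def)
  finally have 1: "emeasure (distr M borel e) A' = 1" using A by simp
  have inj: "inj_on f A'"
  proof (rule inj_onI)
    fix s t assume st: "s \<in> A'" "t \<in> A'" "f s = f t"
    then have "r' (e' (F (r s))) = r' (e' (F (r t)))" by (simp add: f_def)
    moreover have "F (r s) \<in> space N" "F (r t) \<in> space N"
      using st AM measurable_space[OF F] by (auto simp: A'_def)
    ultimately have "F (r s) = F (r t)" using re' by simp
    then have "r s = r t" using st A(3) by (auto simp: A'_def dest: inj_onD)
    then show "s = t" using st by (auto simp: A'_def)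
  qed
  obtain g B where gB: "g \<in> borel_measurable borel" "B \<in> sets borel" "B \<subseteq> A'"
    "emeasure (distr M borel e) B = 1" "\<And>x. x \<in> B \<Longrightarrow> g (f x) = x"
    using real_ae_inverse[OF f prob_space_distr[OF e] _ A' 1 inj] by auto
  note [measurable] = gB(1,2)
  show thesis
  proof (rule that[of "\<lambda>y. r (g (e' y))" "e -` B \<inter> space M"])
    show "(\<lambda>y. r (g (e' y))) \<in> N \<rightarrow>\<^sub>M M" by measurable
    show "e -` B \<inter> space M \<in> sets M" by measurable
    show "e -` B \<inter> space M \<subseteq> A" using gB(3) re by (auto simp: A'_def)
    show "emeasure M (e -` B \<inter> space M) = 1" using gB(4) emeasure_distr[OF e gB(2)] by simp
    fix x assume "x \<in> e -` B \<inter> space M"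
    then have "g (f (e x)) = e x" "x \<in> space M" using gB(5) by auto
    then show "r (g (e' (F x))) = x" using re by (simp add: f_def)
  qed
qed

section \<open>The Ky Fan distance\<close>

context prob_space
begin

lemma ky_fan_nonempty: "1 \<in> {\<epsilon>. 0 < \<epsilon> \<and> measure M {x \<in> space M. \<bar>f x - g x :: real\<bar> > \<epsilon>} \<le> \<epsilon>}"
  by simp

lemma ky_fan_nonneg: "0 \<le> ky_fan M f g"
  unfolding ky_fan_def by (rule cInf_greatest) (use ky_fan_nonempty[of f g] in blast, simp)

lemma ky_fan_le: "0 < e \<Longrightarrow> measure M {x \<in> space M. \<bar>f x - g x\<bar> > e} \<le> e \<Longrightarrow> ky_fan M f g \<le> e"
  unfolding ky_fan_def by (intro cInf_lower) (auto intro: bdd_belowI[of _ 0])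

lemma ky_fan_le_1: "ky_fan M f g \<le> 1"
  by (rule ky_fan_le) auto

lemma ky_fan_less:
  assumes "ky_fan M f g < e" and [measurable]: "f \<in> borel_measurable M" "g \<in> borel_measurable M"
  shows "measure M {x \<in> space M. \<bar>f x - g x\<bar> > e} < e"
proof -
  obtain a where a: "0 < a" "measure M {x \<in> space M. \<bar>f x - g x\<bar> > a} \<le> a" "a < e"
    using cInf_lessD[of "{\<epsilon>. 0 < \<epsilon> \<and> measure M {x \<in> space M. \<bar>f x - g x\<bar> > \<epsilon>} \<le> \<epsilon>}" e]
      assms(1) ky_fan_nonempty[of f g] unfolding ky_fan_def by blast
  have "measure M {x \<in> space M. \<bar>f x - g x\<bar> > e} \<le> measure M {x \<in> space M. \<bar>f x - g x\<bar> > a}"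
    using a by (intro finite_measure_mono) auto
  then show ?thesis using a by simp
qed

lemma ky_fan_commute: "ky_fan M f g = ky_fan M g f"
  by (simp add: ky_fan_def abs_minus_commute)

lemma ky_fan_triangle:
  assumes [measurable]: "f \<in> borel_measurable M" "g \<in> borel_measurable M" "h \<in> borel_measurable M"
  shows "ky_fan M f h \<le> ky_fan M f g + ky_fan M g h"
proof (rule field_le_epsilon)
  fix e :: real assume e: "0 < e"
  define a where "a = ky_fan M f g + e/2"
  define b where "b = ky_fan M g h + e/2"
  have a: "0 < a" "ky_fan M f g < a" and b: "0 < b" "ky_fan M g h < b"
    using e ky_fan_nonneg[of f g] ky_fan_nonneg[of g h] by (auto simp: a_def b_def)
  have "measure M {x \<in> space M. \<bar>f x - h x\<bar> > a + b}
      \<le> measure M ({x \<in> space M. \<bar>f x - g x\<bar> > a} \<union> {x \<in> space M. \<bar>g x - h x\<bar> > b})"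
    by (intro finite_measure_mono) auto
  also have "\<dots> \<le> measure M {x \<in> space M. \<bar>f x - g x\<bar> > a} + measure M {x \<in> space M. \<bar>g x - h x\<bar> > b}"
    by (intro measure_Un_le) auto
  also have "\<dots> \<le> a + b" using ky_fan_less[OF a(2)] ky_fan_less[OF b(2)] assms by fastforce
  finally have "ky_fan M f h \<le> a + b" using a b by (intro ky_fan_le) auto
  then show "ky_fan M f h \<le> ky_fan M f g + ky_fan M g h + e" by (simp add: a_def b_def)
qed

lemma ky_fan_cong_AE:
  assumes [measurable]: "f \<in> borel_measurable M" "g \<in> borel_measurable M"
      "f' \<in> borel_measurable M" "g' \<in> borel_measurable M"
    and "AE x in M. f x = f' x" "AE x in M. g x = g' x"
  shows "ky_fan M f g = ky_fan M f' g'"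
proof -
  have "measure M {x \<in> space M. \<bar>f x - g x\<bar> > e} = measure M {x \<in> space M. \<bar>f' x - g' x\<bar> > e}" for e
  proof (rule finite_measure_eq_AE)
    show "AE x in M. (x \<in> {x \<in> space M. \<bar>f x - g x\<bar> > e}) = (x \<in> {x \<in> space M. \<bar>f' x - g' x\<bar> > e})"
      using assms(5,6) by eventually_elim auto
  qed measurable
  then show ?thesis by (simp add: ky_fan_def)
qed

lemma ky_fan_le_AE:
  assumes "AE x in M. \<bar>f x - g x\<bar> \<le> e" "0 \<le> e"
    and [measurable]: "f \<in> borel_measurable M" "g \<in> borel_measurable M"
  shows "ky_fan M f g \<le> e"
proof (rule field_le_epsilon)
  fix a :: real assume a: "0 < a"
  have "measure M {x \<in> space M. \<bar>f x - g x\<bar> > e + a} = measure M {}"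
  proof (rule finite_measure_eq_AE)
    show "AE x in M. (x \<in> {x \<in> space M. \<bar>f x - g x\<bar> > e + a}) = (x \<in> {})"
      using assms(1) by eventually_elim (use a in auto)
  qed measurable
  then show "ky_fan M f g \<le> e + a" using a assms(2) by (intro ky_fan_le) auto
qed

lemma ky_fan_eq_0_iff:
  assumes [measurable]: "f \<in> borel_measurable M" "g \<in> borel_measurable M"
  shows "ky_fan M f g = 0 \<longleftrightarrow> (AE x in M. f x = g x)"
proof
  assume "AE x in M. f x = g x"
  then have "ky_fan M f g \<le> 0" by (intro ky_fan_le_AE) (auto elim!: AE_mp intro!: AE_I2)
  then show "ky_fan M f g = 0" using ky_fan_nonneg[of f g] by simp
next
  assume 0: "ky_fan M f g = 0"
  have z: "measure M {x \<in> space M. \<bar>f x - g x\<bar> > e} = 0" if "e > 0" for e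
  proof (rule antisym[OF field_le_epsilon])
    fix a :: real assume "a > 0"
    \<comment> \<open>Lowering the threshold to \<open>min a e\<close> only enlarges the exceptional
      set, and at that threshold its measure is below \<open>a\<close>.\<close>
    have "measure M {x \<in> space M. \<bar>f x - g x\<bar> > e} \<le> measure M {x \<in> space M. \<bar>f x - g x\<bar> > min a e}"
      by (intro finite_measure_mono) auto
    also have "\<dots> \<le> min a e" using ky_fan_less[of f g "min a e"] 0 \<open>a > 0\<close> that by simp
    finally show "measure M {x \<in> space M. \<bar>f x - g x\<bar> > e} \<le> 0 + a" by simp
  qed simp
  have "AE x in M. \<bar>f x - g x\<bar> \<le> inverse (Suc n)" for n
    using z[of "inverse (Suc n)"]
    by (intro AE_I[of _ _ "{x \<in> space M. \<bar>f x - g x\<bar> > inverse (Suc n)}"]) (auto simp: emeasure_eq_measure not_le)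
  then have "AE x in M. \<forall>n. \<bar>f x - g x\<bar> \<le> inverse (Suc n)" by (simp add: AE_all_countable)
  then show "AE x in M. f x = g x"
  proof eventually_elim
    case (elim x)
    show ?case
    proof (rule ccontr)
      assume "f x \<noteq> g x"
      then obtain n where "inverse (real (Suc n)) < \<bar>f x - g x\<bar>" using reals_Archimedean[of "\<bar>f x - g x\<bar>"] by auto
      with elim show False by (meson not_less)
    qed
  qed
qed

lemma ky_fan_shift: "ky_fan M (\<lambda>x. f x + c) (\<lambda>x. g x + c) = ky_fan M f g"
  by (simp add: ky_fan_def)

lemma ky_fan_shift_le:
  assumes [measurable]: "f \<in> borel_measurable M"
  shows "ky_fan M (\<lambda>x. f x + a) (\<lambda>x. f x + b) \<le> \<bar>a - b\<bar>"
  by (rule ky_fan_le_AE) auto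

lemma ky_fan_tendsto_0:
  assumes [measurable]: "\<And>n. f n \<in> borel_measurable M" "g \<in> borel_measurable M"
    and lim: "AE x in M. (\<lambda>n. f n x) \<longlonglongrightarrow> g x"
  shows "(\<lambda>n. ky_fan M (f n) g) \<longlonglongrightarrow> 0"
proof (rule order_tendstoI)
  fix a :: real assume "a < 0"
  then show "\<forall>\<^sub>F n in sequentially. a < ky_fan M (f n) g"
    by (auto intro!: always_eventually less_le_trans[OF _ ky_fan_nonneg])
next
  fix a :: real assume a: "0 < a"
  let ?A = "\<lambda>n. {x \<in> space M. \<bar>f n x - g x\<bar> > a/2}"
  have "(\<lambda>n. \<integral>x. indicator (?A n) x \<partial>M) \<longlonglongrightarrow> (\<integral>x. 0 \<partial>M :: real)"
  proof (rule integral_dominated_convergence)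
    show "AE x in M. (\<lambda>n. indicator (?A n) x :: real) \<longlonglongrightarrow> 0"
      using lim
    proof eventually_elim
      case (elim x)
      then have "\<forall>\<^sub>F n in sequentially. dist (f n x) (g x) < a/2" using a by (intro tendstoD) auto
      then have "\<forall>\<^sub>F n in sequentially. indicator (?A n) x = (0::real)"
        by eventually_elim (auto simp: dist_real_def)
      then show ?case by (rule tendsto_eventually)
    qed
    show "integrable M (\<lambda>x. 1 :: real)" by simp
    show "AE x in M. norm (indicator (?A n) x :: real) \<le> 1" for n by (auto simp: indicator_def)
  qed measurable
  then have "(\<lambda>n. measure M (?A n)) \<longlonglongrightarrow> 0" by (simp add: Int_absorb2)
  then have "\<forall>\<^sub>F n in sequentially. measure M (?A n) < a/2" by (rule order_tendstoD) (use a in auto)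
  then show "\<forall>\<^sub>F n in sequentially. ky_fan M (f n) g < a"
  proof eventually_elim
    case (elim n)
    then have "ky_fan M (f n) g \<le> a/2" using a by (intro ky_fan_le) auto
    then show ?case using a by simp
  qed
qed

text \<open>Summability of \<open>(1/2)^n\<close> is used twice: by Borel-Cantelli almost every
  point is exceptional for finitely many \<open>n\<close> only, and from then on the increments at
  that point are dominated by a geometric series.\<close>

lemma ky_fan_fast_AE_convergent:
  assumes [measurable]: "\<And>n. f n \<in> borel_measurable M"
    and fast: "\<And>n. ky_fan M (f n) (f (Suc n)) < (1/2)^n"
  obtains g where "g \<in> borel_measurable M" "AE x in M. (\<lambda>n. f n x) \<longlonglongrightarrow> g x"
proof -
  let ?A = "\<lambda>n. {x \<in> space M. \<bar>f n x - f (Suc n) x\<bar> > (1/2)^n}"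
  have "AE x in M. eventually (\<lambda>n. x \<in> space M - ?A n) sequentially"
  proof (rule borel_cantelli_AE1)
    show "?A n \<in> sets M" for n by measurable
    show "emeasure M (?A n) < \<infinity>" for n by (simp add: emeasure_eq_measure)
    have "measure M (?A n) \<le> (1/2)^n" for n using ky_fan_less[OF fast[of n]] by (simp add: less_imp_le)
    then show "summable (\<lambda>n. measure M (?A n))"
      by (intro summable_comparison_test'[of "\<lambda>n. (1/2)^n" 0 "\<lambda>n. measure M (?A n)"]) (simp_all add: summable_geometric)
  qed
  then have conv: "AE x in M. convergent (\<lambda>n. f n x)"
  proof eventually_elim
    case (elim x)
    then obtain N where N: "\<And>n. n \<ge> N \<Longrightarrow> \<bar>f n x - f (Suc n) x\<bar> \<le> (1/2)^n"
      by (auto simp: eventually_sequentially not_less)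
    have "summable (\<lambda>n. f (Suc n) x - f n x)"
      by (rule summable_comparison_test'[of "\<lambda>n. (1/2)^n" N])
        (use N in \<open>auto simp: summable_geometric abs_minus_commute\<close>)
    then have "convergent (\<lambda>n. \<Sum>k<n. f (Suc k) x - f k x)"
      by (simp add: summable_iff_convergent)
    moreover have "(\<Sum>k<n. f (Suc k) x - f k x) = f n x - f 0 x" for n
      by (rule sum_lessThan_telescope)
    ultimately have "convergent (\<lambda>n. f n x - f 0 x)" by simp
    from convergent_add[OF this convergent_const[of "f 0 x"]] show "convergent (\<lambda>n. f n x)" by simp
  qed
  show thesis
  proof (rule that)
    show "(\<lambda>x. lim (\<lambda>n. f n x)) \<in> borel_measurable M" by measurable
    show "AE x in M. (\<lambda>n. f n x) \<longlonglongrightarrow> lim (\<lambda>n. f n x)"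
      using conv by eventually_elim (simp add: convergent_LIMSEQ_iff)
  qed
qed

section \<open>Classes of measurable functions\<close>

lemma L0_class_self: "f \<in> borel_measurable M \<Longrightarrow> f \<in> L0_class M f"
  by (simp add: L0_class_def)

lemma L0_class_eq_iff:
  assumes "f \<in> borel_measurable M" "g \<in> borel_measurable M"
  shows "L0_class M f = L0_class M g \<longleftrightarrow> (AE x in M. f x = g x)"
proof
  assume "L0_class M f = L0_class M g"
  then have "f \<in> L0_class M g" using L0_class_self[OF assms(1)] by simp
  then show "AE x in M. f x = g x" by (simp add: L0_class_def eq_commute)
next
  assume *: "AE x in M. f x = g x"
  have "(AE x in M. f x = h x) \<longleftrightarrow> (AE x in M. g x = h x)" for h
  proof
    assume "AE x in M. f x = h x" with * show "AE x in M. g x = h x" by eventually_elim simp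
  next
    assume "AE x in M. g x = h x" with * show "AE x in M. f x = h x" by eventually_elim simp
  qed
  then show "L0_class M f = L0_class M g" by (auto simp: L0_class_def)
qed

text \<open>\<open>L0_dist\<close> evaluates at chosen representatives; invariance of the Ky Fan
  distance under a.e. equality makes it computable from any others.\<close>

lemma L0_dist_class:
  assumes "f \<in> borel_measurable M" "g \<in> borel_measurable M"
  shows "L0_dist M (L0_class M f) (L0_class M g) = ky_fan M f g"
proof -
  have r: "rep (L0_class M h) \<in> borel_measurable M \<and> (AE x in M. h x = rep (L0_class M h) x)"
    if "h \<in> borel_measurable M" for h
    using someI[of "\<lambda>x. x \<in> L0_class M h", OF L0_class_self[OF that]]
    by (simp add: rep_def L0_class_def)
  show ?thesis unfolding L0_dist_def
    using ky_fan_cong_AE[of f g] r[OF assms(1)] r[OF assms(2)] assms by metis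
qed

end

lemma ky_fan_distr:
  assumes "\<phi> \<in> M \<rightarrow>\<^sub>M N" "distr M N \<phi> = N" "f \<in> borel_measurable N" "g \<in> borel_measurable N"
  shows "ky_fan M (f \<circ> \<phi>) (g \<circ> \<phi>) = ky_fan N f g"
proof -
  note [measurable] = assms(1,3,4)
  have "measure M {x \<in> space M. \<bar>f (\<phi> x) - g (\<phi> x)\<bar> > e} = measure N {x \<in> space N. \<bar>f x - g x\<bar> > e}" for e
  proof -
    have "measure N {x \<in> space N. \<bar>f x - g x\<bar> > e} = measure (distr M N \<phi>) {x \<in> space N. \<bar>f x - g x\<bar> > e}"
      using assms(2) by simp
    also have "\<dots> = measure M (\<phi> -` {x \<in> space N. \<bar>f x - g x\<bar> > e} \<inter> space M)"
      by (rule measure_distr) measurable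
    also have "\<phi> -` {x \<in> space N. \<bar>f x - g x\<bar> > e} \<inter> space M = {x \<in> space M. \<bar>f (\<phi> x) - g (\<phi> x)\<bar> > e}"
      using measurable_space[OF assms(1)] by auto
    finally show ?thesis by simp
  qed
  then show ?thesis by (simp add: ky_fan_def)
qed

lemma AE_distr_self:
  assumes "\<phi> \<in> M \<rightarrow>\<^sub>M N" "distr M N \<phi> = N" "AE y in N. P y"
  shows "AE x in M. P (\<phi> x)"
proof -
  obtain Z where Z: "Z \<in> null_sets N" "{x\<in>space N. \<not> P x} \<subseteq> Z"
    using assms(3) unfolding eventually_ae_filter by auto
  have "emeasure M (\<phi> -` Z \<inter> space M) = emeasure (distr M N \<phi>) Z"
    using Z by (intro emeasure_distr[symmetric] assms) auto
  also have "\<dots> = 0" using Z assms(2) by auto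
  finally show ?thesis
    using Z measurable_sets[OF assms(1)] measurable_space[OF assms(1)]
    by (intro AE_I[of _ _ "\<phi> -` Z \<inter> space M"]) auto
qed

subsection \<open>The Ky Fan distance modulo constants\<close>

text \<open>The quotient distance of L^0 modulo constants, taken on functions. By translation
  invariance a constant on one side is enough.\<close>

definition ky_fan_mod :: "'a measure \<Rightarrow> ('a \<Rightarrow> real) \<Rightarrow> ('a \<Rightarrow> real) \<Rightarrow> real" where
  "ky_fan_mod M f g = (INF c. ky_fan M f (\<lambda>x. g x + c))"

lemma ky_fan_mod_distr:
  assumes "\<phi> \<in> M \<rightarrow>\<^sub>M N" "distr M N \<phi> = N" "f \<in> borel_measurable N" "g \<in> borel_measurable N"
  shows "ky_fan_mod M (f \<circ> \<phi>) (g \<circ> \<phi>) = ky_fan_mod N f g"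
proof -
  have "ky_fan M (f \<circ> \<phi>) (\<lambda>x. (g \<circ> \<phi>) x + c) = ky_fan N f (\<lambda>x. g x + c)" for c
    using ky_fan_distr[OF assms(1-3), of "\<lambda>x. g x + c"] assms(4) by (simp add: comp_def)
  then show ?thesis by (simp add: ky_fan_mod_def)
qed

context prob_space
begin

lemma ky_fan_mod_bdd: "bdd_below (range (\<lambda>c. ky_fan M f (\<lambda>x. g x + c)))"
  using ky_fan_nonneg by (intro bdd_belowI[of _ 0]) auto

lemma ky_fan_mod_le: "ky_fan_mod M f g \<le> ky_fan M f (\<lambda>x. g x + c)"
  unfolding ky_fan_mod_def by (rule cINF_lower[OF ky_fan_mod_bdd]) simp

lemma ky_fan_mod_le_ky_fan: "ky_fan_mod M f g \<le> ky_fan M f g"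
  using ky_fan_mod_le[of f g 0] by simp

lemma ky_fan_mod_less: "ky_fan_mod M f g < e \<Longrightarrow> \<exists>c. ky_fan M f (\<lambda>x. g x + c) < e"
  unfolding ky_fan_mod_def by (simp add: cINF_less_iff[OF _ ky_fan_mod_bdd])

lemma ky_fan_mod_nonneg: "0 \<le> ky_fan_mod M f g"
  unfolding ky_fan_mod_def by (rule cINF_greatest) (auto simp: ky_fan_nonneg)

lemma ky_fan_mod_commute: "ky_fan_mod M f g = ky_fan_mod M g f"
proof -
  have "ky_fan_mod M f g \<le> ky_fan_mod M g f" for f g
    unfolding ky_fan_mod_def[of M g f]
  proof (rule cINF_greatest)
    fix c
    have "ky_fan_mod M f g \<le> ky_fan M f (\<lambda>x. g x + (- c))" by (rule ky_fan_mod_le)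
    also have "\<dots> = ky_fan M g (\<lambda>x. f x + c)"
      using ky_fan_shift[of f c "\<lambda>x. g x + (- c)"] by (simp add: ky_fan_commute)
    finally show "ky_fan_mod M f g \<le> ky_fan M g (\<lambda>x. f x + c)" .
  qed simp
  then show ?thesis by (simp add: antisym)
qed

lemma ky_fan_mod_triangle:
  assumes [measurable]: "f \<in> borel_measurable M" "g \<in> borel_measurable M" "h \<in> borel_measurable M"
  shows "ky_fan_mod M f h \<le> ky_fan_mod M f g + ky_fan_mod M g h"
proof (rule field_le_epsilon)
  fix e :: real assume e: "0 < e"
  obtain a where a: "ky_fan M f (\<lambda>x. g x + a) < ky_fan_mod M f g + e/2"
    using ky_fan_mod_less[of f g "ky_fan_mod M f g + e/2"] e by auto
  obtain b where b: "ky_fan M g (\<lambda>x. h x + b) < ky_fan_mod M g h + e/2"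
    using ky_fan_mod_less[of g h "ky_fan_mod M g h + e/2"] e by auto
  have "ky_fan_mod M f h \<le> ky_fan M f (\<lambda>x. h x + b + a)"
    using ky_fan_mod_le[of f h "b + a"] by (simp add: add.assoc)
  also have "\<dots> \<le> ky_fan M f (\<lambda>x. g x + a) + ky_fan M (\<lambda>x. g x + a) (\<lambda>x. h x + b + a)"
    by (rule ky_fan_triangle) auto
  also have "\<dots> = ky_fan M f (\<lambda>x. g x + a) + ky_fan M g (\<lambda>x. h x + b)"
    by (simp only: ky_fan_shift)
  finally show "ky_fan_mod M f h \<le> ky_fan_mod M f g + ky_fan_mod M g h + e"
    using a b by simp
qed

text \<open>Constants that nearly attain the infimum form a Cauchy sequence, because any two of the
  approximations hold simultaneously at some point. Their limit attains the infimum.\<close>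

lemma ky_fan_mod_eq_0:
  assumes [measurable]: "f \<in> borel_measurable M" "g \<in> borel_measurable M"
    and 0: "ky_fan_mod M f g = 0"
  shows "\<exists>c. AE x in M. f x = g x + c"
proof -
  \<comment> \<open>Bounded by 1/4, so that two exceptional sets have total measure below 1 and
    cannot cover the space.\<close>
  define e where "e n = (1/4) * inverse (real (Suc n))" for n
  have e: "0 < e n" "e n \<le> 1/4" for n by (auto simp: e_def field_simps)
  have "\<exists>c. ky_fan M f (\<lambda>x. g x + c) < e n" for n
    using ky_fan_mod_less[of f g "e n"] 0 e by auto
  then obtain c where c: "\<And>n. ky_fan M f (\<lambda>x. g x + c n) < e n" by metis
  have e0: "e \<longlonglongrightarrow> 0" unfolding e_def using tendsto_mult[OF tendsto_const LIMSEQ_inverse_real_of_nat, of "1/4"] by simp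
  have dd: "\<bar>c n - c m\<bar> \<le> e n + e m" for n m
  proof (rule ccontr)
    assume "\<not> \<bar>c n - c m\<bar> \<le> e n + e m"
    then have "{x\<in>space M. \<bar>f x - (g x + c n)\<bar> > e n} \<union> {x\<in>space M. \<bar>f x - (g x + c m)\<bar> > e m} = space M"
      by auto
    then have "1 = measure M ({x\<in>space M. \<bar>f x - (g x + c n)\<bar> > e n} \<union> {x\<in>space M. \<bar>f x - (g x + c m)\<bar> > e m})"
      by (simp add: prob_space)
    also have "\<dots> \<le> measure M {x\<in>space M. \<bar>f x - (g x + c n)\<bar> > e n} + measure M {x\<in>space M. \<bar>f x - (g x + c m)\<bar> > e m}"
      by (intro measure_Un_le) auto
    also have "\<dots> < e n + e m"
      by (intro add_strict_mono ky_fan_less c) auto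
    finally show False using e(2)[of n] e(2)[of m] by simp
  qed
  have "Cauchy c"
  proof (rule CauchyI)
    fix a :: real assume "0 < a"
    then obtain N where N: "\<And>n. n \<ge> N \<Longrightarrow> e n < a/2"
      using order_tendstoD(2)[OF e0, of "a/2"] by (auto simp: eventually_sequentially)
    have "norm (c m - c n) < a" if "m \<ge> N" "n \<ge> N" for m n
      using dd[of m n] N[OF that(1)] N[OF that(2)] by simp
    then show "\<exists>N. \<forall>m\<ge>N. \<forall>n\<ge>N. norm (c m - c n) < a" by blast
  qed
  then obtain l where l: "c \<longlonglongrightarrow> l" using Cauchy_convergent convergentD by blast
  have "ky_fan M f (\<lambda>x. g x + l) \<le> e n + \<bar>c n - l\<bar>" for n
  proof -
    have "ky_fan M f (\<lambda>x. g x + l) \<le> ky_fan M f (\<lambda>x. g x + c n) + ky_fan M (\<lambda>x. g x + c n) (\<lambda>x. g x + l)"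
      by (rule ky_fan_triangle) auto
    then show ?thesis using c[of n] ky_fan_shift_le[of g "c n" l] by simp
  qed
  moreover have "(\<lambda>n. e n + \<bar>c n - l\<bar>) \<longlonglongrightarrow> 0 + 0"
    by (intro tendsto_add e0 tendsto_rabs_zero LIM_zero l)
  ultimately have "ky_fan M f (\<lambda>x. g x + l) \<le> 0"
    by (intro LIMSEQ_le_const[where X="\<lambda>n. e n + \<bar>c n - l\<bar>"]) auto
  then have "ky_fan M f (\<lambda>x. g x + l) = 0" using ky_fan_nonneg by (metis antisym)
  then show ?thesis by (subst (asm) ky_fan_eq_0_iff) auto
qed

lemma ky_fan_mod_fast_AE_convergent:
  assumes [measurable]: "\<And>n. f n \<in> borel_measurable M"
    and fast: "\<And>n. ky_fan_mod M (f n) (f (Suc n)) < (1/2)^n"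
  obtains c g where "g \<in> borel_measurable M" "AE x in M. (\<lambda>n. f n x + c n) \<longlonglongrightarrow> g x"
proof -
  have "\<exists>a. ky_fan M (f n) (\<lambda>x. f (Suc n) x + a) < (1/2)^n" for n
    using ky_fan_mod_less[OF fast] by blast
  then obtain a where a: "\<And>n. ky_fan M (f n) (\<lambda>x. f (Suc n) x + a n) < (1/2)^n" by metis
  \<comment> \<open>Shifting by the accumulated constants aligns each term with its successor, so
    that the bound modulo constants becomes a bound for the Ky Fan distance itself.\<close>
  define c where "c n = (\<Sum>k<n. a k)" for n
  have "ky_fan M (\<lambda>x. f n x + c n) (\<lambda>x. f (Suc n) x + c (Suc n)) < (1/2)^n" for n
    using a[of n] ky_fan_shift[of "f n" "c n" "\<lambda>x. f (Suc n) x + a n"] by (simp add: c_def algebra_simps)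
  then obtain g where "g \<in> borel_measurable M" "AE x in M. (\<lambda>n. f n x + c n) \<longlonglongrightarrow> g x"
    using ky_fan_fast_AE_convergent[of "\<lambda>n x. f n x + c n"] by auto
  then show thesis by (rule that)
qed

end

section \<open>One-Lipschitz functions\<close>

text \<open>Functions instead of classes, and any set containing almost every point instead of a
  measurable set of measure 1. Compositions and limits are easier to treat in this form, and
  \<open>Lip1_eq\<close> recovers the original notion.\<close>

definition lip1 :: "'a emm_data \<Rightarrow> ('a \<Rightarrow> real) set" where
  "lip1 X = {f \<in> borel_measurable (emm_measure X).
     \<exists>E. (AE x in emm_measure X. x \<in> E) \<and> (\<forall>x\<in>E. \<forall>y\<in>E. ennreal \<bar>f x - f y\<bar> \<le> emm_dist X x y)}"

definition mod_class :: "'a measure \<Rightarrow> ('a \<Rightarrow> real) \<Rightarrow> ('a \<Rightarrow> real) set set" where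
  "mod_class M f = range (\<lambda>c. L0_class M (\<lambda>x. f x + c))"

lemma (in prob_space) AE_iff_full_set:
  "(\<exists>E. (AE x in M. x \<in> E) \<and> (\<forall>x\<in>E. \<forall>y\<in>E. P x y)) \<longleftrightarrow>
   (\<exists>E\<in>sets M. emeasure M E = 1 \<and> (\<forall>x\<in>E. \<forall>y\<in>E. P x y))"
proof safe
  fix E assume E: "AE x in M. x \<in> E" "\<forall>x\<in>E. \<forall>y\<in>E. P x y"
  obtain N where N: "{x\<in>space M. x \<notin> E} \<subseteq> N" "N \<in> null_sets M"
    using E(1) unfolding eventually_ae_filter by auto
  have "emeasure M (space M - N) = 1"
    using N emeasure_Diff_null_set[of N M "space M"] by (simp add: emeasure_space_1)
  then show "\<exists>E\<in>sets M. emeasure M E = 1 \<and> (\<forall>x\<in>E. \<forall>y\<in>E. P x y)"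
    using N E(2) by (intro bexI[of _ "space M - N"]) auto
next
  fix E assume E: "E \<in> sets M" "emeasure M E = 1" "\<forall>x\<in>E. \<forall>y\<in>E. P x y"
  then show "\<exists>E. (AE x in M. x \<in> E) \<and> (\<forall>x\<in>E. \<forall>y\<in>E. P x y)"
    by (intro exI[of _ E]) (simp add: AE_in_set_eq_1 emeasure_eq_measure)
qed

lemma lip1_measurable: "f \<in> lip1 X \<Longrightarrow> f \<in> borel_measurable (emm_measure X)"
  by (simp add: lip1_def)

lemma lip1_add_const: "f \<in> lip1 X \<Longrightarrow> (\<lambda>x. f x + c) \<in> lip1 X"
  by (auto simp: lip1_def)

lemma zero_in_lip1: "(\<lambda>x. 0) \<in> lip1 X"
  by (auto simp: lip1_def intro!: exI[of _ UNIV])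

lemma lip1_cong_AE:
  assumes "f \<in> lip1 X" "g \<in> borel_measurable (emm_measure X)" "AE x in emm_measure X. f x = g x"
  shows "g \<in> lip1 X"
proof -
  obtain E where E: "AE x in emm_measure X. x \<in> E" "\<forall>x\<in>E. \<forall>y\<in>E. ennreal \<bar>f x - f y\<bar> \<le> emm_dist X x y"
    using assms(1) by (auto simp: lip1_def)
  have "AE x in emm_measure X. x \<in> {x\<in>E. f x = g x}" using E(1) assms(3) by eventually_elim simp
  moreover have "\<forall>x\<in>{x\<in>E. f x = g x}. \<forall>y\<in>{x\<in>E. f x = g x}. ennreal \<bar>g x - g y\<bar> \<le> emm_dist X x y"
    using E(2) by fastforce
  ultimately show ?thesis using assms(2) unfolding lip1_def by blast
qed

text \<open>The countably many full-measure sets are intersected with the set of convergence; there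
  the Lipschitz bounds pass to the limit.\<close>

lemma lip1_AE_limit:
  assumes f: "\<And>n::nat. f n \<in> lip1 X" and g: "g \<in> borel_measurable (emm_measure X)"
    and lim: "AE x in emm_measure X. (\<lambda>n. f n x) \<longlonglongrightarrow> g x"
  shows "g \<in> lip1 X"
proof -
  have "\<forall>n. \<exists>E. (AE x in emm_measure X. x \<in> E) \<and> (\<forall>x\<in>E. \<forall>y\<in>E. ennreal \<bar>f n x - f n y\<bar> \<le> emm_dist X x y)"
    using f by (auto simp: lip1_def)
  then obtain E where E: "\<And>n. AE x in emm_measure X. x \<in> E n"
    "\<And>n x y. x \<in> E n \<Longrightarrow> y \<in> E n \<Longrightarrow> ennreal \<bar>f n x - f n y\<bar> \<le> emm_dist X x y" by metis
  let ?E = "{x. (\<forall>n. x \<in> E n) \<and> (\<lambda>n. f n x) \<longlonglongrightarrow> g x}"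
  have "AE x in emm_measure X. \<forall>n. x \<in> E n" using E(1) by (simp add: AE_all_countable)
  with lim have "AE x in emm_measure X. x \<in> ?E" by eventually_elim simp
  moreover have "ennreal \<bar>g x - g y\<bar> \<le> emm_dist X x y" if "x \<in> ?E" "y \<in> ?E" for x y
  proof (rule LIMSEQ_le_const2)
    show "(\<lambda>n. ennreal \<bar>f n x - f n y\<bar>) \<longlonglongrightarrow> ennreal \<bar>g x - g y\<bar>"
      using that by (intro tendsto_ennrealI tendsto_rabs tendsto_diff) auto
    show "\<exists>N. \<forall>n\<ge>N. ennreal \<bar>f n x - f n y\<bar> \<le> emm_dist X x y" using that E(2) by blast
  qed
  ultimately show ?thesis using g by (auto simp: lip1_def intro!: exI[of _ ?E])
qed

context
  fixes X :: "'a emm_data"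
  assumes pX: "prob_space (emm_measure X)"
begin

interpretation prob_space "emm_measure X" by (rule pX)

lemma Lip1_eq: "Lip1 X = L0_class (emm_measure X) ` lip1 X"
proof safe
  fix F assume "F \<in> Lip1 X"
  then obtain f where f: "F \<in> L0 (emm_measure X)" "f \<in> F" "\<exists>E \<in> sets (emm_measure X). emeasure (emm_measure X) E = 1 \<and>
       (\<forall>x\<in>E. \<forall>y\<in>E. ennreal \<bar>f x - f y\<bar> \<le> emm_dist X x y)"
    by (auto simp: Lip1_def)
  obtain h where h: "h \<in> borel_measurable (emm_measure X)" "F = L0_class (emm_measure X) h"
    using f(1) by (auto simp: L0_def)
  have "f \<in> borel_measurable (emm_measure X)" "AE x in emm_measure X. h x = f x"
    using h f by (auto simp: L0_class_def)
  moreover from this have "F = L0_class (emm_measure X) f" using h L0_class_eq_iff by simp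
  ultimately show "F \<in> L0_class (emm_measure X) ` lip1 X"
    using f(3) AE_iff_full_set[of "\<lambda>x y. ennreal \<bar>f x - f y\<bar> \<le> emm_dist X x y"] by (auto simp: lip1_def)
next
  fix f assume "f \<in> lip1 X"
  then show "L0_class (emm_measure X) f \<in> Lip1 X"
    using AE_iff_full_set[of "\<lambda>x y. ennreal \<bar>f x - f y\<bar> \<le> emm_dist X x y"] L0_class_self[of f]
    by (auto simp: lip1_def Lip1_def L0_def)
qed

lemma translates_L0_class:
  assumes f [measurable]: "f \<in> borel_measurable (emm_measure X)"
  shows "translates (emm_measure X) (L0_class (emm_measure X) f) = mod_class (emm_measure X) f"
proof -
  have "L0_class (emm_measure X) (\<lambda>x. g x + c) = L0_class (emm_measure X) (\<lambda>x. f x + c)"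
    if "g \<in> L0_class (emm_measure X) f" for g c
  proof -
    have g: "g \<in> borel_measurable (emm_measure X)" "AE x in emm_measure X. f x = g x"
      using that by (auto simp: L0_class_def)
    have "AE x in emm_measure X. g x + c = f x + c" using g(2) by eventually_elim simp
    then show ?thesis using g(1) by (subst L0_class_eq_iff) auto
  qed
  note * = this
  show ?thesis unfolding translates_def mod_class_def
  proof (intro equalityI subsetI)
    fix F assume "F \<in> {L0_class (emm_measure X) (\<lambda>x. g x + c) |g c. g \<in> L0_class (emm_measure X) f}"
    then obtain g c where "F = L0_class (emm_measure X) (\<lambda>x. g x + c)" "g \<in> L0_class (emm_measure X) f" by auto
    then show "F \<in> range (\<lambda>c. L0_class (emm_measure X) (\<lambda>x. f x + c))" using *[of g c] by simp
  next
    fix F assume "F \<in> range (\<lambda>c. L0_class (emm_measure X) (\<lambda>x. f x + c))"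
    then show "F \<in> {L0_class (emm_measure X) (\<lambda>x. g x + c) |g c. g \<in> L0_class (emm_measure X) f}"
      using L0_class_self[OF f] by blast
  qed
qed

lemma mod_class_eq_iff:
  assumes [measurable]: "f \<in> borel_measurable (emm_measure X)" "g \<in> borel_measurable (emm_measure X)"
  shows "mod_class (emm_measure X) f = mod_class (emm_measure X) g \<longleftrightarrow> ky_fan_mod (emm_measure X) f g = 0"
proof
  assume "mod_class (emm_measure X) f = mod_class (emm_measure X) g"
  then have "L0_class (emm_measure X) (\<lambda>x. f x + 0) \<in> mod_class (emm_measure X) g" unfolding mod_class_def by blast
  then obtain c where "L0_class (emm_measure X) f = L0_class (emm_measure X) (\<lambda>x. g x + c)" by (auto simp: mod_class_def)
  then have "AE x in emm_measure X. f x = g x + c" by (subst (asm) L0_class_eq_iff) auto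
  then have "ky_fan (emm_measure X) f (\<lambda>x. g x + c) = 0" by (subst ky_fan_eq_0_iff) auto
  then show "ky_fan_mod (emm_measure X) f g = 0"
    using ky_fan_mod_le[of f g c] ky_fan_mod_nonneg[of f g] by simp
next
  assume "ky_fan_mod (emm_measure X) f g = 0"
  then obtain c where c: "AE x in emm_measure X. f x = g x + c" using ky_fan_mod_eq_0 assms by blast
  have "L0_class (emm_measure X) (\<lambda>x. f x + a) = L0_class (emm_measure X) (\<lambda>x. g x + (c + a))" for a
    using c by (subst L0_class_eq_iff) (auto elim!: AE_mp intro!: AE_I2)
  then have "mod_class (emm_measure X) f = range (\<lambda>a. L0_class (emm_measure X) (\<lambda>x. g x + (c + a)))"
    by (simp add: mod_class_def)
  \<comment> \<open>Adding \<open>c\<close> permutes the constants, so both classes are the range of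
    the same family.\<close>
  also have "\<dots> = (\<lambda>a. L0_class (emm_measure X) (\<lambda>x. g x + a)) ` range ((+) c)" by (simp only: image_image)
  also have "range ((+) c) = UNIV" by (rule surjI[of _ "\<lambda>x. x - c"]) simp
  finally show "mod_class (emm_measure X) f = mod_class (emm_measure X) g"
    by (simp add: mod_class_def)
qed

lemma mod_class_dist:
  assumes [measurable]: "f \<in> borel_measurable (emm_measure X)" "g \<in> borel_measurable (emm_measure X)"
  shows "Inf {L0_dist (emm_measure X) F G |F G. F \<in> mod_class (emm_measure X) f \<and> G \<in> mod_class (emm_measure X) g}
    = ky_fan_mod (emm_measure X) f g"
proof -
  have "{L0_dist (emm_measure X) F G |F G. F \<in> mod_class (emm_measure X) f \<and> G \<in> mod_class (emm_measure X) g}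
    = {ky_fan (emm_measure X) (\<lambda>x. f x + a) (\<lambda>x. g x + b) | a b. True}"
    unfolding mod_class_def using L0_dist_class[of "\<lambda>x. f x + _" "\<lambda>x. g x + _"] assms by auto (metis (no_types, lifting) rangeI)+
  also have "\<dots> = range (\<lambda>c. ky_fan (emm_measure X) f (\<lambda>x. g x + c))"
  proof safe
    fix a b
    show "ky_fan (emm_measure X) (\<lambda>x. f x + a) (\<lambda>x. g x + b) \<in> range (\<lambda>c. ky_fan (emm_measure X) f (\<lambda>x. g x + c))"
      using ky_fan_shift[of f a "\<lambda>x. g x + (b - a)"] by (auto intro!: image_eqI[of _ _ "b - a"])
  next
    fix c
    show "\<exists>a b. ky_fan (emm_measure X) f (\<lambda>x. g x + c) = ky_fan (emm_measure X) (\<lambda>x. f x + a) (\<lambda>x. g x + b) \<and> True"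
      by (intro exI[of _ 0] exI[of _ c]) simp
  qed
  finally show ?thesis by (simp add: ky_fan_mod_def)
qed

text \<open>Points of \<open>L1_metric X\<close> are handled from here on as functions with the
  distance \<open>ky_fan_mod\<close>. Its vanishing means a.e. equality up to a constant, that is,
  equality of classes; so the metric axioms hold and \<open>metric_on\<close> returns the intended
  carrier and distance.\<close>

lemma
  shows mspace_L1_metric: "mspace (L1_metric X) = mod_class (emm_measure X) ` lip1 X"
    and mdist_L1_metric: "\<lbrakk>f \<in> lip1 X; g \<in> lip1 X\<rbrakk> \<Longrightarrow>
      mdist (L1_metric X) (mod_class (emm_measure X) f) (mod_class (emm_measure X) g) = ky_fan_mod (emm_measure X) f g"
proof -
  let ?S = "translates (emm_measure X) ` Lip1 X"
  let ?d = "\<lambda>U V. Inf {L0_dist (emm_measure X) F G |F G. F \<in> U \<and> G \<in> V}"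
  have S: "?S = mod_class (emm_measure X) ` lip1 X"
    unfolding Lip1_eq image_image by (intro image_cong refl translates_L0_class lip1_measurable)
  have d: "?d (mod_class (emm_measure X) f) (mod_class (emm_measure X) g) = ky_fan_mod (emm_measure X) f g"
    if "f \<in> lip1 X" "g \<in> lip1 X" for f g
    using that by (intro mod_class_dist lip1_measurable)
  have "Metric_space ?S (\<lambda>x y. if x \<in> ?S \<and> y \<in> ?S then ?d x y else 0)"
  proof
    fix x y z
    show "0 \<le> (if x \<in> ?S \<and> y \<in> ?S then ?d x y else 0)"
      unfolding S using d ky_fan_mod_nonneg by auto
    show "(if x \<in> ?S \<and> y \<in> ?S then ?d x y else 0) = (if y \<in> ?S \<and> x \<in> ?S then ?d y x else 0)"
      unfolding S using d ky_fan_mod_commute by auto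
    show "((if x \<in> ?S \<and> y \<in> ?S then ?d x y else 0) = 0) = (x = y)" if xy: "x \<in> ?S" "y \<in> ?S"
    proof -
      obtain f g where fg: "f \<in> lip1 X" "g \<in> lip1 X" "x = mod_class (emm_measure X) f" "y = mod_class (emm_measure X) g"
        using xy unfolding S by blast
      have "x = y \<longleftrightarrow> ky_fan_mod (emm_measure X) f g = 0"
        unfolding fg(3,4) by (rule mod_class_eq_iff) (use fg lip1_measurable in auto)
      then show ?thesis using xy d[OF fg(1,2)] fg(3,4) by simp
    qed
    show "(if x \<in> ?S \<and> z \<in> ?S then ?d x z else 0) \<le> (if x \<in> ?S \<and> y \<in> ?S then ?d x y else 0) + (if y \<in> ?S \<and> z \<in> ?S then ?d y z else 0)"
      if "x \<in> ?S" "y \<in> ?S" "z \<in> ?S"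
      using that unfolding S by (auto simp: d intro!: ky_fan_mod_triangle lip1_measurable)
  qed
  then have *: "mspace (L1_metric X) = ?S" "mdist (L1_metric X) = (\<lambda>x y. if x \<in> ?S \<and> y \<in> ?S then ?d x y else 0)"
    unfolding L1_metric_def metric_on_def by (simp_all add: Metric_space.mspace_metric Metric_space.mdist_metric)
  show "mspace (L1_metric X) = mod_class (emm_measure X) ` lip1 X" using * S by simp
  show "mdist (L1_metric X) (mod_class (emm_measure X) f) (mod_class (emm_measure X) g) = ky_fan_mod (emm_measure X) f g"
    if "f \<in> lip1 X" "g \<in> lip1 X" using that d unfolding * S by auto
qed

end

lemma (in Metric_space) MCauchy_fast_subsequence:
  assumes "MCauchy \<sigma>"
  obtains r :: "nat \<Rightarrow> nat" where "strict_mono r" "\<And>n. d (\<sigma> (r n)) (\<sigma> (r (Suc n))) < (1/2)^n"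
proof -
  have "\<exists>N. \<forall>i j. N \<le> i \<longrightarrow> N \<le> j \<longrightarrow> d (\<sigma> i) (\<sigma> j) < (1/2)^n" for n
    using assms unfolding MCauchy_def by simp
  then obtain N where N: "\<And>n i j. N n \<le> i \<Longrightarrow> N n \<le> j \<Longrightarrow> d (\<sigma> i) (\<sigma> j) < (1/2)^n" by metis
  define r where "r = rec_nat (N 0) (\<lambda>n k. max (Suc k) (N (Suc n)))"
  have r: "r 0 = N 0" "\<And>n. r (Suc n) = max (Suc (r n)) (N (Suc n))" by (simp_all add: r_def)
  have mono: "strict_mono r" by (auto simp: strict_mono_Suc_iff r less_max_iff_disj)
  have ge: "N n \<le> r n" for n by (cases n) (auto simp: r)
  have "d (\<sigma> (r n)) (\<sigma> (r (Suc n))) < (1/2)^n" for n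
    using ge[of n] mono by (intro N) (auto simp: r)
  with mono that show thesis by blast
qed

text \<open>A fast subsequence, shifted by suitable constants, converges a.e.; its limit is again
  a.e. 1-Lipschitz, and a Cauchy sequence with a convergent subsequence converges.\<close>

lemma mcomplete_L1_metric:
  assumes pX: "prob_space (emm_measure X)"
  shows "mcomplete_of (L1_metric X)"
proof -
  interpret prob_space "emm_measure X" by fact
  interpret L: Metric_space "mspace (L1_metric X)" "mdist (L1_metric X)" by simp
  note ms = mspace_L1_metric[OF pX] and md = mdist_L1_metric[OF pX]
  show ?thesis unfolding mcomplete_of_def L.mcomplete_def
  proof (intro allI impI)
    fix \<sigma> assume C: "L.MCauchy \<sigma>"
    then obtain r where r: "strict_mono r" "\<And>n. mdist (L1_metric X) (\<sigma> (r n)) (\<sigma> (r (Suc n))) < (1/2)^n"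
      using L.MCauchy_fast_subsequence by blast
    have "\<forall>n. \<exists>f\<in>lip1 X. \<sigma> (r n) = mod_class (emm_measure X) f"
    proof -
      have "range \<sigma> \<subseteq> mspace (L1_metric X)" using C unfolding L.MCauchy_def by simp
      then show ?thesis unfolding ms by blast
    qed
    then obtain f where f: "\<And>n. f n \<in> lip1 X" "\<And>n. \<sigma> (r n) = mod_class (emm_measure X) (f n)" by metis
    have fast: "ky_fan_mod (emm_measure X) (f n) (f (Suc n)) < (1/2)^n" for n
      using r(2)[of n] f by (simp add: md)
    obtain c g where g: "g \<in> borel_measurable (emm_measure X)" "AE x in emm_measure X. (\<lambda>n. f n x + c n) \<longlonglongrightarrow> g x"
      by (rule ky_fan_mod_fast_AE_convergent[OF lip1_measurable[OF f(1)] fast])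
    have gl: "g \<in> lip1 X" by (rule lip1_AE_limit[OF lip1_add_const[OF f(1)] g])
    have m: "(\<lambda>x. f n x + c n) \<in> borel_measurable (emm_measure X)" for n
      using lip1_measurable[OF f(1)] by simp
    have "(\<lambda>n. ky_fan (emm_measure X) (\<lambda>x. f n x + c n) g) \<longlonglongrightarrow> 0"
      using ky_fan_tendsto_0[OF m g] .
    then have "(\<lambda>n. ky_fan_mod (emm_measure X) (f n) g) \<longlonglongrightarrow> 0"
    proof (rule Lim_null_comparison[rotated], intro always_eventually allI)
      fix n
      show "norm (ky_fan_mod (emm_measure X) (f n) g) \<le> ky_fan (emm_measure X) (\<lambda>x. f n x + c n) g"
        using ky_fan_mod_le[of g "f n" "c n"] ky_fan_mod_nonneg[of "f n" g]
        by (simp add: ky_fan_mod_commute ky_fan_commute)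
    qed
    then have "limitin L.mtopology (\<sigma> \<circ> r) (mod_class (emm_measure X) g) sequentially"
      unfolding L.limitin_metric_dist_null
    proof (intro conjI)
      show "mod_class (emm_measure X) g \<in> mspace (L1_metric X)" using gl by (simp add: ms)
      show "\<forall>\<^sub>F n in sequentially. (\<sigma> \<circ> r) n \<in> mspace (L1_metric X)" using f by (simp add: ms)
      show "(\<lambda>n. mdist (L1_metric X) ((\<sigma> \<circ> r) n) (mod_class (emm_measure X) g)) \<longlonglongrightarrow> 0"
        if "(\<lambda>n. ky_fan_mod (emm_measure X) (f n) g) \<longlonglongrightarrow> 0"
        using that f gl by (simp add: md)
    qed
    then show "\<exists>x. limitin L.mtopology \<sigma> x sequentially"
      using L.MCauchy_convergent_subsequence[OF C r(1)] by blast
  qed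
qed

section \<open>Domination and isomorphism\<close>

text \<open>The witness of domination is made explicit so that such maps can be composed and
  functions pulled back along them.\<close>

definition lip_map :: "'a emm_data \<Rightarrow> 'b emm_data \<Rightarrow> ('a \<Rightarrow> 'b) \<Rightarrow> bool" where
  "lip_map X Y \<phi> \<longleftrightarrow> \<phi> \<in> emm_measure X \<rightarrow>\<^sub>M emm_measure Y \<and>
     distr (emm_measure X) (emm_measure Y) \<phi> = emm_measure Y \<and>
     (\<exists>E. (AE x in emm_measure X. x \<in> E) \<and>
        (\<forall>x\<in>E. \<forall>y\<in>E. emm_dist Y (\<phi> x) (\<phi> y) \<le> emm_dist X x y))"

lemma emm_prec_iff:
  assumes "prob_space (emm_measure X)"
  shows "Y \<prec>\<^sub>e X \<longleftrightarrow> (\<exists>\<phi>. lip_map X Y \<phi>)"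
  unfolding emm_prec_def lip_map_def prob_space.AE_iff_full_set[OF assms] by blast

lemma lip_map_measurable: "lip_map X Y \<phi> \<Longrightarrow> \<phi> \<in> emm_measure X \<rightarrow>\<^sub>M emm_measure Y"
  and lip_map_distr: "lip_map X Y \<phi> \<Longrightarrow> distr (emm_measure X) (emm_measure Y) \<phi> = emm_measure Y"
  by (auto simp: lip_map_def)

lemma lip_map_comp:
  assumes \<phi>: "lip_map X Y \<phi>" and \<psi>: "lip_map Y Z \<psi>"
  shows "lip_map X Z (\<psi> \<circ> \<phi>)"
proof -
  obtain E where E: "AE x in emm_measure X. x \<in> E"
    "\<And>x y. x\<in>E \<Longrightarrow> y\<in>E \<Longrightarrow> emm_dist Y (\<phi> x) (\<phi> y) \<le> emm_dist X x y"
    using \<phi> unfolding lip_map_def by blast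
  obtain E' where E': "AE y in emm_measure Y. y \<in> E'"
    "\<And>x y. x\<in>E' \<Longrightarrow> y\<in>E' \<Longrightarrow> emm_dist Z (\<psi> x) (\<psi> y) \<le> emm_dist Y x y"
    using \<psi> unfolding lip_map_def by blast
  note m = lip_map_measurable[OF \<phi>] lip_map_distr[OF \<phi>] lip_map_measurable[OF \<psi>] lip_map_distr[OF \<psi>]
  have "AE x in emm_measure X. \<phi> x \<in> E'" by (rule AE_distr_self[OF m(1,2) E'(1)])
  with E(1) have "AE x in emm_measure X. x \<in> {x\<in>E. \<phi> x \<in> E'}" by eventually_elim simp
  moreover have "\<forall>x\<in>{x\<in>E. \<phi> x \<in> E'}. \<forall>y\<in>{x\<in>E. \<phi> x \<in> E'}. emm_dist Z ((\<psi> \<circ> \<phi>) x) ((\<psi> \<circ> \<phi>) y) \<le> emm_dist X x y"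
    by (auto intro!: order_trans[OF E'(2) E(2)])
  moreover have "distr (emm_measure X) (emm_measure Z) (\<psi> \<circ> \<phi>) = emm_measure Z"
    using distr_distr[OF m(3,1)] m(2,4) by simp
  ultimately show ?thesis unfolding lip_map_def using measurable_comp[OF m(1,3)] by blast
qed

text \<open>The full-measure set belonging to \<open>f\<close> is pulled back along
  \<open>\<phi>\<close> and remains full because \<open>\<phi>\<close> preserves the measure. This
  pullback places the 1-Lipschitz functions of a dominated space among those of
  \<open>X\<close>.\<close>

lemma lip1_comp_lip_map:
  assumes \<phi>: "lip_map X Y \<phi>" and f: "f \<in> lip1 Y"
  shows "f \<circ> \<phi> \<in> lip1 X"
proof -
  obtain E where E: "AE x in emm_measure X. x \<in> E"
    "\<And>x y. x\<in>E \<Longrightarrow> y\<in>E \<Longrightarrow> emm_dist Y (\<phi> x) (\<phi> y) \<le> emm_dist X x y"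
    using \<phi> unfolding lip_map_def by blast
  obtain E' where E': "AE y in emm_measure Y. y \<in> E'"
    "\<And>x y. x\<in>E' \<Longrightarrow> y\<in>E' \<Longrightarrow> ennreal \<bar>f x - f y\<bar> \<le> emm_dist Y x y"
    using f unfolding lip1_def by blast
  have "AE x in emm_measure X. \<phi> x \<in> E'"
    by (rule AE_distr_self[OF lip_map_measurable[OF \<phi>] lip_map_distr[OF \<phi>] E'(1)])
  with E(1) have "AE x in emm_measure X. x \<in> {x\<in>E. \<phi> x \<in> E'}" by eventually_elim simp
  moreover have "\<forall>x\<in>{x\<in>E. \<phi> x \<in> E'}. \<forall>y\<in>{x\<in>E. \<phi> x \<in> E'}. ennreal \<bar>(f \<circ> \<phi>) x - (f \<circ> \<phi>) y\<bar> \<le> emm_dist X x y"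
    by (auto intro!: order_trans[OF E'(2) E(2)])
  ultimately show ?thesis unfolding lip1_def
    using measurable_comp[OF lip_map_measurable[OF \<phi>] lip1_measurable[OF f]] by blast
qed

text \<open>The a.e. inverse is kept as data, which makes the relation symmetric and closed under
  composition. That \<open>G\<close> preserves distances a.e. follows from the same property of
  \<open>F\<close>.\<close>

definition iso_pair :: "'a emm_data \<Rightarrow> 'b emm_data \<Rightarrow> ('a \<Rightarrow> 'b) \<Rightarrow> ('b \<Rightarrow> 'a) \<Rightarrow> bool" where
  "iso_pair X Y F G \<longleftrightarrow>
     F \<in> emm_measure X \<rightarrow>\<^sub>M emm_measure Y \<and> distr (emm_measure X) (emm_measure Y) F = emm_measure Y \<and>
     G \<in> emm_measure Y \<rightarrow>\<^sub>M emm_measure X \<and> distr (emm_measure Y) (emm_measure X) G = emm_measure X \<and>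
     (AE x in emm_measure X. G (F x) = x) \<and> (AE y in emm_measure Y. F (G y) = y) \<and>
     (\<exists>A. (AE x in emm_measure X. x \<in> A) \<and> (\<forall>x\<in>A. \<forall>y\<in>A. emm_dist Y (F x) (F y) = emm_dist X x y))"

lemma iso_pair_sym:
  assumes "iso_pair X Y F G" shows "iso_pair Y X G F"
proof -
  obtain A where A: "AE x in emm_measure X. x \<in> A"
    "\<And>x y. x\<in>A \<Longrightarrow> y\<in>A \<Longrightarrow> emm_dist Y (F x) (F y) = emm_dist X x y"
    using assms unfolding iso_pair_def by blast
  have *: "G \<in> emm_measure Y \<rightarrow>\<^sub>M emm_measure X" "distr (emm_measure Y) (emm_measure X) G = emm_measure X"
    "AE y in emm_measure Y. F (G y) = y" using assms unfolding iso_pair_def by auto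
  have "AE y in emm_measure Y. G y \<in> A" by (rule AE_distr_self[OF *(1,2) A(1)])
  with *(3) have "AE y in emm_measure Y. y \<in> {y. F (G y) = y \<and> G y \<in> A}" by eventually_elim simp
  moreover have "\<forall>x\<in>{y. F (G y) = y \<and> G y \<in> A}. \<forall>y\<in>{y. F (G y) = y \<and> G y \<in> A}. emm_dist X (G x) (G y) = emm_dist Y x y"
    using A(2) by fastforce
  ultimately show ?thesis using assms unfolding iso_pair_def by blast
qed

lemma iso_pair_lip_map: assumes "iso_pair X Y F G" shows "lip_map X Y F"
proof -
  obtain A where A: "AE x in emm_measure X. x \<in> A"
    "\<And>x y. x\<in>A \<Longrightarrow> y\<in>A \<Longrightarrow> emm_dist Y (F x) (F y) = emm_dist X x y"
    using assms unfolding iso_pair_def by blast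
  then have "\<exists>E. (AE x in emm_measure X. x \<in> E) \<and> (\<forall>x\<in>E. \<forall>y\<in>E. emm_dist Y (F x) (F y) \<le> emm_dist X x y)"
    by (intro exI[of _ A]) simp
  then show ?thesis using assms unfolding iso_pair_def lip_map_def by blast
qed

lemma iso_pair_trans:
  assumes 1: "iso_pair X Y F G" and 2: "iso_pair Y Z F' G'"
  shows "iso_pair X Z (F' \<circ> F) (G \<circ> G')"
proof -
  obtain A where A: "AE x in emm_measure X. x \<in> A"
    "\<And>x y. x\<in>A \<Longrightarrow> y\<in>A \<Longrightarrow> emm_dist Y (F x) (F y) = emm_dist X x y"
    using 1 unfolding iso_pair_def by blast
  obtain A' where A': "AE x in emm_measure Y. x \<in> A'"
    "\<And>x y. x\<in>A' \<Longrightarrow> y\<in>A' \<Longrightarrow> emm_dist Z (F' x) (F' y) = emm_dist Y x y"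
    using 2 unfolding iso_pair_def by blast
  have m1: "F \<in> emm_measure X \<rightarrow>\<^sub>M emm_measure Y" "distr (emm_measure X) (emm_measure Y) F = emm_measure Y"
     "G \<in> emm_measure Y \<rightarrow>\<^sub>M emm_measure X" "distr (emm_measure Y) (emm_measure X) G = emm_measure X"
     "AE x in emm_measure X. G (F x) = x" "AE y in emm_measure Y. F (G y) = y"
    using 1 by (auto simp: iso_pair_def)
  have m2: "F' \<in> emm_measure Y \<rightarrow>\<^sub>M emm_measure Z" "distr (emm_measure Y) (emm_measure Z) F' = emm_measure Z"
     "G' \<in> emm_measure Z \<rightarrow>\<^sub>M emm_measure Y" "distr (emm_measure Z) (emm_measure Y) G' = emm_measure Y"
     "AE x in emm_measure Y. G' (F' x) = x" "AE y in emm_measure Z. F' (G' y) = y"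
    using 2 by (auto simp: iso_pair_def)
  have "distr (emm_measure X) (emm_measure Z) (F' \<circ> F) = emm_measure Z"
    "distr (emm_measure Z) (emm_measure X) (G \<circ> G') = emm_measure X"
    using distr_distr[OF m2(1) m1(1)] distr_distr[OF m1(3) m2(3)] m1(2,4) m2(2,4) by simp_all
  moreover have "AE x in emm_measure X. (G \<circ> G') ((F' \<circ> F) x) = x"
    using m1(5) AE_distr_self[OF m1(1,2) m2(5)] by eventually_elim simp
  moreover have "AE y in emm_measure Z. (F' \<circ> F) ((G \<circ> G') y) = y"
    using m2(6) AE_distr_self[OF m2(3,4) m1(6)] by eventually_elim simp
  moreover have "AE x in emm_measure X. x \<in> {x\<in>A. F x \<in> A'}"
    using A(1) AE_distr_self[OF m1(1,2) A'(1)] by eventually_elim simp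
  moreover have "\<forall>x\<in>{x\<in>A. F x \<in> A'}. \<forall>y\<in>{x\<in>A. F x \<in> A'}. emm_dist Z ((F' \<circ> F) x) ((F' \<circ> F) y) = emm_dist X x y"
    using A(2) A'(2) by simp
  moreover have "F' \<circ> F \<in> emm_measure X \<rightarrow>\<^sub>M emm_measure Z" "G \<circ> G' \<in> emm_measure Z \<rightarrow>\<^sub>M emm_measure X"
    using m1 m2 by auto
  ultimately show ?thesis unfolding iso_pair_def by blast
qed

text \<open>A map that preserves distances on a full-measure set is injective there, so
  \<open>standard_ae_inverse\<close> provides \<open>G\<close>. It carries the measure back because
  \<open>G \<circ> F\<close> is a.e. the identity.\<close>

lemma iso_pairI:
  assumes X: "standard (emm_measure X)" "prob_space (emm_measure X)" and Y: "standard (emm_measure Y)"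
    and X0: "\<And>x y. x \<in> space (emm_measure X) \<Longrightarrow> y \<in> space (emm_measure X) \<Longrightarrow> emm_dist X x y = 0 \<Longrightarrow> x = y"
    and Y0: "\<And>y. y \<in> space (emm_measure Y) \<Longrightarrow> emm_dist Y y y = 0"
    and F: "F \<in> emm_measure X \<rightarrow>\<^sub>M emm_measure Y" "distr (emm_measure X) (emm_measure Y) F = emm_measure Y"
    and A: "AE x in emm_measure X. x \<in> A" "\<And>x y. x \<in> A \<Longrightarrow> y \<in> A \<Longrightarrow> emm_dist Y (F x) (F y) = emm_dist X x y"
  obtains G where "iso_pair X Y F G"
proof -
  interpret prob_space "emm_measure X" by fact
  obtain B where B: "B \<in> sets (emm_measure X)" "emeasure (emm_measure X) B = 1"
    "\<forall>x\<in>B. \<forall>y\<in>B. emm_dist Y (F x) (F y) = emm_dist X x y"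
    using AE_iff_full_set[of "\<lambda>x y. emm_dist Y (F x) (F y) = emm_dist X x y"] A by blast
  have "inj_on F B"
  proof (rule inj_onI)
    fix x y assume xy: "x \<in> B" "y \<in> B" "F x = F y"
    then have sp: "x \<in> space (emm_measure X)" "y \<in> space (emm_measure X)"
      using sets.sets_into_space[OF B(1)] by auto
    have "emm_dist X x y = emm_dist Y (F x) (F y)" using xy(1,2) B(3) by simp
    also have "\<dots> = 0" using xy Y0 measurable_space[OF F(1) sp(2)] by simp
    finally show "x = y" using X0 sp by blast
  qed
  then obtain G C where G: "G \<in> emm_measure Y \<rightarrow>\<^sub>M emm_measure X" and C: "C \<in> sets (emm_measure X)"
    "emeasure (emm_measure X) C = 1" "\<And>x. x \<in> C \<Longrightarrow> G (F x) = x"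
    using standard_ae_inverse[OF X Y F(1) B(1,2)] by metis
  have "AE x in emm_measure X. x \<in> C" using C by (simp add: AE_in_set_eq_1 emeasure_eq_measure)
  then have GF: "AE x in emm_measure X. G (F x) = x" by eventually_elim (rule C)
  have "distr (emm_measure Y) (emm_measure X) G = distr (distr (emm_measure X) (emm_measure Y) F) (emm_measure X) G"
    using F by simp
  also have "\<dots> = distr (emm_measure X) (emm_measure X) (G \<circ> F)" by (rule distr_distr[OF G F(1)])
  also have "\<dots> = distr (emm_measure X) (emm_measure X) (\<lambda>x. x)"
    by (rule distr_cong_AE) (use GF F G in auto)
  finally have Gd: "distr (emm_measure Y) (emm_measure X) G = emm_measure X" by simp
  obtain e r where e: "e \<in> borel_measurable (emm_measure Y)" and "r \<in> (borel :: real measure) \<rightarrow>\<^sub>M emm_measure Y"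
    and r: "\<forall>y\<in>space (emm_measure Y). r (e y) = y" by (rule standardE[OF Y])
  \<comment> \<open>Equality in \<open>Y\<close> is tested through the code \<open>e\<close>, which
    makes the set of good points measurable.\<close>
  have "AE y in distr (emm_measure X) (emm_measure Y) F. e (F (G y)) = e y"
  proof (subst AE_distr_iff[OF F(1)])
    show "{x \<in> space (emm_measure Y). e (F (G x)) = e x} \<in> sets (emm_measure Y)"
      using e F G by measurable
    show "AE x in emm_measure X. e (F (G (F x))) = e (F x)" using GF by eventually_elim simp
  qed
  then have "AE y in emm_measure Y. e (F (G y)) = e y" unfolding F(2) .
  then have "AE y in emm_measure Y. F (G y) = y"
  proof (rule AE_mp, intro AE_I2 impI)
    fix y assume "y \<in> space (emm_measure Y)" "e (F (G y)) = e y"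
    then show "F (G y) = y" using r measurable_space[OF F(1) measurable_space[OF G]] by metis
  qed
  then have "iso_pair X Y F G" unfolding iso_pair_def using F G Gd GF A by blast
  then show thesis by (rule that)
qed

subsection \<open>Emm-spaces\<close>

lemma
  assumes "emm_space X"
  shows emm_space_prob: "prob_space (emm_measure X)"
    and emm_space_standard: "standard (emm_measure X)"
    and emm_space_space: "space (emm_measure X) = topspace (emm_top X)"
    and emm_dist_eq_0: "\<And>x y. x \<in> space (emm_measure X) \<Longrightarrow> y \<in> space (emm_measure X) \<Longrightarrow> emm_dist X x y = 0 \<longleftrightarrow> x = y"
proof -
  show p: "prob_space (emm_measure X)" using assms by (simp add: emm_space_def)
  have s: "sets (emm_measure X) = sets (borel_of (emm_top X))" using assms by (simp add: emm_space_def)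
  show "standard (emm_measure X)"
    by (rule standard_polish[OF _ _ s p]) (use assms in \<open>auto simp: emm_space_def\<close>)
  show sp: "space (emm_measure X) = topspace (emm_top X)" using sets_eq_imp_space_eq[OF s] by simp
  show "emm_dist X x y = 0 \<longleftrightarrow> x = y" if "x \<in> space (emm_measure X)" "y \<in> space (emm_measure X)" for x y
    using assms that unfolding sp by (simp add: emm_space_def ext_distance_on_def)
qed

text \<open>In \<open>emm_iso\<close> the map and the set are measurable only for the completion.
  Through the code of \<open>Y\<close> the map agrees a.e. with a Borel map, and the set contains a
  Borel set of full measure.\<close>

lemma emm_iso_iff:
  assumes X: "emm_space X" and Y: "emm_space Y"
  shows "emm_iso X Y \<longleftrightarrow> (\<exists>F G. iso_pair X Y F G)"
proof
  assume "\<exists>F G. iso_pair X Y F G"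
  then obtain F G where iso: "iso_pair X Y F G" by blast
  interpret prob_space "emm_measure X" using X by (rule emm_space_prob)
  have "\<exists>A. (AE x in emm_measure X. x \<in> A) \<and> (\<forall>x\<in>A. \<forall>y\<in>A. emm_dist Y (F x) (F y) = emm_dist X x y)"
    using iso by (simp add: iso_pair_def)
  then obtain A where A: "A \<in> sets (emm_measure X)" "emeasure (emm_measure X) A = 1"
    "\<forall>x\<in>A. \<forall>y\<in>A. emm_dist Y (F x) (F y) = emm_dist X x y"
    using AE_iff_full_set[of "\<lambda>x y. emm_dist Y (F x) (F y) = emm_dist X x y"] by blast
  have F: "F \<in> emm_measure X \<rightarrow>\<^sub>M emm_measure Y" "distr (emm_measure X) (emm_measure Y) F = emm_measure Y"
    using iso by (simp_all add: iso_pair_def)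
  show "emm_iso X Y" unfolding emm_iso_def
  proof (intro bexI[of _ F] conjI bexI[of _ A])
    show "distr (completion (emm_measure X)) (emm_measure Y) F = emm_measure Y"
      using distr_completion[OF F(1)] F(2) by simp
    show "A \<in> sets (completion (emm_measure X))" using A(1) by simp
    show "emeasure (completion (emm_measure X)) A = 1" using A by simp
  qed (use A F measurable_completion in auto)
next
  assume "emm_iso X Y"
  then obtain F A where F: "F \<in> completion (emm_measure X) \<rightarrow>\<^sub>M emm_measure Y"
    "distr (completion (emm_measure X)) (emm_measure Y) F = emm_measure Y"
    and A: "A \<in> sets (completion (emm_measure X))" "emeasure (completion (emm_measure X)) A = 1"
    "\<And>x y. x \<in> A \<Longrightarrow> y \<in> A \<Longrightarrow> emm_dist Y (F x) (F y) = emm_dist X x y"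
    unfolding emm_iso_def by blast
  interpret prob_space "emm_measure X" using X by (rule emm_space_prob)
  obtain e r where e: "e \<in> borel_measurable (emm_measure Y)" and r: "r \<in> (borel :: real measure) \<rightarrow>\<^sub>M emm_measure Y"
    and re: "\<And>y. y \<in> space (emm_measure Y) \<Longrightarrow> r (e y) = y"
    using emm_space_standard[OF Y] by (auto simp: standard_def)
  have "(\<lambda>x. e (F x)) \<in> borel_measurable (completion (emm_measure X))"
    using measurable_compose[OF F(1) e] .
  then obtain h where h: "h \<in> borel_measurable (emm_measure X)" "AE x in emm_measure X. e (F x) = h x"
    using completion_ex_borel_measurable_real by blast
  define F' where "F' = r \<circ> h"
  have F': "F' \<in> emm_measure X \<rightarrow>\<^sub>M emm_measure Y" unfolding F'_def using h r by auto
  have FF': "AE x in emm_measure X. F x = F' x"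
    using h(2) AE_space
  proof eventually_elim
    case (elim x)
    then have "F x \<in> space (emm_measure Y)" using measurable_space[OF F(1)] by simp
    with re elim show ?case by (simp add: F'_def) metis
  qed
  have "distr (emm_measure X) (emm_measure Y) F' = distr (completion (emm_measure X)) (emm_measure Y) F'"
    by (rule distr_completion[OF F', symmetric])
  also have "\<dots> = distr (completion (emm_measure X)) (emm_measure Y) F"
  proof (rule distr_cong_AE)
    have "AE x in emm_measure X. F' x = F x" using FF' by eventually_elim simp
    then show "AE x in completion (emm_measure X). F' x = F x" by (rule AE_completion)
    show "F' \<in> completion (emm_measure X) \<rightarrow>\<^sub>M emm_measure Y" using F' by (rule measurable_completion)
  qed (use F in simp_all)
  finally have F'd: "distr (emm_measure X) (emm_measure Y) F' = emm_measure Y" using F by simp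
  obtain S N N' where S: "A = S \<union> N" "N \<subseteq> N'" "N' \<in> null_sets (emm_measure X)" "S \<in> sets (emm_measure X)"
    using sets_completionE[OF A(1)] .
  have "emeasure (emm_measure X) (S \<union> N') = 1"
  proof (rule antisym)
    have "1 = emeasure (completion (emm_measure X)) A" using A by simp
    also have "\<dots> \<le> emeasure (completion (emm_measure X)) (S \<union> N')"
      using S by (intro emeasure_mono) auto
    finally show "1 \<le> emeasure (emm_measure X) (S \<union> N')" using S by auto
  qed (rule emeasure_le_1)
  then have "emeasure (emm_measure X) S = 1" using S emeasure_Un_null_set[of S "emm_measure X" N'] by simp
  then have "AE x in emm_measure X. x \<in> S" using S by (simp add: AE_in_set_eq_1 emeasure_eq_measure)
  with FF' have AES: "AE x in emm_measure X. x \<in> {x\<in>S. F x = F' x}" by eventually_elim simp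
  have dist: "emm_dist Y (F' x) (F' y) = emm_dist X x y" if "x \<in> {x\<in>S. F x = F' x}" "y \<in> {x\<in>S. F x = F' x}" for x y
    using that A(3)[of x y] S(1) by auto
  obtain G where "iso_pair X Y F' G"
    by (rule iso_pairI[OF emm_space_standard[OF X] emm_space_prob[OF X] emm_space_standard[OF Y] _ _ F' F'd AES dist])
      (use emm_dist_eq_0[OF X] emm_dist_eq_0[OF Y] in simp_all)
  then show "\<exists>F G. iso_pair X Y F G" by blast
qed

lemma mtopology_of_eq: "mtopology_of M = Metric_space.mtopology (mspace M) (mdist M)"
  by (simp add: mtopology_of_def)

lemma emm_of_mm_simps [simp]:
  "emm_top (emm_of_mm Y) = mtopology_of (mm_metric Y)"
  "emm_dist (emm_of_mm Y) x y = ennreal (mdist (mm_metric Y) x y)"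
  "emm_measure (emm_of_mm Y) = mm_measure Y"
  by (simp_all add: emm_of_mm_def)

lemma emm_space_emm_of_mm:
  assumes "mm_space Y" shows "emm_space (emm_of_mm Y)"
proof -
  let ?M = "mspace (mm_metric Y)" and ?d = "mdist (mm_metric Y)"
  interpret Metric_space ?M ?d by simp
  have top: "mtopology_of (mm_metric Y) = mtopology" by (rule mtopology_of_eq)
  have compl: "mcomplete" using assms by (simp add: mm_space_def mcomplete_of_def)
  have "ext_complete_on ?M (\<lambda>x y. ennreal (?d x y))"
    unfolding ext_complete_on_def
  proof (intro allI impI)
    fix s :: "nat \<Rightarrow> 'a" assume s: "range s \<subseteq> ?M" "\<forall>\<epsilon>>0. \<exists>N. \<forall>m\<ge>N. \<forall>n\<ge>N. ennreal (?d (s m) (s n)) < \<epsilon>"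
    have "MCauchy s" unfolding MCauchy_def
    proof (intro conjI allI impI)
      fix e :: real assume "e > 0"
      then obtain N where "\<forall>m\<ge>N. \<forall>n\<ge>N. ennreal (?d (s m) (s n)) < ennreal e" using s(2)[rule_format, of "ennreal e"] by auto
      then show "\<exists>N. \<forall>n n'. N \<le> n \<longrightarrow> N \<le> n' \<longrightarrow> ?d (s n) (s n') < e" by (auto simp: ennreal_less_iff)
    qed (rule s)
    then obtain x where "limitin mtopology s x sequentially" using compl unfolding mcomplete_def by blast
    then have "x \<in> ?M" "(\<lambda>n. ?d (s n) x) \<longlonglongrightarrow> 0" by (auto simp: limitin_metric_dist_null)
    then show "\<exists>x\<in>?M. (\<lambda>n. ennreal (?d (s n) x)) \<longlonglongrightarrow> 0"
      using tendsto_ennrealI[of "\<lambda>n. ?d (s n) x" 0] by (intro bexI[of _ x]) auto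
  qed
  moreover have "ext_distance_on ?M (\<lambda>x y. ennreal (?d x y))"
    unfolding ext_distance_on_def
  proof (intro conjI ballI)
    fix x y z assume xyz: "x \<in> ?M" "y \<in> ?M" "z \<in> ?M"
    show "ennreal (?d x z) \<le> ennreal (?d x y) + ennreal (?d y z)"
      using ennreal_leI[OF triangle[OF xyz]] by (simp add: ennreal_plus[symmetric] del: ennreal_plus)
  qed (auto simp: commute)
  moreover have "openin (prod_topology mtopology mtopology) {p \<in> ?M \<times> ?M. a < ennreal (?d (fst p) (snd p))}" for a
  proof (cases a)
    case (real r)
    have "continuous_map (prod_topology mtopology mtopology) (mtopology_of (mm_metric Y)) fst"
      "continuous_map (prod_topology mtopology mtopology) (mtopology_of (mm_metric Y)) snd"
      unfolding top by (rule continuous_map_fst continuous_map_snd)+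
    then have cm: "continuous_map (prod_topology mtopology mtopology) euclideanreal (\<lambda>p. ?d (fst p) (snd p))"
      by (rule continuous_map_mdist)
    have "{p \<in> ?M \<times> ?M. a < ennreal (?d (fst p) (snd p))} = {p \<in> topspace (prod_topology mtopology mtopology). ?d (fst p) (snd p) \<in> {r<..}}"
      using real by (auto simp: ennreal_less_iff)
    then show ?thesis using openin_continuous_map_preimage[OF cm, of "{r<..}"] by simp
  next
    case top
    then show ?thesis by simp
  qed
  moreover have "ext_open_on ?M (\<lambda>x y. ennreal (?d x y)) U" if U: "openin mtopology U" for U
    unfolding ext_open_on_def
  proof (intro conjI ballI)
    show "U \<subseteq> ?M" using openin_subset[OF U] by simp
    fix x assume x: "x \<in> U"
    then obtain r where r: "r > 0" "mball x r \<subseteq> U" using U by (meson openin_mtopology)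
    moreover have "x \<in> ?M" using \<open>U \<subseteq> ?M\<close> x by blast
    ultimately show "\<exists>r>0. {y \<in> ?M. ennreal (?d x y) < r} \<subseteq> U"
      by (intro exI[of _ "ennreal r"]) (auto simp: ennreal_less_iff subset_iff)
  qed
  ultimately show ?thesis using assms completely_metrizable_space_mtopology[OF compl]
    unfolding emm_space_def mm_space_def emm_of_mm_def by (simp add: top)
qed

lemma mm_space_dense_sequence:
  assumes "mm_space Y"
  obtains a :: "nat \<Rightarrow> 'a" where "range a \<subseteq> mspace (mm_metric Y)"
    "\<And>x e. x \<in> mspace (mm_metric Y) \<Longrightarrow> 0 < e \<Longrightarrow> \<exists>i. mdist (mm_metric Y) (a i) x < e"
proof -
  interpret Metric_space "mspace (mm_metric Y)" "mdist (mm_metric Y)" by simp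
  have "mspace (mm_metric Y) \<noteq> {}"
    using prob_space.not_empty[of "mm_measure Y"] emm_space_space[OF emm_space_emm_of_mm[OF assms]] assms
    by (simp add: mm_space_def)
  moreover have "separable_space mtopology" using assms by (simp add: mm_space_def mtopology_of_eq)
  ultimately show thesis using separable_dense_sequence that by metis
qed

lemma mm_space_space: "mm_space Y \<Longrightarrow> space (mm_measure Y) = mspace (mm_metric Y)"
  using emm_space_space[OF emm_space_emm_of_mm] by fastforce

text \<open>A point outside the support has a null neighbourhood and so lies in a null ball from the
  countable family of dyadic balls around a dense sequence. The union of all null balls of this
  family is null.\<close>

lemma AE_mm_support:
  assumes Y: "mm_space Y" shows "AE x in mm_measure Y. x \<in> mm_support Y"
proof -
  interpret Metric_space "mspace (mm_metric Y)" "mdist (mm_metric Y)" by simp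
  have top: "mtopology_of (mm_metric Y) = mtopology" by (rule mtopology_of_eq)
  obtain a :: "nat \<Rightarrow> 'a" where a: "range a \<subseteq> mspace (mm_metric Y)"
    "\<And>x e. x \<in> mspace (mm_metric Y) \<Longrightarrow> 0 < e \<Longrightarrow> \<exists>i. mdist (mm_metric Y) (a i) x < e"
    using mm_space_dense_sequence[OF Y] by metis
  have sets: "sets (mm_measure Y) = sets (borel_of mtopology)" using Y by (simp add: mm_space_def top)
  let ?I = "{p :: nat \<times> nat. emeasure (mm_measure Y) (mball (a (fst p)) ((1/2)^snd p)) = 0}"
  have "AE x in mm_measure Y. \<forall>p\<in>?I. x \<notin> mball (a (fst p)) ((1/2)^snd p)"
    by (subst AE_ball_countable, simp, intro ballI AE_not_in)
      (simp add: null_sets_def sets openin_sets_borel_of)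
  then show ?thesis using AE_space
  proof eventually_elim
    case (elim x)
    then have x: "x \<in> mspace (mm_metric Y)" using mm_space_space[OF Y] by simp
    have "0 < emeasure (mm_measure Y) U" if "openin mtopology U" "x \<in> U" for U
    proof (rule ccontr)
      assume "\<not> 0 < emeasure (mm_measure Y) U"
      then have U0: "emeasure (mm_measure Y) U = 0" by simp
      obtain r where r: "r > 0" "mball x r \<subseteq> U" using \<open>openin mtopology U\<close> \<open>x \<in> U\<close> by (meson openin_mtopology)
      obtain j where j: "(1/2)^j < r/2" using r(1) real_arch_pow_inv[of "r/2" "1/2"] by auto
      obtain i where i: "mdist (mm_metric Y) (a i) x < (1/2)^j" using a(2)[OF x, of "(1/2)^j"] by auto
      have ai: "a i \<in> mspace (mm_metric Y)" using a by auto
      have "mball (a i) ((1/2)^j) \<subseteq> mball x r"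
        by (rule mball_subset) (use i j x ai commute[of "a i" x] in auto)
      then have "emeasure (mm_measure Y) (mball (a i) ((1/2)^j)) \<le> emeasure (mm_measure Y) U"
        using r \<open>openin mtopology U\<close> by (intro emeasure_mono) (auto simp: sets openin_sets_borel_of)
      then have "(i, j) \<in> ?I" using U0 by simp
      then have "x \<notin> mball (a i) ((1/2)^j)" using elim by auto
      then show False using i ai x by simp
    qed
    then show ?case using x by (simp add: mm_support_def top)
  qed
qed

lemma mm_iso_imp_iso_pair:
  assumes X: "mm_space X" and Y: "mm_space Y" and iso: "mm_iso X Y"
  obtains F G where "iso_pair (emm_of_mm X) (emm_of_mm Y) F G"
proof -
  obtain F where F: "F \<in> mm_measure X \<rightarrow>\<^sub>M mm_measure Y" "distr (mm_measure X) (mm_measure Y) F = mm_measure Y"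
    "\<And>x y. x \<in> mm_support X \<Longrightarrow> y \<in> mm_support X \<Longrightarrow> mdist (mm_metric Y) (F x) (F y) = mdist (mm_metric X) x y"
    using iso unfolding mm_iso_def by blast
  note eX = emm_space_emm_of_mm[OF X] and eY = emm_space_emm_of_mm[OF Y]
  have F': "F \<in> emm_measure (emm_of_mm X) \<rightarrow>\<^sub>M emm_measure (emm_of_mm Y)"
    "distr (emm_measure (emm_of_mm X)) (emm_measure (emm_of_mm Y)) F = emm_measure (emm_of_mm Y)"
    using F by simp_all
  have A: "AE x in emm_measure (emm_of_mm X). x \<in> mm_support X"
    using AE_mm_support[OF X] by (simp only: emm_of_mm_simps)
  have d: "emm_dist (emm_of_mm Y) (F x) (F y) = emm_dist (emm_of_mm X) x y"
    if "x \<in> mm_support X" "y \<in> mm_support X" for x y using F(3)[OF that] by simp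
  obtain G where "iso_pair (emm_of_mm X) (emm_of_mm Y) F G"
    by (rule iso_pairI[OF emm_space_standard[OF eX] emm_space_prob[OF eX] emm_space_standard[OF eY] _ _ F' A d])
      (use emm_dist_eq_0[OF eX] emm_dist_eq_0[OF eY] in auto)
  then show thesis by (rule that)
qed

text \<open>As \<open>mm_iso\<close> asks for equal distances on the whole support, \<open>h\<close>
  has to send support points to support points. Continuity together with preservation of measure
  gives this.\<close>

lemma mm_iso_comp:
  assumes Y': "mm_space Y'"
    and h: "h \<in> mm_measure Y' \<rightarrow>\<^sub>M mm_measure Y" "distr (mm_measure Y') (mm_measure Y) h = mm_measure Y"
    and cont: "continuous_map (mtopology_of (mm_metric Y')) (mtopology_of (mm_metric Y)) h"
    and isom: "\<And>x y. x \<in> mspace (mm_metric Y') \<Longrightarrow> y \<in> mspace (mm_metric Y') \<Longrightarrow>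
        mdist (mm_metric Y) (h x) (h y) = mdist (mm_metric Y') x y"
    and Y: "mm_space Y" and iso: "mm_iso Y Z"
  shows "mm_iso Y' Z"
proof -
  obtain F where F: "F \<in> mm_measure Y \<rightarrow>\<^sub>M mm_measure Z" "distr (mm_measure Y) (mm_measure Z) F = mm_measure Z"
    "\<And>x y. x \<in> mm_support Y \<Longrightarrow> y \<in> mm_support Y \<Longrightarrow> mdist (mm_metric Z) (F x) (F y) = mdist (mm_metric Y) x y"
    using iso unfolding mm_iso_def by blast
  have sup: "h x \<in> mm_support Y" if x: "x \<in> mm_support Y'" for x
    unfolding mm_support_def
  proof safe
    have xM: "x \<in> mspace (mm_metric Y')" using x by (simp add: mm_support_def)
    then show "h x \<in> mspace (mm_metric Y)" using cont continuous_map_image_subset_topspace by fastforce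
    fix U assume U: "openin (mtopology_of (mm_metric Y)) U" "h x \<in> U"
    let ?V = "{x \<in> mspace (mm_metric Y'). h x \<in> U}"
    have "openin (mtopology_of (mm_metric Y')) ?V"
      using openin_continuous_map_preimage[OF cont U(1)] by simp
    then have "0 < emeasure (mm_measure Y') ?V" using x xM U(2) by (simp add: mm_support_def)
    also have "?V = h -` U \<inter> space (mm_measure Y')" using mm_space_space[OF Y'] by auto
    also have "emeasure (mm_measure Y') \<dots> = emeasure (mm_measure Y) U"
    proof -
      have "U \<in> sets (mm_measure Y)" using Y openin_sets_borel_of[OF U(1)] by (simp add: mm_space_def)
      from emeasure_distr[OF h(1) this] show ?thesis using h(2) by simp
    qed
    finally show "0 < emeasure (mm_measure Y) U" .
  qed
  show ?thesis unfolding mm_iso_def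
  proof (intro bexI[of _ "F \<circ> h"] conjI ballI)
    show "distr (mm_measure Y') (mm_measure Z) (F \<circ> h) = mm_measure Z"
      using distr_distr[OF F(1) h(1)] h(2) F(2) by simp
    show "F \<circ> h \<in> mm_measure Y' \<rightarrow>\<^sub>M mm_measure Z" using h F by auto
    fix x y assume "x \<in> mm_support Y'" "y \<in> mm_support Y'"
    then show "mdist (mm_metric Z) ((F \<circ> h) x) ((F \<circ> h) y) = mdist (mm_metric Y') x y"
      using F(3)[OF sup sup] isom by (simp add: mm_support_def)
  qed
qed

subsection \<open>Copies over the reals\<close>

lemma isometry_continuous_map:
  assumes "f \<in> mspace M \<rightarrow> mspace N"
    and "\<And>x y. x \<in> mspace M \<Longrightarrow> y \<in> mspace M \<Longrightarrow> mdist N (f x) (f y) = mdist M x y"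
  shows "continuous_map (mtopology_of M) (mtopology_of N) f"
  by (rule Lipschitz_continuous_imp_continuous_map)
    (use assms in \<open>auto simp: Lipschitz_continuous_map_def intro!: exI[of _ 1]\<close>)

lemma measurable_continuous_map:
  assumes "continuous_map S T f" "sets M = sets (borel_of S)" "sets N = sets (borel_of T)"
  shows "f \<in> M \<rightarrow>\<^sub>M N"
proof -
  have "f \<in> borel_of S \<rightarrow>\<^sub>M borel_of T"
    unfolding borel_of_def[of T]
  proof (rule measurable_measure_of)
    show "{U. openin T U} \<subseteq> Pow (topspace T)" using openin_subset by blast
    show "f \<in> space (borel_of S) \<rightarrow> topspace T"
      using assms(1) continuous_map_image_subset_topspace by fastforce
    fix U assume "U \<in> {U. openin T U}"
    then have "openin S {x \<in> topspace S. f x \<in> U}" using openin_continuous_map_preimage[OF assms(1)] by simp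
    moreover have "{x \<in> topspace S. f x \<in> U} = f -` U \<inter> space (borel_of S)" by auto
    ultimately show "f -` U \<inter> space (borel_of S) \<in> sets (borel_of S)" using openin_sets_borel_of by metis
  qed
  then show ?thesis using measurable_cong_sets[OF assms(2,3)] by simp
qed

lemma isometric_mcomplete:
  assumes M: "mcomplete_of M" and f: "f ` mspace M = mspace N"
    and isom: "\<And>x y. x \<in> mspace M \<Longrightarrow> y \<in> mspace M \<Longrightarrow> mdist N (f x) (f y) = mdist M x y"
  shows "mcomplete_of N"
proof -
  interpret M: Metric_space "mspace M" "mdist M" by simp
  interpret N: Metric_space "mspace N" "mdist N" by simp
  show ?thesis unfolding mcomplete_of_def N.mcomplete_def
  proof (intro allI impI)
    fix \<sigma> assume \<sigma>: "N.MCauchy \<sigma>"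
    then have r: "range \<sigma> \<subseteq> mspace N" by (simp add: N.MCauchy_def)
    define \<rho> where "\<rho> n = inv_into (mspace M) f (\<sigma> n)" for n
    have \<rho>: "\<rho> n \<in> mspace M" "f (\<rho> n) = \<sigma> n" for n
      using r f inv_into_into[of "\<sigma> n" f "mspace M"] f_inv_into_f[of "\<sigma> n" f "mspace M"]
      unfolding \<rho>_def by auto
    have "mdist M (\<rho> i) (\<rho> j) = mdist N (\<sigma> i) (\<sigma> j)" for i j using isom[OF \<rho>(1) \<rho>(1)] \<rho>(2) by simp
    then have "M.MCauchy \<rho>" using \<sigma> \<rho>(1) by (auto simp: M.MCauchy_def N.MCauchy_def)
    then obtain x where x: "limitin M.mtopology \<rho> x sequentially"
      using M unfolding mcomplete_of_def M.mcomplete_def by blast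
    then have x: "x \<in> mspace M" "(\<lambda>n. mdist M (\<rho> n) x) \<longlonglongrightarrow> 0" by (auto simp: M.limitin_metric_dist_null)
    moreover have "mdist M (\<rho> n) x = mdist N (\<sigma> n) (f x)" for n using isom[OF \<rho>(1) x(1)] \<rho>(2) by simp
    ultimately have "limitin N.mtopology \<sigma> (f x) sequentially"
      using f r by (auto simp: N.limitin_metric_dist_null range_subsetD)
    then show "\<exists>x. limitin N.mtopology \<sigma> x sequentially" by blast
  qed
qed

text \<open>The code \<open>e\<close> is injective on the carrier with inverse \<open>r\<close>, so
  the metric can be moved to the set of codes. The real numbers serve as labels only.\<close>

lemma real_metric_copy:
  fixes M :: "'b metric" and e :: "'b \<Rightarrow> real"
  assumes re: "\<And>x. x \<in> mspace M \<Longrightarrow> r (e x) = x"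
  obtains N :: "real metric" where "mspace N = e ` mspace M"
    "\<forall>x\<in>mspace M. \<forall>y\<in>mspace M. mdist N (e x) (e y) = mdist M x y"
    "\<forall>s\<in>mspace N. \<forall>t\<in>mspace N. mdist M (r s) (r t) = mdist N s t"
    "continuous_map (mtopology_of M) (mtopology_of N) e" "continuous_map (mtopology_of N) (mtopology_of M) r"
    "mcomplete_of M \<longrightarrow> mcomplete_of N"
    "separable_space (mtopology_of M) \<longrightarrow> separable_space (mtopology_of N)"
proof -
  let ?S = "e ` mspace M" and ?d = "\<lambda>s t. mdist M (r s) (r t)"
  have "Metric_space ?S ?d"
  proof
    show "?d x y = 0 \<longleftrightarrow> x = y" if "x \<in> ?S" "y \<in> ?S" for x y using that re by auto
    show "?d x z \<le> ?d x y + ?d y z" if "x \<in> ?S" "y \<in> ?S" "z \<in> ?S" for x y z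
      using that re by (auto intro: mdist_triangle)
  qed (auto simp: mdist_commute)
  then have N: "mspace (metric (?S, ?d)) = ?S" "mdist (metric (?S, ?d)) = ?d"
    by (simp_all add: Metric_space.mspace_metric Metric_space.mdist_metric)
  let ?N = "metric (?S, ?d)"
  have c: "continuous_map (mtopology_of M) (mtopology_of ?N) e"
    by (rule isometry_continuous_map) (use N re in auto)
  show thesis
  proof (rule that[of ?N])
    show "continuous_map (mtopology_of ?N) (mtopology_of M) r"
      by (rule isometry_continuous_map) (use N re in auto)
    show "mcomplete_of M \<longrightarrow> mcomplete_of ?N"
      by (intro impI, rule isometric_mcomplete[of M e]) (use N re in auto)
    show "separable_space (mtopology_of M) \<longrightarrow> separable_space (mtopology_of ?N)"
      by (intro impI, rule separable_space_continuous_map_image[OF _ c]) (use N in auto)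
  qed (use N re c in auto)
qed

lemma distr_copy:
  assumes e: "e \<in> M \<rightarrow>\<^sub>M B" and r: "r \<in> distr M B e \<rightarrow>\<^sub>M M" and re: "\<And>x. x \<in> space M \<Longrightarrow> r (e x) = x"
  shows "distr (distr M B e) M r = M" "distr M (distr M B e) e = distr M B e"
proof -
  have "distr (distr M B e) M r = distr M M (r \<circ> e)" using r by (intro distr_distr e) simp
  also have "\<dots> = distr M M (\<lambda>x. x)" by (rule distr_cong) (use re in auto)
  finally show "distr (distr M B e) M r = M" by simp
  show "distr M (distr M B e) e = distr M B e" by (rule distr_cong) auto
qed

text \<open>Equal classes means that the same real spaces are isomorphic to \<open>Y\<close> and to
  its copy; composing an isomorphism with \<open>e\<close> or with \<open>r\<close> passes from one
  to the other.\<close>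

lemma mm_space_real_copy:
  fixes Y :: "'b mm_data"
  assumes Y: "mm_space Y"
  obtains Y' :: "real mm_data" where "mm_space Y'" "mm_class Y' = mm_class Y" "mm_iso Y Y'"
proof -
  obtain e r where "\<forall>y\<in>space (mm_measure Y). r (e y :: real) = y"
    using standardE[OF emm_space_standard[OF emm_space_emm_of_mm[OF Y]]] by (metis emm_of_mm_simps(3))
  then have re: "\<And>y. y \<in> mspace (mm_metric Y) \<Longrightarrow> r (e y) = y" using mm_space_space[OF Y] by auto
  obtain N :: "real metric" where N: "mspace N = e ` mspace (mm_metric Y)"
    "\<forall>x\<in>mspace (mm_metric Y). \<forall>y\<in>mspace (mm_metric Y). mdist N (e x) (e y) = mdist (mm_metric Y) x y"
    "\<forall>s\<in>mspace N. \<forall>t\<in>mspace N. mdist (mm_metric Y) (r s) (r t) = mdist N s t"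
    "continuous_map (mtopology_of (mm_metric Y)) (mtopology_of N) e"
    "continuous_map (mtopology_of N) (mtopology_of (mm_metric Y)) r"
    "mcomplete_of (mm_metric Y) \<longrightarrow> mcomplete_of N"
    "separable_space (mtopology_of (mm_metric Y)) \<longrightarrow> separable_space (mtopology_of N)"
    by (rule real_metric_copy[OF re])
  define \<mu> where "\<mu> = distr (mm_measure Y) (borel_of (mtopology_of N)) e"
  have sY: "sets (mm_measure Y) = sets (borel_of (mtopology_of (mm_metric Y)))" using Y by (simp add: mm_space_def)
  have s\<mu>: "sets \<mu> = sets (borel_of (mtopology_of N))" by (simp add: \<mu>_def)
  have em: "e \<in> mm_measure Y \<rightarrow>\<^sub>M borel_of (mtopology_of N)"
    by (rule measurable_continuous_map[OF N(4) sY refl])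
  have e\<mu>: "e \<in> mm_measure Y \<rightarrow>\<^sub>M \<mu>" by (rule measurable_continuous_map[OF N(4) sY s\<mu>])
  have r\<mu>: "r \<in> \<mu> \<rightarrow>\<^sub>M mm_measure Y" by (rule measurable_continuous_map[OF N(5) s\<mu> sY])
  have d: "distr \<mu> (mm_measure Y) r = mm_measure Y" "distr (mm_measure Y) \<mu> e = \<mu>"
    using distr_copy[OF em] r\<mu> re mm_space_space[OF Y] unfolding \<mu>_def by auto
  define Y' where "Y' = \<lparr>mm_metric = N, mm_measure = \<mu>\<rparr>"
  have Y': "mm_space Y'"
    using Y N(6,7) s\<mu> prob_space.prob_space_distr[OF _ em] by (simp add: mm_space_def Y'_def \<mu>_def)
  have i1: "mm_iso Y' Z \<Longrightarrow> mm_iso Y Z" for Z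
    using mm_iso_comp[OF Y, of e Y' Z] e\<mu> d(2) N(2,4) Y' by (simp add: Y'_def)
  have i2: "mm_iso Y Z \<Longrightarrow> mm_iso Y' Z" for Z
    using mm_iso_comp[OF Y', of r Y Z] r\<mu> d(1) N(3,5) Y by (simp add: Y'_def)
  have refl: "mm_iso Y' Y'"
    unfolding mm_iso_def by (rule bexI[of _ "\<lambda>x. x"]) auto
  show thesis
  proof (rule that[of Y', OF Y'])
    show "mm_class Y' = mm_class Y" unfolding mm_class_def using i1 i2 by blast
    show "mm_iso Y Y'" by (rule i1[OF refl])
  qed
qed

lemma rep_in: "x \<in> c \<Longrightarrow> rep c \<in> c"
  unfolding rep_def by (rule someI)

lemma mm_class_rep:
  assumes Y: "mm_space Y"
  shows "mm_class Y \<in> mm_classes" "mm_space (rep (mm_class Y))" "mm_iso Y (rep (mm_class Y))"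
proof -
  obtain Y' :: "real mm_data" where Y': "mm_space Y'" "mm_class Y' = mm_class Y" "mm_iso Y Y'"
    by (rule mm_space_real_copy[OF Y])
  show "mm_class Y \<in> mm_classes" unfolding mm_classes_def using Y' by blast
  have "Y' \<in> mm_class Y" using Y' by (simp add: mm_class_def)
  from rep_in[OF this] show "mm_space (rep (mm_class Y))" "mm_iso Y (rep (mm_class Y))"
    by (auto simp: mm_class_def)
qed

lemma mm_classes_rep: "c \<in> mm_classes \<Longrightarrow> mm_space (rep c)"
  using mm_class_rep(2) by (auto simp: mm_classes_def)

lemma mm_class_rep_iso_pair:
  assumes Y: "mm_space Y"
  obtains F G where "iso_pair (emm_of_mm Y) (emm_of_mm (rep (mm_class Y))) F G"
  using mm_iso_imp_iso_pair[OF Y mm_class_rep(2,3)[OF Y]] .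

text \<open>The topology is carried over by a complete metric inducing it, the extended distance
  separately through \<open>r\<close>. Lower semicontinuity and the comparison of topologies are
  inherited because \<open>e\<close> and \<open>r\<close> are mutually inverse homeomorphisms of the
  carriers.\<close>

lemma emm_space_real_copy:
  fixes X :: "'b emm_data"
  assumes X: "emm_space X"
  obtains Z :: "real emm_data" and F G where "emm_space Z" "emm_class Z = emm_class X" "iso_pair X Z F G"
proof -
  obtain e r where "\<forall>y\<in>space (emm_measure X). r (e y :: real) = y"
    using standardE[OF emm_space_standard[OF X]] by metis
  then have re: "\<And>y. y \<in> topspace (emm_top X) \<Longrightarrow> r (e y) = y" using emm_space_space[OF X] by auto
  obtain S d where S: "Metric_space S d" "Metric_space.mcomplete S d" "emm_top X = Metric_space.mtopology S d"
    using X by (auto simp: emm_space_def completely_metrizable_space_def)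
  interpret Metric_space S d by fact
  have M: "mspace (metric (S, d)) = S" "mtopology_of (metric (S, d)) = emm_top X" "mcomplete_of (metric (S, d))"
    using S by auto
  have tS: "topspace (emm_top X) = S" using S(3) by simp
  have re': "\<And>y. y \<in> mspace (metric (S, d)) \<Longrightarrow> r (e y) = y" using re M(1) tS by simp
  obtain N :: "real metric" where "mspace N = e ` mspace (metric (S, d))"
    "\<forall>x\<in>mspace (metric (S, d)). \<forall>y\<in>mspace (metric (S, d)). mdist N (e x) (e y) = mdist (metric (S, d)) x y"
    "\<forall>s\<in>mspace N. \<forall>t\<in>mspace N. mdist (metric (S, d)) (r s) (r t) = mdist N s t"
    "continuous_map (mtopology_of (metric (S, d))) (mtopology_of N) e"
    "continuous_map (mtopology_of N) (mtopology_of (metric (S, d))) r"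
    "mcomplete_of (metric (S, d)) \<longrightarrow> mcomplete_of N"
    "separable_space (mtopology_of (metric (S, d))) \<longrightarrow> separable_space (mtopology_of N)"
    by (rule real_metric_copy[OF re'])
  then have N: "mspace N = e ` S" "continuous_map (emm_top X) (mtopology_of N) e"
    "continuous_map (mtopology_of N) (emm_top X) r"
    "mcomplete_of N" "separable_space (emm_top X) \<longrightarrow> separable_space (mtopology_of N)"
    using M by simp_all
  interpret N: Metric_space "mspace N" "mdist N" by simp
  define \<mu> where "\<mu> = distr (emm_measure X) (borel_of (mtopology_of N)) e"
  have sX: "sets (emm_measure X) = sets (borel_of (emm_top X))" using X by (simp add: emm_space_def)
  have s\<mu>: "sets \<mu> = sets (borel_of (mtopology_of N))" by (simp add: \<mu>_def)
  have em: "e \<in> emm_measure X \<rightarrow>\<^sub>M borel_of (mtopology_of N)"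
    by (rule measurable_continuous_map[OF N(2) sX refl])
  have e\<mu>: "e \<in> emm_measure X \<rightarrow>\<^sub>M \<mu>" by (rule measurable_continuous_map[OF N(2) sX s\<mu>])
  have r\<mu>: "r \<in> \<mu> \<rightarrow>\<^sub>M emm_measure X" by (rule measurable_continuous_map[OF N(3) s\<mu> sX])
  have dd: "distr \<mu> (emm_measure X) r = emm_measure X" "distr (emm_measure X) \<mu> e = \<mu>"
    using distr_copy[OF em] r\<mu> re emm_space_space[OF X] unfolding \<mu>_def by auto
  define Z where "Z = \<lparr>emm_top = mtopology_of N, emm_dist = (\<lambda>s t. emm_dist X (r s) (r t)), emm_measure = \<mu>\<rparr>"
  have reS: "x \<in> S \<Longrightarrow> r (e x) = x" for x using re tS by simp
  have dX: "ext_distance_on S (emm_dist X)" "ext_complete_on S (emm_dist X)"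
    "\<And>U. openin (emm_top X) U \<Longrightarrow> ext_open_on S (emm_dist X) U"
    "\<And>a. openin (prod_topology (emm_top X) (emm_top X)) {p \<in> S \<times> S. a < emm_dist X (fst p) (snd p)}"
    using X tS by (auto simp: emm_space_def)
  have "completely_metrizable_space (mtopology_of N)"
    using N(4) N.completely_metrizable_space_mtopology by (simp add: mcomplete_of_def mtopology_of_eq)
  moreover have "ext_distance_on (mspace N) (emm_dist Z)"
  proof -
    have "x = y" if "x \<in> S" "y \<in> S" "e x = e y" for x y using reS that by metis
    then show ?thesis using dX(1) reS unfolding ext_distance_on_def N(1) Z_def by auto
  qed
  moreover have "ext_complete_on (mspace N) (emm_dist Z)"
    unfolding ext_complete_on_def
  proof (intro allI impI)
    fix s :: "nat \<Rightarrow> real" assume s: "range s \<subseteq> mspace N" "\<forall>\<epsilon>>0. \<exists>N. \<forall>m\<ge>N. \<forall>n\<ge>N. emm_dist Z (s m) (s n) < \<epsilon>"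
    have "r (s n) \<in> S" for n
    proof -
      have "s n \<in> e ` S" using s(1) unfolding N(1) by (rule range_subsetD)
      then show ?thesis using reS by auto
    qed
    then have "range (r \<circ> s) \<subseteq> S" unfolding comp_def by (rule image_subsetI)
    moreover have "\<forall>\<epsilon>>0. \<exists>N. \<forall>m\<ge>N. \<forall>n\<ge>N. emm_dist X ((r \<circ> s) m) ((r \<circ> s) n) < \<epsilon>"
      using s(2) unfolding Z_def by simp
    ultimately obtain x where x: "x \<in> S" "(\<lambda>n. emm_dist X ((r \<circ> s) n) x) \<longlonglongrightarrow> 0"
      using dX(2)[unfolded ext_complete_on_def, THEN spec, of "r \<circ> s"] by blast
    then show "\<exists>x\<in>mspace N. (\<lambda>n. emm_dist Z (s n) x) \<longlonglongrightarrow> 0"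
      using reS by (intro bexI[of _ "e x"]) (auto simp: Z_def N(1))
  qed
  moreover have "openin (prod_topology (mtopology_of N) (mtopology_of N)) {p \<in> mspace N \<times> mspace N. a < emm_dist Z (fst p) (snd p)}" for a
  proof -
    have c: "continuous_map (prod_topology (mtopology_of N) (mtopology_of N)) (prod_topology (emm_top X) (emm_top X)) (\<lambda>p. (r (fst p), r (snd p)))"
      by (intro continuous_map_pairedI continuous_map_compose[OF continuous_map_fst N(3), unfolded comp_def]
          continuous_map_compose[OF continuous_map_snd N(3), unfolded comp_def])
    have "{p \<in> mspace N \<times> mspace N. a < emm_dist Z (fst p) (snd p)} =
      {p \<in> topspace (prod_topology (mtopology_of N) (mtopology_of N)). (r (fst p), r (snd p)) \<in> {p \<in> S \<times> S. a < emm_dist X (fst p) (snd p)}}"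
      using reS by (auto simp: N(1) Z_def)
    then show ?thesis using openin_continuous_map_preimage[OF c dX(4)] by simp
  qed
  moreover have "ext_open_on (mspace N) (emm_dist Z) U" if U: "openin (mtopology_of N) U" for U
    unfolding ext_open_on_def
  proof (intro conjI ballI)
    show UN: "U \<subseteq> mspace N" using openin_subset[OF U] by simp
    fix s assume s: "s \<in> U"
    then obtain x where x: "x \<in> S" "s = e x" using UN N(1) by auto
    have "openin (emm_top X) {x \<in> S. e x \<in> U}"
      using openin_continuous_map_preimage[OF N(2) U] tS by simp
    from dX(3)[OF this] obtain \<rho> where \<rho>: "\<rho> > 0" "{y \<in> S. emm_dist X x y < \<rho>} \<subseteq> {x \<in> S. e x \<in> U}"
      using x s by (auto simp: ext_open_on_def)
    then show "\<exists>\<rho>>0. {t \<in> mspace N. emm_dist Z s t < \<rho>} \<subseteq> U"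
      using x reS by (intro exI[of _ \<rho>]) (auto simp: Z_def N(1))
  qed
  moreover have "prob_space \<mu>" unfolding \<mu>_def by (rule prob_space.prob_space_distr[OF emm_space_prob[OF X] em])
  ultimately have Z: "emm_space Z"
    using X N(5) s\<mu> unfolding emm_space_def by (simp add: Z_def)
  have iso: "iso_pair X Z e r"
    unfolding iso_pair_def
  proof (intro conjI exI[of _ S])
    show "AE x in emm_measure X. r (e x) = x" "AE x in emm_measure X. x \<in> S"
      using re emm_space_space[OF X] tS by auto
    have "space \<mu> = e ` S" using sets_eq_imp_space_eq[OF s\<mu>] N(1) by simp
    then show "AE y in emm_measure Z. e (r y) = y" using reS by (intro AE_I2) (auto simp: Z_def)
  qed (use e\<mu> r\<mu> dd reS in \<open>auto simp: Z_def\<close>)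
  have "emm_iso Z W \<longleftrightarrow> emm_iso X W" if "emm_space W" for W :: "real emm_data"
    using iso_pair_trans[OF iso] iso_pair_trans[OF iso_pair_sym[OF iso]]
    unfolding emm_iso_iff[OF Z that] emm_iso_iff[OF X that] by meson
  then have "emm_class Z = emm_class X" unfolding emm_class_def by blast
  with Z iso show thesis by (intro that)
qed

text \<open>The class is inhabited by the real copy, so \<open>rep\<close> indeed returns a space
  isomorphic to \<open>X\<close>.\<close>

lemma emm_class_rep_iso_pair:
  assumes X: "emm_space X"
  obtains F G where "emm_space (rep (emm_class X))" "iso_pair X (rep (emm_class X)) F G"
proof -
  obtain Z :: "real emm_data" and F G where Z: "emm_space Z" "emm_class Z = emm_class X" "iso_pair X Z F G"
    by (rule emm_space_real_copy[OF X])
  then have "Z \<in> emm_class X" using emm_iso_iff[OF X Z(1)] by (auto simp: emm_class_def)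
  from rep_in[OF this] have "emm_space (rep (emm_class X))" "emm_iso X (rep (emm_class X))"
    by (auto simp: emm_class_def)
  then show thesis using that emm_iso_iff[OF X] by blast
qed

section \<open>Joins of mm-spaces\<close>

lemma mdist_self [simp]: "x \<in> mspace M \<Longrightarrow> mdist M x x = 0"
  by (rule Metric_space.mdist_zero[OF Metric_space_mspace_mdist])

text \<open>With the maximum, a pair of 1-Lipschitz maps is again 1-Lipschitz, and so are both
  projections.\<close>

definition max_metric :: "'a metric \<Rightarrow> 'b metric \<Rightarrow> ('a \<times> 'b) metric" where
  "max_metric M N = metric (mspace M \<times> mspace N, \<lambda>p q. max (mdist M (fst p) (fst q)) (mdist N (snd p) (snd q)))"

lemma mspace_max_metric [simp]: "mspace (max_metric M N) = mspace M \<times> mspace N"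
  and mdist_max_metric [simp]: "mdist (max_metric M N) p q = max (mdist M (fst p) (fst q)) (mdist N (snd p) (snd q))"
proof -
  have "Metric_space (mspace M \<times> mspace N) (\<lambda>p q. max (mdist M (fst p) (fst q)) (mdist N (snd p) (snd q)))"
  proof
    fix x y z :: "'a \<times> 'b"
    assume "x \<in> mspace M \<times> mspace N" "y \<in> mspace M \<times> mspace N" "z \<in> mspace M \<times> mspace N"
    then have "mdist M (fst x) (fst z) \<le> mdist M (fst x) (fst y) + mdist M (fst y) (fst z)"
      "mdist N (snd x) (snd z) \<le> mdist N (snd x) (snd y) + mdist N (snd y) (snd z)"
      by (auto intro: mdist_triangle)
    then show "max (mdist M (fst x) (fst z)) (mdist N (snd x) (snd z)) \<le> max (mdist M (fst x) (fst y)) (mdist N (snd x) (snd y)) + max (mdist M (fst y) (fst z)) (mdist N (snd y) (snd z))"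
      by linarith
  next
    fix x y :: "'a \<times> 'b"
    assume xy: "x \<in> mspace M \<times> mspace N" "y \<in> mspace M \<times> mspace N"
    show "max (mdist M (fst x) (fst y)) (mdist N (snd x) (snd y)) = 0 \<longleftrightarrow> x = y"
    proof
      assume "max (mdist M (fst x) (fst y)) (mdist N (snd x) (snd y)) = 0"
      then have "mdist M (fst x) (fst y) = 0" "mdist N (snd x) (snd y) = 0"
        using mdist_nonneg[of M "fst x" "fst y"] mdist_nonneg[of N "snd x" "snd y"] by linarith+
      then show "x = y" using xy by (auto simp: prod_eq_iff)
    qed (use xy in auto)
  qed (auto simp: mdist_commute le_max_iff_disj)
  then show "mspace (max_metric M N) = mspace M \<times> mspace N"
    "mdist (max_metric M N) p q = max (mdist M (fst p) (fst q)) (mdist N (snd p) (snd q))"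
    unfolding max_metric_def by (simp_all add: Metric_space.mspace_metric Metric_space.mdist_metric)
qed

lemma mcomplete_max_metric:
  assumes "mcomplete_of M" "mcomplete_of N" shows "mcomplete_of (max_metric M N)"
proof -
  interpret M: Metric_space "mspace M" "mdist M" by simp
  interpret N: Metric_space "mspace N" "mdist N" by simp
  interpret P: Metric_space "mspace (max_metric M N)" "mdist (max_metric M N)" by (rule Metric_space_mspace_mdist)
  show ?thesis unfolding mcomplete_of_def P.mcomplete_def
  proof (intro allI impI)
    fix \<sigma> assume \<sigma>: "P.MCauchy \<sigma>"
    then have r: "\<sigma> n \<in> mspace M \<times> mspace N" for n unfolding P.MCauchy_def by auto
    have *: "\<exists>n0. \<forall>i j. n0 \<le> i \<longrightarrow> n0 \<le> j \<longrightarrow> max (mdist M (fst (\<sigma> i)) (fst (\<sigma> j))) (mdist N (snd (\<sigma> i)) (snd (\<sigma> j))) < e"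
      if "0 < e" for e using \<sigma> that unfolding P.MCauchy_def by simp
    have "M.MCauchy (fst \<circ> \<sigma>)" unfolding M.MCauchy_def comp_def
    proof (intro conjI allI impI)
      show "range (\<lambda>n. fst (\<sigma> n)) \<subseteq> mspace M" using r by (auto simp: mem_Times_iff)
      fix e :: real assume "0 < e"
      from *[OF this] show "\<exists>n0. \<forall>i j. n0 \<le> i \<longrightarrow> n0 \<le> j \<longrightarrow> mdist M (fst (\<sigma> i)) (fst (\<sigma> j)) < e"
        unfolding max_less_iff_conj by blast
    qed
    moreover have "N.MCauchy (snd \<circ> \<sigma>)" unfolding N.MCauchy_def comp_def
    proof (intro conjI allI impI)
      show "range (\<lambda>n. snd (\<sigma> n)) \<subseteq> mspace N" using r by (auto simp: mem_Times_iff)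
      fix e :: real assume "0 < e"
      from *[OF this] show "\<exists>n0. \<forall>i j. n0 \<le> i \<longrightarrow> n0 \<le> j \<longrightarrow> mdist N (snd (\<sigma> i)) (snd (\<sigma> j)) < e"
        unfolding max_less_iff_conj by blast
    qed
    ultimately obtain x y where "limitin M.mtopology (fst \<circ> \<sigma>) x sequentially" "limitin N.mtopology (snd \<circ> \<sigma>) y sequentially"
      using assms unfolding mcomplete_of_def M.mcomplete_def N.mcomplete_def by blast
    then have xy: "x \<in> mspace M" "y \<in> mspace N" "(\<lambda>n. mdist M (fst (\<sigma> n)) x) \<longlonglongrightarrow> 0" "(\<lambda>n. mdist N (snd (\<sigma> n)) y) \<longlonglongrightarrow> 0"
      by (auto simp: M.limitin_metric_dist_null N.limitin_metric_dist_null)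
    have "(\<lambda>n. max (mdist M (fst (\<sigma> n)) x) (mdist N (snd (\<sigma> n)) y)) \<longlonglongrightarrow> max 0 0"
      by (intro tendsto_max xy)
    then have "limitin P.mtopology \<sigma> (x, y) sequentially"
      using xy r unfolding P.limitin_metric_dist_null by simp
    then show "\<exists>z. limitin P.mtopology \<sigma> z sequentially" by blast
  qed
qed

lemma separable_spaceI:
  fixes a :: "nat \<Rightarrow> 'a"
  assumes "range a \<subseteq> mspace M" "\<And>x e. x \<in> mspace M \<Longrightarrow> 0 < e \<Longrightarrow> \<exists>i. mdist M (a i) x < e"
  shows "separable_space (mtopology_of M)"
proof -
  interpret Metric_space "mspace M" "mdist M" by simp
  have "x \<in> mtopology closure_of range a" if x: "x \<in> mspace M" for x
    unfolding metric_closure_of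
  proof (intro CollectI conjI allI impI x)
    fix r :: real assume "0 < r"
    then obtain i where i: "mdist M (a i) x < r" using assms(2)[OF x] by blast
    have "a i \<in> mspace M" using assms(1) by auto
    then have "a i \<in> mball x r" using i x by (simp add: mdist_commute)
    then show "\<exists>y\<in>range a. y \<in> mball x r" by blast
  qed
  then have "mtopology closure_of range a = mspace M"
    using closure_of_subset_topspace[of mtopology "range a"] by auto
  then show ?thesis unfolding separable_space_def mtopology_of_eq using assms(1) by (intro exI[of _ "range a"]) auto
qed

lemma mm_measurable_dist:
  assumes Y: "mm_space Y" and a: "a \<in> mspace (mm_metric Y)"
  shows "mdist (mm_metric Y) a \<in> borel_measurable (mm_measure Y)"
proof -
  interpret Metric_space "mspace (mm_metric Y)" "mdist (mm_metric Y)" by simp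
  have "sets (mm_measure Y) = sets (borel_of mtopology)" using Y by (simp add: mm_space_def mtopology_of_eq)
  from measurable_cong_sets[OF this refl] measurable_dist_borel_of[OF a] show ?thesis by blast
qed

lemma lip_mapI:
  assumes "\<phi> \<in> emm_measure X \<rightarrow>\<^sub>M emm_measure Y" "distr (emm_measure X) (emm_measure Y) \<phi> = emm_measure Y"
    "AE x in emm_measure X. x \<in> E" "\<And>x y. x \<in> E \<Longrightarrow> y \<in> E \<Longrightarrow> emm_dist Y (\<phi> x) (\<phi> y) \<le> emm_dist X x y"
  shows "lip_map X Y \<phi>"
  unfolding lip_map_def using assms by blast

text \<open>\<open>Z\<close> carries the joint law of the two maps. Such joins give common
  dominators in the pyramid and, when iterated, spaces through which finitely many functions
  factor.\<close>

lemma mm_join: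
  fixes X :: "'a emm_data" and Y1 :: "'b mm_data" and Y2 :: "'c mm_data"
  assumes X: "prob_space (emm_measure X)" and Y: "mm_space Y1" "mm_space Y2"
    and \<phi>: "lip_map X (emm_of_mm Y1) \<phi>1" "lip_map X (emm_of_mm Y2) \<phi>2"
  obtains Z :: "('b \<times> 'c) mm_data" where "mm_space Z" "lip_map X (emm_of_mm Z) (\<lambda>x. (\<phi>1 x, \<phi>2 x))"
    "lip_map (emm_of_mm Z) (emm_of_mm Y1) fst" "lip_map (emm_of_mm Z) (emm_of_mm Y2) snd"
proof -
  let ?P = "max_metric (mm_metric Y1) (mm_metric Y2)"
  interpret P: Metric_space "mspace ?P" "mdist ?P" by (rule Metric_space_mspace_mdist)
  obtain a :: "nat \<Rightarrow> 'b" where a: "range a \<subseteq> mspace (mm_metric Y1)"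
    "\<And>x e. x \<in> mspace (mm_metric Y1) \<Longrightarrow> 0 < e \<Longrightarrow> \<exists>i. mdist (mm_metric Y1) (a i) x < e"
    using mm_space_dense_sequence[OF Y(1)] by metis
  obtain b :: "nat \<Rightarrow> 'c" where b: "range b \<subseteq> mspace (mm_metric Y2)"
    "\<And>x e. x \<in> mspace (mm_metric Y2) \<Longrightarrow> 0 < e \<Longrightarrow> \<exists>i. mdist (mm_metric Y2) (b i) x < e"
    using mm_space_dense_sequence[OF Y(2)] by metis
  define c where "c n = (a (fst (prod_decode n)), b (snd (prod_decode n)))" for n
  have c: "range c \<subseteq> mspace ?P" using a(1) b(1) by (auto simp: c_def)
  have dense: "\<exists>n. mdist ?P (c n) z < e" if z: "z \<in> mspace ?P" and e: "0 < e" for z e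
  proof -
    obtain i where i: "mdist (mm_metric Y1) (a i) (fst z) < e" using a(2)[of "fst z" e] z e by auto
    obtain j where j: "mdist (mm_metric Y2) (b j) (snd z) < e" using b(2)[of "snd z" e] z e by auto
    show ?thesis by (intro exI[of _ "prod_encode (i, j)"]) (simp add: c_def i j)
  qed
  have top: "mtopology_of ?P = P.mtopology" by (rule mtopology_of_eq)
  have m1: "\<phi>1 \<in> emm_measure X \<rightarrow>\<^sub>M mm_measure Y1" and m2: "\<phi>2 \<in> emm_measure X \<rightarrow>\<^sub>M mm_measure Y2"
    using \<phi>[THEN lip_map_measurable] by simp_all
  let ?\<phi> = "\<lambda>x. (\<phi>1 x, \<phi>2 x)"
  have m: "?\<phi> \<in> emm_measure X \<rightarrow>\<^sub>M borel_of P.mtopology"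
  proof (rule P.measurable_borel_of_mtopology[OF c dense])
    show "?\<phi> \<in> space (emm_measure X) \<rightarrow> mspace ?P"
      using measurable_space[OF m1] measurable_space[OF m2] mm_space_space[OF Y(1)] mm_space_space[OF Y(2)] by auto
    fix n
    have "fst (c n) \<in> mspace (mm_metric Y1)" "snd (c n) \<in> mspace (mm_metric Y2)" using c by (auto simp: c_def)
    then show "(\<lambda>x. mdist ?P (c n) (?\<phi> x)) \<in> borel_measurable (emm_measure X)"
      using measurable_compose[OF m1 mm_measurable_dist[OF Y(1)]] measurable_compose[OF m2 mm_measurable_dist[OF Y(2)]]
      by simp
  qed
  define \<mu> where "\<mu> = distr (emm_measure X) (borel_of P.mtopology) ?\<phi>"
  define Z where "Z = \<lparr>mm_metric = ?P, mm_measure = \<mu>\<rparr>"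
  have s\<mu>: "sets \<mu> = sets (borel_of (mtopology_of ?P))" by (simp add: \<mu>_def top)
  have "mcomplete_of ?P" using Y by (intro mcomplete_max_metric) (simp_all add: mm_space_def)
  moreover have "separable_space (mtopology_of ?P)" by (rule separable_spaceI[OF c dense])
  moreover have "prob_space \<mu>" unfolding \<mu>_def by (rule prob_space.prob_space_distr[OF X m])
  ultimately have Z: "mm_space Z" by (simp add: mm_space_def Z_def s\<mu>)
  have mZ: "?\<phi> \<in> emm_measure X \<rightarrow>\<^sub>M \<mu>" unfolding measurable_cong_sets[OF refl s\<mu>[unfolded top]] by (rule m)
  have dZ: "distr (emm_measure X) \<mu> ?\<phi> = \<mu>" unfolding \<mu>_def by (rule distr_cong) auto
  obtain E1 where E1: "AE x in emm_measure X. x \<in> E1" "\<And>x y. x \<in> E1 \<Longrightarrow> y \<in> E1 \<Longrightarrow> ennreal (mdist (mm_metric Y1) (\<phi>1 x) (\<phi>1 y)) \<le> emm_dist X x y"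
    using \<phi>(1) unfolding lip_map_def by auto
  obtain E2 where E2: "AE x in emm_measure X. x \<in> E2" "\<And>x y. x \<in> E2 \<Longrightarrow> y \<in> E2 \<Longrightarrow> ennreal (mdist (mm_metric Y2) (\<phi>2 x) (\<phi>2 y)) \<le> emm_dist X x y"
    using \<phi>(2) unfolding lip_map_def by auto
  have "AE x in emm_measure X. x \<in> E1 \<inter> E2" using E1(1) E2(1) by eventually_elim simp
  then have "lip_map X (emm_of_mm Z) ?\<phi>"
    by (rule lip_mapI[rotated 2]) (use mZ dZ E1(2) E2(2) in \<open>auto simp: Z_def max_def\<close>)
  moreover have "lip_map (emm_of_mm Z) (emm_of_mm Y1) fst"
  proof (rule lip_mapI)
    have "continuous_map (mtopology_of ?P) (mtopology_of (mm_metric Y1)) fst"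
      by (rule Lipschitz_continuous_imp_continuous_map) (auto simp: Lipschitz_continuous_map_def intro!: exI[of _ 1])
    then have f: "fst \<in> \<mu> \<rightarrow>\<^sub>M mm_measure Y1"
      by (rule measurable_continuous_map[OF _ s\<mu>]) (use Y in \<open>simp add: mm_space_def\<close>)
    then show "fst \<in> emm_measure (emm_of_mm Z) \<rightarrow>\<^sub>M emm_measure (emm_of_mm Y1)" by (simp add: Z_def)
    have "distr \<mu> (mm_measure Y1) fst = distr (distr (emm_measure X) \<mu> ?\<phi>) (mm_measure Y1) fst" unfolding dZ ..
    also have "\<dots> = distr (emm_measure X) (mm_measure Y1) \<phi>1" using distr_distr[OF f mZ] by (simp add: comp_def)
    finally show "distr (emm_measure (emm_of_mm Z)) (emm_measure (emm_of_mm Y1)) fst = emm_measure (emm_of_mm Y1)"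
      using lip_map_distr[OF \<phi>(1)] by (simp add: Z_def)
  qed (auto simp: Z_def ennreal_leI)
  moreover have "lip_map (emm_of_mm Z) (emm_of_mm Y2) snd"
  proof (rule lip_mapI)
    have "continuous_map (mtopology_of ?P) (mtopology_of (mm_metric Y2)) snd"
      by (rule Lipschitz_continuous_imp_continuous_map) (auto simp: Lipschitz_continuous_map_def intro!: exI[of _ 1])
    then have f: "snd \<in> \<mu> \<rightarrow>\<^sub>M mm_measure Y2"
      by (rule measurable_continuous_map[OF _ s\<mu>]) (use Y in \<open>simp add: mm_space_def\<close>)
    then show "snd \<in> emm_measure (emm_of_mm Z) \<rightarrow>\<^sub>M emm_measure (emm_of_mm Y2)" by (simp add: Z_def)
    have "distr \<mu> (mm_measure Y2) snd = distr (distr (emm_measure X) \<mu> ?\<phi>) (mm_measure Y2) snd" unfolding dZ ..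
    also have "\<dots> = distr (emm_measure X) (mm_measure Y2) \<phi>2" using distr_distr[OF f mZ] by (simp add: comp_def)
    finally show "distr (emm_measure (emm_of_mm Z)) (emm_measure (emm_of_mm Y2)) snd = emm_measure (emm_of_mm Y2)"
      using lip_map_distr[OF \<phi>(2)] by (simp add: Z_def)
  qed (auto simp: Z_def ennreal_leI)
  ultimately show thesis using that[OF Z] by blast
qed

lemma borel_of_euclidean: "borel_of (euclidean :: 'a::topological_space topology) = borel"
  unfolding borel_of_def borel_def by simp

text \<open>The law of \<open>f\<close> on the Euclidean line; \<open>f\<close> itself is recovered
  by pulling back the identity.\<close>

lemma mm_line:
  assumes X: "prob_space (emm_measure X)" and f: "f \<in> lip1 X"
  obtains Y :: "real mm_data" where "mm_space Y" "lip_map X (emm_of_mm Y) f" "(\<lambda>t. t) \<in> lip1 (emm_of_mm Y)"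
proof -
  have fm: "f \<in> borel_measurable (emm_measure X)" by (rule lip1_measurable[OF f])
  define \<mu> where "\<mu> = distr (emm_measure X) borel f"
  define Y where "Y = \<lparr>mm_metric = euclidean_metric, mm_measure = \<mu>\<rparr>"
  have s\<mu>: "sets \<mu> = sets borel" by (simp add: \<mu>_def)
  obtain q :: "nat \<Rightarrow> rat" where q: "surj q" using surj_from_nat by blast
  have "separable_space (mtopology_of (euclidean_metric :: real metric))"
  proof (rule separable_spaceI[of "\<lambda>n. of_rat (q n)"])
    fix x e :: real assume "0 < e"
    then obtain r where "x < of_rat r" "of_rat r < x + e" using of_rat_dense[of x "x + e"] by auto
    moreover obtain i where "q i = r" using q by (metis surjD)
    ultimately show "\<exists>i. mdist euclidean_metric (of_rat (q i)) x < e"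
      by (intro exI[of _ i]) (simp add: dist_real_def)
  qed simp
  moreover have "mcomplete_of (euclidean_metric :: real metric)"
    by (simp add: mcomplete_of_def complete_UNIV)
  ultimately have Y: "mm_space Y"
    using prob_space.prob_space_distr[OF X fm] by (simp add: mm_space_def Y_def borel_of_euclidean \<mu>_def)
  have f\<mu>: "f \<in> emm_measure X \<rightarrow>\<^sub>M \<mu>" using fm measurable_cong_sets[OF refl s\<mu>] by blast
  have d\<mu>: "distr (emm_measure X) \<mu> f = \<mu>" unfolding \<mu>_def by (rule distr_cong) auto
  obtain E where E: "AE x in emm_measure X. x \<in> E" "\<And>x y. x \<in> E \<Longrightarrow> y \<in> E \<Longrightarrow> ennreal \<bar>f x - f y\<bar> \<le> emm_dist X x y"
    using f unfolding lip1_def by blast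
  have "lip_map X (emm_of_mm Y) f"
    by (rule lip_mapI[OF _ _ E(1)]) (use f\<mu> d\<mu> E(2) in \<open>auto simp: Y_def dist_real_def\<close>)
  moreover have "(\<lambda>t. t) \<in> \<mu> \<rightarrow>\<^sub>M borel" by (rule measurable_ident_sets[OF s\<mu>])
  then have "(\<lambda>t. t) \<in> lip1 (emm_of_mm Y)"
    by (auto simp: lip1_def Y_def dist_real_def intro!: exI[of _ UNIV])
  ultimately show thesis using that[OF Y] by blast
qed

text \<open>\<open>Y\<close> is a copy of the image of \<open>X\<close> under the functions in \<open>F\<close>, in a finite-dimensional space
  with the maximum metric.\<close>

lemma mm_finite_factor:
  fixes X :: "'a emm_data"
  assumes X: "prob_space (emm_measure X)" and F: "finite F" "F \<subseteq> lip1 X"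
  shows "\<exists>(Y :: real mm_data) \<phi>. mm_space Y \<and> lip_map X (emm_of_mm Y) \<phi> \<and>
    (\<forall>f\<in>F. \<exists>u\<in>lip1 (emm_of_mm Y). AE x in emm_measure X. f x = u (\<phi> x))"
  using F
proof (induction rule: finite_induct)
  case empty
  then show ?case using mm_line[OF X zero_in_lip1[of X]] by blast
next
  case (insert f F)
  then obtain Y1 :: "real mm_data" and \<phi>1 where Y1: "mm_space Y1" "lip_map X (emm_of_mm Y1) \<phi>1"
    "\<And>g. g\<in>F \<Longrightarrow> \<exists>u\<in>lip1 (emm_of_mm Y1). AE x in emm_measure X. g x = u (\<phi>1 x)" by auto
  have "f \<in> lip1 X" using insert by simp
  then obtain Y2 :: "real mm_data" where Y2: "mm_space Y2" "lip_map X (emm_of_mm Y2) f" "(\<lambda>t. t) \<in> lip1 (emm_of_mm Y2)"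
    by (rule mm_line[OF X])
  obtain Z :: "(real \<times> real) mm_data" where Z: "mm_space Z" "lip_map X (emm_of_mm Z) (\<lambda>x. (\<phi>1 x, f x))"
    "lip_map (emm_of_mm Z) (emm_of_mm Y1) fst" "lip_map (emm_of_mm Z) (emm_of_mm Y2) snd"
    by (rule mm_join[OF X Y1(1) Y2(1) Y1(2) Y2(2)])
  \<comment> \<open>The induction hypothesis speaks of real carriers, so the product is copied back
    to the line. \<open>G\<close> undoes the copying almost everywhere, which keeps the functions
    factored.\<close>
  obtain Y :: "real mm_data" where Y: "mm_space Y" "mm_class Y = mm_class Z" "mm_iso Z Y"
    by (rule mm_space_real_copy[OF Z(1)])
  obtain H G where HG: "iso_pair (emm_of_mm Z) (emm_of_mm Y) H G" by (rule mm_iso_imp_iso_pair[OF Z(1) Y(1,3)])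
  note H = iso_pair_lip_map[OF HG] and G = iso_pair_lip_map[OF iso_pair_sym[OF HG]]
  let ?\<phi> = "H \<circ> (\<lambda>x. (\<phi>1 x, f x))"
  have "AE z in emm_measure (emm_of_mm Z). G (H z) = z" using HG by (simp add: iso_pair_def)
  then have GH: "AE x in emm_measure X. G (H (\<phi>1 x, f x)) = (\<phi>1 x, f x)"
    by (rule AE_distr_self[OF lip_map_measurable[OF Z(2)] lip_map_distr[OF Z(2)]])
  have "\<exists>u\<in>lip1 (emm_of_mm Y). AE x in emm_measure X. g x = u (?\<phi> x)" if "g \<in> insert f F" for g
  proof (cases "g = f")
    case True
    have "AE x in emm_measure X. f x = ((\<lambda>t. t) \<circ> (snd \<circ> G)) (?\<phi> x)" using GH by eventually_elim simp
    then show ?thesis unfolding True using lip1_comp_lip_map[OF lip_map_comp[OF G Z(4)] Y2(3)] by blast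
  next
    case False
    then obtain u where u: "u \<in> lip1 (emm_of_mm Y1)" "AE x in emm_measure X. g x = u (\<phi>1 x)" using Y1(3)[of g] \<open>g \<in> insert f F\<close> by blast
    have "AE x in emm_measure X. g x = (u \<circ> (fst \<circ> G)) (?\<phi> x)" using GH u(2) by eventually_elim simp
    then show ?thesis using lip1_comp_lip_map[OF lip_map_comp[OF G Z(3)] u(1)] by blast
  qed
  then show ?case using Y(1) lip_map_comp[OF Z(2) H] by blast
qed

subsection \<open>The mm-spaces dominated by an emm-space\<close>

lemma mm_class_in_mm_below:
  assumes X: "prob_space (emm_measure X)" and Y: "mm_space Y" "lip_map X (emm_of_mm Y) \<phi>"
  shows "mm_class Y \<in> mm_below X"
proof -
  obtain F G where "iso_pair (emm_of_mm Y) (emm_of_mm (rep (mm_class Y))) F G" by (rule mm_class_rep_iso_pair[OF Y(1)])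
  from lip_map_comp[OF Y(2) iso_pair_lip_map[OF this]]
  show ?thesis using mm_class_rep(1)[OF Y(1)] by (auto simp: mm_below_def emm_prec_iff[OF X])
qed

lemma mm_below_nonempty: "prob_space (emm_measure X) \<Longrightarrow> mm_below X \<noteq> {}"
  using mm_line[OF _ zero_in_lip1] mm_class_in_mm_below by (metis empty_iff)

lemma prob_space_mm: "mm_space Y \<Longrightarrow> prob_space (emm_measure (emm_of_mm Y))"
  by (simp add: mm_space_def)

lemma mm_class_prec_iff:
  assumes "c' \<in> mm_classes"
  shows "mm_class_prec c c' \<longleftrightarrow> (\<exists>\<phi>. lip_map (emm_of_mm (rep c')) (emm_of_mm (rep c)) \<phi>)"
  unfolding mm_class_prec_def by (rule emm_prec_iff[OF prob_space_mm[OF mm_classes_rep[OF assms]]])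

lemma mm_below_iff:
  assumes "prob_space (emm_measure X)"
  shows "c \<in> mm_below X \<longleftrightarrow> c \<in> mm_classes \<and> (\<exists>\<phi>. lip_map X (emm_of_mm (rep c)) \<phi>)"
  by (simp add: mm_below_def emm_prec_iff[OF assms])

lemma mm_below_downward:
  assumes X: "prob_space (emm_measure X)" and c: "c \<in> mm_below X" "c' \<in> mm_classes" "mm_class_prec c' c"
  shows "c' \<in> mm_below X"
proof -
  have "c \<in> mm_classes" using c(1) by (simp add: mm_below_def)
  then show ?thesis using c lip_map_comp unfolding mm_below_iff[OF X] mm_class_prec_iff[OF \<open>c \<in> mm_classes\<close>] by blast
qed

text \<open>The join supplies the common dominator; it stays below \<open>X\<close> because the pair
  of maps is itself 1-Lipschitz.\<close>

lemma mm_below_directed: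
  assumes X: "prob_space (emm_measure X)" and c: "c \<in> mm_below X" "c' \<in> mm_below X"
  shows "\<exists>z\<in>mm_below X. mm_class_prec c z \<and> mm_class_prec c' z"
proof -
  obtain \<phi> \<phi>' where \<phi>: "lip_map X (emm_of_mm (rep c)) \<phi>" "lip_map X (emm_of_mm (rep c')) \<phi>'"
    and cc: "c \<in> mm_classes" "c' \<in> mm_classes" using c by (auto simp: mm_below_iff[OF X])
  obtain Z :: "(real \<times> real) mm_data" where Z: "mm_space Z" "lip_map X (emm_of_mm Z) (\<lambda>x. (\<phi> x, \<phi>' x))"
    "lip_map (emm_of_mm Z) (emm_of_mm (rep c)) fst" "lip_map (emm_of_mm Z) (emm_of_mm (rep c')) snd"
    by (rule mm_join[OF X mm_classes_rep[OF cc(1)] mm_classes_rep[OF cc(2)] \<phi>])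
  obtain F G where "iso_pair (emm_of_mm Z) (emm_of_mm (rep (mm_class Z))) F G" by (rule mm_class_rep_iso_pair[OF Z(1)])
  note G = iso_pair_lip_map[OF iso_pair_sym[OF this]]
  have "mm_class_prec c (mm_class Z)" "mm_class_prec c' (mm_class Z)"
    unfolding mm_class_prec_iff[OF mm_class_rep(1)[OF Z(1)]] using lip_map_comp[OF G Z(3)] lip_map_comp[OF G Z(4)] by blast+
  then show ?thesis using mm_class_in_mm_below[OF X Z(1,2)] by blast
qed

section \<open>Total boundedness and the observable distance\<close>

text \<open>The nets consist of functions rather than classes, so that their members can serve as
  coordinates of a map out of \<open>X\<close>.\<close>

definition lip1_totally_bounded :: "'a emm_data \<Rightarrow> bool" where
  "lip1_totally_bounded X \<longleftrightarrow> (\<forall>e>0. \<exists>F. finite F \<and> F \<subseteq> lip1 X \<and>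
     (\<forall>f\<in>lip1 X. \<exists>g\<in>F. ky_fan_mod (emm_measure X) f g < e))"

lemma lip1_totally_boundedE:
  assumes "lip1_totally_bounded X" "0 < e"
  obtains F where "finite F" "F \<subseteq> lip1 X" "\<forall>f\<in>lip1 X. \<exists>g\<in>F. ky_fan_mod (emm_measure X) f g < e"
proof -
  have "\<exists>F. finite F \<and> F \<subseteq> lip1 X \<and> (\<forall>f\<in>lip1 X. \<exists>g\<in>F. ky_fan_mod (emm_measure X) f g < e)"
    using assms unfolding lip1_totally_bounded_def by (elim allE[of _ e] impE)
  then show thesis using that by (elim exE conjE)
qed

lemma compact_L1_metric_iff:
  assumes X: "prob_space (emm_measure X)"
  shows "compact_space (mtopology_of (L1_metric X)) \<longleftrightarrow> lip1_totally_bounded X"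
proof -
  interpret prob_space "emm_measure X" by fact
  let ?L = "L1_metric X" and ?m = "mod_class (emm_measure X)"
  interpret L: Metric_space "mspace ?L" "mdist ?L" by simp
  note ms = mspace_L1_metric[OF X] and md = mdist_L1_metric[OF X]
  have "compact_space (mtopology_of ?L) \<longleftrightarrow> L.mtotally_bounded (mspace ?L)"
    using mcomplete_L1_metric[OF X] L.compact_space_eq_mcomplete_mtotally_bounded
    by (simp add: mtopology_of_eq mcomplete_of_def)
  also have "\<dots> \<longleftrightarrow> lip1_totally_bounded X"
  proof
    assume tb: "L.mtotally_bounded (mspace ?L)"
    show "lip1_totally_bounded X" unfolding lip1_totally_bounded_def
    proof (intro allI impI)
      fix e :: real assume e: "0 < e"
      obtain K where K: "finite K" "K \<subseteq> mspace ?L" "mspace ?L \<subseteq> (\<Union>x\<in>K. L.mball x e)"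
        using tb e unfolding L.mtotally_bounded_def by (elim allE[of _ e] impE exE conjE) simp_all
      have "K \<subseteq> ?m ` lip1 X" using K(2) unfolding ms .
      from finite_subset_image[OF K(1) this] obtain F where F: "F \<subseteq> lip1 X" "finite F" "K = ?m ` F" by blast
      have "\<exists>g\<in>F. ky_fan_mod (emm_measure X) f g < e" if f: "f \<in> lip1 X" for f
      proof -
        have "?m f \<in> mspace ?L" using f by (simp add: ms)
        from subsetD[OF K(3) this] obtain g where g: "g \<in> F" "?m f \<in> L.mball (?m g) e" unfolding F(3) by auto
        then have "g \<in> lip1 X" using F(1) by blast
        from md[OF this f] g have "ky_fan_mod (emm_measure X) g f < e" by simp
        then show ?thesis using g(1) ky_fan_mod_commute[of f g] by (intro bexI[of _ g]) simp_all
      qed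
      then show "\<exists>F. finite F \<and> F \<subseteq> lip1 X \<and> (\<forall>f\<in>lip1 X. \<exists>g\<in>F. ky_fan_mod (emm_measure X) f g < e)"
        using F by blast
    qed
  next
    assume tb: "lip1_totally_bounded X"
    show "L.mtotally_bounded (mspace ?L)" unfolding L.mtotally_bounded_def
    proof (intro allI impI)
      fix e :: real assume "0 < e"
      then obtain F where F: "finite F" "F \<subseteq> lip1 X" "\<forall>f\<in>lip1 X. \<exists>g\<in>F. ky_fan_mod (emm_measure X) f g < e"
        by (rule lip1_totally_boundedE[OF tb])
      have "\<exists>x\<in>?m ` F. ?m f \<in> L.mball x e" if f: "f \<in> lip1 X" for f
      proof -
        obtain g where g: "g \<in> F" "ky_fan_mod (emm_measure X) f g < e" using F(3) f by blast
        then have gl: "g \<in> lip1 X" using F(2) by blast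
        have "mdist ?L (?m g) (?m f) < e" using md[OF gl f] g(2) ky_fan_mod_commute[of f g] by simp
        moreover have "?m g \<in> mspace ?L" "?m f \<in> mspace ?L" using gl f unfolding ms by blast+
        ultimately have "?m f \<in> L.mball (?m g) e" by simp
        then show ?thesis using g(1) by blast
      qed
      then have "mspace ?L \<subseteq> (\<Union>x\<in>?m ` F. L.mball x e)" unfolding ms by blast
      moreover have "?m ` F \<subseteq> mspace ?L" unfolding ms using F(2) by (rule image_mono)
      ultimately show "\<exists>K. finite K \<and> K \<subseteq> mspace ?L \<and> mspace ?L \<subseteq> (\<Union>x\<in>K. L.mball x e)"
        using F(1) by (intro exI[of _ "?m ` F"] conjI finite_imageI)
    qed
  qed
  finally show ?thesis .
qed

text \<open>Composition with \<open>F\<close> carries a net of \<open>lip1 Y\<close> to a net of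
  \<open>lip1 X\<close>, because \<open>f\<close> agrees a.e. with
  \<open>(f \<circ> G) \<circ> F\<close>.\<close>

lemma lip1_totally_bounded_iso:
  assumes iso: "iso_pair X Y F G" and pX: "prob_space (emm_measure X)" and pY: "prob_space (emm_measure Y)"
    and Y: "lip1_totally_bounded Y"
  shows "lip1_totally_bounded X"
  unfolding lip1_totally_bounded_def
proof (intro allI impI)
  interpret X: prob_space "emm_measure X" by fact
  interpret Y: prob_space "emm_measure Y" by fact
  fix e :: real assume "0 < e"
  then obtain A where A: "finite A" "A \<subseteq> lip1 Y" "\<forall>f\<in>lip1 Y. \<exists>g\<in>A. ky_fan_mod (emm_measure Y) f g < e"
    by (rule lip1_totally_boundedE[OF Y])
  note F = iso_pair_lip_map[OF iso] and G = iso_pair_lip_map[OF iso_pair_sym[OF iso]]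
  have "\<exists>g\<in>(\<lambda>g. g \<circ> F) ` A. ky_fan_mod (emm_measure X) f g < e" if f: "f \<in> lip1 X" for f
  proof -
    have fG: "f \<circ> G \<in> lip1 Y" by (rule lip1_comp_lip_map[OF G f])
    then obtain g where g: "g \<in> A" "ky_fan_mod (emm_measure Y) (f \<circ> G) g < e" using A(3) by blast
    then have gY: "g \<in> lip1 Y" using A(2) by blast
    obtain c where c: "ky_fan (emm_measure Y) (f \<circ> G) (\<lambda>x. g x + c) < e" using Y.ky_fan_mod_less[OF g(2)] by blast
    have gcF: "(\<lambda>x. g x + c) \<circ> F \<in> lip1 X" by (rule lip1_comp_lip_map[OF F lip1_add_const[OF gY]])
    have "AE x in emm_measure X. G (F x) = x" using iso by (simp add: iso_pair_def)
    then have "AE x in emm_measure X. f x = ((f \<circ> G) \<circ> F) x" by eventually_elim simp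
    then have "ky_fan (emm_measure X) f ((\<lambda>x. g x + c) \<circ> F) = ky_fan (emm_measure X) ((f \<circ> G) \<circ> F) ((\<lambda>x. g x + c) \<circ> F)"
      by (intro X.ky_fan_cong_AE lip1_measurable[OF f] lip1_measurable[OF lip1_comp_lip_map[OF F fG]] lip1_measurable[OF gcF]) auto
    also have "\<dots> = ky_fan (emm_measure Y) (f \<circ> G) (\<lambda>x. g x + c)"
      by (rule ky_fan_distr[OF lip_map_measurable[OF F] lip_map_distr[OF F] lip1_measurable[OF fG] lip1_measurable[OF lip1_add_const[OF gY]]])
    finally have "ky_fan (emm_measure X) f (\<lambda>x. (g \<circ> F) x + c) < e" using c by (simp add: comp_def)
    then have "ky_fan_mod (emm_measure X) f (g \<circ> F) < e" using X.ky_fan_mod_le[of f "g \<circ> F" c] by simp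
    then show ?thesis using g(1) by blast
  qed
  moreover have "(\<lambda>g. g \<circ> F) ` A \<subseteq> lip1 X" using A(2) lip1_comp_lip_map[OF F] by blast
  ultimately show "\<exists>A. finite A \<and> A \<subseteq> lip1 X \<and> (\<forall>f\<in>lip1 X. \<exists>g\<in>A. ky_fan_mod (emm_measure X) f g < e)"
    using A(1) by blast
qed

section \<open>Pulled-back Lipschitz functions and the observable distance\<close>

lemma pullback_Lip1_eq:
  assumes X: "prob_space (emm_measure X)"
  shows "pullback_Lip1 \<iota> X = (\<lambda>f. L0_class Leb_I (f \<circ> \<iota>)) ` lip1 X"
proof -
  interpret prob_space "emm_measure X" by fact
  have "f \<in> lip1 X" if "F \<in> Lip1 X" "f \<in> F" for f F
    using that lip1_cong_AE unfolding Lip1_eq[OF X] L0_class_def by auto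
  moreover have "\<exists>F. F \<in> Lip1 X \<and> f \<in> F" if "f \<in> lip1 X" for f
    using that L0_class_self[OF lip1_measurable[OF that]] unfolding Lip1_eq[OF X] by blast
  ultimately show ?thesis unfolding pullback_Lip1_def by blast
qed

text \<open>Every 1-Lipschitz function of \<open>X\<close> is, up to a.e. equality, pulled back from
  \<open>Y\<close>. Hence an observable distance between representatives of classes can be estimated
  on any spaces isomorphic to them.\<close>

lemma pullback_Lip1_iso:
  assumes iso: "iso_pair X Y F G" and pX: "prob_space (emm_measure X)" and pY: "prob_space (emm_measure Y)"
    and \<iota>: "\<iota> \<in> parameters (emm_measure X)"
  shows "F \<circ> \<iota> \<in> parameters (emm_measure Y)" "pullback_Lip1 (F \<circ> \<iota>) Y = pullback_Lip1 \<iota> X"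
proof -
  interpret L: prob_space Leb_I by (rule prob_space_Leb_I)
  note F = iso_pair_lip_map[OF iso] and G = iso_pair_lip_map[OF iso_pair_sym[OF iso]]
  have \<iota>m: "\<iota> \<in> Leb_I \<rightarrow>\<^sub>M emm_measure X" "distr Leb_I (emm_measure X) \<iota> = emm_measure X"
    using \<iota> by (auto simp: parameters_def)
  show "F \<circ> \<iota> \<in> parameters (emm_measure Y)"
    using distr_distr[OF lip_map_measurable[OF F] \<iota>m(1)] \<iota>m lip_map_distr[OF F] lip_map_measurable[OF F]
    by (auto simp: parameters_def)
  have "AE x in emm_measure X. G (F x) = x" using iso by (simp add: iso_pair_def)
  from AE_distr_self[OF \<iota>m this] have GF: "AE s in Leb_I. G (F (\<iota> s)) = \<iota> s" .
  show "pullback_Lip1 (F \<circ> \<iota>) Y = pullback_Lip1 \<iota> X"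
    unfolding pullback_Lip1_eq[OF pX] pullback_Lip1_eq[OF pY]
  proof (intro equalityI image_subsetI)
    fix f assume "f \<in> lip1 Y"
    then show "L0_class Leb_I (f \<circ> (F \<circ> \<iota>)) \<in> (\<lambda>f. L0_class Leb_I (f \<circ> \<iota>)) ` lip1 X"
      using lip1_comp_lip_map[OF F] by (intro image_eqI[of _ _ "f \<circ> F"]) (auto simp: comp_assoc)
  next
    fix f assume f: "f \<in> lip1 X"
    have fG: "f \<circ> G \<in> lip1 Y" by (rule lip1_comp_lip_map[OF G f])
    have "L0_class Leb_I (f \<circ> \<iota>) = L0_class Leb_I ((f \<circ> G) \<circ> (F \<circ> \<iota>))"
    proof (subst L.L0_class_eq_iff)
      show "f \<circ> \<iota> \<in> borel_measurable Leb_I" using lip1_measurable[OF f] \<iota>m by auto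
      show "(f \<circ> G) \<circ> (F \<circ> \<iota>) \<in> borel_measurable Leb_I"
        using lip1_measurable[OF fG] lip_map_measurable[OF F] \<iota>m by (intro measurable_comp[of _ _ "emm_measure Y"]) auto
      show "AE s in Leb_I. (f \<circ> \<iota>) s = ((f \<circ> G) \<circ> (F \<circ> \<iota>)) s" using GF by eventually_elim simp
    qed
    then show "L0_class Leb_I (f \<circ> \<iota>) \<in> (\<lambda>f. L0_class Leb_I (f \<circ> (F \<circ> \<iota>))) ` lip1 Y" using fG by blast
  qed
qed

lemma hausdorff_dist_le:
  assumes "0 \<le> r" "\<forall>a\<in>A. \<exists>b\<in>B. d a b \<le> r" "\<forall>b\<in>B. \<exists>a\<in>A. d a b \<le> r"
  shows "hausdorff_dist d A B \<le> r"
  unfolding hausdorff_dist_def by (rule cInf_lower) (use assms in \<open>auto intro: bdd_belowI[of _ 0]\<close>)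

lemma hausdorff_dist_nonneg:
  assumes "0 \<le> r" "\<forall>a\<in>A. \<exists>b\<in>B. d a b \<le> r" "\<forall>b\<in>B. \<exists>a\<in>A. d a b \<le> r"
  shows "0 \<le> hausdorff_dist d A B"
  unfolding hausdorff_dist_def by (rule cInf_greatest) (use assms in auto)

text \<open>The Ky Fan distance is at most 1, so \<open>hausdorff_dist\<close> takes the infimum of
  a nonempty set; the infimum of the empty set of reals would carry no information.\<close>

lemma pullback_Lip1_bounded:
  fixes X :: "'a emm_data" and Y :: "'b emm_data"
  assumes "prob_space (emm_measure X)" "prob_space (emm_measure Y)"
    "\<iota> \<in> parameters (emm_measure X)" "\<kappa> \<in> parameters (emm_measure Y)"
  shows "0 \<le> hausdorff_dist (L0_dist Leb_I) (pullback_Lip1 \<iota> X) (pullback_Lip1 \<kappa> Y)"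
proof -
  interpret L: prob_space Leb_I by (rule prob_space_Leb_I)
  have ne: "lip1 X \<noteq> {}" "lip1 Y \<noteq> {}" using zero_in_lip1 by blast+
  have "L0_dist Leb_I (L0_class Leb_I (f \<circ> \<iota>)) (L0_class Leb_I (g \<circ> \<kappa>)) \<le> 1" if "f \<in> lip1 X" "g \<in> lip1 Y" for f g
    using that assms L.ky_fan_le_1[of "f \<circ> \<iota>" "g \<circ> \<kappa>"]
    by (subst L.L0_dist_class) (auto simp: parameters_def dest!: lip1_measurable)
  then show ?thesis
    unfolding pullback_Lip1_eq[OF assms(1)] pullback_Lip1_eq[OF assms(2)] using ne
    by (intro hausdorff_dist_nonneg[of 1]) auto
qed

lemma d_conc_nonneg:
  assumes "emm_space X" "emm_space Y" shows "0 \<le> d_conc X Y"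
proof -
  have "parameters (emm_measure X) \<noteq> {}" "parameters (emm_measure Y) \<noteq> {}"
    using parameters_nonempty emm_space_standard emm_space_prob assms by blast+
  then obtain \<iota> \<kappa> where "\<iota> \<in> parameters (emm_measure X)" "\<kappa> \<in> parameters (emm_measure Y)" by blast
  then show ?thesis unfolding d_conc_def
  proof (intro cInf_greatest)
    fix v assume "v \<in> {hausdorff_dist (L0_dist Leb_I) (pullback_Lip1 \<iota> X) (pullback_Lip1 \<kappa> Y) | \<iota> \<kappa>.
            \<iota> \<in> parameters (emm_measure X) \<and> \<kappa> \<in> parameters (emm_measure Y)}"
    then show "0 \<le> v" by (auto intro: pullback_Lip1_bounded emm_space_prob assms)
  qed blast
qed

lemma d_conc_le:
  fixes X :: "'a emm_data" and Y :: "'b emm_data"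
  assumes X: "emm_space X" and Y: "emm_space Y"
    and \<iota>: "\<iota> \<in> parameters (emm_measure X)" and \<kappa>: "\<kappa> \<in> parameters (emm_measure Y)" and r: "0 \<le> r"
    and 1: "\<forall>a\<in>pullback_Lip1 \<iota> X. \<exists>b\<in>pullback_Lip1 \<kappa> Y. L0_dist Leb_I a b \<le> r"
    and 2: "\<forall>b\<in>pullback_Lip1 \<kappa> Y. \<exists>a\<in>pullback_Lip1 \<iota> X. L0_dist Leb_I a b \<le> r"
  shows "d_conc X Y \<le> r"
proof -
  have "d_conc X Y \<le> hausdorff_dist (L0_dist Leb_I) (pullback_Lip1 \<iota> X) (pullback_Lip1 \<kappa> Y)"
    unfolding d_conc_def
  proof (rule cInf_lower)
    show "bdd_below {hausdorff_dist (L0_dist Leb_I) (pullback_Lip1 \<iota> X) (pullback_Lip1 \<kappa> Y) | \<iota> \<kappa>.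
            \<iota> \<in> parameters (emm_measure X) \<and> \<kappa> \<in> parameters (emm_measure Y)}"
      by (rule bdd_belowI[of _ 0]) (auto intro: pullback_Lip1_bounded emm_space_prob X Y)
  qed (use \<iota> \<kappa> in blast)
  also have "\<dots> \<le> r" by (rule hausdorff_dist_le[OF r 1 2])
  finally show ?thesis .
qed

lemma d_conc_iso_le:
  assumes X: "emm_space X" "emm_space X'" "iso_pair X X' F G" and Y: "emm_space Y" "emm_space Y'" "iso_pair Y Y' F' G'"
    and \<iota>: "\<iota> \<in> parameters (emm_measure X)" and \<kappa>: "\<kappa> \<in> parameters (emm_measure Y)" and r: "0 \<le> r"
    and 1: "\<forall>a\<in>pullback_Lip1 \<iota> X. \<exists>b\<in>pullback_Lip1 \<kappa> Y. L0_dist Leb_I a b \<le> r"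
    and 2: "\<forall>b\<in>pullback_Lip1 \<kappa> Y. \<exists>a\<in>pullback_Lip1 \<iota> X. L0_dist Leb_I a b \<le> r"
  shows "d_conc X' Y' \<le> r"
proof -
  note p = emm_space_prob[OF X(1)] emm_space_prob[OF X(2)] emm_space_prob[OF Y(1)] emm_space_prob[OF Y(2)]
  note i = pullback_Lip1_iso[OF X(3) p(1,2) \<iota>] and k = pullback_Lip1_iso[OF Y(3) p(3,4) \<kappa>]
  show ?thesis by (rule d_conc_le[OF X(2) Y(2) i(1) k(1) r]) (use 1 2 in \<open>simp_all add: i(2) k(2)\<close>)
qed

text \<open>\<open>Y\<close> is obtained from a finite net of \<open>lip1 X\<close> modulo constants.\<close>

lemma mm_approximation:
  fixes X :: "'a emm_data"
  assumes X: "emm_space X" and tb: "lip1_totally_bounded X" and \<iota>: "\<iota> \<in> parameters (emm_measure X)" and e: "0 < e"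
  obtains Y :: "real mm_data" and \<kappa> where "mm_space Y" "\<kappa> \<in> parameters (mm_measure Y)"
    "pullback_Lip1 \<kappa> (emm_of_mm Y) \<subseteq> pullback_Lip1 \<iota> X"
    "\<forall>a\<in>pullback_Lip1 \<iota> X. \<exists>b\<in>pullback_Lip1 \<kappa> (emm_of_mm Y). L0_dist Leb_I a b \<le> e"
proof -
  note pX = emm_space_prob[OF X]
  interpret X: prob_space "emm_measure X" by fact
  interpret L: prob_space Leb_I by (rule prob_space_Leb_I)
  obtain A where A: "finite A" "A \<subseteq> lip1 X" "\<forall>f\<in>lip1 X. \<exists>g\<in>A. ky_fan_mod (emm_measure X) f g < e"
    by (rule lip1_totally_boundedE[OF tb e])
  obtain Y :: "real mm_data" and \<phi> where Y: "mm_space Y" and \<phi>: "lip_map X (emm_of_mm Y) \<phi>"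
    and A': "\<forall>f\<in>A. \<exists>u\<in>lip1 (emm_of_mm Y). AE x in emm_measure X. f x = u (\<phi> x)"
    using mm_finite_factor[OF pX A(1,2)] by blast
  note pY = prob_space_mm[OF Y]
  have \<iota>m: "\<iota> \<in> Leb_I \<rightarrow>\<^sub>M emm_measure X" "distr Leb_I (emm_measure X) \<iota> = emm_measure X"
    using \<iota> by (auto simp: parameters_def)
  note \<phi>m = lip_map_measurable[OF \<phi>] lip_map_distr[OF \<phi>]
  \<comment> \<open>Taking the parameter of \<open>X\<close> followed by \<open>\<phi>\<close> makes
    the pulled-back functions of \<open>Y\<close> a subset of those of \<open>X\<close>.\<close>
  show thesis
  proof (rule that[OF Y, of "\<phi> \<circ> \<iota>"])
    show "\<phi> \<circ> \<iota> \<in> parameters (mm_measure Y)"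
      using distr_distr[OF \<phi>m(1) \<iota>m(1)] \<iota>m \<phi>m by (auto simp: parameters_def)
    show "pullback_Lip1 (\<phi> \<circ> \<iota>) (emm_of_mm Y) \<subseteq> pullback_Lip1 \<iota> X"
      unfolding pullback_Lip1_eq[OF pX] pullback_Lip1_eq[OF pY]
    proof (rule image_subsetI)
      fix f assume "f \<in> lip1 (emm_of_mm Y)"
      then show "L0_class Leb_I (f \<circ> (\<phi> \<circ> \<iota>)) \<in> (\<lambda>f. L0_class Leb_I (f \<circ> \<iota>)) ` lip1 X"
        using lip1_comp_lip_map[OF \<phi>] by (intro image_eqI[of _ _ "f \<circ> \<phi>"]) (auto simp: comp_assoc)
    qed
    show "\<forall>a\<in>pullback_Lip1 \<iota> X. \<exists>b\<in>pullback_Lip1 (\<phi> \<circ> \<iota>) (emm_of_mm Y). L0_dist Leb_I a b \<le> e"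
    proof
      fix a assume "a \<in> pullback_Lip1 \<iota> X"
      then obtain f where f: "f \<in> lip1 X" and a: "a = L0_class Leb_I (f \<circ> \<iota>)"
        unfolding pullback_Lip1_eq[OF pX] by blast
      obtain g where g: "g \<in> A" "ky_fan_mod (emm_measure X) f g < e" using A(3) f by blast
      \<comment> \<open>The net is one modulo constants, whereas \<open>pullback_Lip1\<close> is not
        a quotient. The missing constant \<open>c\<close> is added to the factor \<open>u\<close>,
        which stays 1-Lipschitz.\<close>
      obtain c where c: "ky_fan (emm_measure X) f (\<lambda>x. g x + c) < e" using X.ky_fan_mod_less[OF g(2)] by blast
      obtain u where u: "u \<in> lip1 (emm_of_mm Y)" "AE x in emm_measure X. g x = u (\<phi> x)" using A' g(1) by blast
      have gl: "g \<in> lip1 X" using g(1) A(2) by blast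
      note uc = lip1_add_const[OF u(1), of c]
      note ucX = lip1_comp_lip_map[OF \<phi> uc]
      have "L0_dist Leb_I (L0_class Leb_I (f \<circ> \<iota>)) (L0_class Leb_I ((\<lambda>x. u x + c) \<circ> (\<phi> \<circ> \<iota>)))
          = ky_fan Leb_I (f \<circ> \<iota>) (((\<lambda>x. u x + c) \<circ> \<phi>) \<circ> \<iota>)"
        unfolding comp_assoc[symmetric] using lip1_measurable[OF f] lip1_measurable[OF ucX] \<iota>m(1)
        by (intro L.L0_dist_class) (auto intro: measurable_comp)
      also have "\<dots> = ky_fan (emm_measure X) f ((\<lambda>x. u x + c) \<circ> \<phi>)"
        by (rule ky_fan_distr[OF \<iota>m lip1_measurable[OF f] lip1_measurable[OF ucX]])
      also have "\<dots> = ky_fan (emm_measure X) f (\<lambda>x. g x + c)"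
      proof (rule X.ky_fan_cong_AE)
        show "AE x in emm_measure X. ((\<lambda>x. u x + c) \<circ> \<phi>) x = g x + c" using u(2) by eventually_elim simp
      qed (use lip1_measurable[OF f] lip1_measurable[OF ucX] lip1_measurable[OF gl] in auto)
      finally have "L0_dist Leb_I a (L0_class Leb_I ((\<lambda>x. u x + c) \<circ> (\<phi> \<circ> \<iota>))) \<le> e" using c a by simp
      then show "\<exists>b\<in>pullback_Lip1 (\<phi> \<circ> \<iota>) (emm_of_mm Y). L0_dist Leb_I a b \<le> e"
        unfolding pullback_Lip1_eq[OF pY] using uc by blast
    qed
  qed
qed

lemma L0_dist_self: "(L0_dist Leb_I) a a = 0"
proof -
  interpret L: prob_space Leb_I by (rule prob_space_Leb_I)
  have "ky_fan Leb_I f f \<le> 0 + e" if "0 < e" for f e using that by (intro L.ky_fan_le) auto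
  then have "ky_fan Leb_I f f \<le> 0" for f by (rule field_le_epsilon)
  then show ?thesis unfolding L0_dist_def using L.ky_fan_nonneg by (metis antisym)
qed

text \<open>For compact \<open>L1_metric X\<close>, one parameter \<open>\<iota>\<close> is fixed
  for all approximations. Their pulled-back sets lie in that of \<open>X\<close> and are dense in it
  up to \<open>?e n\<close>, which bounds the distances among them and to \<open>X\<close>
  alike.\<close>

lemma conc_completion_iff:
  fixes X :: "'a emm_data"
  assumes X: "emm_space X"
  shows "compact_space (mtopology_of (L1_metric X)) \<longleftrightarrow> emm_class X \<in> conc_completion"
proof
  assume "emm_class X \<in> conc_completion"
  \<comment> \<open>A point of the completion is identified with a class in
    \<open>conc_classes\<close>. Compactness passes from a concentrated member to \<open>X\<close>
    by total boundedness, which is invariant under isomorphism.\<close>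
  then have "emm_class X \<in> conc_classes" by (auto simp: conc_completion_def conc_identified_def)
  then obtain Z :: "real emm_data" where Z: "emm_space Z" "concentrated Z" "emm_class X = emm_class Z"
    by (auto simp: conc_classes_def)
  obtain F G where R: "emm_space (rep (emm_class X))" and XR: "iso_pair X (rep (emm_class X)) F G"
    by (rule emm_class_rep_iso_pair[OF X])
  obtain F' G' where ZR: "iso_pair Z (rep (emm_class X)) F' G'"
    using emm_class_rep_iso_pair[OF Z(1)] Z(3) by metis
  have "lip1_totally_bounded Z" using Z(2) compact_L1_metric_iff[OF emm_space_prob[OF Z(1)]] by (simp add: concentrated_def)
  then have "lip1_totally_bounded X"
    by (rule lip1_totally_bounded_iso[OF iso_pair_trans[OF XR iso_pair_sym[OF ZR]] emm_space_prob[OF X] emm_space_prob[OF Z(1)]])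
  then show "compact_space (mtopology_of (L1_metric X))" using compact_L1_metric_iff[OF emm_space_prob[OF X]] by simp
next
  assume "compact_space (mtopology_of (L1_metric X))"
  then have tb: "lip1_totally_bounded X" using compact_L1_metric_iff[OF emm_space_prob[OF X]] by simp
  let ?e = "\<lambda>n. inverse (real (Suc n))"
  obtain \<iota> where \<iota>: "\<iota> \<in> parameters (emm_measure X)"
    using parameters_nonempty[OF emm_space_standard[OF X] emm_space_prob[OF X]] by blast
  have "\<exists>(Y :: real mm_data) \<kappa>. mm_space Y \<and> \<kappa> \<in> parameters (mm_measure Y) \<and>
    pullback_Lip1 \<kappa> (emm_of_mm Y) \<subseteq> pullback_Lip1 \<iota> X \<and>
    (\<forall>a\<in>pullback_Lip1 \<iota> X. \<exists>b\<in>pullback_Lip1 \<kappa> (emm_of_mm Y). L0_dist Leb_I a b \<le> ?e n)" for n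
    using mm_approximation[OF X tb \<iota>, of "?e n"] by (metis inverse_positive_iff_positive of_nat_0_less_iff zero_less_Suc)
  then obtain Y :: "nat \<Rightarrow> real mm_data" and \<kappa> where Y: "\<And>n. mm_space (Y n)" "\<And>n. \<kappa> n \<in> parameters (mm_measure (Y n))"
    "\<And>n. pullback_Lip1 (\<kappa> n) (emm_of_mm (Y n)) \<subseteq> pullback_Lip1 \<iota> X"
    "\<And>n. \<forall>a\<in>pullback_Lip1 \<iota> X. \<exists>b\<in>pullback_Lip1 (\<kappa> n) (emm_of_mm (Y n)). L0_dist Leb_I a b \<le> ?e n" by metis
  define s where "s n = mm_class (Y n)" for n
  have sc: "s n \<in> mm_classes" for n unfolding s_def by (rule mm_class_rep(1)[OF Y(1)])
  note eY = emm_space_emm_of_mm[OF Y(1)] and eR = emm_space_emm_of_mm[OF mm_classes_rep[OF sc]]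
  have \<kappa>: "\<kappa> n \<in> parameters (emm_measure (emm_of_mm (Y n)))" for n using Y(2) by simp
  have "\<exists>F G. iso_pair (emm_of_mm (Y n)) (emm_of_mm (rep (s n))) F G" for n
    using mm_class_rep_iso_pair[OF Y(1)] unfolding s_def by metis
  then obtain F G where FG: "\<And>n. iso_pair (emm_of_mm (Y n)) (emm_of_mm (rep (s n))) (F n) (G n)" by metis
  have comm: "L0_dist Leb_I a b = L0_dist Leb_I b a" for a b
    unfolding L0_dist_def by (rule prob_space.ky_fan_commute[OF prob_space_Leb_I])
  have dd: "mm_class_conc (s m) (s n) \<le> max (?e m) (?e n)" for m n
    unfolding mm_class_conc_def
  proof (rule d_conc_iso_le[OF eY eR FG eY eR FG \<kappa> \<kappa>])
    show "\<forall>a\<in>pullback_Lip1 (\<kappa> m) (emm_of_mm (Y m)). \<exists>b\<in>pullback_Lip1 (\<kappa> n) (emm_of_mm (Y n)). L0_dist Leb_I a b \<le> max (?e m) (?e n)"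
      using Y(3)[of m] Y(4)[of n] by (meson max.coboundedI2 subsetD)
    show "\<forall>b\<in>pullback_Lip1 (\<kappa> n) (emm_of_mm (Y n)). \<exists>a\<in>pullback_Lip1 (\<kappa> m) (emm_of_mm (Y m)). L0_dist Leb_I a b \<le> max (?e m) (?e n)"
      using Y(3)[of n] Y(4)[of m] comm by (metis max.coboundedI1 subsetD)
  qed (simp add: le_max_iff_disj)
  have "s \<in> cauchy_seqs mm_classes mm_class_conc"
    unfolding cauchy_seqs_def
  proof (intro CollectI conjI allI impI)
    show "range s \<subseteq> mm_classes" using sc by blast
    fix e :: real assume "0 < e"
    then obtain N where N: "?e N < e" using reals_Archimedean by blast
    have "mm_class_conc (s m) (s n) < e" if "m \<ge> N" "n \<ge> N" for m n
    proof -
      have "?e m \<le> ?e N" "?e n \<le> ?e N" using that by simp_all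
      then show ?thesis using dd[of m n] N by linarith
    qed
    then show "\<exists>N. \<forall>m\<ge>N. \<forall>n\<ge>N. mm_class_conc (s m) (s n) < e" by blast
  qed
  \<comment> \<open>Vanishing self-distances put \<open>s\<close> into its own equivalence class,
    and this class is the point of the completion.\<close>
  moreover have "mm_class_conc (s n) (s n) = 0" for n
  proof (rule antisym)
    show "mm_class_conc (s n) (s n) \<le> 0" unfolding mm_class_conc_def
      by (rule d_conc_iso_le[OF eY eR FG eY eR FG \<kappa> \<kappa>]) (auto intro!: bexI eq_refl[OF L0_dist_self])
    show "0 \<le> mm_class_conc (s n) (s n)" unfolding mm_class_conc_def by (rule d_conc_nonneg[OF eR eR])
  qed
  ultimately have in_class: "s \<in> {(s, t). s \<in> cauchy_seqs mm_classes mm_class_conc \<and> t \<in> cauchy_seqs mm_classes mm_class_conc \<and>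
                                 (\<lambda>n. mm_class_conc (s n) (t n)) \<longlonglongrightarrow> 0} `` {s}" (is "s \<in> ?\<xi>")
    and s: "s \<in> cauchy_seqs mm_classes mm_class_conc" by auto
  have \<xi>: "?\<xi> \<in> cauchy_completion mm_classes mm_class_conc"
    unfolding cauchy_completion_def by (rule quotientI[OF s])
  obtain H K where R: "emm_space (rep (emm_class X))" and XR: "iso_pair X (rep (emm_class X)) H K"
    by (rule emm_class_rep_iso_pair[OF X])
  have dX: "emm_class_conc (emm_of_mm_class (s n)) (emm_class X) \<in> {0..?e n}" for n
  proof -
    obtain H' K' where R': "emm_space (rep (emm_of_mm_class (s n)))" "iso_pair (emm_of_mm (rep (s n))) (rep (emm_of_mm_class (s n))) H' K'"
      unfolding emm_of_mm_class_def by (rule emm_class_rep_iso_pair[OF eR])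
    have "emm_class_conc (emm_of_mm_class (s n)) (emm_class X) \<le> ?e n"
      unfolding emm_class_conc_def
    proof (rule d_conc_iso_le[OF eY R'(1) iso_pair_trans[OF FG R'(2)] X R XR \<kappa> \<iota>])
      show "\<forall>a\<in>pullback_Lip1 (\<kappa> n) (emm_of_mm (Y n)). \<exists>b\<in>pullback_Lip1 \<iota> X. L0_dist Leb_I a b \<le> ?e n"
        using Y(3)[of n] L0_dist_self by (metis inverse_nonnegative_iff_nonnegative of_nat_0_le_iff subsetD)
      show "\<forall>b\<in>pullback_Lip1 \<iota> X. \<exists>a\<in>pullback_Lip1 (\<kappa> n) (emm_of_mm (Y n)). L0_dist Leb_I a b \<le> ?e n"
        using Y(4)[of n] comm by metis
    qed simp
    then show ?thesis using d_conc_nonneg[OF R'(1) R] by (simp add: emm_class_conc_def)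
  qed
  have "(\<lambda>n. emm_class_conc (emm_of_mm_class (s n)) (emm_class X)) \<longlonglongrightarrow> 0"
    by (rule tendsto_sandwich[OF _ _ tendsto_const LIMSEQ_inverse_real_of_nat]; intro always_eventually allI)
      (use dX in auto)
  moreover have "emm_class X \<in> conc_classes"
  proof -
    obtain Z :: "real emm_data" and F G where Z: "emm_space Z" "emm_class Z = emm_class X" "iso_pair X Z F G"
      by (rule emm_space_real_copy[OF X])
    have "lip1_totally_bounded Z"
      by (rule lip1_totally_bounded_iso[OF iso_pair_sym[OF Z(3)] emm_space_prob[OF Z(1)] emm_space_prob[OF X] tb])
    then have "concentrated Z" using compact_L1_metric_iff[OF emm_space_prob[OF Z(1)]] by (simp add: concentrated_def)
    then show ?thesis unfolding conc_classes_def using Z(1,2) by blast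
  qed
  ultimately have "conc_identified ?\<xi> (emm_class X)"
    unfolding conc_identified_def using in_class by blast
  then show "emm_class X \<in> conc_completion" unfolding conc_completion_def using \<xi> by blast
qed

section \<open>Limits in law of dominated mm-spaces\<close>

context prob_space
begin

lemma tail_small:
  assumes [measurable]: "g \<in> borel_measurable M" and e: "0 < (e :: real)"
  obtains R :: real where "measure M {x \<in> space M. \<bar>g x\<bar> > R} < e"
proof -
  let ?A = "\<lambda>n::nat. {x \<in> space M. \<bar>g x\<bar> > real n}"
  have "(\<lambda>n. measure M (?A n)) \<longlonglongrightarrow> measure M (\<Inter>n. ?A n)"
    by (rule finite_Lim_measure_decseq) (auto simp: decseq_def)
  moreover have "(\<Inter>n. ?A n) = {}"
  proof -
    have "\<exists>n::nat. \<not> \<bar>g x\<bar> > real n" for x using real_arch_simple[of "\<bar>g x\<bar>"] by (metis not_less)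
    then show ?thesis by blast
  qed
  ultimately have "(\<lambda>n. measure M (?A n)) \<longlonglongrightarrow> 0" by simp
  from order_tendstoD(2)[OF this e] obtain n where "measure M (?A n) < e" by (auto simp: eventually_sequentially)
  then show thesis by (rule that)
qed

text \<open>Convergence modulo constants becomes convergence along a subsequence when the functions are
  tight, since the constants are then bounded.\<close>

lemma AE_convergent_subsequence_of_tight:
  fixes f :: "nat \<Rightarrow> 'a \<Rightarrow> real"
  assumes f [measurable]: "\<And>n. f n \<in> borel_measurable M" and g [measurable]: "g \<in> borel_measurable M"
    and lim: "AE x in M. (\<lambda>n. f n x + c n) \<longlonglongrightarrow> g x"
    and tight: "\<And>n. measure M {x \<in> space M. \<bar>f n x\<bar> > R} \<le> 3/8"
  obtains r G where "strict_mono (r :: nat \<Rightarrow> nat)" "G \<in> borel_measurable M" "AE x in M. (\<lambda>n. f (r n) x) \<longlonglongrightarrow> G x"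
proof -
  have fc: "(\<lambda>x. f n x + c n) \<in> borel_measurable M" for n by simp
  obtain R' where R': "measure M {x \<in> space M. \<bar>g x\<bar> > R'} < 1/8" using tail_small[OF g, of "1/8"] by auto
  have "\<forall>\<^sub>F n in sequentially. ky_fan M (\<lambda>x. f n x + c n) g < 1/8"
    by (rule order_tendstoD(2)[OF ky_fan_tendsto_0[OF fc g lim]]) simp
  then obtain N where N: "\<And>n. n \<ge> N \<Longrightarrow> ky_fan M (\<lambda>x. f n x + c n) g < 1/8"
    unfolding eventually_sequentially by blast
  \<comment> \<open>Otherwise three sets of measure at most 3/8, 1/8 and 1/8 would cover the
    space.\<close>
  have cb: "\<bar>c n\<bar> \<le> R + R' + 1/8" if n: "n \<ge> N" for n
  proof (rule ccontr)
    assume far: "\<not> \<bar>c n\<bar> \<le> R + R' + 1/8"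
    let ?A = "{x \<in> space M. \<bar>f n x\<bar> > R}" and ?B = "{x \<in> space M. \<bar>f n x + c n - g x\<bar> > 1/8}" and ?C = "{x \<in> space M. \<bar>g x\<bar> > R'}"
    have "1/8 < \<bar>f n x + c n - g x\<bar>" if "\<bar>f n x\<bar> \<le> R" "\<bar>g x\<bar> \<le> R'" for x
      using far that by linarith
    then have "space M = ?A \<union> (?B \<union> ?C)" by (auto simp: not_less)
    then have "1 = measure M (?A \<union> (?B \<union> ?C))" using prob_space by simp
    also have "\<dots> \<le> measure M ?A + measure M (?B \<union> ?C)" by (intro measure_Un_le) auto
    also have "measure M (?B \<union> ?C) \<le> measure M ?B + measure M ?C" by (intro measure_Un_le) auto
    also have "measure M ?B < 1/8" using ky_fan_less[OF N[OF n] fc g] .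
    finally show False using tight[of n] R' by simp
  qed
  then have "bounded (range (\<lambda>n. c (n + N)))" by (intro boundedI[of _ "R + R' + 1/8"]) auto
  then obtain l s where s: "strict_mono (s :: nat \<Rightarrow> nat)" "((\<lambda>n. c (n + N)) \<circ> s) \<longlonglongrightarrow> l"
    using bounded_imp_convergent_subsequence by blast
  let ?r = "\<lambda>n. s n + N"
  have r: "strict_mono ?r" using s(1) by (auto simp: strict_mono_def)
  show thesis
  proof (rule that[OF r])
    show "(\<lambda>x. g x - l) \<in> borel_measurable M" by simp
    show "AE x in M. (\<lambda>n. f (?r n) x) \<longlonglongrightarrow> g x - l"
      using lim
    proof eventually_elim
      case (elim x)
      have "(\<lambda>n. f (?r n) x + c (?r n)) \<longlonglongrightarrow> g x" using LIMSEQ_subseq_LIMSEQ[OF elim r] by (simp add: comp_def)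
      moreover have "(\<lambda>n. c (?r n)) \<longlonglongrightarrow> l" using s(2) by (simp add: comp_def)
      ultimately have "(\<lambda>n. (f (?r n) x + c (?r n)) - c (?r n)) \<longlonglongrightarrow> g x - l" by (rule tendsto_diff)
      then show ?case by simp
    qed
  qed
qed

end

text \<open>Compactness of \<open>L1_metric X\<close> gives a subsequence that converges modulo
  constants; a fast one among its subsequences converges a.e. after constants are added, and
  tightness removes these again.\<close>

lemma lip1_subsequence:
  assumes X: "prob_space (emm_measure X)" and tb: "lip1_totally_bounded X" and f: "\<And>n. f n \<in> lip1 X"
    and tight: "\<And>n. measure (emm_measure X) {x \<in> space (emm_measure X). \<bar>f n x\<bar> > R} \<le> 3/8"
  obtains r G where "strict_mono (r :: nat \<Rightarrow> nat)" "G \<in> borel_measurable (emm_measure X)"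
    "AE x in emm_measure X. (\<lambda>n. f (r n) x) \<longlonglongrightarrow> G x"
proof -
  interpret prob_space "emm_measure X" by fact
  let ?L = "L1_metric X" and ?m = "mod_class (emm_measure X)"
  interpret L: Metric_space "mspace ?L" "mdist ?L" by simp
  note ms = mspace_L1_metric[OF X] and md = mdist_L1_metric[OF X]
  have c: "compact_space L.mtopology" using compact_L1_metric_iff[OF X] tb by (simp add: mtopology_of_eq)
  have "range (\<lambda>n. ?m (f n)) \<subseteq> mspace ?L" unfolding ms using f by blast
  then obtain l s where s: "strict_mono (s :: nat \<Rightarrow> nat)" "limitin L.mtopology ((\<lambda>n. ?m (f n)) \<circ> s) l sequentially"
    using c unfolding L.compact_space_sequentially by blast
  have "L.MCauchy ((\<lambda>n. ?m (f n)) \<circ> s)"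
  proof (rule L.convergent_imp_MCauchy[OF _ s(2)])
    show "range ((\<lambda>n. ?m (f n)) \<circ> s) \<subseteq> mspace ?L" unfolding ms using f by auto
  qed
  then obtain t where t: "strict_mono (t :: nat \<Rightarrow> nat)"
    "\<And>n. mdist ?L (((\<lambda>n. ?m (f n)) \<circ> s) (t n)) (((\<lambda>n. ?m (f n)) \<circ> s) (t (Suc n))) < (1/2)^n"
    by (rule L.MCauchy_fast_subsequence) blast
  have fast: "ky_fan_mod (emm_measure X) (f (s (t n))) (f (s (t (Suc n)))) < (1/2)^n" for n
    using t(2)[of n] md[OF f f, of "s (t n)" "s (t (Suc n))"] by simp
  obtain c g where g: "g \<in> borel_measurable (emm_measure X)" "AE x in emm_measure X. (\<lambda>n. f (s (t n)) x + c n) \<longlonglongrightarrow> g x"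
    by (rule ky_fan_mod_fast_AE_convergent[OF lip1_measurable[OF f] fast])
  obtain r G where r: "strict_mono (r :: nat \<Rightarrow> nat)" "G \<in> borel_measurable (emm_measure X)"
    "AE x in emm_measure X. (\<lambda>n. f (s (t (r n))) x) \<longlonglongrightarrow> G x"
    by (rule AE_convergent_subsequence_of_tight[OF lip1_measurable[OF f] g tight])
  show thesis
  proof (rule that[of "\<lambda>n. s (t (r n))", OF _ r(2,3)])
    show "strict_mono (\<lambda>n. s (t (r n)))" using s(1) t(1) r(1) by (auto simp: strict_mono_def)
  qed
qed

subsection \<open>Realizing a limit law\<close>

text \<open>Lower sets with finitely many constraints, an intersection-stable generator of the
  product sigma-algebra on sequences. Laws are therefore determined by their finite-dimensional
  distribution functions.\<close>

definition half_spaces :: "(nat \<Rightarrow> real) set set" where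
  "half_spaces = {{z. \<forall>i\<in>I. z i \<le> a i} |I a. finite I}"

lemma half_spacesI: "finite I \<Longrightarrow> {z. \<forall>i\<in>I. z i \<le> a i} \<in> half_spaces"
  unfolding half_spaces_def by (intro CollectI exI[of _ I] exI[of _ a]) simp

lemma Int_stable_half_spaces: "Int_stable half_spaces"
proof (rule Int_stableI)
  fix A B assume "A \<in> half_spaces" "B \<in> half_spaces"
  then obtain I a J b where *: "finite I" "A = {z. \<forall>i\<in>I. z i \<le> a i}" "finite J" "B = {z. \<forall>i\<in>J. z i \<le> b i}"
    by (auto simp: half_spaces_def)
  have "A \<inter> B = {z. \<forall>i\<in>I \<union> J. z i \<le> (if i \<in> I \<and> i \<in> J then min (a i) (b i) else if i \<in> I then a i else b i)}"
    unfolding * by auto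
  then show "A \<inter> B \<in> half_spaces" using half_spacesI[of "I \<union> J"] *(1,3) by simp
qed

lemma half_spaces_measurable:
  assumes "\<And>k. (\<lambda>x. \<Gamma> x k) \<in> borel_measurable M"
  shows "\<Gamma> \<in> M \<rightarrow>\<^sub>M sigma UNIV half_spaces"
proof (rule measurable_measure_of)
  fix A assume "A \<in> half_spaces"
  then obtain I a where *: "finite I" "A = {z. \<forall>i\<in>I. z i \<le> a i}" by (auto simp: half_spaces_def)
  have "\<Gamma> -` A \<inter> space M = {x \<in> space M. \<forall>i\<in>I. \<Gamma> x i \<le> a i}" unfolding * by auto
  also have "\<dots> \<in> sets M"
    by (rule sets.sets_Collect_finite_All[OF _ *(1)]) (rule borel_measurable_le[OF assms borel_measurable_const])
  finally show "\<Gamma> -` A \<inter> space M \<in> sets M" .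
qed auto

lemma half_spaces_coordinate: "(\<lambda>z. z k) \<in> borel_measurable (sigma UNIV half_spaces)"
  unfolding borel_measurable_iff_le
proof
  fix c
  have "{z. \<forall>i\<in>{k}. z i \<le> c} \<in> half_spaces" by (rule half_spacesI) simp
  then have "{z. z k \<le> c} \<in> half_spaces" by simp
  then show "{w \<in> space (sigma UNIV half_spaces). w k \<le> c} \<in> sets (sigma UNIV half_spaces)"
    by (simp add: space_measure_of_conv sets_measure_of sigma_sets.Basic)
qed

text \<open>Uniqueness of measures on an intersection-stable generator; the exhausting sequence is
  the constant one, since the whole space is the half-space without constraints.\<close>

lemma distr_eq_half_spaces:
  assumes M: "prob_space M" "prob_space N"
    and m: "\<And>k. (\<lambda>x. \<Gamma> x k) \<in> borel_measurable M" "\<And>k. (\<lambda>x. \<Delta> x k) \<in> borel_measurable N"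
    and law: "\<And>I a. finite I \<Longrightarrow> measure M {x \<in> space M. \<forall>i\<in>I. \<Gamma> x i \<le> a i} = measure N {x \<in> space N. \<forall>i\<in>I. \<Delta> x i \<le> a i}"
  shows "distr M (sigma UNIV half_spaces) \<Gamma> = distr N (sigma UNIV half_spaces) \<Delta>"
proof (rule measure_eqI_generator_eq[OF Int_stable_half_spaces, of UNIV])
  interpret M: prob_space M by fact
  interpret N: prob_space N by fact
  note \<Gamma> = half_spaces_measurable[OF m(1)] and \<Delta> = half_spaces_measurable[OF m(2)]
  fix A assume A: "A \<in> half_spaces"
  then have As: "A \<in> sets (sigma UNIV half_spaces)" by (simp add: sets_measure_of sigma_sets.Basic)
  obtain I a where *: "finite I" "A = {z. \<forall>i\<in>I. z i \<le> a i}" using A by (auto simp: half_spaces_def)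
  have "\<Gamma> -` A \<inter> space M = {x \<in> space M. \<forall>i\<in>I. \<Gamma> x i \<le> a i}" "\<Delta> -` A \<inter> space N = {x \<in> space N. \<forall>i\<in>I. \<Delta> x i \<le> a i}"
    unfolding * by auto
  then show "emeasure (distr M (sigma UNIV half_spaces) \<Gamma>) A = emeasure (distr N (sigma UNIV half_spaces) \<Delta>) A"
    using law[OF *(1), of a] by (simp add: emeasure_distr[OF \<Gamma> As] emeasure_distr[OF \<Delta> As] M.emeasure_eq_measure N.emeasure_eq_measure)
next
  interpret M: prob_space M by fact
  show "range (\<lambda>_::nat. UNIV) \<subseteq> half_spaces" using half_spacesI[of "{}"] by simp
  interpret D: prob_space "distr M (sigma UNIV half_spaces) \<Gamma>"
    by (rule M.prob_space_distr[OF half_spaces_measurable[OF m(1)]])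
  show "emeasure (distr M (sigma UNIV half_spaces) \<Gamma>) UNIV \<noteq> \<infinity>" by (simp add: D.emeasure_eq_measure)
qed auto

text \<open>The conditions on \<open>z\<close> are countably many, which makes the image and the inverse of the
  Kuratowski embedding measurable.\<close>

lemma kuratowski_image:
  assumes Y: "mcomplete_of M" and a: "range a \<subseteq> mspace M"
    and z: "\<And>i k. \<bar>z k - mdist M (a k) (a i)\<bar> \<le> z i" "\<And>m::nat. \<exists>i. z i < inverse (real (Suc m))"
  obtains y where "y \<in> mspace M" "\<forall>k. mdist M (a k) y = z k"
proof -
  interpret Metric_space "mspace M" "mdist M" by simp
  have aM: "a k \<in> mspace M" for k using a by auto
  \<comment> \<open>Indices whose prescribed distance to the point sought tends to 0. The condition
    on \<open>z\<close> bounds the distance of \<open>a i\<close> and \<open>a k\<close> by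
    \<open>z i + z k\<close>, so the selected points form a Cauchy sequence.\<close>
  obtain i where i: "\<And>m. z (i m) < inverse (real (Suc m))" using z(2) by metis
  have i0: "(\<lambda>m. z (i m)) \<longlonglongrightarrow> 0"
  proof (rule tendsto_sandwich[OF _ _ tendsto_const LIMSEQ_inverse_real_of_nat]; intro always_eventually allI)
    show "0 \<le> z (i m)" for m using z(1)[of "i m" "i m"] by linarith
    show "z (i m) \<le> inverse (real (Suc m))" for m using i[of m] by simp
  qed
  have "MCauchy (\<lambda>m. a (i m))" unfolding MCauchy_def
  proof (intro conjI allI impI)
    show "range (\<lambda>m. a (i m)) \<subseteq> mspace M" using aM by blast
    fix e :: real assume "0 < e"
    then obtain n0 where n0: "\<And>m. m \<ge> n0 \<Longrightarrow> z (i m) < e/2"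
      using order_tendstoD(2)[OF i0, of "e/2"] by (auto simp: eventually_sequentially)
    have "mdist M (a (i m)) (a (i l)) < e" if "n0 \<le> m" "n0 \<le> l" for m l
      using z(1)[of "i m" "i l"] n0[OF that(1)] n0[OF that(2)] z(1)[of "i l" "i m"] by linarith
    then show "\<exists>n0. \<forall>m l. n0 \<le> m \<longrightarrow> n0 \<le> l \<longrightarrow> mdist M (a (i m)) (a (i l)) < e" by blast
  qed
  then obtain y where "limitin mtopology (\<lambda>m. a (i m)) y sequentially"
    using Y unfolding mcomplete_of_def mcomplete_def by blast
  then have y: "y \<in> mspace M" "(\<lambda>m. mdist M (a (i m)) y) \<longlonglongrightarrow> 0" by (auto simp: limitin_metric_dist_null)
  have "mdist M (a k) y = z k" for k
  proof -
    have "\<bar>mdist M (a k) y - z k\<bar> \<le> mdist M (a (i m)) y + z (i m)" for m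
    proof -
      have "mdist M (a k) y \<le> mdist M (a k) (a (i m)) + mdist M (a (i m)) y" by (intro mdist_triangle aM y)
      moreover have "mdist M (a k) (a (i m)) \<le> mdist M (a k) y + mdist M y (a (i m))" by (intro mdist_triangle aM y)
      ultimately show ?thesis using z(1)[of k "i m"] unfolding mdist_commute[of M y "a (i m)"] by linarith
    qed
    moreover have "(\<lambda>m. mdist M (a (i m)) y + z (i m)) \<longlonglongrightarrow> 0 + 0" by (intro tendsto_add y i0)
    ultimately have "\<bar>mdist M (a k) y - z k\<bar> \<le> 0" by (intro LIMSEQ_le_const[where X="\<lambda>m. mdist M (a (i m)) y + z (i m)"]) auto
    then show ?thesis by simp
  qed
  then show thesis using that y(1) by blast
qed

text \<open>Equality of laws puts the sequence of values \<open>G k x\<close> a.e. into the image of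
  the Kuratowski embedding of \<open>Y\<close>, whose inverse \<open>j\<close> then defines the map.
  It is 1-Lipschitz because all its coordinates are and because the coordinates determine the
  distance of \<open>Y\<close>.\<close>

lemma lip_map_of_law:
  fixes X :: "'a emm_data" and Y :: "'b mm_data" and a :: "nat \<Rightarrow> 'b"
  assumes X: "prob_space (emm_measure X)" and Y: "mm_space Y"
    and a: "range a \<subseteq> mspace (mm_metric Y)"
    and dense: "\<And>y e. y \<in> mspace (mm_metric Y) \<Longrightarrow> 0 < e \<Longrightarrow> \<exists>i. mdist (mm_metric Y) (a i) y < e"
    and G: "\<And>k. G k \<in> lip1 X"
    and law: "\<And>I c. finite I \<Longrightarrow> measure (emm_measure X) {x \<in> space (emm_measure X). \<forall>i\<in>I. G i x \<le> c i}
        = measure (mm_measure Y) {y \<in> space (mm_measure Y). \<forall>i\<in>I. mdist (mm_metric Y) (a i) y \<le> c i}"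
  obtains \<psi> where "lip_map X (emm_of_mm Y) \<psi>"
proof -
  let ?d = "mdist (mm_metric Y)" and ?M = "mspace (mm_metric Y)"
  interpret X: prob_space "emm_measure X" by fact
  interpret Y: Metric_space ?M ?d by simp
  have pY: "prob_space (mm_measure Y)" and cY: "mcomplete_of (mm_metric Y)"
    and sY: "sets (mm_measure Y) = sets (borel_of Y.mtopology)" using Y by (auto simp: mm_space_def mtopology_of_eq)
  have spY: "space (mm_measure Y) = ?M" by (rule mm_space_space[OF Y])
  have aM: "a k \<in> ?M" for k using a by auto
  let ?N = "sigma UNIV half_spaces"
  let ?\<Gamma> = "\<lambda>x k. G k x" and ?\<Delta> = "\<lambda>y k. ?d (a k) y"
  have m\<Gamma>: "(\<lambda>x. ?\<Gamma> x k) \<in> borel_measurable (emm_measure X)" for k using lip1_measurable[OF G] .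
  have m\<Delta>: "(\<lambda>y. ?\<Delta> y k) \<in> borel_measurable (mm_measure Y)" for k by (rule mm_measurable_dist[OF Y aM])
  note \<Gamma> = half_spaces_measurable[of ?\<Gamma>, OF m\<Gamma>] and \<Delta> = half_spaces_measurable[of ?\<Delta>, OF m\<Delta>]
  have deq: "distr (emm_measure X) ?N ?\<Gamma> = distr (mm_measure Y) ?N ?\<Delta>"
    by (rule distr_eq_half_spaces[OF X pY m\<Gamma> m\<Delta> law])
  define S where "S z \<longleftrightarrow> (\<forall>i k. \<bar>z k - ?d (a k) (a i)\<bar> \<le> z i) \<and> (\<forall>m::nat. \<exists>i. z i < inverse (real (Suc m)))" for z
  have Sm [measurable]: "Measurable.pred ?N S" unfolding S_def pred_def
    by (intro sets.sets_Collect_conj sets.sets_Collect_countable_All sets.sets_Collect_countable_Ex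
        borel_measurable_le borel_measurable_less borel_measurable_abs borel_measurable_diff
        half_spaces_coordinate borel_measurable_const)
  define j where "j z = (if S z then SOME y. y \<in> ?M \<and> (\<forall>k. ?d (a k) y = z k) else a 0)" for z
  have jS: "j z \<in> ?M" "?d (a k) (j z) = z k" if z: "S z" for z k
  proof -
    have "\<exists>y. y \<in> ?M \<and> (\<forall>k. ?d (a k) y = z k)"
      using kuratowski_image[OF cY a, of z] z unfolding S_def by metis
    from someI_ex[OF this] show "j z \<in> ?M" "?d (a k) (j z) = z k" using z by (auto simp: j_def)
  qed
  have jM: "j z \<in> ?M" for z using jS(1)[of z] aM by (cases "S z") (auto simp: j_def)
  have jm: "j \<in> ?N \<rightarrow>\<^sub>M mm_measure Y"
    unfolding measurable_cong_sets[OF refl sY]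
  proof (rule Y.measurable_borel_of_mtopology[OF a dense])
    show "j \<in> space ?N \<rightarrow> ?M" using jM by blast
    fix k
    have "?d (a k) (j z) = (if S z then z k else ?d (a k) (a 0))" for z using jS(2)[of z k] by (simp add: j_def)
    then show "(\<lambda>z. ?d (a k) (j z)) \<in> borel_measurable ?N"
      by (simp, intro measurable_If half_spaces_coordinate borel_measurable_const Sm[unfolded pred_def])
  qed
  have S\<Delta>: "S (?\<Delta> y)" if y: "y \<in> ?M" for y
    unfolding S_def
  proof (intro conjI allI)
    fix i k
    have "?d (a k) y \<le> ?d (a k) (a i) + ?d (a i) y" "?d (a k) (a i) \<le> ?d (a k) y + ?d y (a i)"
      by (intro mdist_triangle aM y)+
    then show "\<bar>?d (a k) y - ?d (a k) (a i)\<bar> \<le> ?d (a i) y" unfolding mdist_commute[of _ y "a i"] by linarith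
  next
    fix m :: nat show "\<exists>i. ?d (a i) y < inverse (real (Suc m))" using dense[OF y, of "inverse (real (Suc m))"] by simp
  qed
  have eq: "y = y'" if y: "y \<in> ?M" "y' \<in> ?M" and k: "\<And>k. ?d (a k) y = ?d (a k) y'" for y y'
  proof -
    have "?d y y' \<le> 0 + e" if e: "0 < e" for e
    proof -
      obtain i where i: "?d (a i) y < e/2" using dense[OF y(1), of "e/2"] e by auto
      have "?d y y' \<le> ?d y (a i) + ?d (a i) y'" by (intro mdist_triangle aM y)
      then show ?thesis using i k[of i] by (simp add: mdist_commute[of _ y "a i"])
    qed
    then have "?d y y' \<le> 0" by (rule field_le_epsilon)
    then have "?d y y' = 0" using mdist_nonneg[of "mm_metric Y" y y'] by linarith
    then show ?thesis using y by simp
  qed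
  have j\<Delta>: "j (?\<Delta> y) = y" if "y \<in> ?M" for y
    using jS[OF S\<Delta>[OF that]] that by (intro eq) auto
  \<comment> \<open>\<open>S\<close> holds for every sequence of distances from a point of
    \<open>Y\<close>. Being measurable, it is transferred to \<open>X\<close> by the equality of
    laws.\<close>
  have "AE z in distr (mm_measure Y) ?N ?\<Delta>. S z"
    unfolding AE_distr_iff[OF \<Delta> Sm[unfolded pred_def]] by (rule AE_I2) (use S\<Delta> spY in simp)
  then have "AE z in distr (emm_measure X) ?N ?\<Gamma>. S z" unfolding deq .
  then have AES: "AE x in emm_measure X. S (?\<Gamma> x)" unfolding AE_distr_iff[OF \<Gamma> Sm[unfolded pred_def]] .
  have "\<forall>k. \<exists>E. (AE x in emm_measure X. x \<in> E) \<and> (\<forall>x\<in>E. \<forall>y\<in>E. ennreal \<bar>G k x - G k y\<bar> \<le> emm_dist X x y)"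
    using G by (simp add: lip1_def)
  then obtain E where E: "\<And>k. AE x in emm_measure X. x \<in> E k"
    "\<And>k x y. x \<in> E k \<Longrightarrow> y \<in> E k \<Longrightarrow> ennreal \<bar>G k x - G k y\<bar> \<le> emm_dist X x y" by metis
  have "AE x in emm_measure X. \<forall>k. x \<in> E k" using E(1) by (simp add: AE_all_countable)
  with AES have AEE: "AE x in emm_measure X. x \<in> {x. S (?\<Gamma> x) \<and> (\<forall>k. x \<in> E k)}" by eventually_elim simp
  have \<psi>m: "(j \<circ> ?\<Gamma>) \<in> emm_measure X \<rightarrow>\<^sub>M mm_measure Y" by (rule measurable_comp[OF \<Gamma> jm])
  have "distr (emm_measure X) (mm_measure Y) (j \<circ> ?\<Gamma>) = distr (distr (mm_measure Y) ?N ?\<Delta>) (mm_measure Y) j"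
    using distr_distr[OF jm \<Gamma>] deq by simp
  also have "\<dots> = distr (mm_measure Y) (mm_measure Y) (j \<circ> ?\<Delta>)" by (rule distr_distr[OF jm \<Delta>])
  also have "\<dots> = distr (mm_measure Y) (mm_measure Y) (\<lambda>y. y)" by (rule distr_cong) (use j\<Delta> spY in auto)
  finally have \<psi>d: "distr (emm_measure X) (mm_measure Y) (j \<circ> ?\<Gamma>) = mm_measure Y" by simp
  have "lip_map X (emm_of_mm Y) (j \<circ> ?\<Gamma>)"
  proof (rule lip_mapI[OF _ _ AEE])
    show "(j \<circ> ?\<Gamma>) \<in> emm_measure X \<rightarrow>\<^sub>M emm_measure (emm_of_mm Y)" using \<psi>m by simp
    show "distr (emm_measure X) (emm_measure (emm_of_mm Y)) (j \<circ> ?\<Gamma>) = emm_measure (emm_of_mm Y)" using \<psi>d by simp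
    fix x y assume xy: "x \<in> {x. S (?\<Gamma> x) \<and> (\<forall>k. x \<in> E k)}" "y \<in> {x. S (?\<Gamma> x) \<and> (\<forall>k. x \<in> E k)}"
    let ?p = "j (?\<Gamma> x)" and ?q = "j (?\<Gamma> y)"
    have p: "?p \<in> ?M" "\<And>k. ?d (a k) ?p = G k x" and q: "?q \<in> ?M" "\<And>k. ?d (a k) ?q = G k y"
      using jS xy by auto
    show "emm_dist (emm_of_mm Y) ((j \<circ> ?\<Gamma>) x) ((j \<circ> ?\<Gamma>) y) \<le> emm_dist X x y"
    proof (cases "emm_dist X x y")
      case (real r)
      have le: "\<bar>G k x - G k y\<bar> \<le> r" for k
        using E(2)[of x k y] xy real by simp
      \<comment> \<open>Seen from some \<open>a i\<close> close to \<open>?p\<close>, the difference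
        of the coordinates is almost the full distance of \<open>?p\<close> and
        \<open>?q\<close>.\<close>
      have "?d ?p ?q \<le> r + e" if e: "0 < e" for e
      proof -
        obtain i where i: "?d (a i) ?p < e/2" using dense[OF p(1), of "e/2"] e by auto
        have "?d ?p ?q \<le> ?d ?p (a i) + ?d (a i) ?q" by (intro mdist_triangle aM p q)
        then show ?thesis using i le[of i] p(2)[of i] q(2)[of i] unfolding mdist_commute[of _ ?p "a i"] by linarith
      qed
      then have "?d ?p ?q \<le> r" by (rule field_le_epsilon)
      then show ?thesis using real by (simp add: ennreal_leI)
    qed simp
  qed
  then show thesis by (rule that)
qed

text \<open>A continuous substitute for the indicator of \<open>u \<le> c\<close>, falling with
  slope \<open>-m\<close> to the right of \<open>c\<close>. Unlike the indicator it varies little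
  when \<open>u\<close> does, and the indicator is regained as \<open>m\<close> grows.\<close>

definition ramp :: "nat \<Rightarrow> real \<Rightarrow> real \<Rightarrow> real" where
  "ramp m c u = max 0 (min 1 (1 - real m * (u - c)))"

lemma ramp_bounds: "0 \<le> ramp m c u" "ramp m c u \<le> 1"
  by (auto simp: ramp_def)

lemma ramp_lipschitz: "\<bar>ramp m c u - ramp m c v\<bar> \<le> real m * \<bar>u - v\<bar>"
proof -
  have "\<bar>ramp m c u - ramp m c v\<bar> \<le> \<bar>real m * (u - c) - real m * (v - c)\<bar>"
    unfolding ramp_def by linarith
  also have "real m * (u - c) - real m * (v - c) = real m * (u - v)" by (simp add: algebra_simps)
  finally show ?thesis by (simp add: abs_mult)
qed

lemma ramp_tendsto_indicator: "(\<lambda>m. ramp m c u) \<longlonglongrightarrow> (if u \<le> c then 1 else 0)"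
proof (cases "u \<le> c")
  case True
  then have "real m * (u - c) \<le> 0" for m by (simp add: mult_nonneg_nonpos)
  then have "ramp m c u = 1" for m by (simp add: ramp_def)
  then show ?thesis using True by simp
next
  case False
  then obtain N :: nat where N: "1 < real N * (u - c)" using ex_less_of_nat_mult[of "u - c" 1] by auto
  have "ramp m c u = 0" if "m \<ge> N" for m
  proof -
    have "real N * (u - c) \<le> real m * (u - c)" using False that by (intro mult_right_mono) auto
    then show ?thesis using N by (simp add: ramp_def)
  qed
  then have "\<forall>\<^sub>F m in sequentially. ramp m c u = 0" unfolding eventually_sequentially by blast
  then show ?thesis using False by (simp add: tendsto_eventually)
qed

lemma tendsto_ramp: "(f \<longlongrightarrow> u) F \<Longrightarrow> ((\<lambda>x. ramp m c (f x)) \<longlongrightarrow> ramp m c u) F"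
  unfolding ramp_def by (intro tendsto_intros)

lemma measurable_ramp [measurable]: "ramp m c \<in> borel_measurable borel"
  unfolding ramp_def by measurable

lemma prod_ramp_bounds: "0 \<le> (\<Prod>i\<in>I. ramp m (c i) (u i))" "(\<Prod>i\<in>I. ramp m (c i) (u i)) \<le> 1"
  by (auto intro!: prod_nonneg prod_le_1 simp: ramp_bounds)

lemma prod_ramp_norm: "norm (\<Prod>i\<in>I. ramp m (c i) (u i)) \<le> 1"
  using prod_ramp_bounds[where I=I and m=m and c=c and u=u] by simp

lemma (in prob_space) integrable_prod_ramp:
  assumes [measurable]: "\<And>i. f i \<in> borel_measurable M"
  shows "integrable M (\<lambda>x. \<Prod>i\<in>I. ramp m (c i) (f i x))"
  by (rule integrable_const_bound[of _ 1]) (rule AE_I2, rule prod_ramp_norm, measurable)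

lemma (in prob_space) integral_prod_ramp_tendsto:
  assumes [measurable]: "\<And>i. f i \<in> borel_measurable M" and I: "finite I"
  shows "(\<lambda>m. \<integral>x. (\<Prod>i\<in>I. ramp m (c i) (f i x)) \<partial>M) \<longlonglongrightarrow> measure M {x \<in> space M. \<forall>i\<in>I. f i x \<le> c i}"
proof -
  let ?A = "{x \<in> space M. \<forall>i\<in>I. f i x \<le> c i}"
  have A: "?A \<in> sets M"
    by (rule sets.sets_Collect_finite_All[OF _ I]) (rule borel_measurable_le; simp)
  have "(\<lambda>m. \<integral>x. (\<Prod>i\<in>I. ramp m (c i) (f i x)) \<partial>M) \<longlonglongrightarrow> (\<integral>x. indicator ?A x \<partial>M)"
  proof (rule integral_dominated_convergence[where w="\<lambda>_. 1"])
    show "AE x in M. (\<lambda>m. \<Prod>i\<in>I. ramp m (c i) (f i x)) \<longlonglongrightarrow> indicator ?A x"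
    proof (rule AE_I2)
      fix x assume x: "x \<in> space M"
      have "(\<lambda>m. \<Prod>i\<in>I. ramp m (c i) (f i x)) \<longlonglongrightarrow> (\<Prod>i\<in>I. if f i x \<le> c i then 1 else 0)"
        by (intro tendsto_prod ramp_tendsto_indicator)
      also have "(\<Prod>i\<in>I. if f i x \<le> c i then 1 else 0) = (indicator ?A x :: real)"
        using x I by (auto simp: indicator_def)
      finally show "(\<lambda>m. \<Prod>i\<in>I. ramp m (c i) (f i x)) \<longlonglongrightarrow> indicator ?A x" .
    qed
    show "AE x in M. norm (\<Prod>i\<in>I. ramp m (c i) (f i x)) \<le> 1" for m by (rule AE_I2) (rule prod_ramp_norm)
  qed (use A in auto)
  then show ?thesis using A by simp
qed

text \<open>\<open>h n\<close> and \<open>f\<close> live on different spaces. Their laws are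
  realized on the common space \<open>L\<close> by \<open>p n\<close> and \<open>q n\<close>, which
  differ by at most \<open>e n\<close> outside a set of measure at most \<open>e n\<close>. So
  integrals of products of ramps agree in the limit, and then \<open>m\<close> tends to
  infinity.\<close>

lemma law_limit:
  fixes h :: "nat \<Rightarrow> nat \<Rightarrow> 'a \<Rightarrow> real" and f :: "nat \<Rightarrow> 'b \<Rightarrow> real" and p q :: "nat \<Rightarrow> nat \<Rightarrow> 'c \<Rightarrow> real"
  assumes M: "prob_space M" and N: "prob_space N" and L: "prob_space L"
    and h [measurable]: "\<And>n i. h n i \<in> borel_measurable M" and G [measurable]: "\<And>i. G i \<in> borel_measurable M"
    and lim: "\<And>i. AE x in M. (\<lambda>n. h n i x) \<longlonglongrightarrow> G i x"
    and f [measurable]: "\<And>i. f i \<in> borel_measurable N"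
    and p [measurable]: "\<And>n i. p n i \<in> borel_measurable L" and q [measurable]: "\<And>n i. q n i \<in> borel_measurable L"
    and hp: "\<And>n I m c. (\<integral>x. (\<Prod>i\<in>I. ramp m (c i) (h n i x)) \<partial>M) = (\<integral>t. (\<Prod>i\<in>I. ramp m (c i) (p n i t)) \<partial>L)"
    and fq: "\<And>n I m c. (\<integral>x. (\<Prod>i\<in>I. ramp m (c i) (f i x)) \<partial>N) = (\<integral>t. (\<Prod>i\<in>I. ramp m (c i) (q n i t)) \<partial>L)"
    and e: "e \<longlonglongrightarrow> 0" and J: "\<And>n. J n \<in> sets L" "\<And>n. 1 - e n \<le> measure L (J n)"
    and pq: "\<And>n i t. t \<in> J n \<Longrightarrow> \<bar>p n i t - q n i t\<bar> \<le> e n"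
    and I: "finite I"
  shows "measure M {x \<in> space M. \<forall>i\<in>I. G i x \<le> c i} = measure N {x \<in> space N. \<forall>i\<in>I. f i x \<le> c i}"
proof -
  interpret M: prob_space M by fact
  interpret N: prob_space N by fact
  interpret L: prob_space L by fact
  have eq: "(\<integral>x. (\<Prod>i\<in>I. ramp m (c i) (G i x)) \<partial>M) = (\<integral>x. (\<Prod>i\<in>I. ramp m (c i) (f i x)) \<partial>N)" for m
  proof -
    have 1: "(\<lambda>n. \<integral>x. (\<Prod>i\<in>I. ramp m (c i) (h n i x)) \<partial>M) \<longlonglongrightarrow> (\<integral>x. (\<Prod>i\<in>I. ramp m (c i) (G i x)) \<partial>M)"
    proof (rule integral_dominated_convergence[where w="\<lambda>_. 1"])
      have "AE x in M. \<forall>i. (\<lambda>n. h n i x) \<longlonglongrightarrow> G i x" using lim by (simp add: AE_all_countable)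
      then show "AE x in M. (\<lambda>n. \<Prod>i\<in>I. ramp m (c i) (h n i x)) \<longlonglongrightarrow> (\<Prod>i\<in>I. ramp m (c i) (G i x))"
        by eventually_elim (intro tendsto_prod tendsto_ramp, simp)
      show "AE x in M. norm (\<Prod>i\<in>I. ramp m (c i) (h n i x)) \<le> 1" for n by (rule AE_I2) (rule prod_ramp_norm)
    qed auto
    \<comment> \<open>On \<open>J n\<close> a product of \<open>card I\<close> factors, each
      \<open>m\<close>-Lipschitz and between 0 and 1, changes by at most the first summand. Off
      \<open>J n\<close> the integrands differ by at most 1, on a set of measure at most
      \<open>e n\<close>.\<close>
    let ?b = "\<lambda>n. real (card I) * (real m * e n) + e n"
    have 2: "\<bar>(\<integral>x. (\<Prod>i\<in>I. ramp m (c i) (h n i x)) \<partial>M) - (\<integral>x. (\<Prod>i\<in>I. ramp m (c i) (f i x)) \<partial>N)\<bar> \<le> ?b n" for n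
    proof -
      let ?P = "\<lambda>t. \<Prod>i\<in>I. ramp m (c i) (p n i t)" and ?Q = "\<lambda>t. \<Prod>i\<in>I. ramp m (c i) (q n i t)"
      have e0: "0 \<le> e n" using J(2)[of n] L.prob_le_1[of "J n"] by linarith
      have iPQ: "integrable L ?P" "integrable L ?Q" by (rule L.integrable_prod_ramp; simp)+
      have bound: "\<bar>?P t - ?Q t\<bar> \<le> real (card I) * (real m * e n) + indicator (space L - J n) t" if t: "t \<in> space L" for t
      proof (cases "t \<in> J n")
        case True
        have "norm (?P t - ?Q t) \<le> (\<Sum>i\<in>I. norm (ramp m (c i) (p n i t) - ramp m (c i) (q n i t)))"
          by (rule norm_prod_diff) (auto simp: ramp_bounds)
        also have "\<dots> \<le> (\<Sum>i\<in>I. real m * e n)"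
        proof (rule sum_mono)
          fix i
          have "norm (ramp m (c i) (p n i t) - ramp m (c i) (q n i t)) \<le> real m * \<bar>p n i t - q n i t\<bar>"
            using ramp_lipschitz by simp
          also have "\<dots> \<le> real m * e n" using pq[OF True] by (intro mult_left_mono) auto
          finally show "norm (ramp m (c i) (p n i t) - ramp m (c i) (q n i t)) \<le> real m * e n" .
        qed
        finally show ?thesis using True by simp
      next
        case False
        have "\<bar>?P t - ?Q t\<bar> \<le> 1"
          using prod_ramp_bounds[where I=I and m=m and c=c and u="\<lambda>i. p n i t"]
            prod_ramp_bounds[where I=I and m=m and c=c and u="\<lambda>i. q n i t"] by linarith
        moreover have "0 \<le> real (card I) * (real m * e n)" using e0 by simp
        ultimately show ?thesis using False t by simp
      qed
      have "\<bar>(\<integral>t. ?P t \<partial>L) - (\<integral>t. ?Q t \<partial>L)\<bar> = \<bar>\<integral>t. ?P t - ?Q t \<partial>L\<bar>" using iPQ by simp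
      also have "\<dots> \<le> (\<integral>t. \<bar>?P t - ?Q t\<bar> \<partial>L)" by (rule integral_abs_bound)
      also have "\<dots> \<le> (\<integral>t. real (card I) * (real m * e n) + indicator (space L - J n) t \<partial>L)"
        by (rule integral_mono) (use iPQ J(1) bound in \<open>auto intro!: integrable_real_indicator simp: L.emeasure_eq_measure\<close>)
      also have "\<dots> = real (card I) * (real m * e n) + measure L (space L - J n)"
      proof -
        have "integrable L (indicator (space L - J n) :: _ \<Rightarrow> real)"
          using J(1) by (intro integrable_real_indicator) (auto simp: L.emeasure_eq_measure)
        moreover have "(\<integral>t. indicator (space L - J n) t \<partial>L) = measure L (space L - J n)"
          using sets.sets_into_space[OF J(1)] by (simp add: Int_absorb2)
        ultimately show ?thesis by (simp add: L.prob_space)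
      qed
      also have "measure L (space L - J n) \<le> e n" using J(2)[of n] L.prob_compl[OF J(1)[of n]] by linarith
      finally show ?thesis unfolding hp[where n=n] fq[where n=n] by simp
    qed
    have "?b \<longlonglongrightarrow> real (card I) * (real m * 0) + 0" by (intro tendsto_intros e)
    then have "?b \<longlonglongrightarrow> 0" by simp
    then have "(\<lambda>n. (\<integral>x. (\<Prod>i\<in>I. ramp m (c i) (h n i x)) \<partial>M) - (\<integral>x. (\<Prod>i\<in>I. ramp m (c i) (f i x)) \<partial>N)) \<longlonglongrightarrow> 0"
      by (rule Lim_null_comparison[rotated]) (use 2 in \<open>auto intro!: always_eventually\<close>)
    then have "(\<lambda>n. \<integral>x. (\<Prod>i\<in>I. ramp m (c i) (h n i x)) \<partial>M) \<longlonglongrightarrow> (\<integral>x. (\<Prod>i\<in>I. ramp m (c i) (f i x)) \<partial>N)"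
      by (simp add: LIM_zero_iff)
    with 1 show ?thesis by (rule LIMSEQ_unique)
  qed
  show ?thesis
    using M.integral_prod_ramp_tendsto[where f=G and I=I and c=c, OF G I] N.integral_prod_ramp_tendsto[where f=f and I=I and c=c, OF f I]
    unfolding eq by (rule LIMSEQ_unique)
qed

section \<open>The set of dominated mm-spaces is box-closed\<close>

abbreviation box_admissible :: "'a mm_data \<Rightarrow> 'b mm_data \<Rightarrow> (real \<Rightarrow> 'a) \<Rightarrow> (real \<Rightarrow> 'b) \<Rightarrow> real set" where
  "box_admissible Y Z \<iota> \<kappa> \<equiv> {\<epsilon>. 0 \<le> \<epsilon> \<and> (\<exists>J \<in> sets Leb_I. measure Leb_I J \<ge> 1 - \<epsilon> \<and>
     (\<forall>s\<in>J. \<forall>t\<in>J. \<bar>mdist (mm_metric Y) (\<iota> s) (\<iota> t) - mdist (mm_metric Z) (\<kappa> s) (\<kappa> t)\<bar> \<le> \<epsilon>))}"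

lemma box_admissible_1: "1 \<in> box_admissible Y Z \<iota> \<kappa>"
  by (auto intro!: bexI[of _ "{}"])

lemma mm_parameters_nonempty: "mm_space Y \<Longrightarrow> parameters (mm_measure Y) \<noteq> {}"
  using parameters_nonempty[OF emm_space_standard[OF emm_space_emm_of_mm] emm_space_prob[OF emm_space_emm_of_mm]] by simp

lemma box_dist_lessE:
  assumes less: "box_dist Y Z < e" and Y: "mm_space Y" and Z: "mm_space Z"
  obtains \<iota> \<kappa> J where "\<iota> \<in> parameters (mm_measure Y)" "\<kappa> \<in> parameters (mm_measure Z)" "J \<in> sets Leb_I"
    "1 - e \<le> measure Leb_I J"
    "\<forall>s\<in>J. \<forall>t\<in>J. \<bar>mdist (mm_metric Y) (\<iota> s) (\<iota> t) - mdist (mm_metric Z) (\<kappa> s) (\<kappa> t)\<bar> \<le> e"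
proof -
  let ?O = "{Inf (box_admissible Y Z \<iota> \<kappa>) | \<iota> \<kappa>. \<iota> \<in> parameters (mm_measure Y) \<and> \<kappa> \<in> parameters (mm_measure Z)}"
  have ne: "?O \<noteq> {}" using mm_parameters_nonempty[OF Y] mm_parameters_nonempty[OF Z] by blast
  have "Inf ?O < e" using less unfolding box_dist_def .
  from cInf_lessD[OF ne this] obtain \<iota> \<kappa> where p: "\<iota> \<in> parameters (mm_measure Y)" "\<kappa> \<in> parameters (mm_measure Z)"
    and i: "Inf (box_admissible Y Z \<iota> \<kappa>) < e" by blast
  have ne': "box_admissible Y Z \<iota> \<kappa> \<noteq> {}" using box_admissible_1 by blast
  from cInf_lessD[OF ne' i] obtain \<epsilon> J where J: "\<epsilon> < e" "J \<in> sets Leb_I" "1 - \<epsilon> \<le> measure Leb_I J"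
    "\<forall>s\<in>J. \<forall>t\<in>J. \<bar>mdist (mm_metric Y) (\<iota> s) (\<iota> t) - mdist (mm_metric Z) (\<kappa> s) (\<kappa> t)\<bar> \<le> \<epsilon>" by blast
  have "\<forall>s\<in>J. \<forall>t\<in>J. \<bar>mdist (mm_metric Y) (\<iota> s) (\<iota> t) - mdist (mm_metric Z) (\<kappa> s) (\<kappa> t)\<bar> \<le> e"
    using J(1,4) by (meson less_imp_le order_trans)
  then show thesis using that[OF p J(2)] J(1,3) by simp
qed

lemma box_dist_self: assumes Y: "mm_space Y" shows "box_dist Y Y \<le> 0"
proof -
  obtain \<iota> where \<iota>: "\<iota> \<in> parameters (mm_measure Y)" using mm_parameters_nonempty[OF Y] by blast
  have bdd: "bdd_below (box_admissible Y Y \<iota> \<kappa>)" for \<iota> \<kappa> by (rule bdd_belowI[of _ 0]) simp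
  have nonneg: "0 \<le> Inf (box_admissible Y Y \<iota> \<kappa>)" for \<iota> \<kappa>
    by (rule cInf_greatest) (use box_admissible_1[where Y=Y and Z=Y and \<iota>=\<iota> and \<kappa>=\<kappa>] in blast, simp)
  have "0 \<in> box_admissible Y Y \<iota> \<iota>"
    using prob_space.prob_space[OF prob_space_Leb_I] by (auto intro!: bexI[of _ "space Leb_I"])
  then have "Inf (box_admissible Y Y \<iota> \<iota>) \<le> 0" by (rule cInf_lower[OF _ bdd])
  moreover have "box_dist Y Y \<le> Inf (box_admissible Y Y \<iota> \<iota>)"
    unfolding box_dist_def
  proof (rule cInf_lower)
    show "bdd_below {Inf (box_admissible Y Y \<iota> \<kappa>) | \<iota> \<kappa>. \<iota> \<in> parameters (mm_measure Y) \<and> \<kappa> \<in> parameters (mm_measure Y)}"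
      by (rule bdd_belowI[of _ 0]) (use nonneg in blast)
  qed (use \<iota> in blast)
  ultimately show ?thesis by simp
qed

lemma box_closure_superset: "P \<subseteq> mm_classes \<Longrightarrow> P \<subseteq> box_closure P"
  unfolding box_closure_def using box_dist_self[OF mm_classes_rep] by force

lemma mm_lip1I:
  assumes Y: "mm_space Y"
    and lip: "\<And>x y. x \<in> mspace (mm_metric Y) \<Longrightarrow> y \<in> mspace (mm_metric Y) \<Longrightarrow> g x \<le> g y + mdist (mm_metric Y) x y"
  shows "g \<in> lip1 (emm_of_mm Y)"
proof -
  have *: "\<bar>g x - g y\<bar> \<le> mdist (mm_metric Y) x y" if "x \<in> mspace (mm_metric Y)" "y \<in> mspace (mm_metric Y)" for x y
    using lip[OF that] lip[OF that(2,1)] unfolding mdist_commute[of _ y x] by linarith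
  have "continuous_map (mtopology_of (mm_metric Y)) (mtopology_of euclidean_metric) g"
    by (rule Lipschitz_continuous_imp_continuous_map)
      (use * in \<open>auto simp: Lipschitz_continuous_map_def dist_real_def intro!: exI[of _ 1]\<close>)
  then have "g \<in> mm_measure Y \<rightarrow>\<^sub>M borel"
    by (rule measurable_continuous_map) (use Y in \<open>simp_all add: mm_space_def borel_of_euclidean\<close>)
  moreover have "AE x in mm_measure Y. x \<in> mspace (mm_metric Y)"
    unfolding mm_space_space[OF Y, symmetric] by (rule AE_space)
  moreover have "\<forall>x\<in>mspace (mm_metric Y). \<forall>y\<in>mspace (mm_metric Y). ennreal \<bar>g x - g y\<bar> \<le> ennreal (mdist (mm_metric Y) x y)"
    using * by (auto intro: ennreal_leI)
  ultimately show ?thesis unfolding lip1_def mem_Collect_eq emm_of_mm_simps by blast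
qed

text \<open>McShane extension of the values at \<open>\<iota> s\<close>, prescribed at
  \<open>\<kappa> s\<close>. They are 1-Lipschitz for the distances in \<open>Y\<close>, hence only
  up to \<open>e\<close> for those in \<open>Z\<close>; the extension may fall short of them by
  \<open>e\<close> but never exceeds them.\<close>

lemma mcshane_transport:
  fixes Y :: "'a mm_data" and Z :: "'b mm_data"
  assumes Z: "mm_space Z" and J: "J \<noteq> {}"
    and \<iota>: "\<And>s. s \<in> J \<Longrightarrow> \<iota> s \<in> mspace (mm_metric Y)" and \<kappa>: "\<And>s. s \<in> J \<Longrightarrow> \<kappa> s \<in> mspace (mm_metric Z)"
    and e: "\<And>s t. s \<in> J \<Longrightarrow> t \<in> J \<Longrightarrow> \<bar>mdist (mm_metric Y) (\<iota> s) (\<iota> t) - mdist (mm_metric Z) (\<kappa> s) (\<kappa> t)\<bar> \<le> e"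
    and a: "a \<in> mspace (mm_metric Y)"
  obtains g where "g \<in> lip1 (emm_of_mm Z)" "\<forall>t\<in>J. \<bar>g (\<kappa> t) - mdist (mm_metric Y) a (\<iota> t)\<bar> \<le> e"
proof -
  let ?f = "mdist (mm_metric Y) a" and ?d = "mdist (mm_metric Z)"
  define g where "g y = (INF s\<in>J. ?f (\<iota> s) + ?d y (\<kappa> s))" for y
  have bdd: "bdd_below ((\<lambda>s. ?f (\<iota> s) + ?d y (\<kappa> s)) ` J)" for y by (rule bdd_belowI[of _ 0]) auto
  have g_le: "g y \<le> ?f (\<iota> s) + ?d y (\<kappa> s)" if "s \<in> J" for y s
    unfolding g_def by (rule cINF_lower[OF bdd that])
  have g_ge: "c \<le> g y" if "\<And>s. s \<in> J \<Longrightarrow> c \<le> ?f (\<iota> s) + ?d y (\<kappa> s)" for c y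
    unfolding g_def by (rule cINF_greatest[OF J that])
  show thesis
  proof (rule that)
    show "g \<in> lip1 (emm_of_mm Z)"
    proof (rule mm_lip1I[OF Z])
      fix x y assume xy: "x \<in> mspace (mm_metric Z)" "y \<in> mspace (mm_metric Z)"
      have "g x - ?d x y \<le> g y"
      proof (rule g_ge)
        fix s assume s: "s \<in> J"
        have "?d x (\<kappa> s) \<le> ?d x y + ?d y (\<kappa> s)" by (intro mdist_triangle xy \<kappa> s)
        then show "g x - ?d x y \<le> ?f (\<iota> s) + ?d y (\<kappa> s)" using g_le[OF s, of x] by simp
      qed
      then show "g x \<le> g y + ?d x y" by simp
    qed
    show "\<forall>t\<in>J. \<bar>g (\<kappa> t) - ?f (\<iota> t)\<bar> \<le> e"
    proof
      fix t assume t: "t \<in> J"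
      have e0: "0 \<le> e" using e[OF t t] by linarith
      have "g (\<kappa> t) \<le> ?f (\<iota> t)" using g_le[OF t, of "\<kappa> t"] \<kappa>[OF t] by simp
      moreover have "?f (\<iota> t) - e \<le> g (\<kappa> t)"
      proof (rule g_ge)
        fix s assume s: "s \<in> J"
        have "?f (\<iota> t) \<le> ?f (\<iota> s) + mdist (mm_metric Y) (\<iota> s) (\<iota> t)" by (intro mdist_triangle a \<iota> s t)
        then show "?f (\<iota> t) - e \<le> ?f (\<iota> s) + ?d (\<kappa> t) (\<kappa> s)"
          using e[OF s t] unfolding mdist_commute[of _ "\<kappa> t" "\<kappa> s"] by linarith
      qed
      ultimately show "\<bar>g (\<kappa> t) - ?f (\<iota> t)\<bar> \<le> e" using e0 by linarith
    qed
  qed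
qed

lemma integral_distr_self:
  assumes "\<phi> \<in> M \<rightarrow>\<^sub>M N" "distr M N \<phi> = N" "u \<in> borel_measurable N"
  shows "(\<integral>x. u (\<phi> x) \<partial>M) = (\<integral>y. u y \<partial>N :: real)"
  using integral_distr[OF assms(1), of u] assms(2,3) by simp

lemma measure_distr_self:
  assumes "\<phi> \<in> M \<rightarrow>\<^sub>M N" "distr M N \<phi> = N" "A \<in> sets N"
  shows "measure M {x \<in> space M. \<phi> x \<in> A} = measure N A"
proof -
  have "{x \<in> space M. \<phi> x \<in> A} = \<phi> -` A \<inter> space M" by auto
  then show ?thesis using measure_distr[OF assms(1,3)] assms(2) by simp
qed

lemma box_closure_mm_below:
  assumes X: "prob_space (emm_measure X)" and tb: "lip1_totally_bounded X"
  shows "box_closure (mm_below X) = mm_below X"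
proof
  show "mm_below X \<subseteq> box_closure (mm_below X)" by (rule box_closure_superset) (auto simp: mm_below_def)
  show "box_closure (mm_below X) \<subseteq> mm_below X"
  proof
    fix c assume c: "c \<in> box_closure (mm_below X)"
    interpret X: prob_space "emm_measure X" by fact
    interpret L: prob_space Leb_I by (rule prob_space_Leb_I)
    have cm: "c \<in> mm_classes" using c by (simp add: box_closure_def)
    define Y where "Y = rep c"
    have Y: "mm_space Y" unfolding Y_def by (rule mm_classes_rep[OF cm])
    interpret Y: prob_space "mm_measure Y" using prob_space_mm[OF Y] by simp
    obtain a :: "nat \<Rightarrow> real" where a: "range a \<subseteq> mspace (mm_metric Y)"
      and dense: "\<And>y e. y \<in> mspace (mm_metric Y) \<Longrightarrow> 0 < e \<Longrightarrow> \<exists>i. mdist (mm_metric Y) (a i) y < e"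
      using mm_space_dense_sequence[OF Y] by metis
    have aM: "a k \<in> mspace (mm_metric Y)" for k using a by auto
    let ?f = "\<lambda>k. mdist (mm_metric Y) (a k)"
    have fm: "?f k \<in> borel_measurable (mm_measure Y)" for k by (rule mm_measurable_dist[OF Y aM])
    \<comment> \<open>The bound 1/8 keeps every \<open>J n\<close> nonempty and leaves room in the
      tightness estimate; convergence to 0 gives the limit law.\<close>
    define e where "e n = (1/8) * inverse (real (Suc n))" for n
    have e: "0 < e n" "e n \<le> 1/8" for n by (auto simp: e_def field_simps)
    have e0: "e \<longlonglongrightarrow> 0" unfolding e_def using tendsto_mult[OF tendsto_const LIMSEQ_inverse_real_of_nat, of "1/8"] by simp
    have "\<exists>Z. Z \<in> mm_below X \<and> box_dist Y (rep Z) < e n" for n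
      using c e[of n] unfolding box_closure_def Y_def by blast
    then obtain d where d: "\<And>n. d n \<in> mm_below X" "\<And>n. box_dist Y (rep (d n)) < e n" by metis
    define Z where "Z n = rep (d n)" for n
    have Z: "mm_space (Z n)" for n unfolding Z_def using d(1) mm_classes_rep by (auto simp: mm_below_def)
    have "\<exists>\<phi>. lip_map X (emm_of_mm (Z n)) \<phi>" for n using d(1) unfolding mm_below_iff[OF X] Z_def by blast
    then obtain \<phi> where \<phi>: "\<And>n. lip_map X (emm_of_mm (Z n)) (\<phi> n)" by metis
    have "\<exists>\<iota> \<kappa> J. \<iota> \<in> parameters (mm_measure Y) \<and> \<kappa> \<in> parameters (mm_measure (Z n)) \<and> J \<in> sets Leb_I \<and> 1 - e n \<le> measure Leb_I J \<and>
      (\<forall>s\<in>J. \<forall>t\<in>J. \<bar>mdist (mm_metric Y) (\<iota> s) (\<iota> t) - mdist (mm_metric (Z n)) (\<kappa> s) (\<kappa> t)\<bar> \<le> e n)" for n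
    proof -
      have "box_dist Y (Z n) < e n" using d(2) by (simp add: Z_def)
      from box_dist_lessE[OF this Y Z] show ?thesis by metis
    qed
    then obtain \<iota> \<kappa> J where \<iota>: "\<And>n. \<iota> n \<in> parameters (mm_measure Y)" and \<kappa>: "\<And>n. \<kappa> n \<in> parameters (mm_measure (Z n))"
      and J: "\<And>n. J n \<in> sets Leb_I" "\<And>n. 1 - e n \<le> measure Leb_I (J n)"
      and Je: "\<And>n. \<forall>s\<in>J n. \<forall>t\<in>J n. \<bar>mdist (mm_metric Y) (\<iota> n s) (\<iota> n t) - mdist (mm_metric (Z n)) (\<kappa> n s) (\<kappa> n t)\<bar> \<le> e n"
      by metis
    have \<iota>m: "\<iota> n \<in> Leb_I \<rightarrow>\<^sub>M mm_measure Y" "distr Leb_I (mm_measure Y) (\<iota> n) = mm_measure Y" for n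
      using \<iota> by (auto simp: parameters_def)
    have \<kappa>m: "\<kappa> n \<in> Leb_I \<rightarrow>\<^sub>M mm_measure (Z n)" "distr Leb_I (mm_measure (Z n)) (\<kappa> n) = mm_measure (Z n)" for n
      using \<kappa> by (auto simp: parameters_def)
    have \<phi>m: "\<phi> n \<in> emm_measure X \<rightarrow>\<^sub>M mm_measure (Z n)" "distr (emm_measure X) (mm_measure (Z n)) (\<phi> n) = mm_measure (Z n)" for n
      using lip_map_measurable[OF \<phi>] lip_map_distr[OF \<phi>] by simp_all
    have Js: "J n \<subseteq> space Leb_I" for n by (rule sets.sets_into_space[OF J(1)])
    have "\<exists>g\<in>lip1 (emm_of_mm (Z n)). \<forall>t\<in>J n. \<bar>g (\<kappa> n t) - ?f k (\<iota> n t)\<bar> \<le> e n" for n k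
    proof -
      have Jne: "J n \<noteq> {}" using J(2)[of n] e(2)[of n] by auto
      have 1: "\<iota> n s \<in> mspace (mm_metric Y)" if "s \<in> J n" for s
        using measurable_space[OF \<iota>m(1)] Js that mm_space_space[OF Y] by blast
      have 2: "\<kappa> n s \<in> mspace (mm_metric (Z n))" if "s \<in> J n" for s
        using measurable_space[OF \<kappa>m(1)] Js that mm_space_space[OF Z] by blast
      have 3: "\<bar>mdist (mm_metric Y) (\<iota> n s) (\<iota> n t) - mdist (mm_metric (Z n)) (\<kappa> n s) (\<kappa> n t)\<bar> \<le> e n"
        if "s \<in> J n" "t \<in> J n" for s t using Je that by blast
      obtain g where "g \<in> lip1 (emm_of_mm (Z n))" "\<forall>t\<in>J n. \<bar>g (\<kappa> n t) - ?f k (\<iota> n t)\<bar> \<le> e n"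
        by (rule mcshane_transport[OF Z Jne 1 2 3 aM])
      then show ?thesis by blast
    qed
    then obtain g where g: "\<And>n k. g n k \<in> lip1 (emm_of_mm (Z n))"
      and ge: "\<And>n k t. t \<in> J n \<Longrightarrow> \<bar>g n k (\<kappa> n t) - ?f k (\<iota> n t)\<bar> \<le> e n" by metis
    have gm [measurable]: "g n k \<in> borel_measurable (mm_measure (Z n))" for n k using lip1_measurable[OF g] by simp
    define h where "h n k = g n k \<circ> \<phi> n" for n k
    have h: "h n k \<in> lip1 X" for n k unfolding h_def by (rule lip1_comp_lip_map[OF \<phi> g])
    \<comment> \<open>Tightness uniform in \<open>n\<close>. Where
      \<open>g n k \<circ> \<kappa> n\<close> exceeds \<open>R + 1\<close> in absolute value, either
      the distance function on \<open>Y\<close> exceeds \<open>R\<close>, with probability below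
      1/8, or the parameter lies off \<open>J n\<close>, with probability at most 1/8.\<close>
    have "\<exists>R. \<forall>n. measure (emm_measure X) {x \<in> space (emm_measure X). \<bar>h n k x\<bar> > R} \<le> 3/8" for k
    proof -
      obtain R where R: "measure (mm_measure Y) {y \<in> space (mm_measure Y). \<bar>?f k y\<bar> > R} < 1/8"
        using Y.tail_small[OF fm, of "1/8" k] by auto
      have "measure (emm_measure X) {x \<in> space (emm_measure X). \<bar>h n k x\<bar> > R + 1} \<le> 3/8" for n
      proof -
        let ?A = "{z \<in> space (mm_measure (Z n)). \<bar>g n k z\<bar> > R + 1}"
        let ?B = "{y \<in> space (mm_measure Y). \<bar>?f k y\<bar> > R}"
        have A: "?A \<in> sets (mm_measure (Z n))" by measurable
        have B: "?B \<in> sets (mm_measure Y)" using fm[of k] by measurable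
        have "{x \<in> space (emm_measure X). \<bar>h n k x\<bar> > R + 1} = {x \<in> space (emm_measure X). \<phi> n x \<in> ?A}"
          using measurable_space[OF \<phi>m(1)] by (auto simp: h_def)
        then have "measure (emm_measure X) {x \<in> space (emm_measure X). \<bar>h n k x\<bar> > R + 1} = measure (mm_measure (Z n)) ?A"
          using measure_distr_self[OF \<phi>m A] by simp
        also have "\<dots> = measure Leb_I {t \<in> space Leb_I. \<kappa> n t \<in> ?A}" using measure_distr_self[OF \<kappa>m A] by simp
        also have "\<dots> \<le> measure Leb_I ({t \<in> space Leb_I. \<iota> n t \<in> ?B} \<union> (space Leb_I - J n))"
        proof (rule L.finite_measure_mono)
          show "{t \<in> space Leb_I. \<kappa> n t \<in> ?A} \<subseteq> {t \<in> space Leb_I. \<iota> n t \<in> ?B} \<union> (space Leb_I - J n)"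
          proof
            fix t assume t: "t \<in> {t \<in> space Leb_I. \<kappa> n t \<in> ?A}"
            show "t \<in> {t \<in> space Leb_I. \<iota> n t \<in> ?B} \<union> (space Leb_I - J n)"
            proof (cases "t \<in> J n")
              case True
              have "\<bar>?f k (\<iota> n t)\<bar> > R" using ge[OF True, of k] e(2)[of n] t unfolding mem_Collect_eq by linarith
              then show ?thesis using t measurable_space[OF \<iota>m(1)] by auto
            qed (use t in auto)
          qed
          have "{t \<in> space Leb_I. \<iota> n t \<in> ?B} = \<iota> n -` ?B \<inter> space Leb_I" by auto
          then show "{t \<in> space Leb_I. \<iota> n t \<in> ?B} \<union> (space Leb_I - J n) \<in> sets Leb_I"
            using measurable_sets[OF \<iota>m(1) B] J(1) by auto
        qed
        also have "\<dots> \<le> measure Leb_I {t \<in> space Leb_I. \<iota> n t \<in> ?B} + measure Leb_I (space Leb_I - J n)"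
        proof (rule measure_Un_le)
          have "{t \<in> space Leb_I. \<iota> n t \<in> ?B} = \<iota> n -` ?B \<inter> space Leb_I" by auto
          then show "{t \<in> space Leb_I. \<iota> n t \<in> ?B} \<in> sets Leb_I" using measurable_sets[OF \<iota>m(1) B] by simp
        qed (use J in auto)
        also have "measure Leb_I {t \<in> space Leb_I. \<iota> n t \<in> ?B} = measure (mm_measure Y) ?B" by (rule measure_distr_self[OF \<iota>m B])
        also have "measure Leb_I (space Leb_I - J n) \<le> 1/8" using J(2)[of n] e(2)[of n] L.prob_compl[OF J(1)[of n]] by simp
        finally show ?thesis using R by simp
      qed
      then show ?thesis by blast
    qed
    then obtain R where R: "\<And>n k. measure (emm_measure X) {x \<in> space (emm_measure X). \<bar>h n k x\<bar> > R k} \<le> 3/8" by metis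
    \<comment> \<open>A.e. convergence of the \<open>k\<close>-th function along \<open>s\<close> is
      inherited by subsequences, so a diagonal sequence can serve all \<open>k\<close> at
      once.\<close>
    define P where "P k s \<longleftrightarrow> (\<exists>G\<in>borel_measurable (emm_measure X). AE x in emm_measure X. (\<lambda>n. h (s n) k x) \<longlonglongrightarrow> G x)" for k s
    interpret subseqs P
    proof
      fix k and s :: "nat \<Rightarrow> nat" assume "strict_mono s"
      obtain r G where "strict_mono (r :: nat \<Rightarrow> nat)" "G \<in> borel_measurable (emm_measure X)"
        "AE x in emm_measure X. (\<lambda>n. h (s (r n)) k x) \<longlonglongrightarrow> G x"
        by (rule lip1_subsequence[OF X tb, of "\<lambda>n. h (s n) k" "R k"]) (use h R in auto)
      then show "\<exists>r'. strict_mono r' \<and> P k (s \<circ> r')" unfolding P_def comp_def by blast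
    qed
    define r where "r = diagseq"
    have r: "strict_mono r" unfolding r_def by (rule subseq_diagseq)
    have "P k (r \<circ> (+) (Suc k))" for k unfolding r_def
    proof (rule diagseq_holds)
      fix t s n assume t: "strict_mono (t :: nat \<Rightarrow> nat)" and "P n s"
      then obtain G where G: "G\<in>borel_measurable (emm_measure X)" "AE x in emm_measure X. (\<lambda>j. h (s j) n x) \<longlonglongrightarrow> G x"
        unfolding P_def by blast
      have "AE x in emm_measure X. (\<lambda>j. h ((s \<circ> t) j) n x) \<longlonglongrightarrow> G x"
        using G(2) by eventually_elim (use LIMSEQ_subseq_LIMSEQ[OF _ t] in \<open>fastforce simp: comp_def\<close>)
      then show "P n (s \<circ> t)" unfolding P_def using G(1) by blast
    qed
    then have "\<exists>G\<in>borel_measurable (emm_measure X). AE x in emm_measure X. (\<lambda>n. h (r (Suc k + n)) k x) \<longlonglongrightarrow> G x" for k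
      unfolding P_def comp_def .
    then obtain G where G: "\<And>k. G k \<in> borel_measurable (emm_measure X)"
      "\<And>k. AE x in emm_measure X. (\<lambda>n. h (r (Suc k + n)) k x) \<longlonglongrightarrow> G k x" by metis
    \<comment> \<open>The diagonal sequence is known to be good for \<open>k\<close> from position
      \<open>Suc k\<close> on; dropping this shift does not affect the limit.\<close>
    have Glim: "AE x in emm_measure X. (\<lambda>n. h (r n) k x) \<longlonglongrightarrow> G k x" for k
      using G(2)[of k]
    proof eventually_elim
      case (elim x)
      then have "(\<lambda>n. h (r (n + Suc k)) k x) \<longlonglongrightarrow> G k x" by (simp add: add.commute)
      then show ?case by (rule LIMSEQ_offset)
    qed
    have Gl: "G k \<in> lip1 X" for k by (rule lip1_AE_limit[OF h G(1) Glim])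
    \<comment> \<open>The unit interval is the common space: \<open>\<kappa> (r n)\<close> carries
      the laws of the functions \<open>g (r n)\<close>, which are those of \<open>h (r n)\<close> on
      \<open>X\<close>, and \<open>\<iota> (r n)\<close> carries those of the distance functions on
      \<open>Y\<close>.\<close>
    have law: "measure (emm_measure X) {x \<in> space (emm_measure X). \<forall>i\<in>I. G i x \<le> b i}
        = measure (mm_measure Y) {y \<in> space (mm_measure Y). \<forall>i\<in>I. ?f i y \<le> b i}" if I: "finite I" for I b
    proof (rule law_limit[OF X Y.prob_space_axioms L.prob_space_axioms lip1_measurable[OF h] G(1) Glim fm _ _ _ _ _ J(1) _ _ I,
          where p = "\<lambda>n i. g (r n) i \<circ> \<kappa> (r n)" and q = "\<lambda>n i. ?f i \<circ> \<iota> (r n)" and e = "\<lambda>n. e (r n)"])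
      show "g (r n) i \<circ> \<kappa> (r n) \<in> borel_measurable Leb_I" for n i using \<kappa>m(1) gm by (rule measurable_comp)
      show "?f i \<circ> \<iota> (r n) \<in> borel_measurable Leb_I" for n i using \<iota>m(1) fm by (rule measurable_comp)
      show "(\<integral>x. (\<Prod>i\<in>I. ramp m (c i) (h (r n) i x)) \<partial>emm_measure X) = (\<integral>t. (\<Prod>i\<in>I. ramp m (c i) ((g (r n) i \<circ> \<kappa> (r n)) t)) \<partial>Leb_I)"
        for n m I and c :: "nat \<Rightarrow> real"
      proof -
        let ?u = "\<lambda>z. \<Prod>i\<in>I. ramp m (c i) (g (r n) i z)"
        have u: "?u \<in> borel_measurable (mm_measure (Z (r n)))" by measurable
        show ?thesis using integral_distr_self[OF \<phi>m u] integral_distr_self[OF \<kappa>m u] by (simp add: h_def)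
      qed
      show "(\<integral>x. (\<Prod>i\<in>I. ramp m (c i) (?f i x)) \<partial>mm_measure Y) = (\<integral>t. (\<Prod>i\<in>I. ramp m (c i) ((?f i \<circ> \<iota> (r n)) t)) \<partial>Leb_I)"
        for n m I and c :: "nat \<Rightarrow> real"
      proof -
        let ?u = "\<lambda>z. \<Prod>i\<in>I. ramp m (c i) (?f i z)"
        have u: "?u \<in> borel_measurable (mm_measure Y)" using fm by measurable
        show ?thesis using integral_distr_self[OF \<iota>m u] by simp
      qed
      show "(\<lambda>n. e (r n)) \<longlonglongrightarrow> 0" using LIMSEQ_subseq_LIMSEQ[OF e0 r] by (simp add: comp_def)
      show "1 - e (r n) \<le> measure Leb_I (J (r n))" for n by (rule J(2))
      show "\<bar>(g (r n) i \<circ> \<kappa> (r n)) t - (?f i \<circ> \<iota> (r n)) t\<bar> \<le> e (r n)" if "t \<in> J (r n)" for n i t using ge[OF that] by simp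
    qed
    obtain \<psi> where "lip_map X (emm_of_mm Y) \<psi>" by (rule lip_map_of_law[OF X Y a dense Gl law])
    then show "c \<in> mm_below X" unfolding mm_below_iff[OF X] Y_def using cm by blast
  qed
qed

section \<open>The Gromov--Hausdorff distance\<close>

definition near :: "'a metric \<Rightarrow> 'b metric \<Rightarrow> real \<Rightarrow> bool" where
  "near M N r \<longleftrightarrow> (\<exists>R. R \<subseteq> mspace M \<times> mspace N \<and> (\<forall>x\<in>mspace M. \<exists>y. (x, y) \<in> R) \<and> (\<forall>y\<in>mspace N. \<exists>x. (x, y) \<in> R) \<and>
     (\<forall>x y x' y'. (x, y) \<in> R \<longrightarrow> (x', y') \<in> R \<longrightarrow> \<bar>mdist M x x' - mdist N y y'\<bar> \<le> r))"

text \<open>A relation as in the definition of \<^const>\<open>near\<close> is a correspondence of distortion at most \<open>r\<close>;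
  the Gromov--Hausdorff distance is half the least distortion of a correspondence.\<close>

lemma nearE:
  assumes "near M N r"
  obtains R where "R \<subseteq> mspace M \<times> mspace N" "\<forall>x\<in>mspace M. \<exists>y. (x, y) \<in> R" "\<forall>y\<in>mspace N. \<exists>x. (x, y) \<in> R"
     "\<forall>x y x' y'. (x, y) \<in> R \<longrightarrow> (x', y') \<in> R \<longrightarrow> \<bar>mdist M x x' - mdist N y y'\<bar> \<le> r"
  using assms unfolding near_def by (elim exE conjE)

lemma near_sym: "near M N r \<Longrightarrow> near N M r"
  unfolding near_def
proof (elim exE conjE)
  fix R
  assume "R \<subseteq> mspace M \<times> mspace N" "\<forall>x\<in>mspace M. \<exists>y. (x, y) \<in> R" "\<forall>y\<in>mspace N. \<exists>x. (x, y) \<in> R"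
    "\<forall>x y x' y'. (x, y) \<in> R \<longrightarrow> (x', y') \<in> R \<longrightarrow> \<bar>mdist M x x' - mdist N y y'\<bar> \<le> r"
  then show "\<exists>R. R \<subseteq> mspace N \<times> mspace M \<and> (\<forall>x\<in>mspace N. \<exists>y. (x, y) \<in> R) \<and> (\<forall>y\<in>mspace M. \<exists>x. (x, y) \<in> R) \<and>
     (\<forall>x y x' y'. (x, y) \<in> R \<longrightarrow> (x', y') \<in> R \<longrightarrow> \<bar>mdist N x x' - mdist M y y'\<bar> \<le> r)"
    by (intro exI[of _ "R\<inverse>"]) (force simp: abs_minus_commute)
qed

lemma near_trans:
  assumes "near M N r" "near N P s" shows "near M P (r + s)"
proof -
  obtain R where R: "R \<subseteq> mspace M \<times> mspace N" "\<forall>x\<in>mspace M. \<exists>y. (x, y) \<in> R" "\<forall>y\<in>mspace N. \<exists>x. (x, y) \<in> R"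
    "\<forall>x y x' y'. (x, y) \<in> R \<longrightarrow> (x', y') \<in> R \<longrightarrow> \<bar>mdist M x x' - mdist N y y'\<bar> \<le> r"
    by (rule nearE[OF assms(1)])
  obtain S where S: "S \<subseteq> mspace N \<times> mspace P" "\<forall>x\<in>mspace N. \<exists>y. (x, y) \<in> S" "\<forall>y\<in>mspace P. \<exists>x. (x, y) \<in> S"
    "\<forall>x y x' y'. (x, y) \<in> S \<longrightarrow> (x', y') \<in> S \<longrightarrow> \<bar>mdist N x x' - mdist P y y'\<bar> \<le> s"
    by (rule nearE[OF assms(2)])
  have "\<bar>mdist M x x' - mdist P z z'\<bar> \<le> r + s" if xz: "(x, z) \<in> R O S" "(x', z') \<in> R O S" for x z x' z'
  proof -
    obtain y y' where y: "(x, y) \<in> R" "(y, z) \<in> S" "(x', y') \<in> R" "(y', z') \<in> S"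
      using xz by auto
    have "\<bar>mdist M x x' - mdist N y y'\<bar> \<le> r" "\<bar>mdist N y y' - mdist P z z'\<bar> \<le> s"
      using R(4) S(4) y by blast+
    then show ?thesis by simp
  qed
  moreover have "R O S \<subseteq> mspace M \<times> mspace P" using R(1) S(1) by auto
  moreover have "\<forall>x\<in>mspace M. \<exists>z. (x, z) \<in> R O S" using R(1,2) S(2) by blast
  moreover have "\<forall>z\<in>mspace P. \<exists>x. (x, z) \<in> R O S" using R(3) S(1,3) by blast
  ultimately show ?thesis unfolding near_def by blast
qed

lemma near_mono: "near M N r \<Longrightarrow> r \<le> s \<Longrightarrow> near M N s"
  unfolding near_def by (meson order_trans)

lemma isometric_imp_near: assumes "isometric M N" shows "near M N 0"
proof -
  obtain f where f: "isometric_embedding M N f" "f ` mspace M = mspace N"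
    using assms by (auto simp: isometric_def)
  then show ?thesis unfolding near_def isometric_embedding_def
    by (intro exI[of _ "{(x, f x) |x. x \<in> mspace M}"]) auto
qed

lemma isometric_refl: "isometric M M"
  unfolding isometric_def isometric_embedding_def by (intro exI[of _ "\<lambda>x. x"]) auto

lemma isometric_trans: "isometric M N \<Longrightarrow> isometric N P \<Longrightarrow> isometric M P"
  unfolding isometric_def isometric_embedding_def
proof (elim exE conjE)
  fix f g assume fg: "f ` mspace M = mspace N" "g ` mspace N = mspace P"
    "\<forall>x\<in>mspace M. \<forall>y\<in>mspace M. mdist N (f x) (f y) = mdist M x y"
    "\<forall>x\<in>mspace N. \<forall>y\<in>mspace N. mdist P (g x) (g y) = mdist N x y"
  have "(g \<circ> f) ` mspace M = mspace P" unfolding image_comp[symmetric] fg(1,2) ..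
  moreover have "\<forall>x\<in>mspace M. \<forall>y\<in>mspace M. mdist P ((g \<circ> f) x) ((g \<circ> f) y) = mdist M x y"
  proof (intro ballI)
    fix x y assume "x \<in> mspace M" "y \<in> mspace M"
    then show "mdist P ((g \<circ> f) x) ((g \<circ> f) y) = mdist M x y"
      using fg(3,4) imageI[of _ "mspace M" f, unfolded fg(1)] by simp
  qed
  ultimately show "\<exists>h. (h ` mspace M \<subseteq> mspace P \<and> (\<forall>x\<in>mspace M. \<forall>y\<in>mspace M. mdist P (h x) (h y) = mdist M x y)) \<and> h ` mspace M = mspace P"
    by (intro exI[of _ "g \<circ> f"]) simp
qed

lemma isometric_sym: assumes "isometric M N" shows "isometric N M"
proof -
  obtain f where f: "f ` mspace M = mspace N" "\<forall>x\<in>mspace M. \<forall>y\<in>mspace M. mdist N (f x) (f y) = mdist M x y"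
    using assms by (auto simp: isometric_def isometric_embedding_def)
  let ?g = "inv_into (mspace M) f"
  have g: "?g y \<in> mspace M" "f (?g y) = y" if "y \<in> mspace N" for y
    using that f(1) by (metis inv_into_into, metis f_inv_into_f)
  have "mdist M (?g x) (?g y) = mdist N x y" if "x \<in> mspace N" "y \<in> mspace N" for x y
    using f(2) g that by metis
  moreover have "?g ` mspace N = mspace M"
  proof
    show "?g ` mspace N \<subseteq> mspace M" using g by blast
    show "mspace M \<subseteq> ?g ` mspace N"
    proof
      fix x assume x: "x \<in> mspace M"
      then have fx: "f x \<in> mspace N" using f(1) by blast
      then have "mdist M (?g (f x)) x = mdist N (f (?g (f x))) (f x)" using f(2) g(1) x by simp
      also have "\<dots> = 0" using g(2)[OF fx] fx by simp
      finally have "?g (f x) = x" using g(1)[OF fx] x by simp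
      then show "x \<in> ?g ` mspace N" using fx by (metis imageI)
    qed
  qed
  ultimately show ?thesis unfolding isometric_def isometric_embedding_def by (intro exI[of _ ?g]) auto
qed

section \<open>Distortion of correspondences and the Gromov-Hausdorff distance\<close>

lemma compact_metric_bounded:
  assumes "compact_metric M"
  obtains B where "0 \<le> B" "\<forall>x\<in>mspace M. \<forall>y\<in>mspace M. mdist M x y \<le> B"
proof -
  interpret Metric_space "mspace M" "mdist M" by simp
  have "mbounded (mspace M)"
    using assms by (intro compactin_imp_mbounded) (simp add: compact_metric_def compact_space_def mtopology_of_eq)
  then obtain B where "\<forall>x\<in>mspace M. \<forall>y\<in>mspace M. mdist M x y \<le> B" by (auto simp: mbounded_alt)
  then show thesis using that[of "max 0 B"] by (meson max.cobounded1 max.coboundedI2)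
qed

lemma metric_on_simps:
  assumes "\<And>x y. x \<in> S \<Longrightarrow> y \<in> S \<Longrightarrow> 0 \<le> d x y" "\<And>x y. x \<in> S \<Longrightarrow> y \<in> S \<Longrightarrow> d x y = d y x"
    "\<And>x y. x \<in> S \<Longrightarrow> y \<in> S \<Longrightarrow> d x y = 0 \<longleftrightarrow> x = y"
    "\<And>x y z. x \<in> S \<Longrightarrow> y \<in> S \<Longrightarrow> z \<in> S \<Longrightarrow> d x z \<le> d x y + d y z"
  shows "mspace (metric_on S d) = S" "x \<in> S \<Longrightarrow> y \<in> S \<Longrightarrow> mdist (metric_on S d) x y = d x y"
proof -
  have "Metric_space S (\<lambda>x y. if x \<in> S \<and> y \<in> S then d x y else 0)"
    by standard (use assms in auto)
  then show "mspace (metric_on S d) = S" "x \<in> S \<Longrightarrow> y \<in> S \<Longrightarrow> mdist (metric_on S d) x y = d x y"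
    unfolding metric_on_def by (simp_all add: Metric_space.mspace_metric Metric_space.mdist_metric)
qed

text \<open>Compact spaces are bounded, so the two images lie at finite Hausdorff distance. This
  makes the sets under the infimum in \<open>hausdorff_dist\<close> nonempty.\<close>

lemma embeddings_bounded:
  assumes M: "compact_metric M" and N: "compact_metric N"
    and f: "isometric_embedding M Z f" and g: "isometric_embedding N Z g"
  obtains r where "0 \<le> r" "\<forall>a\<in>f ` mspace M. \<exists>b\<in>g ` mspace N. mdist Z a b \<le> r"
    "\<forall>b\<in>g ` mspace N. \<exists>a\<in>f ` mspace M. mdist Z a b \<le> r"
proof -
  obtain B where B: "0 \<le> B" "\<forall>x\<in>mspace M. \<forall>y\<in>mspace M. mdist M x y \<le> B" by (rule compact_metric_bounded[OF M])
  obtain C where C: "0 \<le> C" "\<forall>x\<in>mspace N. \<forall>y\<in>mspace N. mdist N x y \<le> C" by (rule compact_metric_bounded[OF N])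
  obtain x0 y0 where 0: "x0 \<in> mspace M" "y0 \<in> mspace N" using M N by (auto simp: compact_metric_def)
  let ?r = "B + mdist Z (f x0) (g y0) + C"
  have "mdist Z (f x) (g y) \<le> ?r" if "x \<in> mspace M" "y \<in> mspace N" for x y
  proof -
    have Z: "f x \<in> mspace Z" "f x0 \<in> mspace Z" "g y \<in> mspace Z" "g y0 \<in> mspace Z"
      using that 0 f g by (auto simp: isometric_embedding_def)
    have "mdist Z (f x) (g y) \<le> mdist Z (f x) (f x0) + mdist Z (f x0) (g y)"
      using Z by (intro mdist_triangle)
    moreover have "mdist Z (f x0) (g y) \<le> mdist Z (f x0) (g y0) + mdist Z (g y0) (g y)"
      using Z by (intro mdist_triangle)
    moreover have "mdist Z (f x) (f x0) \<le> B" "mdist Z (g y0) (g y) \<le> C"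
      using f g B C that 0 by (auto simp: isometric_embedding_def)
    ultimately show ?thesis by simp
  qed
  then show thesis using that[of ?r] 0 B C by (smt (verit, best) imageE imageI mdist_nonneg)
qed

context
  fixes M :: "'a metric" and N :: "'b metric"
  assumes M: "compact_metric M" and N: "compact_metric N"
begin

text \<open>The spaces are glued along the correspondence: each pair in \<open>R\<close> becomes a
  bridge of length \<open>r\<close>, and points on different sides are joined by the best path over
  one bridge. A path over two bridges spends \<open>2 * r\<close> on them, which compensates the
  distortion.\<close>

lemma near_ambient:
  assumes near: "near M N (2 * r)" and r: "0 < r"
  obtains Z :: "('a + 'b) metric" where
    "isometric_embedding M Z Inl" "isometric_embedding N Z Inr"
    "hausdorff_dist (mdist Z) (Inl ` mspace M) (Inr ` mspace N) \<le> r"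
proof -
  obtain R where R: "R \<subseteq> mspace M \<times> mspace N" "\<forall>x\<in>mspace M. \<exists>y. (x, y) \<in> R" "\<forall>y\<in>mspace N. \<exists>x. (x, y) \<in> R"
    "\<forall>x y x' y'. (x, y) \<in> R \<longrightarrow> (x', y') \<in> R \<longrightarrow> \<bar>mdist M x x' - mdist N y y'\<bar> \<le> 2 * r"
    by (rule nearE[OF near])
  have Rne: "R \<noteq> {}" using M R(2) by (auto simp: compact_metric_def)
  define T where "T x y p = mdist M x (fst p) + r + mdist N (snd p) y" for x y p
  define \<delta> where "\<delta> x y = (INF p\<in>R. T x y p)" for x y
  have T0: "r \<le> T x y p" for x y p using r by (simp add: T_def)
  have bdd: "bdd_below (T x y ` R)" for x y using T0 by (intro bdd_belowI[of _ r]) auto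
  have \<delta>_le: "p \<in> R \<Longrightarrow> \<delta> x y \<le> T x y p" for x y p unfolding \<delta>_def by (rule cINF_lower[OF bdd])
  have \<delta>_ge: "(\<And>p. p \<in> R \<Longrightarrow> c \<le> T x y p) \<Longrightarrow> c \<le> \<delta> x y" for c x y
    unfolding \<delta>_def by (rule cINF_greatest[OF Rne])
  have \<delta>r: "r \<le> \<delta> x y" for x y by (rule \<delta>_ge) (rule T0)
  have RM: "fst p \<in> mspace M" "snd p \<in> mspace N" if "p \<in> R" for p using that R(1) by auto
  have \<delta>1: "\<delta> x y \<le> mdist M x x' + \<delta> x' y" if "x \<in> mspace M" "x' \<in> mspace M" for x x' y
  proof -
    have "\<delta> x y - mdist M x x' \<le> \<delta> x' y"
    proof (rule \<delta>_ge)
      fix p assume p: "p \<in> R"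
      have "\<delta> x y \<le> T x y p" by (rule \<delta>_le[OF p])
      also have "\<dots> \<le> mdist M x x' + T x' y p"
        using mdist_triangle[OF that RM(1)[OF p]] by (simp add: T_def)
      finally show "\<delta> x y - mdist M x x' \<le> T x' y p" by simp
    qed
    then show ?thesis by simp
  qed
  have \<delta>2: "\<delta> x y \<le> \<delta> x y' + mdist N y' y" if "y \<in> mspace N" "y' \<in> mspace N" for x y y'
  proof -
    have "\<delta> x y - mdist N y' y \<le> \<delta> x y'"
    proof (rule \<delta>_ge)
      fix p assume p: "p \<in> R"
      have "\<delta> x y \<le> T x y p" by (rule \<delta>_le[OF p])
      also have "\<dots> \<le> mdist N y' y + T x y' p"
        using mdist_triangle[OF RM(2)[OF p] that(2,1)] by (simp add: T_def)
      finally show "\<delta> x y - mdist N y' y \<le> T x y' p" by simp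
    qed
    then show ?thesis by simp
  qed
  \<comment> \<open>Here the distortion enters: a path that leaves one side by the bridge
    \<open>p\<close> and returns by \<open>q\<close> is no shorter than the distance on that
    side.\<close>
  have key: "mdist M x x' \<le> T x y p + T x' y q \<and> mdist N y y' \<le> T x y p + T x y' q"
    if "p \<in> R" "q \<in> R" "x \<in> mspace M" "x' \<in> mspace M" "y \<in> mspace N" "y' \<in> mspace N" for x x' y y' p q
  proof -
    have a: "\<bar>mdist M (fst p) (fst q) - mdist N (snd p) (snd q)\<bar> \<le> 2 * r"
      using R(4) that(1,2) by (metis prod.collapse)
    note p = RM[OF that(1)] and q = RM[OF that(2)]
    have "mdist M x x' \<le> mdist M x (fst p) + mdist M (fst p) x'" by (intro mdist_triangle that p)
    moreover have "mdist M (fst p) x' \<le> mdist M (fst p) (fst q) + mdist M (fst q) x'" by (intro mdist_triangle that p q)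
    moreover have "mdist N (snd p) (snd q) \<le> mdist N (snd p) y + mdist N y (snd q)" by (intro mdist_triangle that p q)
    moreover have "mdist N y y' \<le> mdist N y (snd p) + mdist N (snd p) y'" by (intro mdist_triangle that p)
    moreover have "mdist N (snd p) y' \<le> mdist N (snd p) (snd q) + mdist N (snd q) y'" by (intro mdist_triangle that p q)
    moreover have "mdist M (fst p) (fst q) \<le> mdist M (fst p) x + mdist M x (fst q)" by (intro mdist_triangle that p q)
    ultimately show ?thesis using a
      unfolding T_def mdist_commute[of M "fst q" x'] mdist_commute[of M "fst p" x]
          mdist_commute[of N y "snd p"] mdist_commute[of N y "snd q"] by linarith
  qed
  have \<delta>3: "mdist M x x' \<le> \<delta> x y + \<delta> x' y" if "x \<in> mspace M" "x' \<in> mspace M" "y \<in> mspace N" for x x' y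
  proof -
    have "mdist M x x' - T x y p \<le> \<delta> x' y" if "p \<in> R" for p
      by (rule \<delta>_ge) (use key[OF that _ \<open>x \<in> mspace M\<close> \<open>x' \<in> mspace M\<close> \<open>y \<in> mspace N\<close> \<open>y \<in> mspace N\<close>] in fastforce)
    then have "mdist M x x' - \<delta> x' y \<le> \<delta> x y" by (intro \<delta>_ge) (simp add: algebra_simps)
    then show ?thesis by simp
  qed
  have \<delta>4: "mdist N y y' \<le> \<delta> x y + \<delta> x y'" if "x \<in> mspace M" "y \<in> mspace N" "y' \<in> mspace N" for x y y'
  proof -
    have "mdist N y y' - T x y p \<le> \<delta> x y'" if "p \<in> R" for p
      by (rule \<delta>_ge) (use key[OF that _ \<open>x \<in> mspace M\<close> \<open>x \<in> mspace M\<close> \<open>y \<in> mspace N\<close> \<open>y' \<in> mspace N\<close>] in fastforce)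
    then have "mdist N y y' - \<delta> x y' \<le> \<delta> x y" by (intro \<delta>_ge) (simp add: algebra_simps)
    then show ?thesis by simp
  qed
  define D where "D u v = (case u of Inl x \<Rightarrow> (case v of Inl x' \<Rightarrow> mdist M x x' | Inr y \<Rightarrow> \<delta> x y)
      | Inr y \<Rightarrow> (case v of Inl x \<Rightarrow> \<delta> x y | Inr y' \<Rightarrow> mdist N y y'))" for u v
  let ?S = "mspace M <+> mspace N"
  \<comment> \<open>Positivity of \<open>r\<close> keeps points of different sides apart, as a
    metric requires.\<close>
  have \<delta>0: "0 < \<delta> x y" "\<delta> x y \<noteq> 0" "0 \<le> \<delta> x y" for x y using \<delta>r[of x y] r by auto
  have tri: "D u w \<le> D u v + D v w" if "u \<in> ?S" "v \<in> ?S" "w \<in> ?S" for u v w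
    using that by (auto simp: D_def intro: mdist_triangle \<delta>1 \<delta>2 \<delta>3 \<delta>4)
      (use \<delta>1 \<delta>2 mdist_commute in \<open>metis add.commute\<close>)+
  have Z: "mspace (metric_on ?S D) = ?S" "\<And>u v. u \<in> ?S \<Longrightarrow> v \<in> ?S \<Longrightarrow> mdist (metric_on ?S D) u v = D u v"
    by (rule metric_on_simps; use \<delta>0 tri in \<open>auto simp: D_def mdist_commute split: sum.splits\<close>)+
  have ZM: "mdist (metric_on ?S D) (Inl x) (Inl x') = mdist M x x'" if "x \<in> mspace M" "x' \<in> mspace M" for x x'
    using Z(2)[OF InlI[OF that(1)] InlI[OF that(2)]] by (simp add: D_def)
  have ZN: "mdist (metric_on ?S D) (Inr y) (Inr y') = mdist N y y'" if "y \<in> mspace N" "y' \<in> mspace N" for y y'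
    using Z(2)[OF InrI[OF that(1)] InrI[OF that(2)]] by (simp add: D_def)
  have ZR: "mdist (metric_on ?S D) (Inl x) (Inr y) = \<delta> x y" if "x \<in> mspace M" "y \<in> mspace N" for x y
    using Z(2)[OF InlI[OF that(1)] InrI[OF that(2)]] by (simp add: D_def)
  show thesis
  proof (rule that[of "metric_on ?S D"])
    show "isometric_embedding M (metric_on ?S D) Inl" "isometric_embedding N (metric_on ?S D) Inr"
      unfolding isometric_embedding_def Z(1) using ZM ZN by auto
    have \<delta>R: "\<delta> x y \<le> r" if "(x, y) \<in> R" for x y
      using \<delta>_le[OF that, of x y] RM[OF that]
      by (simp add: T_def Metric_space.mdist_zero[OF Metric_space_mspace_mdist])
    show "hausdorff_dist (mdist (metric_on ?S D)) (Inl ` mspace M) (Inr ` mspace N) \<le> r"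
    proof (rule hausdorff_dist_le)
      show "\<forall>a\<in>Inl ` mspace M. \<exists>b\<in>Inr ` mspace N. mdist (metric_on ?S D) a b \<le> r"
      proof
        fix a :: "'a + 'b" assume "a \<in> Inl ` mspace M"
        then obtain x y where "a = Inl x" "x \<in> mspace M" "(x, y) \<in> R" using R(2) by auto
        moreover from this have "y \<in> mspace N" using R(1) by auto
        ultimately show "\<exists>b\<in>Inr ` mspace N. mdist (metric_on ?S D) a b \<le> r" using \<delta>R ZR by auto
      qed
      show "\<forall>b\<in>Inr ` mspace N. \<exists>a\<in>Inl ` mspace M. mdist (metric_on ?S D) a b \<le> r"
      proof
        fix b :: "'a + 'b" assume "b \<in> Inr ` mspace N"
        then obtain x y where "b = Inr y" "y \<in> mspace N" "(x, y) \<in> R" using R(3) by auto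
        moreover from this have "x \<in> mspace M" using R(1) by auto
        ultimately show "\<exists>a\<in>Inl ` mspace M. mdist (metric_on ?S D) a b \<le> r" using \<delta>R ZR by auto
      qed
    qed (use r in simp)
  qed
qed

lemma near_bound: obtains r where "0 < r" "near M N (2 * r)"
proof -
  obtain B where B: "0 \<le> B" "\<forall>x\<in>mspace M. \<forall>y\<in>mspace M. mdist M x y \<le> B" by (rule compact_metric_bounded[OF M])
  obtain C where C: "0 \<le> C" "\<forall>x\<in>mspace N. \<forall>y\<in>mspace N. mdist N x y \<le> C" by (rule compact_metric_bounded[OF N])
  have "\<bar>mdist M x x' - mdist N y y'\<bar> \<le> B + C"
    if "x \<in> mspace M" "x' \<in> mspace M" "y \<in> mspace N" "y' \<in> mspace N" for x x' y y'
    using B C that by (smt (verit, best) mdist_nonneg)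
  then have "near M N (B + C)"
    using M N unfolding near_def compact_metric_def by (intro exI[of _ "mspace M \<times> mspace N"]) auto
  then have "near M N (2 * (B + C + 1))" by (rule near_mono) (use B C in simp)
  then show thesis using that[of "B + C + 1"] B C by simp
qed

lemma hausdorff_dist_embedded_nonneg:
  assumes "isometric_embedding M Z f" "isometric_embedding N Z g"
  shows "0 \<le> hausdorff_dist (mdist Z) (f ` mspace M) (g ` mspace N)"
proof -
  obtain r where "0 \<le> r" "\<forall>a\<in>f ` mspace M. \<exists>b\<in>g ` mspace N. mdist Z a b \<le> r"
    "\<forall>b\<in>g ` mspace N. \<exists>a\<in>f ` mspace M. mdist Z a b \<le> r" by (rule embeddings_bounded[OF M N assms])
  then show ?thesis by (rule hausdorff_dist_nonneg)
qed

lemma GH_values_bdd_below: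
  "bdd_below {hausdorff_dist (mdist Z) (f ` mspace M) (g ` mspace N) | (Z :: ('a + 'b) metric) f g.
            isometric_embedding M Z f \<and> isometric_embedding N Z g}"
  by (rule bdd_belowI[of _ 0]) (auto intro: hausdorff_dist_embedded_nonneg)

lemma GH_values_nonempty:
  "{hausdorff_dist (mdist Z) (f ` mspace M) (g ` mspace N) | (Z :: ('a + 'b) metric) f g.
            isometric_embedding M Z f \<and> isometric_embedding N Z g} \<noteq> {}"
proof -
  obtain r where r: "near M N (2 * r)" "0 < r" by (rule near_bound)
  obtain Z :: "('a + 'b) metric" where "isometric_embedding M Z Inl" "isometric_embedding N Z Inr"
    by (rule near_ambient[OF r])
  then show ?thesis by blast
qed

lemma GH_dist_nonneg: "0 \<le> GH_dist M N"
  unfolding GH_dist_def using GH_values_nonempty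
  by (rule cInf_greatest) (auto intro: hausdorff_dist_embedded_nonneg)

lemma GH_dist_le: assumes "near M N (2 * r)" "0 < r" shows "GH_dist M N \<le> r"
proof -
  obtain Z :: "('a + 'b) metric" where Z:
    "isometric_embedding M Z Inl" "isometric_embedding N Z Inr"
    "hausdorff_dist (mdist Z) (Inl ` mspace M) (Inr ` mspace N) \<le> r"
    by (rule near_ambient[OF assms])
  have "GH_dist M N \<le> hausdorff_dist (mdist Z) (Inl ` mspace M) (Inr ` mspace N)"
    unfolding GH_dist_def by (rule cInf_lower[OF _ GH_values_bdd_below]) (use Z in blast)
  then show ?thesis using Z by simp
qed

lemma GH_dist_less: assumes "GH_dist M N < r" shows "near M N (2 * r)"
proof -
  obtain Z :: "('a + 'b) metric" and f g where Z: "isometric_embedding M Z f" "isometric_embedding N Z g"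
    "hausdorff_dist (mdist Z) (f ` mspace M) (g ` mspace N) < r"
    using cInf_lessD[OF GH_values_nonempty assms[unfolded GH_dist_def]] by blast
  have ne: "{r. 0 \<le> r \<and> (\<forall>a\<in>f ` mspace M. \<exists>b\<in>g ` mspace N. mdist Z a b \<le> r) \<and> (\<forall>b\<in>g ` mspace N. \<exists>a\<in>f ` mspace M. mdist Z a b \<le> r)} \<noteq> {}"
  proof -
    obtain r where "0 \<le> r" "\<forall>a\<in>f ` mspace M. \<exists>b\<in>g ` mspace N. mdist Z a b \<le> r"
      "\<forall>b\<in>g ` mspace N. \<exists>a\<in>f ` mspace M. mdist Z a b \<le> r" by (rule embeddings_bounded[OF M N Z(1,2)])
    then show ?thesis by blast
  qed
  obtain s where s: "s < r" "\<forall>a\<in>f ` mspace M. \<exists>b\<in>g ` mspace N. mdist Z a b \<le> s"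
    "\<forall>b\<in>g ` mspace N. \<exists>a\<in>f ` mspace M. mdist Z a b \<le> s"
    using cInf_lessD[OF ne Z(3)[unfolded hausdorff_dist_def]] by blast
  \<comment> \<open>Points at distance at most \<open>s\<close> in the ambient space are paired;
    moving both endpoints changes a distance by at most \<open>2 * s\<close>.\<close>
  define R where "R = {(x, y). x \<in> mspace M \<and> y \<in> mspace N \<and> mdist Z (f x) (g y) \<le> s}"
  have "\<bar>mdist M x x' - mdist N y y'\<bar> \<le> 2 * r" if "(x, y) \<in> R" "(x', y') \<in> R" for x y x' y'
  proof -
    have m: "f x \<in> mspace Z" "f x' \<in> mspace Z" "g y \<in> mspace Z" "g y' \<in> mspace Z"
      using that Z by (auto simp: R_def isometric_embedding_def)
    have e: "mdist M x x' = mdist Z (f x) (f x')" "mdist N y y' = mdist Z (g y) (g y')"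
      using that Z by (auto simp: R_def isometric_embedding_def)
    have "mdist Z (f x) (f x') \<le> mdist Z (f x) (g y) + mdist Z (g y) (f x')" by (intro mdist_triangle m)
    moreover have "mdist Z (g y) (f x') \<le> mdist Z (g y) (g y') + mdist Z (g y') (f x')" by (intro mdist_triangle m)
    moreover have "mdist Z (g y) (g y') \<le> mdist Z (g y) (f x) + mdist Z (f x) (g y')" by (intro mdist_triangle m)
    moreover have "mdist Z (f x) (g y') \<le> mdist Z (f x) (f x') + mdist Z (f x') (g y')" by (intro mdist_triangle m)
    moreover have "mdist Z (f x) (g y) \<le> s" "mdist Z (f x') (g y') \<le> s" using that by (auto simp: R_def)
    ultimately show ?thesis unfolding e using s(1) by (simp add: mdist_commute[of Z "g y" "f x"] mdist_commute[of Z "g y'" "f x'"])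
  qed
  moreover have "\<forall>x\<in>mspace M. \<exists>y. (x, y) \<in> R" "\<forall>y\<in>mspace N. \<exists>x. (x, y) \<in> R" "R \<subseteq> mspace M \<times> mspace N"
    using s(2,3) by (auto simp: R_def)
  ultimately show ?thesis unfolding near_def by blast
qed

end

lemma GH_dist_commute_le:
  assumes "compact_metric M" "compact_metric N" shows "GH_dist N M \<le> GH_dist M N"
proof (rule field_le_epsilon)
  fix e :: real assume e: "0 < e"
  have "near M N (2 * (GH_dist M N + e))" by (rule GH_dist_less[OF assms]) (use e in simp)
  then show "GH_dist N M \<le> GH_dist M N + e"
    using GH_dist_le[OF assms(2,1) near_sym] GH_dist_nonneg[OF assms] e by simp
qed

lemma GH_dist_commute:
  "compact_metric M \<Longrightarrow> compact_metric N \<Longrightarrow> GH_dist M N = GH_dist N M"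
  by (intro antisym GH_dist_commute_le)

lemma GH_dist_triangle:
  assumes "compact_metric M" "compact_metric N" "compact_metric P"
  shows "GH_dist M P \<le> GH_dist M N + GH_dist N P"
proof (rule field_le_epsilon)
  fix e :: real assume e: "0 < e"
  let ?a = "GH_dist M N + e/2" and ?b = "GH_dist N P + e/2"
  have "near M N (2 * ?a)" "near N P (2 * ?b)" by (rule GH_dist_less; use assms e in simp)+
  then have "near M P (2 * ?a + 2 * ?b)" by (rule near_trans)
  then have "near M P (2 * (GH_dist M N + GH_dist N P + e))" by (simp add: algebra_simps)
  then show "GH_dist M P \<le> GH_dist M N + GH_dist N P + e"
    using GH_dist_nonneg[OF assms(1,2)] GH_dist_nonneg[OF assms(2,3)] e
    by (intro GH_dist_le assms) auto
qed

text \<open>The closures of the tails are nested and meet by compactness. Cluster points take the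
  place of convergent subsequences because the product spaces below may have uncountably many
  factors, and then need not be sequentially compact.\<close>

lemma compact_space_cluster_point:
  assumes X: "compact_space X" and x: "\<And>n::nat. x n \<in> topspace X"
  obtains z where "z \<in> topspace X" "\<forall>U n. openin X U \<longrightarrow> z \<in> U \<longrightarrow> (\<exists>k\<ge>n. x k \<in> U)"
proof -
  let ?C = "\<lambda>n. X closure_of (x ` {n..})"
  have "(\<Inter>n. ?C n) \<noteq> {}"
  proof (rule compact_space_imp_nest[OF X])
    show "?C n \<noteq> {}" for n
      using closure_of_subset_Int[of X "x ` {n..}"] x by fastforce
    show "decseq ?C" by (intro antimonoI closure_of_mono image_mono) auto
  qed simp
  then obtain z where z: "\<And>n. z \<in> ?C n" by auto
  show thesis
  proof (rule that)
    show "z \<in> topspace X" using z closure_of_subset_topspace by fastforce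
    show "\<forall>U n. openin X U \<longrightarrow> z \<in> U \<longrightarrow> (\<exists>k\<ge>n. x k \<in> U)"
      using z unfolding in_closure_of by fastforce
  qed
qed

text \<open>Almost isometric maps, selected from correspondences of small distortion, are points of
  a product of copies of \<open>N\<close>, which is compact by Tychonoff. Any cluster point
  preserves distances exactly.\<close>

lemma near_zero_embedding:
  assumes M: "compact_metric M" and N: "compact_metric N" and near: "\<And>e. 0 < e \<Longrightarrow> near M N e"
  obtains f where "isometric_embedding M N f"
proof -
  define e where "e n = inverse (real (Suc n))" for n
  have e: "0 < e n" for n by (simp add: e_def)
  have e0: "e \<longlonglongrightarrow> 0" unfolding e_def by (rule LIMSEQ_inverse_real_of_nat)
  have "\<exists>\<phi>\<in>mspace M \<rightarrow>\<^sub>E mspace N. \<forall>x\<in>mspace M. \<forall>x'\<in>mspace M. \<bar>mdist M x x' - mdist N (\<phi> x) (\<phi> x')\<bar> \<le> e n" for n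
  proof -
    obtain R where R: "R \<subseteq> mspace M \<times> mspace N" "\<forall>x\<in>mspace M. \<exists>y. (x, y) \<in> R" "\<forall>y\<in>mspace N. \<exists>x. (x, y) \<in> R"
      "\<forall>x y x' y'. (x, y) \<in> R \<longrightarrow> (x', y') \<in> R \<longrightarrow> \<bar>mdist M x x' - mdist N y y'\<bar> \<le> e n"
      by (rule nearE[OF near[OF e]])
    then obtain \<phi> where \<phi>: "\<And>x. x \<in> mspace M \<Longrightarrow> (x, \<phi> x) \<in> R" by metis
    show ?thesis
    proof (intro bexI[of _ "restrict \<phi> (mspace M)"] ballI)
      show "restrict \<phi> (mspace M) \<in> mspace M \<rightarrow>\<^sub>E mspace N" using \<phi> R(1) by auto
    qed (use \<phi> R(4) in auto)
  qed
  then obtain \<phi> where \<phi>: "\<And>n. \<phi> n \<in> mspace M \<rightarrow>\<^sub>E mspace N"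
    "\<And>n x x'. x \<in> mspace M \<Longrightarrow> x' \<in> mspace M \<Longrightarrow> \<bar>mdist M x x' - mdist N (\<phi> n x) (\<phi> n x')\<bar> \<le> e n" by metis
  let ?P = "product_topology (\<lambda>_. mtopology_of N) (mspace M)"
  have tP: "topspace ?P = mspace M \<rightarrow>\<^sub>E mspace N" by simp
  have cP: "compact_space ?P" using N by (simp add: compact_space_product_topology compact_metric_def)
  have \<phi>P: "\<phi> n \<in> topspace ?P" for n using \<phi>(1) unfolding tP .
  obtain \<psi> where \<psi>: "\<psi> \<in> topspace ?P" "\<forall>U n. openin ?P U \<longrightarrow> \<psi> \<in> U \<longrightarrow> (\<exists>k\<ge>n. \<phi> k \<in> U)"
    by (rule compact_space_cluster_point[OF cP \<phi>P])
  interpret N: Metric_space "mspace N" "mdist N" by simp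
  have \<psi>N: "x \<in> mspace M \<Longrightarrow> \<psi> x \<in> mspace N" for x using \<psi>(1) unfolding tP by auto
  have "mdist N (\<psi> x) (\<psi> x') = mdist M x x'" if x: "x \<in> mspace M" "x' \<in> mspace M" for x x'
  proof -
    \<comment> \<open>One \<open>e n\<close> for the distortion of \<open>\<phi> k\<close>, and one
      for each of the two points moved from their place under \<open>\<psi>\<close> to that under
      \<open>\<phi> k\<close>.\<close>
    have "\<bar>mdist N (\<psi> x) (\<psi> x') - mdist M x x'\<bar> \<le> 3 * e n" for n
    proof -
      let ?U = "\<lambda>x. {\<eta> \<in> topspace ?P. \<eta> x \<in> N.mball (\<psi> x) (e n)}"
      have U: "openin ?P (?U x)" if "x \<in> mspace M" for x
        using continuous_map_product_projection[OF that, of "\<lambda>_. mtopology_of N"]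
        by (rule openin_continuous_map_preimage) (simp add: mtopology_of_eq)
      have "openin ?P (?U x \<inter> ?U x')" using U x by blast
      moreover have "\<psi> \<in> ?U x \<inter> ?U x'" using \<psi>(1) \<psi>N x e by auto
      ultimately obtain k where k: "k \<ge> n" "\<phi> k \<in> ?U x \<inter> ?U x'" using \<psi>(2) by meson
      then have d: "mdist N (\<psi> x) (\<phi> k x) < e n" "mdist N (\<psi> x') (\<phi> k x') < e n" 
        and m: "\<phi> k x \<in> mspace N" "\<phi> k x' \<in> mspace N" by auto
      have "\<bar>mdist M x x' - mdist N (\<phi> k x) (\<phi> k x')\<bar> \<le> e k" by (rule \<phi>(2)[OF x])
      also have "e k \<le> e n" using k(1) by (simp add: e_def)
      finally have 1: "\<bar>mdist M x x' - mdist N (\<phi> k x) (\<phi> k x')\<bar> \<le> e n" .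
      note p = \<psi>N[OF x(1)] \<psi>N[OF x(2)]
      have "mdist N (\<psi> x) (\<psi> x') \<le> mdist N (\<psi> x) (\<phi> k x) + mdist N (\<phi> k x) (\<psi> x')" by (intro mdist_triangle p m)
      moreover have "mdist N (\<phi> k x) (\<psi> x') \<le> mdist N (\<phi> k x) (\<phi> k x') + mdist N (\<phi> k x') (\<psi> x')" by (intro mdist_triangle p m)
      moreover have "mdist N (\<phi> k x) (\<phi> k x') \<le> mdist N (\<phi> k x) (\<psi> x) + mdist N (\<psi> x) (\<phi> k x')" by (intro mdist_triangle p m)
      moreover have "mdist N (\<psi> x) (\<phi> k x') \<le> mdist N (\<psi> x) (\<psi> x') + mdist N (\<psi> x') (\<phi> k x')" by (intro mdist_triangle p m)
      ultimately show ?thesis using 1 d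
        by (simp add: mdist_commute[of N "\<phi> k x" "\<psi> x"] mdist_commute[of N "\<phi> k x'" "\<psi> x'"])
    qed
    moreover have "(\<lambda>n. 3 * e n) \<longlonglongrightarrow> 3 * 0" by (intro tendsto_mult tendsto_const e0)
    ultimately have "\<bar>mdist N (\<psi> x) (\<psi> x') - mdist M x x'\<bar> \<le> 0"
      by (intro LIMSEQ_le_const[where X="\<lambda>n. 3 * e n"]) auto
    then show ?thesis by simp
  qed
  then have "isometric_embedding M N \<psi>" using \<psi>N by (auto simp: isometric_embedding_def)
  then show thesis by (rule that)
qed

lemma compact_metric_totally_bounded:
  assumes "compact_metric M" "0 < e"
  obtains K where "finite K" "K \<subseteq> mspace M" "\<forall>x\<in>mspace M. \<exists>y\<in>K. mdist M y x < e"
proof -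
  interpret Metric_space "mspace M" "mdist M" by simp
  have "mtotally_bounded (mspace M)"
    using assms(1) compact_space_eq_mcomplete_mtotally_bounded by (simp add: compact_metric_def mtopology_of_eq)
  then obtain K where K: "finite K" "K \<subseteq> mspace M" "mspace M \<subseteq> (\<Union>x\<in>K. mball x e)"
    using assms(2) unfolding mtotally_bounded_def by (elim allE[of _ e] impE exE conjE) simp_all
  have "\<exists>y\<in>K. mdist M y x < e" if "x \<in> mspace M" for x
    using subsetD[OF K(3) that] by auto
  with K(1,2) that show thesis by blast
qed

text \<open>A missed point \<open>y\<close> has some distance \<open>e\<close> from the range. Two
  terms of its orbit are the isometric image of \<open>y\<close> and a point of the range, so the
  orbit is \<open>e\<close>-separated, against total boundedness.\<close>

lemma compact_self_isometry_surj:
  assumes M: "compact_metric M" and f: "isometric_embedding M M f"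
  shows "f ` mspace M = mspace M"
proof (rule ccontr)
  assume "f ` mspace M \<noteq> mspace M"
  then obtain y where y: "y \<in> mspace M" "y \<notin> f ` mspace M" using f by (auto simp: isometric_embedding_def)
  interpret Metric_space "mspace M" "mdist M" by simp
  have fM: "x \<in> mspace M \<Longrightarrow> f x \<in> mspace M" for x using f by (auto simp: isometric_embedding_def)
  have fd: "x \<in> mspace M \<Longrightarrow> x' \<in> mspace M \<Longrightarrow> mdist M (f x) (f x') = mdist M x x'" for x x'
    using f by (auto simp: isometric_embedding_def)
  have top: "mtopology_of M = mtopology" by (rule mtopology_of_eq)
  have "continuous_map (mtopology_of M) (mtopology_of M) f"
    by (rule isometry_continuous_map) (use fM fd in auto)
  then have "compactin mtopology (f ` mspace M)"
    using image_compactin[of mtopology "mspace M" mtopology f] M by (simp add: top compact_metric_def compact_space_def)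
  then have "closedin mtopology (f ` mspace M)" by (rule compactin_imp_closedin[OF Hausdorff_space_mtopology])
  then obtain e where e: "e > 0" "disjnt (f ` mspace M) (mball y e)" using y unfolding closedin_metric by blast
  have far: "e \<le> mdist M y (f x)" if "x \<in> mspace M" for x
    using e(2) fM[OF that] that y(1) by (force simp: disjnt_iff)
  have fn: "(f ^^ n) y \<in> mspace M" for n by (induction n) (use y fM in auto)
  have sep: "e \<le> mdist M ((f ^^ n) y) ((f ^^ (n + Suc k)) y)" for n k
  proof (induction n)
    case 0
    show ?case using far[OF fn[of k]] by simp
  next
    case (Suc n)
    have "(f ^^ (Suc n + Suc k)) y = f ((f ^^ (n + Suc k)) y)" "(f ^^ Suc n) y = f ((f ^^ n) y)" by simp_all
    then show ?case using Suc fd[OF fn[of n] fn[of "n + Suc k"]] by presburger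
  qed
  obtain K where K: "finite K" "K \<subseteq> mspace M" "\<forall>x\<in>mspace M. \<exists>y\<in>K. mdist M y x < e/2"
    by (rule compact_metric_totally_bounded[OF M, of "e/2"]) (use e in auto)
  have "\<exists>c. c \<in> K \<and> mdist M c ((f ^^ n) y) < e/2" for n using K(3) fn[of n] by blast
  then obtain c where c: "\<And>n. c n \<in> K" "\<And>n. mdist M (c n) ((f ^^ n) y) < e/2" by metis
  have "\<not> inj c" using K(1) c(1) by (meson finite_subset image_subsetI infinite_UNIV_nat finite_imageD)
  then obtain n m where nm: "n < m" "c n = c m" unfolding inj_def by (metis nat_neq_iff)
  then obtain k where k: "m = n + Suc k" using less_iff_Suc_add by auto
  have "mdist M ((f ^^ n) y) ((f ^^ m) y) \<le> mdist M ((f ^^ n) y) (c n) + mdist M (c n) ((f ^^ m) y)"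
    using fn K(2) c(1) by (intro mdist_triangle) auto
  also have "\<dots> < e/2 + e/2" using c(2)[of n] c(2)[of m] nm(2) by (simp add: mdist_commute)
  finally show False using sep[of n k] k by simp
qed

text \<open>Embeddings in both directions compose to a self-embedding of \<open>N\<close>, which is
  onto by compactness; hence the embedding of \<open>M\<close> is onto as well.\<close>

lemma near_zero_isometric:
  assumes M: "compact_metric M" and N: "compact_metric N" and near: "\<And>e. 0 < e \<Longrightarrow> near M N e"
  shows "isometric M N"
proof -
  obtain f where f: "isometric_embedding M N f" using near_zero_embedding[OF M N near] .
  obtain g where g: "isometric_embedding N M g" using near_zero_embedding[OF N M near_sym[OF near]] .
  have "isometric_embedding N N (f \<circ> g)" using f g by (auto simp: isometric_embedding_def image_subset_iff)
  then have "(f \<circ> g) ` mspace N = mspace N" by (rule compact_self_isometry_surj[OF N])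
  moreover have "(f \<circ> g) ` mspace N \<subseteq> f ` mspace M" using g by (auto simp: isometric_embedding_def)
  ultimately have "f ` mspace M = mspace N" using f by (auto simp: isometric_embedding_def)
  then show ?thesis using f by (auto simp: isometric_def)
qed

lemma compact_metric_isometric:
  assumes "compact_metric M" "isometric M N" shows "compact_metric N"
proof -
  obtain f where f: "f ` mspace M = mspace N" "\<And>x y. x \<in> mspace M \<Longrightarrow> y \<in> mspace M \<Longrightarrow> mdist N (f x) (f y) = mdist M x y"
    using assms(2) by (auto simp: isometric_def isometric_embedding_def)
  have "continuous_map (mtopology_of M) (mtopology_of N) f"
    by (rule isometry_continuous_map) (use f in auto)
  then have "compactin (mtopology_of N) (mspace N)"
    using image_compactin[of "mtopology_of M" "mspace M" "mtopology_of N" f] assms(1) f(1)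
    by (simp add: compact_metric_def compact_space_def)
  then show ?thesis using assms(1) f(1) by (auto simp: compact_metric_def compact_space_def)
qed

lemma compact_metric_separable:
  assumes "compact_metric M" shows "separable_space (mtopology_of M)"
proof -
  interpret Metric_space "mspace M" "mdist M" by simp
  have "\<exists>K. finite K \<and> K \<subseteq> mspace M \<and> (\<forall>x\<in>mspace M. \<exists>y\<in>K. mdist M y x < inverse (real (Suc n)))" for n
    using compact_metric_totally_bounded[OF assms, of "inverse (real (Suc n))"] by (metis inverse_positive_iff_positive of_nat_0_less_iff zero_less_Suc)
  then obtain K where K: "\<And>n. finite (K n)" "\<And>n. K n \<subseteq> mspace M"
    "\<And>n x. x \<in> mspace M \<Longrightarrow> \<exists>y\<in>K n. mdist M y x < inverse (real (Suc n))" by metis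
  have "mtopology closure_of (\<Union>n. K n) = mspace M"
  proof
    show "mspace M \<subseteq> mtopology closure_of (\<Union>n. K n)"
    proof
      fix x assume x: "x \<in> mspace M"
      have "\<exists>y\<in>\<Union>n. K n. y \<in> mball x r" if r: "0 < r" for r
      proof -
        obtain n where n: "inverse (real (Suc n)) < r" using reals_Archimedean[OF r] by auto
        obtain y where y: "y \<in> K n" "mdist M y x < inverse (real (Suc n))" using K(3)[OF x] by blast
        then have "y \<in> mball x r" using n x K(2) by (auto simp: mdist_commute)
        with y(1) show ?thesis by blast
      qed
      then show "x \<in> mtopology closure_of (\<Union>n. K n)" using x by (auto simp: metric_closure_of)
    qed
  qed (use closure_of_subset_topspace[of mtopology] in simp)
  then show ?thesis unfolding separable_space_def mtopology_of_eq
    using K by (intro exI[of _ "\<Union>n. K n"]) (auto intro: countable_finite)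
qed

section \<open>Isometry classes as a metric space\<close>

lemma isometry_class_rep:
  fixes M :: "'c metric"
  assumes M: "compact_metric M"
  shows "isometry_class M \<in> GH_space" "compact_metric (rep (isometry_class M))" "isometric M (rep (isometry_class M))"
proof -
  interpret Metric_space "mspace M" "mdist M" by simp
  have "standard (borel_of mtopology)"
    by (rule standard_borel_of)
      (use M compact_metric_separable[OF M] compact_space_imp_mcomplete in \<open>auto simp: compact_metric_def mtopology_of_eq\<close>)
  then obtain e r where "\<forall>x\<in>space (borel_of mtopology). r (e x :: real) = x" using standardE by metis
  then have re: "\<And>x. x \<in> mspace M \<Longrightarrow> r (e x) = x" by simp
  obtain N :: "real metric" where N: "mspace N = e ` mspace M"
    "\<forall>x\<in>mspace M. \<forall>y\<in>mspace M. mdist N (e x) (e y) = mdist M x y"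
    by (rule real_metric_copy[OF re])
  have iso: "isometric M N" using N unfolding isometric_def isometric_embedding_def by (intro exI[of _ e]) auto
  have N: "compact_metric N" by (rule compact_metric_isometric[OF M iso])
  have "isometric M P \<longleftrightarrow> isometric N P" for P :: "real metric"
    using iso isometric_sym isometric_trans by metis
  then have "isometry_class M = isometry_class N" unfolding isometry_class_def by blast
  then show "isometry_class M \<in> GH_space" using N by (auto simp: GH_space_def)
  have "N \<in> isometry_class M" using N iso by (simp add: isometry_class_def)
  from rep_in[OF this] show "compact_metric (rep (isometry_class M))" "isometric M (rep (isometry_class M))"
    by (auto simp: isometry_class_def)
qed

lemma isometry_class_eq:
  assumes "isometric M N" shows "isometry_class M = isometry_class N"
  unfolding isometry_class_def using assms isometric_sym isometric_trans by (metis (no_types, lifting))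

lemma GH_space_rep:
  assumes "c \<in> GH_space"
  shows "compact_metric (rep c)" "isometry_class (rep c) = c"
proof -
  obtain M :: "real metric" where M: "compact_metric M" "c = isometry_class M" using assms by (auto simp: GH_space_def)
  show "compact_metric (rep c)" "isometry_class (rep c) = c"
    using isometry_class_rep[OF M(1)] M(2) isometry_class_eq[OF isometry_class_rep(3)[OF M(1)]] by simp_all
qed

definition GH_metric :: "real metric set metric" where
  "GH_metric = metric_on GH_space (\<lambda>c c'. GH_dist (rep c) (rep c'))"

text \<open>Distance 0 between representatives means correspondences of arbitrarily small
  distortion, hence isometry and equality of the classes. With the other axioms known,
  \<open>metric_on\<close> returns the intended distance.\<close>

lemma mspace_GH_metric: "mspace GH_metric = GH_space"
  and mdist_GH_metric: "c \<in> GH_space \<Longrightarrow> c' \<in> GH_space \<Longrightarrow> mdist GH_metric c c' = GH_dist (rep c) (rep c')"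
proof -
  have zero: "GH_dist (rep c) (rep c') = 0 \<longleftrightarrow> c = c'" if c: "c \<in> GH_space" "c' \<in> GH_space" for c c'
  proof
    assume 0: "GH_dist (rep c) (rep c') = 0"
    have "near (rep c) (rep c') e" if "0 < e" for e
      using GH_dist_less[of "rep c" "rep c'" "e/2"] GH_space_rep c 0 that by simp
    then have "isometric (rep c) (rep c')" using near_zero_isometric GH_space_rep c by blast
    then show "c = c'" using isometry_class_eq GH_space_rep c by metis
  next
    assume "c = c'"
    then have "near (rep c) (rep c') 0" using isometric_imp_near[OF isometric_refl] by simp
    then have "GH_dist (rep c) (rep c') \<le> 0 + e" if "0 < e" for e
      using GH_dist_le[OF GH_space_rep(1)[OF c(1)] GH_space_rep(1)[OF c(2)] near_mono[of _ _ 0 "2 * e"]] that by simp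
    then have "GH_dist (rep c) (rep c') \<le> 0" by (rule field_le_epsilon)
    then show "GH_dist (rep c) (rep c') = 0" using GH_dist_nonneg GH_space_rep c by (metis antisym)
  qed
  show "mspace GH_metric = GH_space"
    unfolding GH_metric_def
    by (rule metric_on_simps; (rule zero GH_dist_nonneg GH_dist_triangle GH_dist_commute; simp add: GH_space_rep)?)
  show "mdist GH_metric c c' = GH_dist (rep c) (rep c')" if "c \<in> GH_space" "c' \<in> GH_space"
    unfolding GH_metric_def
    by (rule metric_on_simps(2)[OF _ _ _ _ that]; (rule zero GH_dist_nonneg GH_dist_triangle GH_dist_commute; simp add: GH_space_rep)?)
qed

lemma GH_topology_eq: "GH_topology = mtopology_of GH_metric"
  by (simp add: GH_topology_def GH_metric_def)

text \<open>Finitely many classes approximate all of \<open>S\<close>, and each has a finite net. An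
  \<open>e\<close>-separated set in a nearby space injects into that net, which bounds its size
  uniformly.\<close>

lemma GH_precompact_separated:
  assumes pre: "precompact_in GH_topology S" and e: "0 < e"
  obtains n :: nat where "\<forall>c\<in>S. \<forall>T. finite T \<longrightarrow> T \<subseteq> mspace (rep c) \<longrightarrow>
      (\<forall>x\<in>T. \<forall>y\<in>T. x \<noteq> y \<longrightarrow> e \<le> mdist (rep c) x y) \<longrightarrow> card T \<le> n"
proof -
  interpret Metric_space GH_space "mdist GH_metric"
    using Metric_space_mspace_mdist[of GH_metric] by (simp add: mspace_GH_metric)
  have top: "GH_topology = mtopology" by (simp add: GH_topology_eq mtopology_of_eq mspace_GH_metric)
  have S: "S \<subseteq> GH_space" using pre by (simp add: precompact_in_def top)
  have "mtotally_bounded S"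
    using pre S unfolding precompact_in_def top
    by (meson compactin_imp_mtotally_bounded closure_of_subset mtotally_bounded_subset topspace_mtopology)
  \<comment> \<open>Radius \<open>e/8\<close> gives correspondences of distortion
    \<open>e/4\<close>. With nets of mesh \<open>e/4\<close>, two points sent to the same net point
    would be at distance below \<open>3/4 * e\<close>.\<close>
  then obtain K where K: "finite K" "K \<subseteq> S" "S \<subseteq> (\<Union>c\<in>K. mball c (e/8))"
    using e unfolding mtotally_bounded_def by (meson divide_pos_pos zero_less_numeral)
  have "\<exists>F. finite F \<and> F \<subseteq> mspace (rep c) \<and> (\<forall>x\<in>mspace (rep c). \<exists>y\<in>F. mdist (rep c) y x < e/4)" if "c \<in> K" for c
    using compact_metric_totally_bounded[of "rep c" "e/4"] GH_space_rep(1) K(2) S e that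
    by (metis divide_pos_pos subsetD zero_less_numeral)
  then obtain F where F: "\<And>c. c \<in> K \<Longrightarrow> finite (F c)" "\<And>c. c \<in> K \<Longrightarrow> F c \<subseteq> mspace (rep c)"
    "\<And>c x. c \<in> K \<Longrightarrow> x \<in> mspace (rep c) \<Longrightarrow> \<exists>y\<in>F c. mdist (rep c) y x < e/4" by metis
  let ?n = "\<Sum>c\<in>K. card (F c)"
  show thesis
  proof (rule that[of ?n], intro ballI allI impI)
    fix c T assume c: "c \<in> S" and T: "finite T" "T \<subseteq> mspace (rep c)" "\<forall>x\<in>T. \<forall>y\<in>T. x \<noteq> y \<longrightarrow> e \<le> mdist (rep c) x y"
    obtain k where k: "k \<in> K" "c \<in> mball k (e/8)" using K(3) c by blast
    have "GH_dist (rep k) (rep c) < e/8" using k(2) mdist_GH_metric[of k c] by simp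
    then have "near (rep k) (rep c) (2 * (e/8))"
      using GH_dist_less GH_space_rep(1) k(1) K(2) S c by (metis subsetD)
    then have "near (rep c) (rep k) (e/4)" using near_sym by fastforce
    then obtain R where R: "R \<subseteq> mspace (rep c) \<times> mspace (rep k)" "\<forall>x\<in>mspace (rep c). \<exists>y. (x, y) \<in> R"
      "\<forall>y\<in>mspace (rep k). \<exists>x. (x, y) \<in> R" "\<forall>x y x' y'. (x, y) \<in> R \<longrightarrow> (x', y') \<in> R \<longrightarrow> \<bar>mdist (rep c) x x' - mdist (rep k) y y'\<bar> \<le> e/4"
      by (rule nearE)
    have "\<exists>y z. (x, y) \<in> R \<and> z \<in> F k \<and> mdist (rep k) z y < e/4" if x: "x \<in> T" for x
    proof -
      obtain y where y: "(x, y) \<in> R" using R(2) T(2) x by blast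
      then have "y \<in> mspace (rep k)" using R(1) by blast
      then show ?thesis using F(3)[OF k(1)] y by blast
    qed
    then obtain p q where pq: "\<And>x. x \<in> T \<Longrightarrow> (x, p x) \<in> R" "\<And>x. x \<in> T \<Longrightarrow> q x \<in> F k" "\<And>x. x \<in> T \<Longrightarrow> mdist (rep k) (q x) (p x) < e/4"
      by metis
    have "inj_on q T"
    proof (rule inj_onI, rule ccontr)
      fix x y assume xy: "x \<in> T" "y \<in> T" "q x = q y" "x \<noteq> y"
      have m: "p x \<in> mspace (rep k)" "p y \<in> mspace (rep k)" "q x \<in> mspace (rep k)"
        using pq(1,2) xy R(1) F(2)[OF k(1)] by blast+
      have "mdist (rep k) (p x) (p y) \<le> mdist (rep k) (p x) (q x) + mdist (rep k) (q x) (p y)"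
        by (intro mdist_triangle m)
      also have "\<dots> < e/4 + e/4" using pq(3)[OF xy(1)] pq(3)[OF xy(2)] xy(3) by (simp add: mdist_commute)
      finally have "mdist (rep k) (p x) (p y) < e/2" by simp
      moreover have "\<bar>mdist (rep c) x y - mdist (rep k) (p x) (p y)\<bar> \<le> e/4" using R(4) pq(1) xy by blast
      moreover have "e \<le> mdist (rep c) x y" using T(3) xy by blast
      ultimately show False using e by linarith
    qed
    then have "card T \<le> card (F k)" using pq(2) F(1)[OF k(1)] by (intro card_inj_on_le[of q]) auto
    also have "\<dots> \<le> ?n" using K(1) k(1) by (intro member_le_sum) auto
    finally show "card T \<le> ?n" .
  qed
qed

section \<open>Compactness of the closed subsets of a compact space\<close>

lemma near_submetric:
  assumes A: "A \<subseteq> mspace K" and B: "B \<subseteq> mspace K"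
    and AB: "\<forall>x\<in>A. \<exists>y\<in>B. mdist K x y < e" "\<forall>y\<in>B. \<exists>x\<in>A. mdist K x y < e"
  shows "near (submetric K A) (submetric K B) (2 * e)"
proof -
  have ms: "mspace (submetric K A) = A" "mspace (submetric K B) = B" using A B by auto
  let ?R = "{(x, y). x \<in> A \<and> y \<in> B \<and> mdist K x y < e}"
  have "\<bar>mdist K x x' - mdist K y y'\<bar> \<le> 2 * e" if "(x, y) \<in> ?R" "(x', y') \<in> ?R" for x y x' y'
  proof -
    have m: "x \<in> mspace K" "y \<in> mspace K" "x' \<in> mspace K" "y' \<in> mspace K" using that A B by auto
    have "mdist K x x' \<le> mdist K x y + mdist K y x'" "mdist K y x' \<le> mdist K y y' + mdist K y' x'"
      "mdist K y y' \<le> mdist K y x + mdist K x y'" "mdist K x y' \<le> mdist K x x' + mdist K x' y'"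
      by (intro mdist_triangle m)+
    moreover have "mdist K x y < e" "mdist K x' y' < e" using that by auto
    ultimately show ?thesis unfolding mdist_commute[of K y x] mdist_commute[of K y' x'] by linarith
  qed
  then show ?thesis unfolding near_def ms mdist_submetric
    using AB by (intro exI[of _ ?R]) auto
qed

text \<open>Blaschke's selection argument: the distance functions of the sets \<open>A n\<close> have a cluster point
  in the product topology, and its zero set is the limit.\<close>

lemma closed_subsets_cluster:
  assumes K: "compact_metric K" and A: "\<And>n. A n \<subseteq> mspace K" "\<And>n::nat. A n \<noteq> {}"
  obtains B where "B \<subseteq> mspace K" "B \<noteq> {}" "closedin (mtopology_of K) B"
    "\<forall>e>0. \<forall>N. \<exists>n\<ge>N. near (submetric K (A n)) (submetric K B) e"
proof -
  interpret Metric_space "mspace K" "mdist K" by simp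
  have top: "mtopology_of K = mtopology" by (rule mtopology_of_eq)
  obtain C where C: "0 \<le> C" "\<forall>x\<in>mspace K. \<forall>y\<in>mspace K. mdist K x y \<le> C" by (rule compact_metric_bounded[OF K])
  define h where "h n x = (INF a\<in>A n. mdist K x a)" for n x
  have bdd: "bdd_below (mdist K x ` A n)" for n x by (intro bdd_belowI[of _ 0]) auto
  have h_le: "h n x \<le> mdist K x a" if "a \<in> A n" for n x a
    unfolding h_def by (rule cINF_lower[OF bdd that])
  have h0: "0 \<le> h n x" for n x unfolding h_def by (rule cINF_greatest[OF A(2)]) simp
  have h_less: "\<exists>a\<in>A n. mdist K x a < e" if "h n x < e" for n x e
    using that unfolding h_def by (simp add: cINF_less_iff[OF A(2) bdd])
  have h_lip: "h n x \<le> h n y + mdist K x y" if xy: "x \<in> mspace K" "y \<in> mspace K" for n x y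
  proof -
    have "h n x - mdist K x y \<le> mdist K y a" if a: "a \<in> A n" for a
    proof -
      have "h n x \<le> mdist K x a" by (rule h_le[OF a])
      also have "\<dots> \<le> mdist K x y + mdist K y a" by (rule mdist_triangle) (use xy A(1) a in auto)
      finally show ?thesis by simp
    qed
    then have "h n x - mdist K x y \<le> h n y" unfolding h_def[of n y] by (intro cINF_greatest[OF A(2)])
    then show ?thesis by simp
  qed
  have hC: "h n x \<in> {0..C}" if x: "x \<in> mspace K" for n x
  proof -
    obtain a where a: "a \<in> A n" using A(2) by blast
    have "h n x \<le> mdist K x a" by (rule h_le[OF a])
    also have "\<dots> \<le> C" using C(2) x A(1) a by blast
    finally show ?thesis using h0 by simp
  qed
  \<comment> \<open>The bound \<open>C\<close> on distances places these functions in a product of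
    compact intervals.\<close>
  let ?P = "product_topology (\<lambda>_. top_of_set {0..C}) (mspace K)"
  have cP: "compact_space ?P" by (simp add: compact_space_product_topology compact_space_subtopology)
  have hP: "restrict (h n) (mspace K) \<in> topspace ?P" for n using hC by auto
  obtain g where g: "g \<in> topspace ?P" "\<forall>U n. openin ?P U \<longrightarrow> g \<in> U \<longrightarrow> (\<exists>k\<ge>n. restrict (h k) (mspace K) \<in> U)"
    by (rule compact_space_cluster_point[OF cP hP])
  have approx_finite: "\<exists>n\<ge>N. \<forall>x\<in>F. \<bar>h n x - g x\<bar> < e" if F: "finite F" "F \<subseteq> mspace K" and e: "0 < e" for F N and e :: real
  proof -
    let ?U = "\<lambda>x. {\<eta> \<in> topspace ?P. \<eta> x \<in> {0..C} \<inter> ball (g x) e}"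
    have U: "openin ?P (?U x)" if "x \<in> mspace K" for x
      using continuous_map_product_projection[OF that, of "\<lambda>_. top_of_set {0..C}"]
      by (rule openin_continuous_map_preimage) (simp add: openin_open_Int)
    have gC: "x \<in> mspace K \<Longrightarrow> g x \<in> {0..C}" for x using g(1) by auto
    let ?V = "topspace ?P \<inter> (\<Inter>x\<in>F. ?U x)"
    have "openin ?P ?V"
    proof (cases "F = {}")
      case True
      then have "?V = topspace ?P" by simp
      then show ?thesis by (simp only: openin_topspace)
    next
      case False
      then have "openin ?P (\<Inter>x\<in>F. ?U x)" using F U by (intro openin_INT2) auto
      then show ?thesis by blast
    qed
    moreover have "g \<in> ?V" using g(1) gC F(2) e by auto
    ultimately obtain n where n: "n \<ge> N" "restrict (h n) (mspace K) \<in> ?V" using g(2) by meson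
    have "\<bar>h n x - g x\<bar> < e" if "x \<in> F" for x
    proof -
      have "restrict (h n) (mspace K) \<in> ?U x" using n(2) that by blast
      moreover have "x \<in> mspace K" using that F by blast
      ultimately show ?thesis by (simp add: dist_real_def abs_minus_commute)
    qed
    with n(1) show ?thesis by blast
  qed
  have g_lip: "\<bar>g x - g y\<bar> \<le> mdist K x y" if xy: "x \<in> mspace K" "y \<in> mspace K" for x y
  proof (rule field_le_epsilon)
    fix e :: real assume e: "0 < e"
    obtain n where "\<bar>h n x - g x\<bar> < e/2" "\<bar>h n y - g y\<bar> < e/2"
      using approx_finite[of "{x, y}" "e/2" 0] e xy by auto
    then show "\<bar>g x - g y\<bar> \<le> mdist K x y + e"
      using h_lip[OF xy, of n] h_lip[OF xy(2,1), of n] unfolding mdist_commute[of K y x] by linarith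
  qed
  \<comment> \<open>The product topology controls finitely many points at a time. A finite net and
    the common Lipschitz bound upgrade this to uniform approximation, at the cost of three times
    \<open>e/3\<close>.\<close>
  have approx: "\<exists>n\<ge>N. \<forall>x\<in>mspace K. \<bar>h n x - g x\<bar> < e" if e: "0 < e" for N and e :: real
  proof -
    obtain F where F: "finite F" "F \<subseteq> mspace K" "\<forall>x\<in>mspace K. \<exists>y\<in>F. mdist K y x < e/3"
      by (rule compact_metric_totally_bounded[OF K, of "e/3"]) (use e in auto)
    obtain n where n: "n \<ge> N" "\<forall>x\<in>F. \<bar>h n x - g x\<bar> < e/3" using approx_finite[OF F(1,2), of "e/3" N] e by auto
    have "\<bar>h n x - g x\<bar> < e" if x: "x \<in> mspace K" for x
    proof -
      obtain y where y: "y \<in> F" "mdist K y x < e/3" using F(3) x by blast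
      then have yK: "y \<in> mspace K" using F by blast
      have "\<bar>h n y - g y\<bar> < e/3" using n(2) y(1) by blast
      then show ?thesis using y(2) h_lip[OF x yK, of n] h_lip[OF yK x, of n] g_lip[OF yK x]
        unfolding mdist_commute[of K x y] by linarith
    qed
    with n(1) show ?thesis by blast
  qed
  define B where "B = {x \<in> mspace K. g x = 0}"
  have g0: "0 \<le> g x" if "x \<in> mspace K" for x using g(1) that by auto
  \<comment> \<open>Compactness turns small values of \<open>g\<close> into closeness to its zero
    set: otherwise points with \<open>g\<close> tending to 0 would accumulate at a zero of
    \<open>g\<close> although they keep distance \<open>e\<close> from all zeros.\<close>
  have small: "\<exists>\<delta>>0. \<forall>x\<in>mspace K. g x \<le> \<delta> \<longrightarrow> (\<exists>y\<in>B. mdist K x y < e)" if e: "0 < e" for e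
  proof (rule ccontr)
    assume "\<not> ?thesis"
    then have "\<exists>x\<in>mspace K. g x \<le> inverse (real (Suc n)) \<and> (\<forall>y\<in>B. e \<le> mdist K x y)" for n
      by (metis inverse_positive_iff_positive not_less of_nat_0_less_iff zero_less_Suc)
    then obtain x where x: "\<And>n. x n \<in> mspace K" "\<And>n. g (x n) \<le> inverse (real (Suc n))" "\<And>n y. y \<in> B \<Longrightarrow> e \<le> mdist K (x n) y"
      by metis
    have "\<exists>l r. l \<in> mspace K \<and> strict_mono r \<and> limitin mtopology (x \<circ> r) l sequentially"
      using K x(1) unfolding compact_metric_def top compact_space_sequentially by blast
    then obtain l r where l: "l \<in> mspace K" "strict_mono (r :: nat \<Rightarrow> nat)" "(\<lambda>n. mdist K (x (r n)) l) \<longlonglongrightarrow> 0"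
      by (auto simp: limitin_metric_dist_null)
    have "g l \<le> inverse (real (Suc n)) + mdist K (x (r n)) l" for n
    proof -
      have "n \<le> r n" by (rule seq_suble[OF l(2)])
      then have "inverse (real (Suc (r n))) \<le> inverse (real (Suc n))" by simp
      then show ?thesis using x(2)[of "r n"] g_lip[OF x(1) l(1), of "r n"] by linarith
    qed
    moreover have "(\<lambda>n. inverse (real (Suc n)) + mdist K (x (r n)) l) \<longlonglongrightarrow> 0 + 0"
      by (intro tendsto_add l LIMSEQ_inverse_real_of_nat)
    ultimately have "g l \<le> 0" by (intro LIMSEQ_le_const[where X="\<lambda>n. inverse (real (Suc n)) + mdist K (x (r n)) l"]) auto
    then have "l \<in> B" using g0[OF l(1)] l(1) by (simp add: B_def)
    moreover obtain n where "mdist K (x (r n)) l < e"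
      using order_tendstoD(2)[OF l(3) e] by (auto simp: eventually_sequentially)
    ultimately show False using x(3) by (meson not_less)
  qed
  show thesis
  proof (rule that)
    show BK: "B \<subseteq> mspace K" by (auto simp: B_def)
    show "B \<noteq> {}"
    proof -
      obtain \<delta> where \<delta>: "\<delta> > 0" "\<forall>x\<in>mspace K. g x \<le> \<delta> \<longrightarrow> (\<exists>y\<in>B. mdist K x y < 1)" using small[of 1] by auto
      obtain n where n: "\<forall>x\<in>mspace K. \<bar>h n x - g x\<bar> < \<delta>" using approx[OF \<delta>(1), of 0] by auto
      obtain a where a: "a \<in> A n" using A(2) by blast
      then have aK: "a \<in> mspace K" using A(1) by blast
      have "h n a \<le> mdist K a a" by (rule h_le[OF a])
      then have "h n a \<le> 0" using aK by simp
      then have "g a \<le> \<delta>" using n aK h0[of n a] by fastforce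
      then show ?thesis using \<delta>(2) aK by blast
    qed
    show "closedin (mtopology_of K) B" unfolding top metric_closedin_iff_sequentially_closed
    proof (intro conjI allI impI BK)
      fix \<sigma> l assume *: "range \<sigma> \<subseteq> B \<and> limitin mtopology \<sigma> l sequentially"
      then have l: "l \<in> mspace K" "(\<lambda>n. mdist K (\<sigma> n) l) \<longlonglongrightarrow> 0" and \<sigma>: "\<And>n. \<sigma> n \<in> B"
        by (auto simp: limitin_metric_dist_null)
      have "g l \<le> mdist K (\<sigma> n) l" for n
        using g_lip[of "\<sigma> n" l] \<sigma>[of n] l(1) by (auto simp: B_def)
      then have "g l \<le> 0" by (intro LIMSEQ_le_const[OF l(2)]) auto
      then show "l \<in> B" using g0[OF l(1)] l(1) by (simp add: B_def)
    qed
    show "\<forall>e>0. \<forall>N. \<exists>n\<ge>N. near (submetric K (A n)) (submetric K B) e"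
    proof (intro allI impI)
      fix e :: real and N :: nat assume e: "0 < e"
      obtain \<delta> where \<delta>: "\<delta> > 0" "\<forall>x\<in>mspace K. g x \<le> \<delta> \<longrightarrow> (\<exists>y\<in>B. mdist K x y < e/2)" using small[of "e/2"] e by auto
      \<comment> \<open>The two bounds in the minimum serve the two directions: \<open>g\<close> is
        below \<open>\<delta>\<close> on \<open>A n\<close>, and every zero of \<open>g\<close> is
        within \<open>e/2\<close> of \<open>A n\<close>.\<close>
      obtain n where n: "n \<ge> N" "\<forall>x\<in>mspace K. \<bar>h n x - g x\<bar> < min \<delta> (e/2)" using approx[of "min \<delta> (e/2)" N] \<delta> e by auto
      have 1: "\<forall>x\<in>A n. \<exists>y\<in>B. mdist K x y < e/2"
      proof
        fix a assume a: "a \<in> A n"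
        then have aK: "a \<in> mspace K" using A(1) by blast
        have "h n a \<le> mdist K a a" by (rule h_le[OF a])
        then have "h n a \<le> 0" using aK by simp
        then have "g a \<le> \<delta>" using n(2) aK h0[of n a] by fastforce
        then show "\<exists>y\<in>B. mdist K a y < e/2" using \<delta>(2) aK by blast
      qed
      have 2: "\<forall>y\<in>B. \<exists>x\<in>A n. mdist K x y < e/2"
      proof
        fix y assume "y \<in> B"
        then have y: "y \<in> mspace K" "g y = 0" by (auto simp: B_def)
        then have "h n y < e/2" using n(2) by fastforce
        from h_less[OF this] show "\<exists>x\<in>A n. mdist K x y < e/2" by (simp add: mdist_commute)
      qed
      have "near (submetric K (A n)) (submetric K B) (2 * (e/2))" by (rule near_submetric[OF A(1) BK 1 2])
      then show "\<exists>n\<ge>N. near (submetric K (A n)) (submetric K B) e" using n(1) by auto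
    qed
  qed
qed

lemma compact_metric_submetric:
  assumes "compact_metric K" "closedin (mtopology_of K) A" "A \<noteq> {}"
  shows "compact_metric (submetric K A)"
proof -
  have "A \<subseteq> mspace K" using closedin_subset[OF assms(2)] by simp
  moreover have "compactin (mtopology_of K) A"
    using assms closedin_compact_space by (auto simp: compact_metric_def)
  ultimately show ?thesis using assms(3)
    by (auto simp: compact_metric_def mtopology_of_submetric compact_space_subtopology)
qed

text \<open>The cluster set of a sequence of closed subsets is, on the level of isometry classes,
  the limit of a subsequence. In a metric space this sequential form is compactness.\<close>

lemma GH_compact_closed_subsets:
  assumes K: "compact_metric K"
  shows "compactin GH_topology {isometry_class (submetric K A) |A. closedin (mtopology_of K) A \<and> A \<noteq> {}}" (is "compactin _ ?S")
proof -
  interpret Metric_space GH_space "mdist GH_metric"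
    using Metric_space_mspace_mdist[of GH_metric] by (simp add: mspace_GH_metric)
  have top: "GH_topology = mtopology" by (simp add: GH_topology_eq mtopology_of_eq mspace_GH_metric)
  have cA: "compact_metric (submetric K A)" if "closedin (mtopology_of K) A" "A \<noteq> {}" for A
    by (rule compact_metric_submetric[OF K that])
  show ?thesis unfolding top compactin_sequentially
  proof (intro conjI allI impI)
    show "?S \<subseteq> GH_space" using isometry_class_rep(1) cA by blast
    fix \<sigma> :: "nat \<Rightarrow> real metric set" assume "range \<sigma> \<subseteq> ?S"
    then have "\<forall>n. \<exists>A. \<sigma> n = isometry_class (submetric K A) \<and> closedin (mtopology_of K) A \<and> A \<noteq> {}" by blast
    then obtain A where A: "\<And>n. \<sigma> n = isometry_class (submetric K (A n))" "\<And>n. closedin (mtopology_of K) (A n)" "\<And>n. A n \<noteq> {}"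
      by metis
    have AK: "A n \<subseteq> mspace K" for n using closedin_subset[OF A(2)] by simp
    obtain B where B: "B \<subseteq> mspace K" "B \<noteq> {}" "closedin (mtopology_of K) B"
      "\<forall>e>0. \<forall>N. \<exists>n\<ge>N. near (submetric K (A n)) (submetric K B) e"
      by (rule closed_subsets_cluster[OF K AK A(3)])
    have "\<exists>n\<ge>N. near (submetric K (A n)) (submetric K B) (2 * inverse (real (Suc j)))" for N j
      using B(4) by simp
    then obtain p where p: "\<And>N j. p N j \<ge> N" "\<And>N j. near (submetric K (A (p N j))) (submetric K B) (2 * inverse (real (Suc j)))"
      by metis
    \<comment> \<open>Each index is chosen beyond the previous one, with distortion at most
      \<open>2 * inverse (real (Suc j))\<close>; the factor 2 disappears in
      \<open>GH_dist_le\<close>.\<close>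
    define r where "r = rec_nat (p 0 0) (\<lambda>j k. p (Suc k) (Suc j))"
    have r: "r 0 = p 0 0" "\<And>j. r (Suc j) = p (Suc (r j)) (Suc j)" by (simp_all add: r_def)
    have mono: "strict_mono r" unfolding strict_mono_Suc_iff r(2) using p(1) Suc_le_eq by blast
    have nr: "near (submetric K (A (r j))) (submetric K B) (2 * inverse (real (Suc j)))" for j
    proof (cases j)
      case 0
      show ?thesis unfolding 0 r by (rule p(2))
    next
      case (Suc k)
      show ?thesis unfolding Suc r by (rule p(2))
    qed
    let ?l = "isometry_class (submetric K B)"
    note cB = cA[OF B(3,2)]
    have d: "mdist GH_metric (\<sigma> (r j)) ?l \<le> inverse (real (Suc j))" for j
    proof -
      note cr = cA[OF A(2,3)[of "r j"]]
      note ir = isometry_class_rep[OF cr] and iB = isometry_class_rep[OF cB]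
      have "near (rep (\<sigma> (r j))) (submetric K (A (r j))) 0"
        using isometric_imp_near[OF ir(3)] near_sym unfolding A(1) by blast
      from near_trans[OF near_trans[OF this nr] isometric_imp_near[OF iB(3)]]
      have "near (rep (\<sigma> (r j))) (rep ?l) (2 * inverse (real (Suc j)))" by simp
      then have "GH_dist (rep (\<sigma> (r j))) (rep ?l) \<le> inverse (real (Suc j))"
        using ir(2) iB(2) unfolding A(1) by (intro GH_dist_le) auto
      then show ?thesis using ir(1) iB(1) unfolding A(1) by (simp add: mdist_GH_metric)
    qed
    have "(\<lambda>j. mdist GH_metric (\<sigma> (r j)) ?l) \<longlonglongrightarrow> 0"
      by (rule tendsto_sandwich[OF _ _ tendsto_const LIMSEQ_inverse_real_of_nat];
          intro always_eventually allI mdist_nonneg d)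
    moreover have "\<sigma> (r j) \<in> GH_space" for j unfolding A(1) by (rule isometry_class_rep(1)[OF cA[OF A(2,3)]])
    ultimately have "limitin mtopology (\<sigma> \<circ> r) ?l sequentially"
      unfolding limitin_metric_dist_null using isometry_class_rep(1)[OF cB] by simp
    then show "\<exists>l r. l \<in> ?S \<and> strict_mono r \<and> limitin mtopology (\<sigma> \<circ> r) l sequentially"
      using B(2,3) mono by (intro exI[of _ ?l] exI[of _ r]) auto
  qed
qed

text \<open>The compact set of classes of closed subsets is closed because the topology is
  Hausdorff, so it contains the closure of \<open>S\<close>.\<close>

lemma precompact_in_closed_subsets:
  assumes K: "compact_metric K"
    and S: "\<And>c. c \<in> S \<Longrightarrow> \<exists>A. closedin (mtopology_of K) A \<and> A \<noteq> {} \<and> c = isometry_class (submetric K A)"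
  shows "precompact_in GH_topology S"
proof -
  let ?C = "{isometry_class (submetric K A) |A. closedin (mtopology_of K) A \<and> A \<noteq> {}}"
  have C: "compactin GH_topology ?C" by (rule GH_compact_closed_subsets[OF K])
  have "Hausdorff_space GH_topology"
    unfolding GH_topology_eq mtopology_of_eq by (rule Metric_space.Hausdorff_space_mtopology) simp
  then have cl: "closedin GH_topology ?C" using C by (rule compactin_imp_closedin)
  have SC: "S \<subseteq> ?C" using S by blast
  have "GH_topology closure_of S \<subseteq> ?C" by (rule closure_of_minimal[OF SC cl])
  then have "compactin GH_topology (GH_topology closure_of S)"
    by (rule closed_compactin[OF C _ closedin_closure_of])
  then show ?thesis unfolding precompact_in_def using SC closedin_subset[OF cl] by blast
qed

section \<open>Concentration of the pyramid\<close>

lemma (in prob_space) ky_fan_mod_cong_AE: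
  assumes [measurable]: "f \<in> borel_measurable M" "g \<in> borel_measurable M"
      "f' \<in> borel_measurable M" "g' \<in> borel_measurable M"
    and "AE x in M. f x = f' x" "AE x in M. g x = g' x"
  shows "ky_fan_mod M f g = ky_fan_mod M f' g'"
proof -
  have "ky_fan M f (\<lambda>x. g x + c) = ky_fan M f' (\<lambda>x. g' x + c)" for c
  proof (rule ky_fan_cong_AE)
    show "AE x in M. g x + c = g' x + c" using assms(6) by eventually_elim simp
  qed (use assms in auto)
  then show ?thesis by (simp add: ky_fan_mod_def)
qed

text \<open>Precomposition with \<open>\<phi>\<close> sends \<open>lip1 Y\<close> into
  \<open>lip1 X\<close> and, since \<open>\<phi>\<close> preserves the measure, keeps the Ky Fan
  distance modulo constants.\<close>

lemma L1_metric_embedding: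
  assumes X: "prob_space (emm_measure X)" and Y: "prob_space (emm_measure Y)" and \<phi>: "lip_map X Y \<phi>"
  obtains T where "isometric_embedding (L1_metric Y) (L1_metric X) T"
proof -
  let ?mX = "mod_class (emm_measure X)" and ?mY = "mod_class (emm_measure Y)"
  have "\<exists>f. f \<in> lip1 Y \<and> U = ?mY f" if "U \<in> mspace (L1_metric Y)" for U
    using that unfolding mspace_L1_metric[OF Y] by blast
  then obtain s where s: "\<And>U. U \<in> mspace (L1_metric Y) \<Longrightarrow> s U \<in> lip1 Y" "\<And>U. U \<in> mspace (L1_metric Y) \<Longrightarrow> U = ?mY (s U)"
    by metis
  have "isometric_embedding (L1_metric Y) (L1_metric X) (\<lambda>U. ?mX (s U \<circ> \<phi>))"
    unfolding isometric_embedding_def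
  proof (intro conjI ballI image_subsetI)
    fix U assume "U \<in> mspace (L1_metric Y)"
    then show "?mX (s U \<circ> \<phi>) \<in> mspace (L1_metric X)"
      unfolding mspace_L1_metric[OF X] using lip1_comp_lip_map[OF \<phi> s(1)] by blast
  next
    fix U V assume UV: "U \<in> mspace (L1_metric Y)" "V \<in> mspace (L1_metric Y)"
    note sU = s(1)[OF UV(1)] and sV = s(1)[OF UV(2)]
    have "mdist (L1_metric X) (?mX (s U \<circ> \<phi>)) (?mX (s V \<circ> \<phi>)) = ky_fan_mod (emm_measure X) (s U \<circ> \<phi>) (s V \<circ> \<phi>)"
      by (rule mdist_L1_metric[OF X lip1_comp_lip_map[OF \<phi> sU] lip1_comp_lip_map[OF \<phi> sV]])
    also have "\<dots> = ky_fan_mod (emm_measure Y) (s U) (s V)"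
      by (rule ky_fan_mod_distr[OF lip_map_measurable[OF \<phi>] lip_map_distr[OF \<phi>] lip1_measurable[OF sU] lip1_measurable[OF sV]])
    also have "\<dots> = mdist (L1_metric Y) (?mY (s U)) (?mY (s V))" by (rule mdist_L1_metric[OF Y sU sV, symmetric])
    also have "\<dots> = mdist (L1_metric Y) U V" using s(2)[OF UV(1)] s(2)[OF UV(2)] by simp
    finally show "mdist (L1_metric X) (?mX (s U \<circ> \<phi>)) (?mX (s V \<circ> \<phi>)) = mdist (L1_metric Y) U V" .
  qed
  then show thesis by (rule that)
qed

lemma L1_metric_nonempty: "prob_space (emm_measure X) \<Longrightarrow> mspace (L1_metric X) \<noteq> {}"
  unfolding mspace_L1_metric using zero_in_lip1[of X] by blast

text \<open>The image of the embedding is complete because \<open>L1_metric Y\<close> is, and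
  complete subsets are closed.\<close>

lemma L1_metric_closed_subset:
  assumes X: "prob_space (emm_measure X)" and Y: "prob_space (emm_measure Y)" and \<phi>: "lip_map X Y \<phi>"
  obtains A where "closedin (mtopology_of (L1_metric X)) A" "A \<noteq> {}" "isometric (L1_metric Y) (submetric (L1_metric X) A)"
proof -
  let ?K = "L1_metric X"
  obtain T where T: "isometric_embedding (L1_metric Y) ?K T" by (rule L1_metric_embedding[OF X Y \<phi>])
  let ?A = "T ` mspace (L1_metric Y)"
  have AK: "?A \<subseteq> mspace ?K" using T by (simp add: isometric_embedding_def)
  have d: "\<And>x y. x \<in> mspace (L1_metric Y) \<Longrightarrow> y \<in> mspace (L1_metric Y) \<Longrightarrow> mdist (submetric ?K ?A) (T x) (T y) = mdist (L1_metric Y) x y"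
    using T by (simp add: isometric_embedding_def)
  have ms: "mspace (submetric ?K ?A) = ?A" using AK by auto
  have "mcomplete_of (submetric ?K ?A)"
    by (rule isometric_mcomplete[OF mcomplete_L1_metric[OF Y] ms[symmetric] d])
  then have compl: "Metric_space.mcomplete ?A (mdist ?K)" unfolding mcomplete_of_def ms mdist_submetric .
  interpret Submetric "mspace ?K" "mdist ?K" ?A
    by (simp add: Submetric_def Submetric_axioms_def AK)
  have "closedin (mtopology_of ?K) ?A" unfolding mtopology_of_eq by (rule mcomplete_imp_closedin[OF compl])
  moreover have "isometric (L1_metric Y) (submetric ?K ?A)"
    unfolding isometric_def isometric_embedding_def using d ms by (intro exI[of _ T]) auto
  moreover have "?A \<noteq> {}" using L1_metric_nonempty[OF Y] by blast
  ultimately show thesis using that by blast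
qed

text \<open>Box-closedness lets the pyramid axioms be checked on \<open>mm_below X\<close> itself,
  where they come from compositions and joins.\<close>

lemma concentrated_pyramid_of_totally_bounded:
  assumes X: "prob_space (emm_measure X)" and tb: "lip1_totally_bounded X"
  shows "concentrated_pyramid (box_closure (mm_below X))"
proof -
  note cl = box_closure_mm_below[OF X tb]
  have sub: "mm_below X \<subseteq> mm_classes" by (auto simp: mm_below_def)
  have "pyramid (mm_below X)"
    unfolding pyramid_def cl using mm_below_nonempty[OF X] sub mm_below_downward[OF X] mm_below_directed[OF X] by blast
  moreover have "precompact_in GH_topology ((\<lambda>c. isometry_class (L1_metric (emm_of_mm (rep c)))) ` mm_below X)"
  proof (rule precompact_in_closed_subsets)
    show "compact_metric (L1_metric X)"
      using L1_metric_nonempty[OF X] compact_L1_metric_iff[OF X] tb by (simp add: compact_metric_def)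
    fix \<kappa> assume "\<kappa> \<in> (\<lambda>c. isometry_class (L1_metric (emm_of_mm (rep c)))) ` mm_below X"
    then obtain c where c: "c \<in> mm_below X" "\<kappa> = isometry_class (L1_metric (emm_of_mm (rep c)))" by blast
    then obtain \<phi> where \<phi>: "lip_map X (emm_of_mm (rep c)) \<phi>" and "c \<in> mm_classes" by (auto simp: mm_below_iff[OF X])
    then have Y: "prob_space (emm_measure (emm_of_mm (rep c)))" using prob_space_mm[OF mm_classes_rep] by blast
    obtain A where "closedin (mtopology_of (L1_metric X)) A" "A \<noteq> {}"
      "isometric (L1_metric (emm_of_mm (rep c))) (submetric (L1_metric X) A)"
      by (rule L1_metric_closed_subset[OF X Y \<phi>])
    then show "\<exists>A. closedin (mtopology_of (L1_metric X)) A \<and> A \<noteq> {} \<and> \<kappa> = isometry_class (submetric (L1_metric X) A)"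
      unfolding c(2) using isometry_class_eq by blast
  qed
  ultimately show ?thesis unfolding concentrated_pyramid_def cl by blast
qed

text \<open>The finite factor is exchanged for the representative of its class by an isomorphism,
  whose a.e. inverse keeps the functions factored.\<close>

lemma mm_below_factor:
  assumes X: "prob_space (emm_measure X)" and F: "finite F" "F \<subseteq> lip1 X"
  obtains c \<phi> where "c \<in> mm_below X" "lip_map X (emm_of_mm (rep c)) \<phi>"
    "\<forall>f\<in>F. \<exists>u\<in>lip1 (emm_of_mm (rep c)). AE x in emm_measure X. f x = u (\<phi> x)"
proof -
  obtain Y :: "real mm_data" and \<phi> where Y: "mm_space Y" "lip_map X (emm_of_mm Y) \<phi>"
    "\<forall>f\<in>F. \<exists>u\<in>lip1 (emm_of_mm Y). AE x in emm_measure X. f x = u (\<phi> x)"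
    using mm_finite_factor[OF X F] by blast
  obtain H G where HG: "iso_pair (emm_of_mm Y) (emm_of_mm (rep (mm_class Y))) H G" by (rule mm_class_rep_iso_pair[OF Y(1)])
  note G = iso_pair_lip_map[OF iso_pair_sym[OF HG]]
  have "AE y in emm_measure (emm_of_mm Y). G (H y) = y" using HG by (simp add: iso_pair_def)
  then have GH: "AE x in emm_measure X. G (H (\<phi> x)) = \<phi> x"
    by (rule AE_distr_self[OF lip_map_measurable[OF Y(2)] lip_map_distr[OF Y(2)]])
  have "\<exists>u\<in>lip1 (emm_of_mm (rep (mm_class Y))). AE x in emm_measure X. f x = u ((H \<circ> \<phi>) x)" if f: "f \<in> F" for f
  proof -
    obtain u where u: "u \<in> lip1 (emm_of_mm Y)" "AE x in emm_measure X. f x = u (\<phi> x)" using Y(3) f by blast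
    have "AE x in emm_measure X. f x = (u \<circ> G) ((H \<circ> \<phi>) x)" using u(2) GH by eventually_elim simp
    then show ?thesis using lip1_comp_lip_map[OF G u(1)] by blast
  qed
  then show thesis
    using that mm_class_in_mm_below[OF X Y(1,2)] lip_map_comp[OF Y(2) iso_pair_lip_map[OF HG]] by blast
qed

text \<open>Greedy choice: no finite family is an \<open>e\<close>-net, so each can be enlarged by a
  function far from all its members. That function is new, since its distance to itself is
  0.\<close>

lemma separated_family:
  assumes X: "prob_space (emm_measure X)" and e: "0 < e"
    and far: "\<And>F. finite F \<Longrightarrow> F \<subseteq> lip1 X \<Longrightarrow> \<exists>f\<in>lip1 X. \<forall>g\<in>F. e \<le> ky_fan_mod (emm_measure X) f g"
  shows "\<exists>F. finite F \<and> F \<subseteq> lip1 X \<and> card F = n \<and> (\<forall>f\<in>F. \<forall>g\<in>F. f \<noteq> g \<longrightarrow> e \<le> ky_fan_mod (emm_measure X) f g)"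
proof (induction n)
  case 0
  show ?case by (intro exI[of _ "{}"]) simp
next
  case (Suc n)
  interpret prob_space "emm_measure X" by fact
  obtain F where F: "finite F" "F \<subseteq> lip1 X" "card F = n" "\<forall>f\<in>F. \<forall>g\<in>F. f \<noteq> g \<longrightarrow> e \<le> ky_fan_mod (emm_measure X) f g"
    using Suc.IH by blast
  obtain f where f: "f \<in> lip1 X" "\<forall>g\<in>F. e \<le> ky_fan_mod (emm_measure X) f g" using far[OF F(1,2)] by blast
  note fm = lip1_measurable[OF f(1)]
  have "ky_fan (emm_measure X) f f = 0" using ky_fan_eq_0_iff[OF fm fm] by simp
  then have "ky_fan_mod (emm_measure X) f f \<le> 0" using ky_fan_mod_le_ky_fan[of f f] by simp
  then have "f \<notin> F" using f(2) e by force
  then show ?case using F f ky_fan_mod_commute by (intro exI[of _ "insert f F"]) auto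
qed

lemma totally_bounded_of_concentrated_pyramid:
  assumes X: "prob_space (emm_measure X)" and conc: "concentrated_pyramid (box_closure (mm_below X))"
  shows "lip1_totally_bounded X"
proof (rule ccontr)
  interpret X: prob_space "emm_measure X" by fact
  assume "\<not> lip1_totally_bounded X"
  then obtain e where e: "0 < e"
    and far: "\<And>F. finite F \<Longrightarrow> F \<subseteq> lip1 X \<Longrightarrow> \<exists>f\<in>lip1 X. \<forall>g\<in>F. e \<le> ky_fan_mod (emm_measure X) f g"
    unfolding lip1_totally_bounded_def by (meson not_less)
  let ?S = "(\<lambda>c. isometry_class (L1_metric (emm_of_mm (rep c)))) ` box_closure (mm_below X)"
  have pre: "precompact_in GH_topology ?S" using conc by (simp add: concentrated_pyramid_def)
  obtain n :: nat where n: "\<forall>\<kappa>\<in>?S. \<forall>T. finite T \<longrightarrow> T \<subseteq> mspace (rep \<kappa>) \<longrightarrow>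
      (\<forall>x\<in>T. \<forall>y\<in>T. x \<noteq> y \<longrightarrow> e \<le> mdist (rep \<kappa>) x y) \<longrightarrow> card T \<le> n"
    by (rule GH_precompact_separated[OF pre e])
  \<comment> \<open>One function more than an \<open>e\<close>-separated set in a member of the
    precompact family can have.\<close>
  obtain F where F: "finite F" "F \<subseteq> lip1 X" "card F = Suc n"
    "\<forall>f\<in>F. \<forall>g\<in>F. f \<noteq> g \<longrightarrow> e \<le> ky_fan_mod (emm_measure X) f g"
    using separated_family[OF X e far, of "Suc n"] by blast
  obtain c \<phi> where c: "c \<in> mm_below X" and \<phi>: "lip_map X (emm_of_mm (rep c)) \<phi>"
    and fac: "\<forall>f\<in>F. \<exists>u\<in>lip1 (emm_of_mm (rep c)). AE x in emm_measure X. f x = u (\<phi> x)"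
    by (rule mm_below_factor[OF X F(1,2)])
  let ?Y = "emm_of_mm (rep c)" and ?\<kappa> = "isometry_class (L1_metric (emm_of_mm (rep c)))"
  have cm: "c \<in> mm_classes" using c by (simp add: mm_below_def)
  have Y: "prob_space (emm_measure ?Y)" by (rule prob_space_mm[OF mm_classes_rep[OF cm]])
  have "mm_below X \<subseteq> box_closure (mm_below X)" by (rule box_closure_superset) (auto simp: mm_below_def)
  then have \<kappa>S: "?\<kappa> \<in> ?S" using c by blast
  \<comment> \<open>Precompactness includes membership in \<open>GH_space\<close>. So the class is
    inhabited, and its \<open>rep\<close> is isometric to the space of Lipschitz functions.\<close>
  then have "?\<kappa> \<in> GH_space" using pre by (auto simp: precompact_in_def GH_topology_eq mspace_GH_metric)
  then obtain N :: "real metric" where N: "compact_metric N" "?\<kappa> = isometry_class N" by (auto simp: GH_space_def)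
  then have "N \<in> ?\<kappa>" by (simp add: isometry_class_def isometric_refl)
  from rep_in[OF this] have "isometric (L1_metric ?Y) (rep ?\<kappa>)" by (simp add: isometry_class_def)
  then obtain t where t: "t ` mspace (L1_metric ?Y) = mspace (rep ?\<kappa>)"
    "\<And>x y. x \<in> mspace (L1_metric ?Y) \<Longrightarrow> y \<in> mspace (L1_metric ?Y) \<Longrightarrow> mdist (rep ?\<kappa>) (t x) (t y) = mdist (L1_metric ?Y) x y"
    by (auto simp: isometric_def isometric_embedding_def)
  obtain u where u: "\<And>f. f \<in> F \<Longrightarrow> u f \<in> lip1 ?Y" "\<And>f. f \<in> F \<Longrightarrow> AE x in emm_measure X. f x = u f (\<phi> x)"
    using fac by metis
  let ?p = "\<lambda>f. t (mod_class (emm_measure ?Y) (u f))"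
  have mem: "mod_class (emm_measure ?Y) (u f) \<in> mspace (L1_metric ?Y)" if "f \<in> F" for f
    unfolding mspace_L1_metric[OF Y] using u(1)[OF that] by blast
  \<comment> \<open>Pulled back along \<open>\<phi>\<close>, the factors \<open>u f\<close> are a.e.
    the original functions, so the separation survives the passage to the dominated space.\<close>
  have dist: "mdist (rep ?\<kappa>) (?p f) (?p g) = ky_fan_mod (emm_measure X) f g" if fg: "f \<in> F" "g \<in> F" for f g
  proof -
    note uf = u(1)[OF fg(1)] and ug = u(1)[OF fg(2)]
    have "mdist (rep ?\<kappa>) (?p f) (?p g) = mdist (L1_metric ?Y) (mod_class (emm_measure ?Y) (u f)) (mod_class (emm_measure ?Y) (u g))"
      by (rule t(2)[OF mem[OF fg(1)] mem[OF fg(2)]])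
    also have "\<dots> = ky_fan_mod (emm_measure ?Y) (u f) (u g)" by (rule mdist_L1_metric[OF Y uf ug])
    also have "\<dots> = ky_fan_mod (emm_measure X) (u f \<circ> \<phi>) (u g \<circ> \<phi>)"
      by (rule ky_fan_mod_distr[OF lip_map_measurable[OF \<phi>] lip_map_distr[OF \<phi>] lip1_measurable[OF uf] lip1_measurable[OF ug], symmetric])
    also have "\<dots> = ky_fan_mod (emm_measure X) f g"
    proof (rule X.ky_fan_mod_cong_AE)
      show "AE x in emm_measure X. (u f \<circ> \<phi>) x = f x" using u(2)[OF fg(1)] by eventually_elim simp
      show "AE x in emm_measure X. (u g \<circ> \<phi>) x = g x" using u(2)[OF fg(2)] by eventually_elim simp
    qed (use fg F(2) lip1_measurable lip1_comp_lip_map[OF \<phi>] uf ug in blast)+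
    finally show ?thesis .
  qed
  have pm: "?p f \<in> mspace (rep ?\<kappa>)" if "f \<in> F" for f using t(1) mem[OF that] by blast
  have "inj_on ?p F"
  proof (rule inj_onI, rule ccontr)
    fix f g assume fg: "f \<in> F" "g \<in> F" "?p f = ?p g" "f \<noteq> g"
    have "mdist (rep ?\<kappa>) (?p f) (?p g) = 0" using fg(3) pm[OF fg(1)] by simp
    then show False using dist[OF fg(1,2)] F(4) fg e by force
  qed
  then have "card (?p ` F) = Suc n" using F(3) by (simp add: card_image)
  moreover have "card (?p ` F) \<le> n"
  proof -
    have "\<forall>x\<in>?p ` F. \<forall>y\<in>?p ` F. x \<noteq> y \<longrightarrow> e \<le> mdist (rep ?\<kappa>) x y"
      using F(4) dist by fastforce
    moreover have "finite (?p ` F)" "?p ` F \<subseteq> mspace (rep ?\<kappa>)" using F(1) pm by auto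
    ultimately show ?thesis using n \<kappa>S by blast
  qed
  ultimately show False by simp
qed

theorem corollary1p4:
  fixes X :: "'a emm_data"
  assumes "emm_space X"
  shows "(compact_space (mtopology_of (L1_metric X)) \<longleftrightarrow> emm_class X \<in> conc_completion) \<and>
         (emm_class X \<in> conc_completion \<longleftrightarrow> concentrated_pyramid (box_closure (mm_below X)))"
proof -
  note X = emm_space_prob[OF assms]
  have "compact_space (mtopology_of (L1_metric X)) \<longleftrightarrow> concentrated_pyramid (box_closure (mm_below X))"
    unfolding compact_L1_metric_iff[OF X]
    using concentrated_pyramid_of_totally_bounded[OF X] totally_bounded_of_concentrated_pyramid[OF X] by blast
  then show ?thesis using conc_completion_iff[OF assms] by simp
qed

end
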